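(* Let $g\in H^{1/2}(\Gamma)$ and $f\in L^2(\Omega)$. Suppose that $\sigma_1,\sigma_2$ are bounded, continuous, non-negative functions that are monotonically increasing in $|x_1|$, respectively $|x_2|$. Then, for every real value $k$, except at most for a discrete set of values of $k$, the truncated PML problem $$-\nabla\cdot A\nabla u_{\mathrm{PML}}-k^2Ju_{\mathrm{PML}}=f \text{ in }\Omega,\qquad u_{\mathrm{PML}}=g\text{ on }\Gamma,\qquad u_{\mathrm{PML}}=0\text{ on }\Gamma_{\mathrm{PML}}$$ has a unique weak solution $u_{\mathrm{PML}}\in \mathbb{H}^1(\Omega)$, i.e. a unique $u_{\mathrm{PML}}\in\mathbb{H}^1(\Omega)$ with $u_{\mathrm{PML}}|_\Gamma=g$, $u_{\mathrm{PML}}|_{\Gamma_{\mathrm{PML}}}=0$ and $B_{k^2}(u_{\mathrm{PML}},v)=\langle f,v\rangle_\Omega$ for all $v\in\mathbb{H}^1_0(\Omega)$.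
   Context: Let $D\subset\mathbb{R}^2$ be a bounded polygonal domain (the scatterer) contained in the rectangle $[-a_1,a_1]\times[-a_2,a_2]$, with $\Gamma=\partial D$, and let $0<a_j<b_j$, $j=1,2$. Set $\Omega=\big((-b_1,b_1)\times(-b_2,b_2)\big)\setminus\overline{D}$ and let $\Gamma_{\mathrm{PML}}$ be the boundary of the rectangle $(-b_1,b_1)\times(-b_2,b_2)$, so $\partial\Omega=\Gamma\cup\Gamma_{\mathrm{PML}}$. The PML stretching functions are $\gamma_j(x_j)=1+i\sigma_j(x_j)$, where $\sigma_j$ is a real-valued symmetric (even) function of $x_j$ that vanishes for $|x_j|<a_j$, $j=1,2$. Set $$A=\mathrm{diag}\left(\frac{\gamma_2(x_2)}{\gamma_1(x_1)},\frac{\gamma_1(x_1)}{\gamma_2(x_2)}\right),\qquad J=\gamma_1(x_1)\gamma_2(x_2).$$ $\mathbb{H}^1(\Omega)$ is the space of complex-valued $L^2$ functions on $\Omega$ with gradient in $L^2$, and $\mathbb{H}^1_0(\Omega)$ is its subspace of functions vanishing on $\partial\Omega$. Define $$B_{k^2}(u,v)=\int_\Omega\left(A\nabla u\cdot\nabla\overline{v}-k^2Ju\,\overline{v}\right)d\mathbf{x},\qquad \langle f,v\rangle_\Omega=\int_\Omega f\overline{v}\,d\mathbf{x}.$$ *)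

theory Defs
  imports "HOL-Analysis.Analysis"
begin

definition partial :: "2 \<Rightarrow> (real^2 \<Rightarrow> complex) \<Rightarrow> real^2 \<Rightarrow> complex" where
  "partial i \<phi> x = frechet_derivative \<phi> (at x) (axis i 1)"

primrec Ck :: "nat \<Rightarrow> (real^2 \<Rightarrow> complex) \<Rightarrow> bool" where
  "Ck 0 \<phi> \<longleftrightarrow> continuous_on UNIV \<phi>"
| "Ck (Suc n) \<phi> \<longleftrightarrow> (\<forall>x. \<phi> differentiable (at x)) \<and> (\<forall>i. Ck n (partial i \<phi>))"

definition smooth :: "(real^2 \<Rightarrow> complex) \<Rightarrow> bool" where
  "smooth \<phi> \<longleftrightarrow> (\<forall>n. Ck n \<phi>)"

definition test_functions :: "(real^2) set \<Rightarrow> (real^2 \<Rightarrow> complex) set" where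
  "test_functions \<Omega> = {\<phi>. smooth \<phi> \<and> compact (closure {x. \<phi> x \<noteq> 0}) \<and> closure {x. \<phi> x \<noteq> 0} \<subseteq> \<Omega>}"

text \<open>Elements of the function spaces are functions; equality in these spaces is equality
  almost everywhere.\<close>

definition L2 :: "(real^2) measure \<Rightarrow> (real^2 \<Rightarrow> complex) set" where
  "L2 M = {u \<in> borel_measurable M. (\<integral>\<^sup>+x. ennreal ((cmod (u x))\<^sup>2) \<partial>M) < \<infinity>}"

definition sq_dist :: "(real^2) measure \<Rightarrow> (real^2 \<Rightarrow> complex) \<Rightarrow> (real^2 \<Rightarrow> complex) \<Rightarrow> ennreal" where
  "sq_dist M u v = (\<integral>\<^sup>+x. ennreal ((cmod (u x - v x))\<^sup>2) \<partial>M)"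

definition weak_gradient :: "(real^2) set \<Rightarrow> (real^2 \<Rightarrow> complex) \<Rightarrow> (real^2 \<Rightarrow> complex^2) \<Rightarrow> bool" where
  "weak_gradient \<Omega> u G \<longleftrightarrow>
     (\<forall>i. (\<lambda>x. G x $ i) \<in> L2 (lebesgue_on \<Omega>) \<and>
       (\<forall>\<phi>\<in>test_functions \<Omega>.
          (LINT x|lebesgue_on \<Omega>. u x * partial i \<phi> x) = - (LINT x|lebesgue_on \<Omega>. G x $ i * \<phi> x)))"

definition H1 :: "(real^2) set \<Rightarrow> (real^2 \<Rightarrow> complex) set" where
  "H1 \<Omega> = {u \<in> L2 (lebesgue_on \<Omega>). \<exists>G. weak_gradient \<Omega> u G}"

text \<open>On an open set the weak gradient is unique up to a null set, so the choice is immaterial.\<close>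

definition wgrad :: "(real^2) set \<Rightarrow> (real^2 \<Rightarrow> complex) \<Rightarrow> real^2 \<Rightarrow> complex^2" where
  "wgrad \<Omega> u = (SOME G. weak_gradient \<Omega> u G)"

text \<open>A boundary curve is given by the finite set of its edges, an edge being the pair of its end
  points. Distinct edges meet at most in common end points.\<close>

definition edge_set :: "((real^2) \<times> (real^2)) set \<Rightarrow> bool" where
  "edge_set E \<longleftrightarrow> finite E \<and> (\<forall>(p,q)\<in>E. p \<noteq> q) \<and>
     (\<forall>(p,q)\<in>E. \<forall>(p',q')\<in>E. (p,q) \<noteq> (p',q') \<longrightarrow>
        closed_segment p q \<inter> closed_segment p' q' \<subseteq> {p,q} \<inter> {p',q'})"

text \<open>The condition \<open>interior (closure D) = D\<close> says that \<open>D\<close> lies on one side only of each edge;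
  it excludes slits, and gives \<open>frontier (closure D) = frontier D\<close>.\<close>

definition polygonal_domain :: "(real^2) set \<Rightarrow> ((real^2) \<times> (real^2)) set \<Rightarrow> bool" where
  "polygonal_domain D E \<longleftrightarrow>
     D \<noteq> {} \<and> open D \<and> connected D \<and> bounded D \<and> interior (closure D) = D \<and>
     edge_set E \<and> frontier D = (\<Union>(p,q)\<in>E. closed_segment p q)"

definition edge_measure :: "(real^2) \<times> (real^2) \<Rightarrow> (real^2) measure" where
  "edge_measure = (\<lambda>(p,q). distr (restrict_space lborel {0..dist p q}) borel
     (\<lambda>t. p + (t / dist p q) *\<^sub>R (q - p)))"

definition arclength :: "((real^2) \<times> (real^2)) set \<Rightarrow> (real^2) measure" where
  "arclength E = measure_of UNIV (sets borel) (\<lambda>S. \<Sum>e\<in>E. emeasure (edge_measure e) S)"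

text \<open>The Sobolev-Slobodeckij space of order \<open>s = 1/2\<close> on a curve; the exponent of the distance
  is \<open>1 + 2 * s = 2\<close>.\<close>

definition H_half :: "((real^2) \<times> (real^2)) set \<Rightarrow> (real^2 \<Rightarrow> complex) set" where
  "H_half E = {g \<in> L2 (arclength E).
     (\<integral>\<^sup>+x. (\<integral>\<^sup>+y. ennreal ((cmod (g x - g y))\<^sup>2 / (dist x y)\<^sup>2) \<partial>arclength E) \<partial>arclength E) < \<infinity>}"

text \<open>The trace operator, as a relation between \<open>u\<close> and its trace \<open>g\<close> on the part of the boundary
  formed by the edges \<open>E\<close>: it is the closure, with respect to the \<open>H1\<close> norm in the domain and the
  \<open>L2\<close> norm on the boundary, of the restriction map on functions smooth up to the boundary.\<close>

definition has_trace ::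
  "(real^2) set \<Rightarrow> ((real^2) \<times> (real^2)) set \<Rightarrow> (real^2 \<Rightarrow> complex) \<Rightarrow> (real^2 \<Rightarrow> complex) \<Rightarrow> bool" where
  "has_trace \<Omega> E u g \<longleftrightarrow> u \<in> H1 \<Omega> \<and> g \<in> L2 (arclength E) \<and>
     (\<exists>\<phi>::nat \<Rightarrow> real^2 \<Rightarrow> complex. (\<forall>n. smooth (\<phi> n)) \<and>
        (\<lambda>n. sq_dist (lebesgue_on \<Omega>) (\<phi> n) u) \<longlonglongrightarrow> 0 \<and>
        (\<forall>i. (\<lambda>n. sq_dist (lebesgue_on \<Omega>) (partial i (\<phi> n)) (\<lambda>x. wgrad \<Omega> u x $ i)) \<longlonglongrightarrow> 0) \<and>
        (\<lambda>n. sq_dist (arclength E) (\<phi> n) g) \<longlonglongrightarrow> 0)"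

definition rect_edges :: "real \<Rightarrow> real \<Rightarrow> ((real^2) \<times> (real^2)) set" where
  "rect_edges b1 b2 =
     {(vector [-b1, -b2], vector [b1, -b2]), (vector [b1, -b2], vector [b1, b2]),
      (vector [b1, b2], vector [-b1, b2]), (vector [-b1, b2], vector [-b1, -b2])}"

definition pml_domain :: "real \<Rightarrow> real \<Rightarrow> (real^2) set \<Rightarrow> (real^2) set" where
  "pml_domain b1 b2 D = {x. - b1 < x$1 \<and> x$1 < b1 \<and> - b2 < x$2 \<and> x$2 < b2} - closure D"

definition H1_0 :: "real \<Rightarrow> real \<Rightarrow> (real^2) set \<Rightarrow> ((real^2) \<times> (real^2)) set \<Rightarrow> (real^2 \<Rightarrow> complex) set" where
  "H1_0 b1 b2 D E =
     {v \<in> H1 (pml_domain b1 b2 D). has_trace (pml_domain b1 b2 D) (E \<union> rect_edges b1 b2) v (\<lambda>x. 0)}"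

definition pml_stretch :: "(real \<Rightarrow> real) \<Rightarrow> real \<Rightarrow> complex" where
  "pml_stretch \<sigma> t = 1 + \<i> * complex_of_real (\<sigma> t)"

definition pml_A :: "(real \<Rightarrow> real) \<Rightarrow> (real \<Rightarrow> real) \<Rightarrow> real^2 \<Rightarrow> complex^2^2" where
  "pml_A \<sigma>1 \<sigma>2 x = vector
     [vector [pml_stretch \<sigma>2 (x$2) / pml_stretch \<sigma>1 (x$1), 0],
      vector [0, pml_stretch \<sigma>1 (x$1) / pml_stretch \<sigma>2 (x$2)]]"

definition pml_J :: "(real \<Rightarrow> real) \<Rightarrow> (real \<Rightarrow> real) \<Rightarrow> real^2 \<Rightarrow> complex" where
  "pml_J \<sigma>1 \<sigma>2 x = pml_stretch \<sigma>1 (x$1) * pml_stretch \<sigma>2 (x$2)"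

definition pml_form ::
  "(real \<Rightarrow> real) \<Rightarrow> (real \<Rightarrow> real) \<Rightarrow> (real^2) set \<Rightarrow> real \<Rightarrow> (real^2 \<Rightarrow> complex) \<Rightarrow> (real^2 \<Rightarrow> complex) \<Rightarrow> complex" where
  "pml_form \<sigma>1 \<sigma>2 \<Omega> \<kappa> u v =
     (LINT x|lebesgue_on \<Omega>.
        (\<Sum>i\<in>UNIV. (pml_A \<sigma>1 \<sigma>2 x *v wgrad \<Omega> u x) $ i * cnj (wgrad \<Omega> v x $ i))
        - complex_of_real \<kappa> * pml_J \<sigma>1 \<sigma>2 x * u x * cnj (v x))"

definition pml_weak_solution ::
  "(real \<Rightarrow> real) \<Rightarrow> (real \<Rightarrow> real) \<Rightarrow> real \<Rightarrow> real \<Rightarrow> (real^2) set \<Rightarrow> ((real^2) \<times> (real^2)) set \<Rightarrow>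
   real \<Rightarrow> (real^2 \<Rightarrow> complex) \<Rightarrow> (real^2 \<Rightarrow> complex) \<Rightarrow> (real^2 \<Rightarrow> complex) \<Rightarrow> bool" where
  "pml_weak_solution \<sigma>1 \<sigma>2 b1 b2 D E k f g u \<longleftrightarrow>
     (let \<Omega> = pml_domain b1 b2 D in
       u \<in> H1 \<Omega> \<and> has_trace \<Omega> E u g \<and> has_trace \<Omega> (rect_edges b1 b2) u (\<lambda>x. 0) \<and>
       (\<forall>v\<in>H1_0 b1 b2 D E.
          pml_form \<sigma>1 \<sigma>2 \<Omega> (k\<^sup>2) u v = (LINT x|lebesgue_on \<Omega>. f x * cnj (v x))))"

end

theory Submission
  imports Defs "HOL-Library.Diagonal_Subsequence" "HOL-Computational_Algebra.Polynomial"
begin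

text \<open>Since Re (gamma_2 / gamma_1) and Re (gamma_1 / gamma_2) are bounded below by a positive constant, the
  Poincare inequality makes the principal part coercive on the functions vanishing on the boundary, and
  the zero order term is compact by a Rellich inequality; the Fredholm alternative for the real pencil
  a - k^2 m then gives the discrete exceptional set. Both inequalities follow from one-dimensional
  oscillation estimates along axis-parallel lines, where each line meets the boundary edges in few points.

  The boundary datum is extended by the quotient of the potentials with kernel (|x - y|^2 + e)^(-2) of g and
  of 1. Its gradient is dominated, uniformly in e, by a double boundary integral whose integral over the
  plane is the H^{1/2} energy of g. Two solutions may have their boundary values attained along
  different approximating sequences; a cutoff glues these, so that the difference lies in the
  homogeneous space.\<close>

text \<open>The trace is a closure relation, so a function of zero trace is reached only through
  smooth functions whose boundary values are small but not zero. Every estimate is therefore proved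
  for smooth functions with an explicit boundary term, which disappears in the limit. To make limits
  harmless a function is carried with its gradient as one field, its jet: the homogeneous space is
  then a closed subspace of an L2 space, and weak gradients occur only where the definitions of the
  statement are met. Scalars are real throughout. Since k^2 is real, the real part of the form is a
  real bilinear pencil, and testing with i v in place of v recovers the imaginary part. The kernel
  exponent suits a one-dimensional boundary. For small e the total weight at distance d from it is
  at least of order d^(-3), and two uses of Cauchy-Schwarz bound the squared gradient at x by the
  double integral of |g y - g z|^2 / (|x - y|^2 + |y - z|^2 / 2)^2, up to a constant. Integration in
  x leaves a multiple of |g y - g z|^2 / |y - z|^2, the H^{1/2} density.\<close>

section \<open>Hilbert space preliminaries: Riesz representation, Lax-Milgram, orthogonal
  vectors\<close>

lemma quadratic_nonneg_imp_linear_zero: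
 fixes a b :: real
 assumes "\<And>t. 0 <= t * a + t^2 * b"
 shows "a = 0"
proof (rule ccontr)
 assume "a \<noteq> 0"
 \<comment> \<open>The sign is opposite to that of \<open>a\<close>, and the step is short enough
   for the linear term to dominate, since b / (|b| + 1) < 1.\<close>
 define t where "t = - a / (\<bar>b\<bar> + 1)"
 define r where "r = \<bar>b\<bar> + 1"
 have r: "r > 0" "b / r < 1" by (auto simp: r_def field_simps)
 have "t * a = - (a^2 / r)" "t^2 * b = (a^2 / r) * (b / r)"
  by (simp_all add: t_def r_def[symmetric] power2_eq_square)
 moreover have "(a^2 / r) * (b / r) < (a^2 / r) * 1"
  using r \<open>a \<noteq> 0\<close> by (intro mult_strict_left_mono) auto
 ultimately have "t^2 * b < - (t * a)" by simp
 then have "t * a + t^2 * b < 0" by simp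
 with assms[of t] show False by simp
qed

lemma Cauchy_of_sq_bound:
 fixes u :: "nat => 'h::real_normed_vector"
 assumes "\<And>n k. (norm (u n - u k))^2 <= e n + e k" "e \<longlonglongrightarrow> 0"
 shows "Cauchy u"
proof (rule CauchyI)
 fix r :: real assume "r > 0"
 then have "\<forall>\<^sub>F n in sequentially. e n < r\<^sup>2 / 2"
  using assms(2) by (intro order_tendstoD(2)[of e 0]) auto
 then obtain N where N: "\<And>n. n \<ge> N ==> e n < r\<^sup>2 / 2"
  by (auto simp: eventually_sequentially)
 show "\<exists>M. \<forall>m\<ge>M. \<forall>n\<ge>M. norm (u m - u n) < r"
 proof (intro exI allI impI)
  fix m n assume "m \<ge> N" "n \<ge> N"
  then have "(norm (u m - u n))^2 < r\<^sup>2" using assms(1)[of m n] N[of m] N[of n] by simp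
  then show "norm (u m - u n) < r" using \<open>r > 0\<close> by (simp add: power2_less_imp_less)
 qed
qed

text \<open>Direct method: the representer minimises |u|^2 - 2 F u over \<open>H\<close>. The result
  is stated for a closed subspace because the function space of the problem is a subset of an L2
  type, not a type of its own.\<close>

lemma riesz_representation_subspace:
 fixes H :: "'h::{real_inner,complete_space} set"
 assumes H: "closed H" "subspace H" and F: "bounded_linear F"
 shows "\<exists>r\<in>H. \<forall>v\<in>H. r \<bullet> v = F v"
proof -
 interpret F: bounded_linear F by fact
 define J where "J u = (norm u)^2 - 2 * F u" for u
 obtain B where B: "\<And>u. \<bar>F u\<bar> <= norm u * B" using F.bounded by auto
 have Jlow: "- B\<^sup>2 <= J u" for u
 proof -
  have "0 <= (norm u - B)^2" by simp
  then show ?thesis using B[of u] by (simp add: J_def power2_eq_square algebra_simps abs_le_iff)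
 qed
 have bdd: "bdd_below (J ` H)" using Jlow by (auto intro!: bdd_belowI2)
 define d where "d = Inf (J ` H)"
 have ne: "J ` H \<noteq> {}" using subspace_0[OF H(2)] by auto
 have d_le: "d <= J u" if "u \<in> H" for u unfolding d_def using that bdd by (intro cInf_lower) auto
 have "\<exists>u\<in>H. J u < d + 1 / real (Suc n)" for n
 proof -
  have "Inf (J ` H) < d + 1 / real (Suc n)" by (simp add: d_def)
  then show ?thesis using cInf_lessD[OF ne] by auto
 qed
 then obtain u where u: "\<And>n. u n \<in> H" "\<And>n. J (u n) < d + 1 / real (Suc n)" by metis
 \<comment> \<open>Parallelogram identity; the linear part cancels. The midpoint stays in
   \<open>H\<close>, where \<open>J\<close> is at least \<open>d\<close>, so near-minimisers are
   close to each other.\<close>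
 have par: "(norm (x - y))^2 = 2 * J x + 2 * J y - 4 * J ((1/2) *\<^sub>R (x + y))" for x y
  by (simp add: J_def F.add F.scale power2_norm_eq_inner inner_add_left inner_add_right
    inner_diff_left inner_diff_right inner_commute[of y x] algebra_simps)
 have "Cauchy u"
 proof (rule Cauchy_of_sq_bound)
  fix n k
  have "(1/2) *\<^sub>R (u n + u k) \<in> H" using u(1) H(2) by (meson subspace_add subspace_scale)
  from d_le[OF this] show "(norm (u n - u k))^2 <= 2 / real (Suc n) + 2 / real (Suc k)"
   using par[of "u n" "u k"] u(2)[of n] u(2)[of k] by simp
 next
  show "(%n. 2 / real (Suc n)) \<longlonglongrightarrow> 0"
   using tendsto_mult_right_zero[OF LIMSEQ_inverse_real_of_nat, of 2]
   by (simp add: divide_inverse)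
 qed
 then obtain r where r: "u \<longlonglongrightarrow> r" by (auto simp: Cauchy_convergent_iff convergent_def)
 have rH: "r \<in> H" using closed_sequentially[OF H(1), of u r] u(1) r by auto
 have "(%n. J (u n)) \<longlonglongrightarrow> J r" unfolding J_def by (intro tendsto_intros F.tendsto r)
 moreover have "(%n. d + 1 / real (Suc n)) \<longlonglongrightarrow> d + 0"
  using LIMSEQ_inverse_real_of_nat by (intro tendsto_intros) (simp add: divide_inverse)
 ultimately have "J r <= d"
  using u(2) by (intro LIMSEQ_le[of "%n. J (u n)" "J r" "%n. d + 1 / real (Suc n)" d])
   (auto intro: less_imp_le)
 have "r \<bullet> v = F v" if "v \<in> H" for v
 proof -
  have "0 <= t * (2 * (r \<bullet> v - F v)) + t^2 * (norm v)^2" for t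
  proof -
   have "r + t *\<^sub>R v \<in> H" using rH that H(2) by (simp add: subspace_add subspace_scale)
   then have "J r <= J (r + t *\<^sub>R v)" using \<open>J r <= d\<close> d_le by fastforce
   then show ?thesis
    unfolding J_def F.add F.scale power2_norm_eq_inner
    by (simp add: inner_add_left inner_add_right inner_commute[of v r] algebra_simps
      power2_eq_square)
  qed
  from quadratic_nonneg_imp_linear_zero[OF this] show ?thesis by simp
 qed
 with rH show ?thesis by blast
qed

lemma eq_if_inner_eq_on_subspace:
 assumes "subspace H" "x \<in> H" "y \<in> H" "\<And>v. v \<in> H ==> x \<bullet> v = y \<bullet> v"
 shows "x = y"
proof -
 have "(x - y) \<bullet> (x - y) = 0"
  using assms(4)[of "x - y"] assms(1-3) by (simp add: subspace_diff inner_diff_left)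
 then show ?thesis by simp
qed

lemma norm_le_if_inner_le:
 fixes r :: "'h::real_inner"
 assumes "r \<in> H" "\<And>v. v \<in> H ==> r \<bullet> v <= M * norm v" "0 <= M"
 shows "norm r <= M"
proof (cases "r = 0")
 case False
 have "norm r * norm r <= M * norm r" using assms(2)[OF assms(1)]
  by (simp add: power2_norm_eq_inner[symmetric] power2_eq_square)
 then show ?thesis using False by simp
qed (use assms in auto)

text \<open>Banach fixed point for u - rho (A u - f), where \<open>A\<close> and \<open>f\<close>
  represent the form and the functional. Symmetry of \<open>a\<close> plays no part in this
  argument, and the real part of the PML form is in general not symmetric.\<close>

lemma lax_milgram_subspace:
 fixes H :: "'h::{real_inner,complete_space} set"
 assumes H: "closed H" "subspace H" and a: "bounded_bilinear a"
  and c: "c > 0" "\<And>u. u \<in> H ==> c * (norm u)^2 <= a u u" and F: "bounded_linear F"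
 shows "\<exists>u\<in>H. \<forall>v\<in>H. a u v = F v"
proof -
 interpret a: bounded_bilinear a by fact
 obtain B0 where B0: "B0 > 0" "\<And>u v. norm (a u v) <= norm u * norm v * B0" using a.pos_bounded by auto
 \<comment> \<open>Enlarging the bound to at least \<open>c\<close> makes 1 - c^2 / B^2 nonnegative,
   so that its square root can serve as contraction factor.\<close>
 define B where "B = max B0 c"
 have B: "B > 0" "c <= B" "\<And>u v. \<bar>a u v\<bar> <= B * norm u * norm v"
 proof -
  show "B > 0" "c <= B" using B0 by (auto simp: B_def)
  fix u v :: 'h
  have "norm u * norm v * B0 <= norm u * norm v * B" by (intro mult_left_mono) (auto simp: B_def)
  then show "\<bar>a u v\<bar> <= B * norm u * norm v" using B0(2)[of u v] by (simp add: mult_ac)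
 qed
 have "\<exists>r\<in>H. \<forall>v\<in>H. r \<bullet> v = a u v" for u :: 'h
  by (rule riesz_representation_subspace[OF H a.bounded_linear_right])
 then obtain A where A: "\<And>u. A u \<in> H" "\<And>u v. v \<in> H ==> A u \<bullet> v = a u v" by metis
 obtain f where f: "f \<in> H" "\<And>v. v \<in> H ==> f \<bullet> v = F v"
  using riesz_representation_subspace[OF H F] by metis
 \<comment> \<open>This value minimises 1 - 2 rho c + rho^2 B^2, the squared Lipschitz bound of the
   iteration.\<close>
 define \<rho> where "\<rho> = c / B^2"
 define q where "q = sqrt (1 - c\<^sup>2 / B^2)"
 have cB: "c^2 / B^2 <= 1" using B c by (simp add: power_mono)
 have q: "0 <= q" "q < 1" "q^2 = 1 - c\<^sup>2 / B^2" using cB B c by (auto simp: q_def)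
 define \<Phi> where "\<Phi> u = u - \<rho> *\<^sub>R (A u - f)" for u
 have Adiff: "A u - A w = A (u - w)" for u w
  by (rule eq_if_inner_eq_on_subspace[OF H(2)])
   (use A H(2) in \<open>auto simp: subspace_diff inner_diff_left a.diff_left\<close>)
 have An: "norm (A w) <= B * norm w" for w
  by (rule norm_le_if_inner_le[of _ H]) (use A B B(3)[of w] in \<open>auto simp: abs_le_iff\<close>)
 have contr: "dist (\<Phi> u) (\<Phi> w) <= q * dist u w" if "u \<in> H" "w \<in> H" for u w
 proof -
  define z where "z = u - w"
  have zH: "z \<in> H" using that H by (simp add: z_def subspace_diff)
  have eq: "\<Phi> u - \<Phi> w = z - \<rho> *\<^sub>R A z"
   unfolding \<Phi>_def z_def Adiff[symmetric] by (simp add: algebra_simps)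
  have "(norm (\<Phi> u - \<Phi> w))^2 = (z - \<rho> *\<^sub>R A z) \<bullet> (z - \<rho> *\<^sub>R A z)"
   unfolding eq power2_norm_eq_inner ..
  also have "\<dots> = z \<bullet> z - 2 * \<rho> * (A z \<bullet> z) + \<rho>^2 * (A z \<bullet> A z)"
   by (simp add: inner_diff_left inner_diff_right inner_commute[of z "A z"] algebra_simps power2_eq_square)
  finally have "(norm (\<Phi> u - \<Phi> w))^2 = (norm z)^2 - 2 * \<rho> * a z z + \<rho>^2 * (norm (A z))^2"
   unfolding A(2)[OF zH] power2_norm_eq_inner[of z] power2_norm_eq_inner[of "A z"] .
  also have "\<dots> <= (norm z)^2 - 2 * \<rho> * (c * (norm z)^2) + \<rho>^2 * (B * norm z)^2"
   using c(2)[OF zH] An[of z] c(1) B(1)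
   by (intro add_mono diff_mono mult_left_mono power_mono) (auto simp: \<rho>_def)
  also have "\<dots> = (q * norm z)^2"
  proof -
   have 1: "\<rho> * c = c^2 / B^2" by (simp add: \<rho>_def power2_eq_square)
   have 3: "\<rho> * B^2 = c" using B(1) by (simp add: \<rho>_def)
   have "\<rho> * (\<rho> * B^2) = c^2 / B^2" unfolding 3 by (rule 1)
   then have 2: "1 - 2 * (\<rho> * c) + \<rho> * (\<rho> * B^2) = q^2" using 1 q(3) by linarith
   have "(norm z)^2 - 2 * \<rho> * (c * (norm z)^2) + \<rho>^2 * (B * norm z)^2
     = (1 - 2 * (\<rho> * c) + \<rho> * (\<rho> * B^2)) * (norm z)^2"
    by (simp add: power2_eq_square algebra_simps)
   also have "\<dots> = (q * norm z)^2" unfolding 2 by (rule power_mult_distrib[symmetric])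
   finally show ?thesis .
  qed
  finally have "norm (\<Phi> u - \<Phi> w) <= q * norm z"
   by (rule power2_le_imp_le) (simp add: q(1))
  then show ?thesis by (simp add: dist_norm z_def)
 qed
 have "\<Phi> u \<in> H" if "u \<in> H" for u
  using that A f H by (simp add: \<Phi>_def subspace_diff subspace_scale)
 then have "\<Phi> ` H \<subseteq> H" by blast
 moreover have "complete H" using H by (simp add: complete_eq_closed)
 moreover have "H \<noteq> {}" using subspace_0[OF H(2)] by auto
 ultimately have "\<exists>!u\<in>H. \<Phi> u = u"
  by (intro Banach_fix[of H q \<Phi>] q(1,2) contr)
 then obtain u where "u \<in> H" "\<Phi> u = u" by (elim ex1E conjE)
 have "\<rho> *\<^sub>R (A u - f) = 0" using \<open>\<Phi> u = u\<close> by (simp add: \<Phi>_def)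
 moreover have "\<rho> \<noteq> 0" using c(1) B(1) by (simp add: \<rho>_def)
 ultimately have "A u = f" by simp
 have "a u v = F v" if "v \<in> H" for v
  unfolding A(2)[OF that, symmetric] \<open>A u = f\<close> by (rule f(2)[OF that])
 then show ?thesis using \<open>u \<in> H\<close> by blast
qed

text \<open>From a point x outside \<open>N\<close> its orthogonal projection is subtracted, which
  is the Riesz representer on \<open>N\<close> of taking the inner product with x. This is the lemma
  of F. Riesz with the optimal constant 1.\<close>

lemma unit_orthogonal_closed_subspace:
 fixes N :: "'h::{real_inner,complete_space} set"
 assumes "closed N" "subspace N" "subspace M" "N \<subseteq> M" "N \<noteq> M"
 shows "\<exists>y\<in>M. norm y = 1 \<and> (\<forall>v\<in>N. y \<bullet> v = 0)"
proof -
 obtain x where x: "x \<in> M" "x \<notin> N" using assms by auto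
 obtain p where p: "p \<in> N" "\<And>v. v \<in> N ==> p \<bullet> v = x \<bullet> v"
  using riesz_representation_subspace[OF assms(1,2) bounded_linear_inner_right[of x]] by metis
 define y where "y = (1 / norm (x - p)) *\<^sub>R (x - p)"
 have "x - p \<noteq> 0" using x p by auto
 moreover have "x - p \<in> M" using x p assms by (auto intro: subspace_diff)
 ultimately show ?thesis using p assms(3)
  by (intro bexI[of _ y]) (auto simp: y_def inner_diff_left subspace_scale)
qed

text \<open>Gram-Schmidt supplies the projection onto a finite span explicitly, in any inner product
  space.\<close>

lemma unit_orthogonal_finite_span:
 fixes x :: "'h::real_inner"
 assumes "finite B" "x \<notin> span B"
 shows "\<exists>y\<in>span (insert x B). norm y = 1 \<and> (\<forall>v\<in>span B. y \<bullet> v = 0)"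
proof -
 obtain C where C: "finite C" "span C = span B" "pairwise orthogonal C"
  using basis_orthogonal[OF assms(1)] by metis
 define p where "p = (\<Sum>b\<in>C. (b \<bullet> x / (b \<bullet> b)) *\<^sub>R b)"
 have p: "p \<in> span B" unfolding p_def C(2)[symmetric]
  by (intro span_sum span_scale span_base)
 have orth: "(x - p) \<bullet> v = 0" if "v \<in> span B" for v
 proof -
  have "orthogonal (x - p) b" if b: "b \<in> C" for b
  proof -
   have "p \<bullet> b = (\<Sum>d\<in>C. if d = b then b \<bullet> x else 0)"
    unfolding p_def inner_sum_left
    by (rule sum.cong) (use C(3) b in \<open>auto simp: pairwise_def orthogonal_def\<close>)
   also have "\<dots> = b \<bullet> x" using b C(1) by simp
   finally show ?thesis unfolding orthogonal_def inner_diff_left inner_commute[of b x] by simp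
  qed
  then have "orthogonal (x - p) v" using that C(2) orthogonal_to_span by metis
  then show ?thesis by (simp add: orthogonal_def)
 qed
 have "x - p \<noteq> 0" using p assms by auto
 moreover have "x - p \<in> span (insert x B)"
  using p by (intro span_diff) (auto intro: span_base span_mono[THEN subsetD, of B])
 ultimately show ?thesis using orth
  by (intro bexI[of _ "(1 / norm (x - p)) *\<^sub>R (x - p)"]) (auto simp: span_scale)
qed

lemma one_le_norm_diff_if_orthogonal:
 fixes y w :: "'h::real_inner"
 assumes "norm y = 1" "y \<bullet> w = 0"
 shows "1 <= norm (y - w)"
proof -
 have "(norm (y - w))^2 = 1 + (norm w)^2"
  using assms by (simp add: power2_norm_eq_inner inner_diff_left inner_diff_right
    inner_commute[of w y] norm_eq_1)
 then have "1^2 <= (norm (y - w))^2" by simp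
 then show ?thesis by (rule power2_le_imp_le) simp
qed


section \<open>Riesz theory of a compact operator\<close>

text \<open>Vectors for distinct characteristic values are independent. The map u - l n K u sends
  the span of n + 1 vectors into the span of the first n and preserves the relation u = mu K u, so
  the induction hypothesis kills the image; then u satisfies the relation for both
  \<open>\<mu>\<close> and \<open>l n\<close>, whence K u = 0. Characteristic values are reciprocals
  of eigenvalues, the parametrisation natural to a pencil.\<close>

lemma eigen_span_trivial:
 fixes K :: "'h::real_vector => 'h" and l :: "nat => real"
 assumes K: "linear K" and e: "\<And>n. e n = l n *\<^sub>R K (e n)"
  and u: "u \<in> span (e ` {..<n})" "u = \<mu> *\<^sub>R K u" "\<And>k. k < n ==> l k \<noteq> \<mu>"
 shows "u = 0"
 using u
proof (induction n arbitrary: u)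
 case 0 then show ?case by simp
next
 case (Suc n)
 interpret K: linear K by fact
 have Kspan: "K v \<in> span (e ` {..<n})" if "v \<in> span (e ` {..<n})" for v
 proof -
  have "K (e k) \<in> span (e ` {..<n})" if "k < n" for k
  \<comment> \<open>The value 0 occurs only together with e k = 0.\<close>
  proof (cases "l k = 0")
   case True
   have "e k = l k *\<^sub>R K (e k)" by (rule e)
   also have "\<dots> = 0" using True by simp
   finally have "e k = 0" .
   then show ?thesis by (simp add: K.zero span_zero)
  next
   case False
   then have "K (e k) = (1 / l k) *\<^sub>R (l k *\<^sub>R K (e k))" by simp
   then have "K (e k) = (1 / l k) *\<^sub>R e k" unfolding e[of k, symmetric] .
   then show ?thesis using that by (auto intro: span_scale span_base)
  qed
  then have "K ` span (e ` {..<n}) \<subseteq> span (e ` {..<n})"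
   unfolding linear_span_image[OF K, symmetric] by (intro span_minimal) auto
  then show ?thesis using that by auto
 qed
 have "u \<in> span (insert (e n) (e ` {..<n}))" using Suc.prems(1) by (simp add: lessThan_Suc)
 then obtain \<alpha> where \<alpha>: "u - \<alpha> *\<^sub>R e n \<in> span (e ` {..<n})" using span_breakdown_eq by blast
 define w where "w = u - \<alpha> *\<^sub>R e n"
 define T where "T v = v - l n *\<^sub>R K v" for v
 have "T (\<alpha> *\<^sub>R e n) = 0" unfolding T_def K.scale
  by (subst scaleR_left_commute) (simp only: e[of n, symmetric] diff_self)
 then have "T u = T w"
  by (simp add: T_def w_def K.diff algebra_simps)
 moreover have "T w \<in> span (e ` {..<n})" unfolding T_def
  using \<alpha> Kspan by (intro span_diff span_scale) (auto simp: w_def)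
 ultimately have "T u \<in> span (e ` {..<n})" by simp
 moreover have "T u = \<mu> *\<^sub>R K (T u)"
 proof -
  have "\<mu> *\<^sub>R K (T u) = \<mu> *\<^sub>R K u - l n *\<^sub>R K (\<mu> *\<^sub>R K u)"
   unfolding T_def K.diff K.scale scaleR_diff_right scaleR_left_commute[of \<mu> "l n"] ..
  then show ?thesis unfolding Suc.prems(2)[symmetric] T_def by (rule sym)
 qed
 ultimately have "T u = 0" using Suc.IH[of "T u"] Suc.prems(3) by simp
 then have 1: "u = l n *\<^sub>R K u" by (simp add: T_def)
 then have "(\<mu> - l n) *\<^sub>R K u = 0" using Suc.prems(2) by (metis right_minus_eq scaleR_left_diff_distrib)
 then have "K u = 0" using Suc.prems(3)[of n] by simp
 then show ?case using 1 by (metis scaleR_zero_right)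
qed

text \<open>The next two results are the Riesz theory of a compact operator. Compactness is only used through:
 the image under \<open>K\<close> of a bounded sequence has a Cauchy subsequence.\<close>

locale compact_operator_subspace =
 fixes H :: "'h::{real_inner,complete_space} set" and K :: "'h => 'h"
 assumes H: "closed H" "subspace H" and K: "bounded_linear K" and KH: "\<And>u. u \<in> H ==> K u \<in> H"
  and comp: "\<And>u::nat => 'h. (\<And>n. u n \<in> H) ==> (\<And>n. norm (u n) <= 1) ==>
   \<exists>r. strict_mono r \<and> Cauchy (%n. K (u (r n)))"
begin

sublocale K: bounded_linear K by (rule K)

text \<open>The form in which compactness gets contradicted below: points at mutual distance at
  least \<epsilon> have no Cauchy subsequence.\<close>

lemma no_separated_image:
 assumes "\<And>n::nat. u n \<in> H" "\<And>n. norm (u n) <= 1" "\<epsilon> > 0"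
  and "\<And>n k. k < n ==> \<epsilon> <= norm (K (u n) - K (u k))"
 shows False
proof -
 obtain r where r: "strict_mono r" "Cauchy (%n. K (u (r n)))" using comp[of u, OF assms(1,2)] by auto
 obtain M where "\<And>m n. m \<ge> M ==> n \<ge> M ==> norm (K (u (r m)) - K (u (r n))) < \<epsilon>"
  using CauchyD[OF r(2) assms(3)] by auto
 from this[of "Suc M" M] assms(4)[of "r M" "r (Suc M)"] r(1) show False
  by (simp add: strict_mono_Suc_iff)
qed

text \<open>Infinitely many characteristic values of size at most \<open>R\<close> give eigenvectors
  with a strictly increasing chain of spans \<open>N n\<close>. Unit vectors \<open>y n\<close> in
  \<open>N (Suc n)\<close> orthogonal to \<open>N n\<close> have images at mutual distance at least
  1 / R, which compactness forbids.\<close>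

lemma eigenvalues_locally_finite:
 "finite {\<mu>. \<bar>\<mu>\<bar> <= R \<and> (\<exists>u\<in>H. u \<noteq> 0 \<and> u = \<mu> *\<^sub>R K u)}"
proof (rule ccontr)
 assume "infinite {\<mu>. \<bar>\<mu>\<bar> <= R \<and> (\<exists>u\<in>H. u \<noteq> 0 \<and> u = \<mu> *\<^sub>R K u)}" (is "infinite ?L")
 from infinite_countable_subset[OF this] obtain l :: "nat => real" where l: "inj l" "range l \<subseteq> ?L"
  by (elim exE conjE)
 have mem: "\<bar>l n\<bar> <= R \<and> (\<exists>u\<in>H. u \<noteq> 0 \<and> u = l n *\<^sub>R K u)" for n
  by (rule CollectD[OF subsetD[OF l(2) rangeI]])
 have "\<exists>u. u \<in> H \<and> u \<noteq> 0 \<and> u = l n *\<^sub>R K u" for n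
  by (rule mem[THEN conjunct2, unfolded Bex_def])
 then have "\<exists>e. \<forall>n. e n \<in> H \<and> e n \<noteq> 0 \<and> e n = l n *\<^sub>R K (e n)" by (intro choice allI)
 then obtain e where e': "\<forall>n. e n \<in> H \<and> e n \<noteq> 0 \<and> e n = l n *\<^sub>R K (e n)" ..
 note e'' = e'[THEN spec]
 note e = e''[THEN conjunct1] e''[THEN conjunct2, THEN conjunct1] e''[THEN conjunct2, THEN conjunct2]
 have lR: "\<bar>l n\<bar> <= R" for n by (rule mem[THEN conjunct1])
 have l0: "l n \<noteq> 0" for n
 proof
  assume "l n = 0"
  have "e n = l n *\<^sub>R K (e n)" by (rule e)
  also have "\<dots> = 0" using \<open>l n = 0\<close> by simp
  finally show False using e(2) by simp
 qed
 define N where "N n = span (e ` {..<n})" for n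
 have NH: "N n \<subseteq> H" for n unfolding N_def using e(1) H(2) by (intro span_minimal) auto
 have mono: "N k \<subseteq> N n" if "k <= n" for k n
  unfolding N_def using that by (intro span_mono image_mono) auto
 have KN: "K v \<in> N n" if "v \<in> N n" for v n
 proof -
  have "K (e k) \<in> N n" if "k < n" for k
  proof -
   have "K (e k) = (1 / l k) *\<^sub>R (l k *\<^sub>R K (e k))" using l0[of k] by simp
   then have "K (e k) = (1 / l k) *\<^sub>R e k" unfolding e(3)[of k, symmetric] .
   then show ?thesis using that unfolding N_def by (auto intro: span_scale span_base)
  qed
  then have "K ` N n \<subseteq> N n"
   unfolding N_def linear_span_image[OF K.linear_axioms, symmetric] by (intro span_minimal) auto
  then show ?thesis using that by auto
 qed
 have "e n \<notin> N n" for n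
 proof
  assume "e n \<in> N n"
  then have "e n = 0" unfolding N_def
   by (rule eigen_span_trivial[where K=K and e=e and l=l and n=n and \<mu>="l n", OF K.linear_axioms e(3) _ e(3)])
    (use l(1) in \<open>auto simp: inj_eq\<close>)
  then show False using e(2) by simp
 qed
 then have "\<exists>y\<in>N (Suc n). norm y = 1 \<and> (\<forall>v\<in>N n. y \<bullet> v = 0)" for n
  unfolding N_def lessThan_Suc image_insert by (intro unit_orthogonal_finite_span) auto
 then obtain y where y: "\<And>n. y n \<in> N (Suc n)" "\<And>n. norm (y n) = 1"
  "\<And>n v. v \<in> N n ==> y n \<bullet> v = 0" by metis
 have TN: "v - l n *\<^sub>R K v \<in> N n" if v: "v \<in> N (Suc n)" for v n
 proof -
  obtain \<alpha> where \<alpha>: "v - \<alpha> *\<^sub>R e n \<in> N n" 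
   using v unfolding N_def lessThan_Suc image_insert span_breakdown_eq by auto
  define w where "w = v - \<alpha> *\<^sub>R e n"
  have "l n *\<^sub>R K (\<alpha> *\<^sub>R e n) = \<alpha> *\<^sub>R e n" unfolding K.scaleR
   by (subst scaleR_left_commute) (simp only: e(3)[of n, symmetric])
  then have "v - l n *\<^sub>R K v = w - l n *\<^sub>R K w"
   by (simp add: w_def K.diff algebra_simps)
  also have "\<dots> \<in> N n" using \<alpha> KN[OF \<alpha>] unfolding w_def[symmetric] 
   unfolding N_def by (intro span_diff span_scale)
  finally show ?thesis .
 qed
 have "0 < R" using lR[of 0] l0[of 0] by linarith
 show False
 proof (rule no_separated_image)
  show "y n \<in> H" "norm (y n) <= 1" for n using y(1,2)[of n] NH[of "Suc n"] by auto
  show "0 < 1 / R" using \<open>0 < R\<close> by simp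
  fix n k :: nat assume "k < n"
  \<comment> \<open>\<open>z\<close> lies in \<open>N n\<close>, and y n - z is \<open>l n\<close>
    times the difference of the two images; orthogonality makes its norm at least 1.\<close>
  define z where "z = (y n - l n *\<^sub>R K (y n)) + l n *\<^sub>R K (y k)"
  have "K (y k) \<in> N n" using KN[OF y(1)[of k]] mono[of "Suc k" n] \<open>k < n\<close> by auto
  then have "z \<in> N n" using TN[OF y(1)[of n]] unfolding z_def N_def
   by (intro span_add span_scale)
  then have "1 <= norm (y n - z)" by (intro one_le_norm_diff_if_orthogonal y)
  also have "y n - z = l n *\<^sub>R (K (y n) - K (y k))" by (simp add: z_def algebra_simps)
  also have "norm \<dots> <= R * norm (K (y n) - K (y k))"
   using lR[of n] by (simp add: mult_right_mono)
  finally show "1 / R <= norm (K (y n) - K (y k))" using \<open>0 < R\<close> by (simp add: field_simps)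
 qed
qed

text \<open>Otherwise there are unit vectors u with u - mu K u tending to 0. A subsequence of them
  converges because its images under \<open>K\<close> do, and the limit is a unit vector in the
  kernel.\<close>

lemma bounded_below_if_injective:
 assumes inj: "\<And>u. u \<in> H ==> u = \<mu> *\<^sub>R K u ==> u = 0"
 shows "\<exists>c>0. \<forall>u\<in>H. c * norm u <= norm (u - \<mu> *\<^sub>R K u)"
proof (rule ccontr)
 define T where "T v = v - \<mu> *\<^sub>R K v" for v
 assume "\<not> ?thesis"
 then have n: "\<exists>u\<in>H. norm (T u) < c * norm u" if "c > 0" for c
  using that by (force simp: T_def not_le)
 have "\<exists>u\<in>H. norm u = 1 \<and> norm (T u) < 1 / real (Suc n)" for n
 proof -
  obtain u where u: "u \<in> H" "norm (T u) < 1 / real (Suc n) * norm u"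
   using n[of "1 / real (Suc n)"] by auto
  then have "u \<noteq> 0" by (auto simp: T_def)
  have "T ((1 / norm u) *\<^sub>R u) = (1 / norm u) *\<^sub>R T u"
   by (simp add: T_def K.scaleR algebra_simps)
  then show ?thesis using u \<open>u \<noteq> 0\<close> H
   by (intro bexI[of _ "(1 / norm u) *\<^sub>R u"]) (auto simp: subspace_scale field_simps)
 qed
 then obtain u where u: "\<And>n. u n \<in> H" "\<And>n. norm (u n) = 1" "\<And>n. norm (T (u n)) < 1 / real (Suc n)"
  by metis
 obtain r where r: "strict_mono r" "Cauchy (%n. K (u (r n)))" using comp[of u] u by auto
 then obtain k where k: "(%n. K (u (r n))) \<longlonglongrightarrow> k" by (auto simp: Cauchy_convergent_iff convergent_def)
 have "(%n. T (u n)) \<longlonglongrightarrow> 0"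
  by (rule tendsto_norm_zero_cancel, rule tendsto_sandwich[OF _ _ tendsto_const LIMSEQ_inverse_real_of_nat])
   (use u(3) in \<open>auto simp: divide_inverse intro!: always_eventually less_imp_le\<close>)
 from LIMSEQ_subseq_LIMSEQ[OF this r(1)] have "(%n. T (u (r n))) \<longlonglongrightarrow> 0" by (simp add: o_def)
 from tendsto_add[OF this tendsto_scaleR[OF tendsto_const[of \<mu>] k]]
 have lim: "(%n. u (r n)) \<longlonglongrightarrow> \<mu> *\<^sub>R k" by (simp add: T_def)
 then have "(%n. K (u (r n))) \<longlonglongrightarrow> K (\<mu> *\<^sub>R k)" by (rule K.tendsto)
 with k have eq: "k = K (\<mu> *\<^sub>R k)" using LIMSEQ_unique by blast
 moreover have "\<mu> *\<^sub>R k \<in> H" using closed_sequentially[OF H(1) _ lim] u(1) by auto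
 ultimately have 0: "\<mu> *\<^sub>R k = 0" using inj[of "\<mu> *\<^sub>R k"] by metis
 have "(%n. 1) \<longlonglongrightarrow> norm (\<mu> *\<^sub>R k)" using tendsto_norm[OF lim] u(2) by simp
 then have "norm (\<mu> *\<^sub>R k) = 1" using LIMSEQ_unique tendsto_const by blast
 then show False unfolding 0 by simp
qed

text \<open>If \<open>f\<close> is missed, injectivity makes the closed ranges \<open>R n\<close> of
  the powers of \<open>T\<close> strictly decreasing, and unit vectors in each range orthogonal to
  the next have separated images under \<open>K\<close>.\<close>

lemma surjective_if_injective:
 assumes inj: "\<And>u. u \<in> H ==> u = \<mu> *\<^sub>R K u ==> u = 0" and f: "f \<in> H"
 shows "\<exists>u\<in>H. u - \<mu> *\<^sub>R K u = f"
proof -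
 define T where "T v = v - \<mu> *\<^sub>R K v" for v
 obtain c where c: "c > 0" "\<And>u. u \<in> H ==> c * norm u <= norm (T u)"
  using bounded_below_if_injective[of \<mu>, OF inj] unfolding T_def by blast
 have T: "bounded_linear T" unfolding T_def
  by (intro bounded_linear_sub bounded_linear_ident bounded_linear_compose[OF bounded_linear_scaleR_right] K)
 then interpret T: bounded_linear T .
 have TH: "T v \<in> H" if "v \<in> H" for v using that KH H by (auto simp: T_def subspace_diff subspace_scale)
 define R where "R n = (T ^^ n) ` H" for n
 have R: "closed (R n)" "subspace (R n)" "R n \<subseteq> H" for n
 proof (induction n)
  case (Suc n)
  have eq: "R (Suc n) = T ` R n" by (auto simp: R_def)
  \<comment> \<open>The lower bound for \<open>T\<close> keeps images of closed subspaces
    closed.\<close>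
  have "complete (T ` R n)"
   by (rule complete_isometric_image[OF c(1) Suc(2) T]) (use Suc c in \<open>auto simp: complete_eq_closed\<close>)
  then show "closed (R (Suc n))" by (simp add: eq complete_eq_closed)
  show "subspace (R (Suc n))" unfolding eq using Suc by (intro linear_subspace_image T.linear_axioms)
  show "R (Suc n) \<subseteq> H" using Suc TH by (auto simp: eq)
 qed (use H in \<open>auto simp: R_def\<close>)
 have dec: "R (Suc n) \<subseteq> R n" for n
  unfolding R_def using TH by (force simp: funpow_swap1)
 then have dec': "R k \<subseteq> R n" if "n <= k" for n k using lift_Suc_antimono_le[of R] that by blast
 show ?thesis
 proof (rule ccontr)
  assume "\<not> ?thesis"
  then have fT: "f \<notin> T ` H" by (auto simp: T_def)
  have Tinj: "x = y" if "T x = T y" "x \<in> H" "y \<in> H" for x y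
   using c(2)[of "x - y"] c(1) that H by (auto simp: T.diff subspace_diff mult_le_0_iff)
  have pow_inj: "x = y" if "(T ^^ n) x = (T ^^ n) y" "x \<in> H" "y \<in> H" for n x y
   using that
  proof (induction n arbitrary: x y)
   case (Suc n)
   then show ?case using Tinj TH by (metis funpow_Suc_right comp_apply)
  qed auto
  have "R (Suc n) \<noteq> R n" for n
  proof
   assume "R (Suc n) = R n"
   then have "(T ^^ n) f \<in> R (Suc n)" using f by (auto simp: R_def)
   then obtain h where h: "h \<in> H" "(T ^^ n) f = (T ^^ n) (T h)"
    by (auto simp: R_def funpow_swap1)
   then have "f = T h" using pow_inj f TH by blast
   with fT h show False by blast
  qed
  then have "\<exists>y\<in>R n. norm y = 1 \<and> (\<forall>v\<in>R (Suc n). y \<bullet> v = 0)" for n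
   using R dec by (intro unit_orthogonal_closed_subspace) auto
  then obtain y where y: "\<And>n. y n \<in> R n" "\<And>n. norm (y n) = 1"
   "\<And>n v. v \<in> R (Suc n) ==> y n \<bullet> v = 0" by metis
  have TR: "T v \<in> R (Suc n)" if "v \<in> R n" for v n using that by (auto simp: R_def)
  have sep: "1 <= \<bar>\<mu>\<bar> * norm (K (y n) - K (y k))" if "k < n" for n k
  proof -
   \<comment> \<open>\<open>z\<close> lies in the next range \<open>R (Suc k)\<close>, and y k - z
     equals - mu times the difference of the two images.\<close>
   define z where "z = T (y k) + y n - T (y n)"
   have "y n \<in> R (Suc k)" "T (y n) \<in> R (Suc k)"
    using dec'[of "Suc k" n] dec'[of "Suc k" "Suc n"] y(1)[of n] TR[of "y n" n] that by auto
   then have "z \<in> R (Suc k)" unfolding z_def using TR[OF y(1)[of k]] R(2)[of "Suc k"]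
    by (simp add: subspace_add subspace_diff)
   then have "1 <= norm (y k - z)" by (intro one_le_norm_diff_if_orthogonal y)
   also have "y k - z = (- \<mu>) *\<^sub>R (K (y n) - K (y k))" by (simp add: z_def T_def algebra_simps)
   finally show ?thesis by simp
  qed
  have "\<mu> \<noteq> 0" using sep[of 0 1] by auto
  show False
  proof (rule no_separated_image)
   show "y n \<in> H" "norm (y n) <= 1" for n using y(1,2)[of n] R(3)[of n] by auto
   show "0 < 1 / \<bar>\<mu>\<bar>" using \<open>\<mu> \<noteq> 0\<close> by simp
   fix n k :: nat assume "k < n"
   from sep[OF this] show "1 / \<bar>\<mu>\<bar> <= norm (K (y n) - K (y k))"
    using \<open>\<mu> \<noteq> 0\<close> by (simp add: field_simps)
  qed
 qed
qed

end

section \<open>The Fredholm alternative for a coercive form with a compact perturbation\<close>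

text \<open>Only smallness at each single scale is assumed; refining successively for the scales 1 /
  (j + 1) and taking the diagonal yields one Cauchy subsequence.\<close>

lemma Cauchy_subsequence_diagonal:
 fixes x :: "nat => 'h::real_normed_vector"
 assumes "\<And>s \<epsilon>. strict_mono (s::nat=>nat) ==> \<epsilon> > 0 ==>
  \<exists>r::nat=>nat. strict_mono r \<and> (\<forall>n k. norm (x (s (r n)) - x (s (r k))) <= \<epsilon>)"
 shows "\<exists>r. strict_mono r \<and> Cauchy (%n. x (r n))"
proof -
 define P where "P j s \<longleftrightarrow> (\<forall>n k. norm (x (s n) - x (s k)) <= 1 / real (Suc j))" for j and s :: "nat=>nat"
 interpret subseqs P
 proof
  fix n s assume "strict_mono (s::nat=>nat)"
  from assms[OF this, of "1 / real (Suc n)"] show "\<exists>r'. strict_mono r' \<and> P n (s \<circ> r')"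
   by (simp add: P_def)
 qed
 have D: "P k (diagseq \<circ> ((+) (Suc k)))" for k
  by (rule diagseq_holds) (auto simp: P_def)
 have "Cauchy (%n. x (diagseq n))"
 proof (rule CauchyI)
  fix e :: real assume "e > 0"
  then obtain j where j: "1 / real (Suc j) < e" using nat_approx_posE by metis
  show "\<exists>M. \<forall>m\<ge>M. \<forall>n\<ge>M. norm (x (diagseq m) - x (diagseq n)) < e"
  proof (intro exI allI impI)
   fix m n assume "m \<ge> Suc j" "n \<ge> Suc j"
   then have "m = Suc j + (m - Suc j)" "n = Suc j + (n - Suc j)" by auto
   then show "norm (x (diagseq m) - x (diagseq n)) < e"
    using P_def[THEN iffD1, OF D[of j], rule_format, of "m - Suc j" "n - Suc j"] j by simp
  qed
 qed
 then show ?thesis using subseq_diagseq by auto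
qed

text \<open>Coercivity lets Lax-Milgram define \<open>K\<close> by a (K u) v = m u v, and the
  problem becomes u - mu K u = f. The hypothesis \<open>comp\<close> is compactness of u to
  \<open>m u\<close> in the dual norm, which coercivity turns into compactness of \<open>K\<close>;
  the exceptional set consists of the characteristic values of \<open>K\<close>.\<close>

theorem fredholm_alternative_pencil:
 fixes H :: "'h::{real_inner,complete_space} set" and a m :: "'h => 'h => real"
 assumes H: "closed H" "subspace H" and a: "bounded_bilinear a" and m: "bounded_bilinear m"
  and c: "c > 0" "\<And>u. u \<in> H ==> c * (norm u)^2 <= a u u"
  and comp: "\<And>(u::nat => 'h) \<epsilon>. (\<And>n. u n \<in> H) ==> (\<And>n. norm (u n) <= 1) ==> \<epsilon> > 0 ==>
   \<exists>r::nat=>nat. strict_mono r \<and> (\<forall>n k. \<forall>v\<in>H. m (u (r n) - u (r k)) v <= \<epsilon> * norm v)"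
 shows "\<exists>\<Lambda>::real set. (\<forall>R. finite (\<Lambda> \<inter> {-R..R})) \<and>
  (\<forall>\<mu>. \<mu> \<notin> \<Lambda> \<longrightarrow>
   (\<forall>F. bounded_linear F \<longrightarrow> (\<exists>u\<in>H. \<forall>v\<in>H. a u v - \<mu> * m u v = F v)) \<and>
   (\<forall>u\<in>H. (\<forall>v\<in>H. a u v - \<mu> * m u v = 0) \<longrightarrow> u = 0))"
proof -
 interpret a: bounded_bilinear a by fact
 interpret m: bounded_bilinear m by fact
 have uniq: "u = w" if "u \<in> H" "w \<in> H" "\<And>v. v \<in> H ==> a u v = a w v" for u w
 proof -
  have "u - w \<in> H" using that H by (simp add: subspace_diff)
  then have "c * (norm (u - w))^2 <= 0" using c(2)[of "u - w"] that(3)[of "u - w"] by (simp add: a.diff_left)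
  then show ?thesis using c(1) by (simp add: mult_le_0_iff)
 qed
 have ex: "\<exists>w\<in>H. \<forall>v\<in>H. a w v = F v" if "bounded_linear F" for F
  using lax_milgram_subspace[OF H a c that] by auto
 then have "\<forall>u. \<exists>w\<in>H. \<forall>v\<in>H. a w v = m u v" using m.bounded_linear_right by blast
 then obtain K where Kp: "\<And>u. K u \<in> H" "\<And>u v. v \<in> H ==> a (K u) v = m u v" by metis
 \<comment> \<open>The dual norm of \<open>m u\<close> controls \<open>K u\<close>: the equation is
   tested with K u itself and divided by its norm.\<close>
 have bound: "norm (K u) <= M / c" if "\<And>v. v \<in> H ==> m u v <= M * norm v" "0 <= M" for u M
 proof (cases "K u = 0")
  case False
  have "c * (norm (K u))^2 <= M * norm (K u)"
   using c(2)[OF Kp(1)[of u]] Kp(2)[OF Kp(1), of u u] that(1)[OF Kp(1)[of u]] by simp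
  then show ?thesis using False c(1) by (simp add: power2_eq_square field_simps)
 qed (use that c in auto)
 obtain B where B: "B > 0" "\<And>u v. norm (m u v) <= norm u * norm v * B" using m.pos_bounded by auto
 have Kadd: "K (u + w) = K u + K w" for u w
  by (rule uniq) (use Kp H in \<open>auto simp: subspace_add a.add_left m.add_left\<close>)
 have Kscale: "K (r *\<^sub>R u) = r *\<^sub>R K u" for u r
  by (rule uniq) (use Kp H in \<open>auto simp: subspace_scale a.scaleR_left m.scaleR_left\<close>)
 have Kb: "bounded_linear K"
 proof (rule bounded_linear_intro[OF Kadd Kscale])
  fix u
  have "norm (K u) <= (norm u * B) / c"
   by (rule bound) (use B(2)[of u] B(1) in \<open>auto simp: abs_le_iff mult_ac\<close>)
  then show "norm (K u) <= norm u * (B / c)" by simp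
 qed
 interpret compact_operator_subspace H K
 proof (rule compact_operator_subspace.intro)
  show "\<exists>r. strict_mono r \<and> Cauchy (%n. K (u (r n)))"
   if u: "\<And>n. u n \<in> H" "\<And>n. norm (u n) <= 1" for u :: "nat => 'h"
  proof (rule Cauchy_subsequence_diagonal)
   fix s :: "nat => nat" and \<epsilon> :: real assume "strict_mono s" "\<epsilon> > 0"
   then obtain r :: "nat => nat" where r: "strict_mono r"
    "\<And>n k v. v \<in> H ==> m (u (s (r n)) - u (s (r k))) v <= (c * \<epsilon>) * norm v"
    using comp[of "%n. u (s n)" "c * \<epsilon>"] u c(1) by auto
   have "norm (K (u (s (r n)) - u (s (r k)))) <= (c * \<epsilon>) / c" for n k
    using r(2) c(1) \<open>\<epsilon> > 0\<close> by (intro bound) auto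
   then show "\<exists>r::nat=>nat. strict_mono r \<and> (\<forall>n k. norm (K (u (s (r n))) - K (u (s (r k)))) <= \<epsilon>)"
    using r(1) c(1) bounded_linear.linear[OF Kb] by (intro exI[of _ r] conjI allI) (auto simp: linear_diff)
  qed
 qed (use H Kb Kp in simp_all)
 define \<Lambda> where "\<Lambda> = {\<mu>. \<exists>u\<in>H. u \<noteq> 0 \<and> u = \<mu> *\<^sub>R K u}"
 have "finite (\<Lambda> \<inter> {-R..R})" for R
 proof (rule finite_subset[OF _ eigenvalues_locally_finite[of R]], rule subsetI)
  fix \<mu> assume "\<mu> \<in> \<Lambda> \<inter> {-R..R}"
  then have "\<mu> \<in> {-R..R}" "\<mu> \<in> \<Lambda>" by simp_all
  then show "\<mu> \<in> {\<mu>. \<bar>\<mu>\<bar> <= R \<and> (\<exists>u\<in>H. u \<noteq> 0 \<and> u = \<mu> *\<^sub>R K u)}"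
   unfolding \<Lambda>_def mem_Collect_eq by (intro conjI) (simp add: abs_le_iff)
 qed
 moreover have "(\<forall>F. bounded_linear F \<longrightarrow> (\<exists>u\<in>H. \<forall>v\<in>H. a u v - \<mu> * m u v = F v)) \<and>
   (\<forall>u\<in>H. (\<forall>v\<in>H. a u v - \<mu> * m u v = 0) \<longrightarrow> u = 0)" if "\<mu> \<notin> \<Lambda>" for \<mu>
 proof (intro conjI allI impI ballI)
  have inj: "u = 0" if "u \<in> H" "u = \<mu> *\<^sub>R K u" for u using that \<open>\<mu> \<notin> \<Lambda>\<close> unfolding \<Lambda>_def by blast
  fix F :: "'h => real" assume "bounded_linear F"
  then obtain f where f: "f \<in> H" "\<And>v. v \<in> H ==> a f v = F v" using ex by metis
  obtain u where u: "u \<in> H" "u - \<mu> *\<^sub>R K u = f" using surjective_if_injective[of \<mu>, OF inj f(1)] by blast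
  have "a u v - \<mu> * m u v = F v" if "v \<in> H" for v
  proof -
   have "a u v - \<mu> * m u v = a (u - \<mu> *\<^sub>R K u) v"
    unfolding a.diff_left a.scaleR_left Kp(2)[OF that] by simp
   also have "\<dots> = F v" unfolding u(2) by (rule f(2)[OF that])
   finally show ?thesis .
  qed
  then show "\<exists>u\<in>H. \<forall>v\<in>H. a u v - \<mu> * m u v = F v" using u by auto
 next
  fix u assume "u \<in> H" and 0: "\<forall>v\<in>H. a u v - \<mu> * m u v = 0"
  have "u = \<mu> *\<^sub>R K u"
   by (rule uniq) (use \<open>u \<in> H\<close> 0 Kp H in \<open>auto simp: subspace_scale a.scaleR_left\<close>)
  then show "u = 0" using \<open>u \<in> H\<close> \<open>\<mu> \<notin> \<Lambda>\<close> unfolding \<Lambda>_def by blast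
 qed
 ultimately show ?thesis by blast
qed

section \<open>L2 as a Hilbert space type\<close>

definition sq_integrable :: "('a::euclidean_space => 'b::euclidean_space) => bool" where
 "sq_integrable f \<longleftrightarrow> f \<in> borel_measurable lebesgue \<and> (\<integral>\<^sup>+x. ennreal ((norm (f x))^2) \<partial>lebesgue) < \<infinity>"

lemma sq_integrable_measurable: "sq_integrable f ==> f \<in> borel_measurable lebesgue"
 by (simp add: sq_integrable_def)

lemma sq_integrable_norm_power2:
 "sq_integrable f ==> integrable lebesgue (%x. (norm (f x))^2)"
 unfolding sq_integrable_def by (intro integrableI_bounded) auto

lemma nn_integral_norm_power2:
 assumes "sq_integrable f"
 shows "(\<integral>\<^sup>+x. ennreal ((norm (f x))^2) \<partial>lebesgue) = ennreal (LINT x|lebesgue. (norm (f x))^2)"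
 by (rule nn_integral_eq_integral[OF sq_integrable_norm_power2[OF assms]]) simp

lemma sq_integrable_zero: "sq_integrable (%x. 0)"
 by (simp add: sq_integrable_def)

lemma power2_norm_add_le: "(norm (x + y))^2 <= 2 * (norm x)^2 + 2 * (norm y)^2"
 for x y :: "'a::real_normed_vector"
proof -
 have "(norm (x + y))^2 <= (norm x + norm y)^2" by (intro power_mono norm_triangle_ineq) simp
 also have "\<dots> <= 2 * (norm x)^2 + 2 * (norm y)^2"
  using sum_squares_bound[of "norm x" "norm y"] by (simp add: power2_sum)
 finally show ?thesis .
qed

lemma power2_norm_diff_le: "(norm (x - y))^2 <= 2 * (norm x)^2 + 2 * (norm y)^2"
 for x y :: "'a::real_normed_vector"
 using power2_norm_add_le[of x "- y"] by simp

lemma sq_integrable_dominated: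
 assumes "f \<in> borel_measurable lebesgue" "integrable lebesgue g" "\<And>x. (norm (f x))^2 <= g x"
 shows "sq_integrable f"
proof -
 have "(\<integral>\<^sup>+x. ennreal ((norm (f x))^2) \<partial>lebesgue) <= (\<integral>\<^sup>+x. ennreal (norm (g x)) \<partial>lebesgue)"
  using assms(3) by (intro nn_integral_mono ennreal_leI) (simp add: order_trans[OF _ abs_ge_self])
 then show ?thesis using assms(1,2) by (auto simp: sq_integrable_def integrable_iff_bounded)
qed

lemma sq_integrable_add:
 assumes "sq_integrable f" "sq_integrable g"
 shows "sq_integrable (%x. f x + g x)"
 by (rule sq_integrable_dominated[of _ "%x. 2 * (norm (f x))^2 + 2 * (norm (g x))^2"])
  (use assms power2_norm_add_le in \<open>auto intro!: sq_integrable_norm_power2 borel_measurable_add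
    simp: sq_integrable_measurable\<close>)

lemma sq_integrable_scaleR: "sq_integrable f ==> sq_integrable (%x. c *\<^sub>R f x)"
 by (rule sq_integrable_dominated[of _ "%x. c^2 * (norm (f x))^2"])
  (auto intro!: sq_integrable_norm_power2 borel_measurable_scaleR simp: sq_integrable_measurable power_mult_distrib)

lemma sq_integrable_minus: "sq_integrable f ==> sq_integrable (%x. - f x)"
 using sq_integrable_scaleR[of f "-1"] by simp

lemma sq_integrable_diff: "sq_integrable f ==> sq_integrable g ==> sq_integrable (%x. f x - g x)"
 using sq_integrable_add[OF _ sq_integrable_minus, of f g] by simp

\<comment> \<open>The space is made a type so that completeness, continuity and bounded bilinear
  maps come from type classes. The quotient is partial: the relation is reflexive exactly on the
  square integrable functions.\<close>
quotient_type (overloaded) ('a, 'b) l2 = "'a::euclidean_space => 'b::euclidean_space" /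
 partial: "%f g. sq_integrable f \<and> sq_integrable g \<and> (AE x in lebesgue. f x = g x)"
proof (rule part_equivpI)
 show "\<exists>f::'a => 'b. sq_integrable f \<and> sq_integrable f \<and> (AE x in lebesgue. f x = f x)"
  using sq_integrable_zero by auto
qed (auto simp: symp_def transp_def elim: eventually_elim2)

text \<open>The quotient maps are used directly: \<open>fun_of F\<close> is some representative of the class \<open>F\<close>.\<close>

abbreviation fun_of :: "('a::euclidean_space, 'b::euclidean_space) l2 => 'a => 'b" where
 "fun_of \<equiv> rep_l2"

lemma sq_integrable_fun_of [simp]: "sq_integrable (fun_of F)"
 using Quotient3_rep_reflp[OF Quotient3_l2, of F] by simp

lemma measurable_fun_of [measurable]: "fun_of F \<in> borel_measurable lebesgue"
 by (simp add: sq_integrable_measurable)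

lemma abs_fun_of [simp]: "abs_l2 (fun_of F) = F"
 by (rule Quotient3_abs_rep[OF Quotient3_l2])

lemma abs_l2_eq: "sq_integrable f ==> sq_integrable g ==> AE x in lebesgue. f x = g x ==> abs_l2 f = abs_l2 g"
 using Quotient3_rel_abs[OF Quotient3_l2, of f g] by simp

lemma fun_of_abs: "sq_integrable f ==> AE x in lebesgue. fun_of (abs_l2 f) x = f x"
 using Quotient3_rep_abs[OF Quotient3_l2, of f] by simp

lemma l2_eqI: "AE x in lebesgue. fun_of F x = fun_of G x ==> F = G"
 using abs_l2_eq[of "fun_of F" "fun_of G"] by simp

lemma integrable_bilinear_field:
 fixes f g :: "'a::euclidean_space => 'b::euclidean_space" and b :: "'a => 'b => 'b => real"
 assumes "sq_integrable f" "sq_integrable g"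
  and "\<And>x p q. \<bar>b x p q\<bar> <= C * norm p * norm q"
  and "(%x. b x (f x) (g x)) \<in> borel_measurable lebesgue"
 shows "integrable lebesgue (%x. b x (f x) (g x))"
proof (rule Bochner_Integration.integrable_bound)
 show "integrable lebesgue (%x. \<bar>C\<bar> * ((norm (f x))^2 + (norm (g x))^2))"
  using assms by (intro integrable_mult_right Bochner_Integration.integrable_add sq_integrable_norm_power2)
 have "\<bar>b x (f x) (g x)\<bar> <= \<bar>C\<bar> * ((norm (f x))^2 + (norm (g x))^2)" for x
 proof -
  have "\<bar>b x (f x) (g x)\<bar> <= C * (norm (f x) * norm (g x))" using assms(3)[of x "f x" "g x"] by (simp add: mult.assoc)
  also have "\<dots> <= \<bar>C\<bar> * (norm (f x) * norm (g x))" by (intro mult_right_mono) auto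
  also have "\<dots> <= \<bar>C\<bar> * ((norm (f x))^2 + (norm (g x))^2)"
  proof (rule mult_left_mono)
   have "2 * (norm (f x) * norm (g x)) <= (norm (f x))^2 + (norm (g x))^2"
    using sum_squares_bound[of "norm (f x)" "norm (g x)"] by (simp add: mult.assoc)
   moreover have "0 <= norm (f x) * norm (g x)" by simp
   ultimately show "norm (f x) * norm (g x) <= (norm (f x))^2 + (norm (g x))^2" by linarith
  qed simp
  finally show ?thesis .
 qed
 then show "AE x in lebesgue. norm (b x (f x) (g x)) <= norm (\<bar>C\<bar> * ((norm (f x))^2 + (norm (g x))^2))"
  by (intro AE_I2) (simp add: order_trans[OF _ abs_ge_self])
qed (rule assms(4))

lemma integrable_inner_l2: "integrable lebesgue (%x. fun_of F x \<bullet> fun_of G x)"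
 by (rule integrable_bilinear_field[where C=1 and b="%x. (\<bullet>)"]) (auto simp: Cauchy_Schwarz_ineq2)

instantiation l2 :: (euclidean_space, euclidean_space) real_vector
begin

definition zero_l2 :: "('a, 'b) l2" where "zero_l2 = abs_l2 (%x. 0)"
definition plus_l2 :: "('a, 'b) l2 => ('a, 'b) l2 => ('a, 'b) l2" where
 "plus_l2 F G = abs_l2 (%x. fun_of F x + fun_of G x)"
definition uminus_l2 :: "('a, 'b) l2 => ('a, 'b) l2" where
 "uminus_l2 F = abs_l2 (%x. - fun_of F x)"
definition minus_l2 :: "('a, 'b) l2 => ('a, 'b) l2 => ('a, 'b) l2" where
 "minus_l2 F G = abs_l2 (%x. fun_of F x - fun_of G x)"
definition scaleR_l2 :: "real => ('a, 'b) l2 => ('a, 'b) l2" where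
 "scaleR_l2 c F = abs_l2 (%x. c *\<^sub>R fun_of F x)"
lemma fun_of_zero: "AE x in lebesgue. fun_of (0 :: ('a, 'b) l2) x = 0"
 unfolding zero_l2_def by (intro fun_of_abs sq_integrable_zero)

lemma fun_of_add: "AE x in lebesgue. fun_of (F + G) x = fun_of F x + fun_of G x" for F G :: "('a, 'b) l2"
 unfolding plus_l2_def by (intro fun_of_abs sq_integrable_add sq_integrable_fun_of)

lemma fun_of_minus: "AE x in lebesgue. fun_of (- F) x = - fun_of F x" for F :: "('a, 'b) l2"
 unfolding uminus_l2_def by (intro fun_of_abs sq_integrable_minus sq_integrable_fun_of)

lemma fun_of_diff: "AE x in lebesgue. fun_of (F - G) x = fun_of F x - fun_of G x" for F G :: "('a, 'b) l2"
 unfolding minus_l2_def by (intro fun_of_abs sq_integrable_diff sq_integrable_fun_of)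

lemma fun_of_scaleR: "AE x in lebesgue. fun_of (c *\<^sub>R F) x = c *\<^sub>R fun_of F x" for F :: "('a, 'b) l2"
 unfolding scaleR_l2_def by (intro fun_of_abs sq_integrable_scaleR sq_integrable_fun_of)

instance
proof
 fix a b c :: "('a, 'b) l2" and r s :: real
 show "a + b + c = a + (b + c)"
  by (rule l2_eqI) (use fun_of_add[of "a + b" c] fun_of_add[of a b] fun_of_add[of a "b + c"] fun_of_add[of b c] in
   \<open>eventually_elim, simp\<close>)
 show "a + b = b + a"
  by (rule l2_eqI) (use fun_of_add[of a b] fun_of_add[of b a] in \<open>eventually_elim, simp\<close>)
 show "0 + a = a"
  by (rule l2_eqI) (use fun_of_add[of 0 a] fun_of_zero in \<open>eventually_elim, simp\<close>)
 show "- a + a = 0"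
  by (rule l2_eqI) (use fun_of_add[of "- a" a] fun_of_zero fun_of_minus[of a] in \<open>eventually_elim, simp\<close>)
 show "a - b = a + - b"
  by (rule l2_eqI) (use fun_of_add[of a "- b"] fun_of_diff[of a b] fun_of_minus[of b] in \<open>eventually_elim, simp\<close>)
 show "r *\<^sub>R (a + b) = r *\<^sub>R a + r *\<^sub>R b"
  by (rule l2_eqI) (use fun_of_add[of a b] fun_of_scaleR[of r "a + b"] fun_of_scaleR[of r a] fun_of_scaleR[of r b]
    fun_of_add[of "r *\<^sub>R a" "r *\<^sub>R b"] in \<open>eventually_elim, simp add: scaleR_add_right\<close>)
 show "(r + s) *\<^sub>R a = r *\<^sub>R a + s *\<^sub>R a"
  by (rule l2_eqI) (use fun_of_scaleR[of "r + s" a] fun_of_scaleR[of r a] fun_of_scaleR[of s a]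
    fun_of_add[of "r *\<^sub>R a" "s *\<^sub>R a"] in \<open>eventually_elim, simp add: scaleR_add_left\<close>)
 show "r *\<^sub>R s *\<^sub>R a = (r * s) *\<^sub>R a"
  by (rule l2_eqI) (use fun_of_scaleR[of "r * s" a] fun_of_scaleR[of r "s *\<^sub>R a"] fun_of_scaleR[of s a]
    in \<open>eventually_elim, simp\<close>)
 show "1 *\<^sub>R a = a"
  by (rule l2_eqI) (use fun_of_scaleR[of 1 a] in \<open>eventually_elim, simp\<close>)
qed

end

instantiation l2 :: (euclidean_space, euclidean_space) real_inner
begin

definition inner_l2 :: "('a, 'b) l2 => ('a, 'b) l2 => real" where
 "inner_l2 F G = (LINT x|lebesgue. fun_of F x \<bullet> fun_of G x)"
definition norm_l2 :: "('a, 'b) l2 => real" where "norm_l2 F = sqrt (F \<bullet> F)"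
definition dist_l2 :: "('a, 'b) l2 => ('a, 'b) l2 => real" where "dist_l2 F G = norm (F - G)"
definition sgn_l2 :: "('a, 'b) l2 => ('a, 'b) l2" where "sgn_l2 F = F /\<^sub>R norm F"
definition uniformity_l2 :: "(('a, 'b) l2 \<times> ('a, 'b) l2) filter" where
 "uniformity_l2 = (INF e\<in>{0<..}. principal {(x, y). dist x y < e})"
definition open_l2 :: "('a, 'b) l2 set => bool" where
 "open_l2 U \<longleftrightarrow> (\<forall>x\<in>U. \<forall>\<^sub>F (x', y) in uniformity. x' = x \<longrightarrow> y \<in> U)"

instance
proof
 fix a b c :: "('a, 'b) l2" and r s :: real
 show "a \<bullet> b = b \<bullet> a" by (simp add: inner_l2_def inner_commute)
 show "(a + b) \<bullet> c = a \<bullet> c + b \<bullet> c"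
 proof -
  have "(a + b) \<bullet> c = (LINT x|lebesgue. fun_of a x \<bullet> fun_of c x + fun_of b x \<bullet> fun_of c x)"
   unfolding inner_l2_def
   by (rule integral_cong_AE) (use fun_of_add[of a b] in \<open>auto simp: inner_add_left\<close>)
  then show ?thesis by (simp add: inner_l2_def integrable_inner_l2)
 qed
 show "(r *\<^sub>R a) \<bullet> b = r * (a \<bullet> b)"
 proof -
  have "(r *\<^sub>R a) \<bullet> b = (LINT x|lebesgue. r * (fun_of a x \<bullet> fun_of b x))"
   unfolding inner_l2_def
   by (rule integral_cong_AE) (use fun_of_scaleR[of r a] in auto)
  then show ?thesis by (simp add: inner_l2_def integrable_inner_l2)
 qed
 show "0 <= a \<bullet> a" by (simp add: inner_l2_def)
 show "a \<bullet> a = 0 \<longleftrightarrow> a = 0"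
 proof
  assume "a \<bullet> a = 0"
  then have "AE x in lebesgue. fun_of a x \<bullet> fun_of a x = 0"
   using integral_nonneg_eq_0_iff_AE[OF integrable_inner_l2[of a a]] by (simp add: inner_l2_def)
  then have "AE x in lebesgue. fun_of a x = fun_of 0 x" using fun_of_zero by eventually_elim simp
  then show "a = 0" by (rule l2_eqI)
 next
  assume "a = 0"
  have "AE x in lebesgue. fun_of a x \<bullet> fun_of a x = 0" using fun_of_zero unfolding \<open>a = 0\<close> by eventually_elim simp
  then show "a \<bullet> a = 0" unfolding inner_l2_def by (rule integral_eq_zero_AE)
 qed
qed (rule dist_l2_def sgn_l2_def uniformity_l2_def open_l2_def norm_l2_def)+

end

lemma norm_l2_power2: "(norm F)^2 = (LINT x|lebesgue. (norm (fun_of F x))^2)"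
 unfolding power2_norm_eq_inner inner_l2_def ..

lemma ennreal_norm_l2: "ennreal ((norm F)^2) = (\<integral>\<^sup>+x. ennreal ((norm (fun_of F x))^2) \<partial>lebesgue)"
 unfolding norm_l2_power2 by (rule nn_integral_norm_power2[symmetric]) simp

lemma ennreal_norm_abs_l2:
 assumes "sq_integrable f"
 shows "ennreal ((norm (abs_l2 f))^2) = (\<integral>\<^sup>+x. ennreal ((norm (f x))^2) \<partial>lebesgue)"
 unfolding ennreal_norm_l2
 by (rule nn_integral_cong_AE) (use fun_of_abs[OF assms] in \<open>eventually_elim, simp\<close>)

lemma ennreal_norm_diff_l2:
 "ennreal ((norm (F - G))^2) = (\<integral>\<^sup>+x. ennreal ((norm (fun_of F x - fun_of G x))^2) \<partial>lebesgue)"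
 unfolding ennreal_norm_l2
 by (rule nn_integral_cong_AE) (use fun_of_diff[of F G] in \<open>eventually_elim, simp\<close>)

text \<open>The weights 2^k are affordable since the squared increments are at most 4^(-k): the
  weighted sum has finite integral, hence is finite at almost every point, and there the increments
  are dominated by a geometric sequence.\<close>

lemma rapidly_Cauchy_AE_convergent:
 fixes X :: "nat => ('a::euclidean_space, 'b::euclidean_space) l2"
 assumes X: "\<And>k. (norm (X (Suc k) - X k))^2 <= (1/4) ^ k"
 shows "AE x in lebesgue. convergent (%k. fun_of (X k) x)"
proof -
 define d where "d k x = fun_of (X (Suc k)) x - fun_of (X k) x" for k x
 have [measurable]: "d k \<in> borel_measurable lebesgue" for k unfolding d_def by measurable
 have "(\<integral>\<^sup>+x. (\<Sum>k. ennreal (2 ^ k * (norm (d k x))^2)) \<partial>lebesgue)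
   = (\<Sum>k. \<integral>\<^sup>+x. ennreal (2 ^ k * (norm (d k x))^2) \<partial>lebesgue)"
  by (rule nn_integral_suminf) measurable
 also have "\<dots> = (\<Sum>k. ennreal (2 ^ k * (norm (X (Suc k) - X k))^2))"
  unfolding ennreal_mult'[OF zero_le_power[OF zero_le_numeral]] ennreal_norm_diff_l2
  by (intro suminf_cong) (simp add: d_def[symmetric] nn_integral_cmult)
 also have "\<dots> <= (\<Sum>k. ennreal ((1/2) ^ k))"
 proof (intro suminf_le ennreal_leI)
  fix k
  have "2 ^ k * (norm (X (Suc k) - X k))^2 <= 2 ^ k * (1/4::real) ^ k" using X by (intro mult_left_mono) auto
  also have "\<dots> = (1/2) ^ k" by (simp add: power_mult_distrib[symmetric])
  finally show "2 ^ k * (norm (X (Suc k) - X k))^2 <= (1/2) ^ k" .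
 qed auto
 also have "\<dots> = ennreal (\<Sum>k. (1/2) ^ k)" by (intro suminf_ennreal2) (auto intro: summable_geometric)
 also have "\<dots> < \<infinity>" by simp
 finally have "AE x in lebesgue. (\<Sum>k. ennreal (2 ^ k * (norm (d k x))^2)) \<noteq> \<infinity>"
  by (intro nn_integral_PInf_AE) auto
 then show ?thesis
 proof eventually_elim
  fix x assume fin: "(\<Sum>k. ennreal (2 ^ k * (norm (d k x))^2)) \<noteq> \<infinity>"
  have "summable (%k. 2 ^ k * (norm (d k x))^2)"
   by (rule summable_suminf_not_top) (use fin in auto)
  then have "Bseq (%k. 2 ^ k * (norm (d k x))^2)"
   using summable_LIMSEQ_zero convergent_def convergent_imp_Bseq by blast
  then obtain C where C: "C > 0" "\<And>k. norm (2 ^ k * (norm (d k x))^2) <= C" by (auto elim: BseqE)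
  have q: "norm (d k x) <= sqrt C * sqrt (1/2) ^ k" for k
  proof (rule power2_le_imp_le)
   have "(norm (d k x))^2 <= C * (1/2) ^ k" using C(2)[of k] by (simp add: power_one_over field_simps)
   also have "\<dots> = (sqrt C * sqrt (1/2) ^ k)^2"
    using C(1) by (simp add: power_mult_distrib power_mult[symmetric] mult.commute[of k])
     (simp add: power_mult)
   finally show "(norm (d k x))^2 <= (sqrt C * sqrt (1/2) ^ k)^2" .
  qed (use C in auto)
  have "summable (%k. d k x)"
  proof (rule summable_comparison_test')
   have "sqrt (1/2) < 1" by (simp add: real_sqrt_lt_1_iff)
   then show "summable (%k. sqrt C * sqrt (1/2) ^ k)" by (intro summable_mult summable_geometric) simp
  qed (use q in auto)
  then have "convergent (%n. \<Sum>k<n. d k x)" by (simp add: summable_iff_convergent)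
  moreover have "(\<Sum>k<n. d k x) = fun_of (X n) x - fun_of (X 0) x" for n
   unfolding d_def by (rule sum_lessThan_telescope)
  ultimately have "convergent (%n. fun_of (X n) x - fun_of (X 0) x)" by simp
  then have "convergent (%n. (fun_of (X n) x - fun_of (X 0) x) + fun_of (X 0) x)"
   by (intro convergent_add convergent_const)
  then show "convergent (%n. fun_of (X n) x)" by simp
 qed
qed

text \<open>A rapidly converging subsequence converges almost everywhere, and Fatou's lemma compares
  its limit with every late member of the original sequence.\<close>

instance l2 :: (euclidean_space, euclidean_space) complete_space
proof
 fix X :: "nat => ('a, 'b) l2" assume "Cauchy X"
 have "\<exists>N. \<forall>m\<ge>N. \<forall>n\<ge>N. norm (X m - X n) < (1/2) ^ k" for k :: nat
  using CauchyD[OF \<open>Cauchy X\<close>, of "(1/2) ^ k"] by simp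
 then obtain N where N: "\<And>k m n. m \<ge> N k ==> n \<ge> N k ==> norm (X m - X n) < (1/2) ^ k" by metis
 \<comment> \<open>The partial sums make \<open>r\<close> monotone and at least \<open>N k\<close>;
   the summand k makes it at least k.\<close>
 define r where "r k = (\<Sum>j\<le>k. N j) + k" for k
 have rN: "N k <= r k" for k
  unfolding r_def using member_le_sum[of k "{..k}" N] by simp
 have rS: "r k <= r (Suc k)" "k <= r k" for k by (auto simp: r_def)
 define Y where "Y k = X (r k)" for k
 have "(norm (Y (Suc k) - Y k))^2 <= (1/4) ^ k" for k
 proof -
  have "norm (Y (Suc k) - Y k) <= (1/2) ^ k"
   unfolding Y_def using rN[of k] rS(1)[of k] by (intro less_imp_le[OF N[of k]]) auto
  then have "(norm (Y (Suc k) - Y k))^2 <= ((1/2) ^ k)^2" by (intro power_mono) auto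
  also have "((1/2::real) ^ k)^2 = (1/4) ^ k"
   by (simp add: power_mult[symmetric] mult.commute[of k] ) (simp add: power_mult power2_eq_square)
  finally show ?thesis .
 qed
 from rapidly_Cauchy_AE_convergent[OF this]
 have conv: "AE x in lebesgue. convergent (%k. fun_of (Y k) x)" .
 define f where "f x = lim (%k. fun_of (Y k) x)" for x
 have f_meas [measurable]: "f \<in> borel_measurable lebesgue"
  unfolding f_def by (rule borel_measurable_lim_metric) measurable
 have lim: "AE x in lebesgue. (%k. fun_of (Y k) x) \<longlonglongrightarrow> f x"
  using conv by eventually_elim (simp add: f_def convergent_LIMSEQ_iff)
 \<comment> \<open>Fatou along the subsequence. The bound is available before the limit is known to
   be square integrable; that follows from it with n = \<open>N 0\<close>.\<close>
 have key: "(\<integral>\<^sup>+x. ennreal ((norm (f x - fun_of (X n) x))^2) \<partial>lebesgue) <= ennreal (((1/2) ^ j)^2)"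
  if "N j <= n" for n j
 proof -
  have "(\<integral>\<^sup>+x. ennreal ((norm (f x - fun_of (X n) x))^2) \<partial>lebesgue)
    = (\<integral>\<^sup>+x. liminf (%k. ennreal ((norm (fun_of (Y k) x - fun_of (X n) x))^2)) \<partial>lebesgue)"
  proof (rule nn_integral_cong_AE, use lim in eventually_elim)
   fix x assume "(%k. fun_of (Y k) x) \<longlonglongrightarrow> f x"
   then have "(%k. ennreal ((norm (fun_of (Y k) x - fun_of (X n) x))^2)) \<longlonglongrightarrow> ennreal ((norm (f x - fun_of (X n) x))^2)"
    by (intro tendsto_intros)
   then show "ennreal ((norm (f x - fun_of (X n) x))^2)
     = liminf (%k. ennreal ((norm (fun_of (Y k) x - fun_of (X n) x))^2))"
    by (intro lim_imp_Liminf[symmetric]) auto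
  qed
  also have "\<dots> <= liminf (%k. \<integral>\<^sup>+x. ennreal ((norm (fun_of (Y k) x - fun_of (X n) x))^2) \<partial>lebesgue)"
   by (rule nn_integral_liminf) measurable
  also have "\<dots> = liminf (%k. ennreal ((norm (Y k - X n))^2))" by (simp add: ennreal_norm_diff_l2)
  also have "\<dots> <= limsup (%k. ennreal ((norm (Y k - X n))^2))" by (rule Liminf_le_Limsup) simp
  also have "\<dots> <= ennreal (((1/2) ^ j)^2)"
  proof (rule Limsup_bounded)
   show "\<forall>\<^sub>F k in sequentially. ennreal ((norm (Y k - X n))^2) <= ennreal (((1/2) ^ j)^2)"
    unfolding eventually_sequentially
   proof (intro exI[of _ "N j"] allI impI ennreal_leI power_mono)
    fix k assume "N j <= k"
    then show "norm (Y k - X n) <= (1/2) ^ j"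
     unfolding Y_def using that rS(2)[of k] by (intro less_imp_le[OF N[of j]]) auto
   qed auto
  qed
  finally show ?thesis .
 qed
 have "sq_integrable (%x. f x - fun_of (X (N 0)) x)"
  using key[of 0 "N 0"] unfolding sq_integrable_def by (auto intro: le_less_trans)
 from sq_integrable_add[OF this sq_integrable_fun_of[of "X (N 0)"]]
 have f: "sq_integrable f" by simp
 have "X \<longlonglongrightarrow> abs_l2 f"
 proof (rule LIMSEQ_I)
  fix e :: real assume "e > 0"
  then obtain j where j: "(1/2) ^ j < e" using real_arch_pow_inv[of e "1/2"] by auto
  have "norm (X n - abs_l2 f) < e" if "n \<ge> N j" for n
  proof -
   have "ennreal ((norm (abs_l2 f - X n))^2) = (\<integral>\<^sup>+x. ennreal ((norm (f x - fun_of (X n) x))^2) \<partial>lebesgue)"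
    unfolding ennreal_norm_diff_l2
    by (rule nn_integral_cong_AE) (use fun_of_abs[OF f] in \<open>eventually_elim, simp\<close>)
   also have "\<dots> <= ennreal (((1/2) ^ j)^2)" by (rule key[OF that])
   finally have "(norm (abs_l2 f - X n))^2 <= ((1/2) ^ j)^2" by (subst (asm) ennreal_le_iff) auto
   then have "norm (abs_l2 f - X n) <= (1/2) ^ j" by (rule power2_le_imp_le) simp
   then show ?thesis using j by (simp add: norm_minus_commute)
  qed
  then show "\<exists>no. \<forall>n\<ge>no. norm (X n - abs_l2 f) < e" by blast
 qed
 then show "convergent X" by (auto simp: convergent_def)
qed

text \<open>The Cauchy-Schwarz inequality of the type bounds only the integral of pointwise inner
  products, so it is applied to the scalar functions |F| and |G|.\<close>

lemma integral_norm_mult_le: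
 fixes F G :: "('a::euclidean_space, 'b::euclidean_space) l2"
 shows "(LINT x|lebesgue. norm (fun_of F x) * norm (fun_of G x)) <= norm F * norm G"
proof -
 have sq: "sq_integrable (%x. norm (fun_of F x))" for F :: "('a, 'b) l2"
  using sq_integrable_fun_of[of F] by (simp add: sq_integrable_def)
 define n where "n F = abs_l2 (%x. norm (fun_of F x))" for F :: "('a, 'b) l2"
 have n: "AE x in lebesgue. fun_of (n F) x = norm (fun_of F x)" for F
  unfolding n_def by (rule fun_of_abs[OF sq])
 have "ennreal ((norm (n F))^2) = ennreal ((norm F)^2)" for F
  unfolding n_def ennreal_norm_abs_l2[OF sq] ennreal_norm_l2[of F] by simp
 then have nn: "norm (n F) = norm F" for F by (simp add: power2_eq_iff_nonneg)
 have "(LINT x|lebesgue. norm (fun_of F x) * norm (fun_of G x)) = n F \<bullet> n G"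
  unfolding inner_l2_def
  by (rule integral_cong_AE) (use n[of F] n[of G] in \<open>auto elim!: eventually_elim2\<close>)
 also have "\<dots> <= norm F * norm G" using norm_cauchy_schwarz[of "n F" "n G"] by (simp add: nn)
 finally show ?thesis .
qed

text \<open>Serves the stiffness and mass forms with variable coefficients as well as the component
  forms of a jet.\<close>

lemma bounded_bilinear_l2:
 fixes b :: "'a::euclidean_space => 'b::euclidean_space => 'b => real"
 assumes add_left: "\<And>x p p' q. b x (p + p') q = b x p q + b x p' q"
  and add_right: "\<And>x p q q'. b x p (q + q') = b x p q + b x p q'"
  and scale_left: "\<And>x r p q. b x (r *\<^sub>R p) q = r * b x p q"
  and scale_right: "\<And>x r p q. b x p (r *\<^sub>R q) = r * b x p q"
  and bound: "\<And>x p q. \<bar>b x p q\<bar> <= C * norm p * norm q"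
  and meas: "\<And>f g. f \<in> borel_measurable lebesgue ==> g \<in> borel_measurable lebesgue ==>
   (%x. b x (f x) (g x)) \<in> borel_measurable lebesgue"
 shows "bounded_bilinear (%F G. LINT x|lebesgue. b x (fun_of F x) (fun_of G x))"
proof
 have int: "integrable lebesgue (%x. b x (fun_of F x) (fun_of G x))" for F G
  by (rule integrable_bilinear_field[OF _ _ bound]) (auto intro: meas)
 have M: "(%x. b x (fun_of F x) (fun_of G x)) \<in> borel_measurable lebesgue" for F G by (auto intro: meas)
 fix F F' G G' :: "('a, 'b) l2" and r :: real
 show "(LINT x|lebesgue. b x (fun_of (F + F') x) (fun_of G x))
  = (LINT x|lebesgue. b x (fun_of F x) (fun_of G x)) + (LINT x|lebesgue. b x (fun_of F' x) (fun_of G x))"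
 proof -
  have "(LINT x|lebesgue. b x (fun_of (F + F') x) (fun_of G x))
    = (LINT x|lebesgue. b x (fun_of F x) (fun_of G x) + b x (fun_of F' x) (fun_of G x))"
   by (rule integral_cong_AE) (use M fun_of_add[of F F'] in \<open>auto simp: add_left\<close>)
  then show ?thesis using int by simp
 qed
 show "(LINT x|lebesgue. b x (fun_of F x) (fun_of (G + G') x))
  = (LINT x|lebesgue. b x (fun_of F x) (fun_of G x)) + (LINT x|lebesgue. b x (fun_of F x) (fun_of G' x))"
 proof -
  have "(LINT x|lebesgue. b x (fun_of F x) (fun_of (G + G') x))
    = (LINT x|lebesgue. b x (fun_of F x) (fun_of G x) + b x (fun_of F x) (fun_of G' x))"
   by (rule integral_cong_AE) (use M fun_of_add[of G G'] in \<open>auto simp: add_right\<close>)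
  then show ?thesis using int by simp
 qed
 show "(LINT x|lebesgue. b x (fun_of (r *\<^sub>R F) x) (fun_of G x)) = r *\<^sub>R (LINT x|lebesgue. b x (fun_of F x) (fun_of G x))"
 proof -
  have "(LINT x|lebesgue. b x (fun_of (r *\<^sub>R F) x) (fun_of G x)) = (LINT x|lebesgue. r * b x (fun_of F x) (fun_of G x))"
   by (rule integral_cong_AE) (use M fun_of_scaleR[of r F] in \<open>auto simp: scale_left\<close>)
  then show ?thesis using int by simp
 qed
 show "(LINT x|lebesgue. b x (fun_of F x) (fun_of (r *\<^sub>R G) x)) = r *\<^sub>R (LINT x|lebesgue. b x (fun_of F x) (fun_of G x))"
 proof -
  have "(LINT x|lebesgue. b x (fun_of F x) (fun_of (r *\<^sub>R G) x)) = (LINT x|lebesgue. r * b x (fun_of F x) (fun_of G x))"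
   by (rule integral_cong_AE) (use M fun_of_scaleR[of r G] in \<open>auto simp: scale_right\<close>)
  then show ?thesis using int by simp
 qed
 show "\<exists>K. \<forall>F G. norm (LINT x|lebesgue. b x (fun_of F x) (fun_of G x)) <= norm F * norm G * K"
 proof (intro exI[of _ "\<bar>C\<bar>"] allI)
  fix F G :: "('a, 'b) l2"
  have "integrable lebesgue (%x. (%x p q. norm p * norm q) x (fun_of F x) (fun_of G x))"
   by (rule integrable_bilinear_field[where C=1]) auto
  then have i: "integrable lebesgue (%x. norm (fun_of F x) * norm (fun_of G x))" by simp
  have "norm (LINT x|lebesgue. b x (fun_of F x) (fun_of G x))
    <= (LINT x|lebesgue. \<bar>C\<bar> * (norm (fun_of F x) * norm (fun_of G x)))"
  proof (rule Bochner_Integration.integral_norm_bound_integral[OF int])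
   fix x
   have "C * (norm (fun_of F x) * norm (fun_of G x)) <= \<bar>C\<bar> * (norm (fun_of F x) * norm (fun_of G x))"
    by (intro mult_right_mono) auto
   then show "norm (b x (fun_of F x) (fun_of G x)) <= \<bar>C\<bar> * (norm (fun_of F x) * norm (fun_of G x))"
    using bound[of x "fun_of F x" "fun_of G x"] by (simp add: mult.assoc)
  qed (use i in simp)
  also have "\<dots> <= \<bar>C\<bar> * (norm F * norm G)"
   using integral_norm_mult_le[of F G] by (simp add: mult_left_mono)
  finally show "norm (LINT x|lebesgue. b x (fun_of F x) (fun_of G x)) <= norm F * norm G * \<bar>C\<bar>"
   by (simp add: mult_ac)
 qed
qed

section \<open>Calculus of smooth functions\<close>

lemma partial_eq:
 assumes "(\<phi> has_derivative \<phi>') (at x)"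
 shows "partial i \<phi> x = \<phi>' (axis i 1)"
 using frechet_derivative_at[OF assms] by (simp add: partial_def)

lemma has_derivative_partials:
 assumes "\<phi> differentiable (at x)"
 shows "(\<phi> has_derivative (%h. \<Sum>i\<in>UNIV. h $ i *\<^sub>R partial i \<phi> x)) (at x)"
proof -
 define D where "D = frechet_derivative \<phi> (at x)"
 have D: "(\<phi> has_derivative D) (at x)" using assms by (simp add: D_def frechet_derivative_works)
 then have lin: "linear D" by (rule has_derivative_linear)
 have "D h = (\<Sum>i\<in>UNIV. h $ i *\<^sub>R partial i \<phi> x)" for h
 proof -
  have "h = (\<Sum>i\<in>UNIV. h $ i *\<^sub>R axis i 1)"
   using basis_expansion[of h] by (simp add: scalar_mult_eq_scaleR)
  then have "D h = D (\<Sum>i\<in>UNIV. h $ i *\<^sub>R axis i 1)" by simp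
  also have "\<dots> = (\<Sum>i\<in>UNIV. h $ i *\<^sub>R D (axis i 1))"
   using lin by (simp add: linear_sum linear_scale)
  finally show ?thesis by (simp add: partial_eq[OF D])
 qed
 then have "D = (%h. \<Sum>i\<in>UNIV. h $ i *\<^sub>R partial i \<phi> x)" by (rule ext)
 with D show ?thesis by simp
qed

lemma partial_const: "partial i (%x. c) = (%x. 0)"
 by (rule ext) (simp add: partial_eq[OF has_derivative_const])

lemma partial_add:
 assumes "\<And>x. f differentiable (at x)" "\<And>x. g differentiable (at x)"
 shows "partial i (%x. f x + g x) = (%x. partial i f x + partial i g x)"
 by (rule ext, subst partial_eq[OF has_derivative_add[OF has_derivative_partials[OF assms(1)] has_derivative_partials[OF assms(2)]]])
  (simp add: axis_def if_distrib[of "%r. r *\<^sub>R _"] cong: if_cong)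

lemma partial_mult:
 assumes "\<And>x. f differentiable (at x)" "\<And>x. g differentiable (at x)"
 shows "partial i (%x. f x * g x) = (%x. f x * partial i g x + partial i f x * g x)"
 by (rule ext, subst partial_eq[OF has_derivative_mult[OF has_derivative_partials[OF assms(1)] has_derivative_partials[OF assms(2)]]])
  (simp add: axis_def if_distrib[of "%r. r *\<^sub>R _"] cong: if_cong)

lemma partial_inverse:
 assumes "\<And>x. f differentiable (at x)" "\<And>x. f x \<noteq> 0"
 shows "partial i (%x. inverse (f x)) = (%x. - (inverse (f x) * partial i f x * inverse (f x)))"
 by (rule ext, subst partial_eq[OF Deriv.has_derivative_inverse[OF assms(2) has_derivative_partials[OF assms(1)]]])
  (simp add: axis_def if_distrib[of "%r. r *\<^sub>R _"] cong: if_cong)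

lemma Ck_SucD: "Ck (Suc n) \<phi> ==> Ck n \<phi>"
proof (induction n arbitrary: \<phi>)
 case 0
 then show ?case by (auto simp: continuous_on_eq_continuous_at intro: differentiable_imp_continuous_within)
next
 case (Suc n)
 then show ?case using Ck.simps(2) by blast
qed

lemma Ck_const: "Ck n (%x. c)"
 by (induction n arbitrary: c) (auto simp: partial_const)

lemma Ck_add: "Ck n f ==> Ck n g ==> Ck n (%x. f x + g x)"
proof (induction n arbitrary: f g)
 case (Suc n)
 then show ?case by (simp add: partial_add)
qed (auto intro: continuous_on_add)

lemma Ck_mult: "Ck n f ==> Ck n g ==> Ck n (%x. f x * g x)"
proof (induction n arbitrary: f g)
 case (Suc n)
 have "Ck n f" "Ck n g" using Suc.prems by (auto intro: Ck_SucD)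
 with Suc show ?case by (simp add: partial_mult Ck_add)
qed (auto intro: continuous_on_mult)

lemma Ck_inverse: "Ck n f ==> (\<And>x. f x \<noteq> 0) ==> Ck n (%x. inverse (f x))"
proof (induction n arbitrary: f)
 case (Suc n)
 have "Ck n (%x. inverse (f x))" by (rule Suc.IH[OF Ck_SucD[OF Suc.prems(1)] Suc.prems(2)])
 moreover have "Ck n (%x. - 1 * (inverse (f x) * partial i f x * inverse (f x)))" for i
  using Suc.prems(1) by (intro Ck_mult Ck_const calculation) simp
 ultimately show ?case using Suc.prems by (simp add: partial_inverse differentiable_inverse)
qed (auto intro: continuous_on_inverse)

lemma smooth_const: "smooth (%x. c)"
 by (simp add: smooth_def Ck_const)

lemma smooth_add: "smooth f ==> smooth g ==> smooth (%x. f x + g x)"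
 by (simp add: smooth_def Ck_add)

lemma smooth_mult: "smooth f ==> smooth g ==> smooth (%x. f x * g x)"
 by (simp add: smooth_def Ck_mult)

lemma smooth_inverse: "smooth f ==> (\<And>x. f x \<noteq> 0) ==> smooth (%x. inverse (f x))"
 by (simp add: smooth_def Ck_inverse)

lemma smooth_diff: "smooth f ==> smooth g ==> smooth (%x. f x - g x)"
 using smooth_add[OF _ smooth_mult[OF smooth_const[of "-1"]], of f g] by simp

lemma smooth_differentiable: "smooth f ==> f differentiable (at x)"
 unfolding smooth_def using Ck.simps(2)[of 0 f] by blast

lemma smooth_partial: "smooth f ==> smooth (partial i f)"
 unfolding smooth_def using Ck.simps(2) by blast

lemma smooth_continuous_on: "smooth f ==> continuous_on S f"
 unfolding smooth_def using Ck.simps(1)[of f] continuous_on_subset by blast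

lemma smooth_measurable: "smooth f ==> f \<in> borel_measurable borel"
 by (intro borel_measurable_continuous_onI smooth_continuous_on)

text \<open>Coinduction for \<open>smooth\<close>, applied to families given by explicit formulas
  that are visibly closed under \<open>partial\<close>, so that no induction on the order of
  differentiation has to be repeated.\<close>

lemma smooth_coinduct:
 assumes "\<phi> \<in> X" and X: "\<And>\<phi> x. \<phi> \<in> X ==> \<phi> differentiable (at x)" "\<And>\<phi> i. \<phi> \<in> X ==> partial i \<phi> \<in> X"
 shows "smooth \<phi>"
proof -
 have "Ck n \<phi>" if "\<phi> \<in> X" for n \<phi>
  using that
 proof (induction n arbitrary: \<phi>)
  case 0
  then show ?case
   using X(1) by (auto simp: continuous_on_eq_continuous_at intro: differentiable_imp_continuous_within)
 qed (auto simp: X)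
 then show ?thesis using assms(1) by (simp add: smooth_def)
qed

lemma smooth_of_coordinate:
 assumes X: "\<And>f. f \<in> X ==> \<exists>f'\<in>X. \<forall>t. (f has_real_derivative f' t) (at t)" and "f \<in> X"
 shows "smooth (%x. complex_of_real (f (x $ i)))"
\<comment> \<open>Zero is added to the family because the partial derivative in the other coordinate
  vanishes.\<close>
proof (rule smooth_coinduct[where X = "insert (%x. 0) {%x. complex_of_real (f (x $ i)) |f. f \<in> X}"])
 have D: "((%x. complex_of_real (f (x $ i))) has_derivative (%h. complex_of_real (f' (x $ i) * h $ i))) (at x)"
  if "\<And>t. (f has_real_derivative f' t) (at t)" for f f' :: "real => real" and x :: "real^2"
 proof -
  have c: "((%x. x $ i) has_derivative (%h. h $ i)) (at x)"
   by (intro bounded_linear_imp_has_derivative bounded_linear_vec_nth)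
  have "((%x. f (x $ i)) has_derivative (%h. f' (x $ i) * h $ i)) (at x)"
   using has_derivative_compose[OF c that[of "x $ i", unfolded has_field_derivative_def]] by simp
  then show ?thesis by (rule bounded_linear.has_derivative[OF bounded_linear_of_real])
 qed
 fix \<phi> x assume \<phi>: "\<phi> \<in> insert (%x. 0) {%x. complex_of_real (f (x $ i)) |f. f \<in> X}"
 show "\<phi> differentiable (at x)"
 proof (cases "\<phi> = (%x. 0)")
  case False
  then obtain f where f: "f \<in> X" "\<phi> = (%x. complex_of_real (f (x $ i)))" using \<phi> by auto
  obtain f' where "\<And>t. (f has_real_derivative f' t) (at t)" using X[OF f(1)] by auto
  from D[OF this] show ?thesis unfolding f(2) differentiable_def by blast
 qed simp
next
 have D: "((%x. complex_of_real (f (x $ i))) has_derivative (%h. complex_of_real (f' (x $ i) * h $ i))) (at x)"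
  if "\<And>t. (f has_real_derivative f' t) (at t)" for f f' :: "real => real" and x :: "real^2"
 proof -
  have c: "((%x. x $ i) has_derivative (%h. h $ i)) (at x)"
   by (intro bounded_linear_imp_has_derivative bounded_linear_vec_nth)
  have "((%x. f (x $ i)) has_derivative (%h. f' (x $ i) * h $ i)) (at x)"
   using has_derivative_compose[OF c that[of "x $ i", unfolded has_field_derivative_def]] by simp
  then show ?thesis by (rule bounded_linear.has_derivative[OF bounded_linear_of_real])
 qed
 fix \<phi> j assume "\<phi> \<in> insert (%x. 0) {%x. complex_of_real (f (x $ i)) |f. f \<in> X}"
 then consider "\<phi> = (%x. 0)" | f where "f \<in> X" "\<phi> = (%x. complex_of_real (f (x $ i)))" by auto
 then show "partial j \<phi> \<in> insert (%x. 0) {%x. complex_of_real (f (x $ i)) |f. f \<in> X}"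
 proof cases
  case 1
  then show ?thesis by (simp add: partial_const)
 next
  case (2 f)
  obtain f' where f': "f' \<in> X" "\<And>t. (f has_real_derivative f' t) (at t)" using X[OF 2(1)] by auto
  have p: "partial j \<phi> x = complex_of_real (f' (x $ i) * axis j 1 $ i)" for x
   unfolding 2(2) by (rule partial_eq[OF D[OF f'(2)]])
  show ?thesis
  proof (cases "j = i")
   case True
   have "partial j \<phi> = (%x. complex_of_real (f' (x $ i)))" using p True by (intro ext) simp
   then show ?thesis using f'(1) by blast
  next
   case False
   have "partial j \<phi> = (%x. 0)" using p False by (intro ext) (simp add: axis_def)
   then show ?thesis by blast
  qed
 qed
qed (use assms(2) in auto)

section \<open>Bump functions and cutoffs\<close>

text \<open>A family that contains the standard bump exp (-1/t) and is stable under differentiation;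
  the polynomial records what the derivatives produce.\<close>

definition exp_inv :: "real poly => real => real" where
 "exp_inv p t = (if t > 0 then poly p (inverse t) * exp (- inverse t) else 0)"

lemma exp_inv_right_limit: "((%t. poly p (inverse t) * exp (- inverse t)) \<longlongrightarrow> (0::real)) (at_right 0)"
proof -
 have "((%y. \<Sum>i\<le>degree p. coeff p i * (y ^ i / exp y)) \<longlongrightarrow> (\<Sum>i\<le>degree p. coeff p i * 0)) at_top"
  by (intro tendsto_sum tendsto_mult tendsto_const tendsto_power_div_exp_0)
 then have "((%y::real. poly p y * exp (- y)) \<longlongrightarrow> 0) at_top"
  by (simp add: poly_altdef sum_distrib_right exp_minus divide_inverse mult.assoc)
 from filterlim_compose[OF this filterlim_inverse_at_top_right] show ?thesis .
qed

text \<open>For t > 0 the derivative is t^(-2) (p - p')(1/t) exp (-1/t), the member with polynomial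
  X^2 (p - p'). At 0 both one-sided difference quotients tend to 0.\<close>

lemma has_derivative_exp_inv:
 "(exp_inv p has_real_derivative exp_inv ([:0,0,1:] * (p - pderiv p)) t) (at t)"
proof -
 consider "t > 0" | "t < 0" | "t = 0" by linarith
 then show ?thesis
 proof cases
  case 1
  have "((%t. poly p (inverse t) * exp (- inverse t)) has_real_derivative
    exp_inv ([:0,0,1:] * (p - pderiv p)) t) (at t)"
   using 1 by (auto intro!: derivative_eq_intros simp: exp_inv_def power2_eq_square field_simps)
  then show ?thesis
   by (rule has_field_derivative_transform_within_open[of _ _ _ "{0<..}"]) (use 1 in \<open>auto simp: exp_inv_def\<close>)
 next
  case 2
  have "((%t. 0) has_real_derivative exp_inv ([:0,0,1:] * (p - pderiv p)) t) (at t)"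
   using 2 by (simp add: exp_inv_def)
  then show ?thesis
   by (rule has_field_derivative_transform_within_open[of _ _ _ "{..<0}"]) (use 2 in \<open>auto simp: exp_inv_def\<close>)
 next
  case 3
  \<comment> \<open>From the right the difference quotient is the member with polynomial X p, which
    tends to 0.\<close>
  have "((%h. exp_inv p h / h) \<longlongrightarrow> 0) (at_right 0)"
  proof (rule Lim_transform_eventually[OF exp_inv_right_limit[of "pCons 0 p"]])
   show "\<forall>\<^sub>F h in at_right 0. poly (pCons 0 p) (inverse h) * exp (- inverse h) = exp_inv p h / h"
    by (rule eventually_at_right_less[THEN eventually_mono]) (simp add: exp_inv_def divide_inverse)
  qed
  moreover have "((%h. exp_inv p h / h) \<longlongrightarrow> 0) (at_left 0)"
   by (rule Lim_transform_eventually[OF tendsto_const])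
    (auto simp: eventually_at_filter exp_inv_def)
  ultimately have "((%h. exp_inv p h / h) \<longlongrightarrow> 0) (at 0)" by (simp add: filterlim_split_at)
  then show ?thesis using 3 by (simp add: DERIV_def exp_inv_def)
 qed
qed

definition hbump :: "real => real" where "hbump = exp_inv 1"

lemma hbump_eq: "hbump t = (if t > 0 then exp (- inverse t) else 0)"
 by (simp add: hbump_def exp_inv_def)

lemma hbump_nonneg: "0 <= hbump t" and hbump_le_1: "hbump t <= 1" and hbump_pos_iff: "0 < hbump t \<longleftrightarrow> 0 < t"
 and hbump_eq_0_iff: "hbump t = 0 \<longleftrightarrow> t <= 0"
 by (auto simp: hbump_eq)

lemma smooth_hbump: "smooth (%x. complex_of_real (hbump (s * x $ i + a)))"
proof (rule smooth_of_coordinate[where X = "{%t. c * exp_inv p (s * t + a) |c p. True}" and f = "%t. hbump (s * t + a)"])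
 show "(%t. hbump (s * t + a)) \<in> {%t. c * exp_inv p (s * t + a) |c p. True}"
  unfolding hbump_def by (intro CollectI exI[of _ 1]) simp
 fix f assume "f \<in> {%t. c * exp_inv p (s * t + a) |c p. True}"
 then obtain c p where f: "f = (%t. c * exp_inv p (s * t + a))" by auto
 have "(f has_real_derivative (c * s) * exp_inv ([:0,0,1:] * (p - pderiv p)) (s * t + a)) (at t)" for t
  unfolding f by (rule DERIV_cong, rule DERIV_cmult, rule DERIV_chain2[OF has_derivative_exp_inv])
   (auto intro!: derivative_eq_intros)
 then show "\<exists>f'\<in>{%t. c * exp_inv p (s * t + a) |c p. True}. \<forall>t. (f has_real_derivative f' t) (at t)"
  by (intro bexI[of _ "%t. (c * s) * exp_inv ([:0,0,1:] * (p - pderiv p)) (s * t + a)"]) blast+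
qed

text \<open>\<open>n\<close> is a steepness: the support stays in the same closed box while the
  values tend to the indicator of the open box, so indicators of boxes are limits of test
  functions.\<close>

definition box_bump :: "real => real^2 => real^2 => real^2 => real" where
 "box_bump n a b x = (\<Prod>i\<in>UNIV. hbump (n * (x $ i - a $ i)) * hbump (n * (b $ i - x $ i)))"

lemma smooth_box_bump: "smooth (%x. complex_of_real (box_bump n a b x))"
proof -
 have 1: "smooth (%x. complex_of_real (hbump (n * (x $ i - a $ i))))" for i
  using smooth_hbump[of n i "- n * a $ i"] by (simp add: algebra_simps)
 have 2: "smooth (%x. complex_of_real (hbump (n * (b $ i - x $ i))))" for i
  using smooth_hbump[of "- n" i "n * b $ i"] by (simp add: algebra_simps)
 show ?thesis unfolding box_bump_def UNIV_2
  by (simp add: smooth_mult 1 2)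
qed

lemma box_bump_support:
 assumes "n > 0"
 shows "{x. complex_of_real (box_bump n a b x) \<noteq> 0} \<subseteq> cbox a b"
 using assms by (auto simp: box_bump_def mem_box_cart hbump_eq_0_iff mult_le_0_iff not_le
   zero_less_mult_iff forall_2 UNIV_2 less_imp_le)

lemma box_bump_bounds: "0 <= box_bump n a b x" "box_bump n a b x <= 1"
 unfolding box_bump_def
 by (auto intro!: prod_nonneg prod_le_1 mult_nonneg_nonneg mult_le_one simp: hbump_nonneg hbump_le_1)

lemma box_bump_limit:
 "(%n. box_bump (real n) a b x) \<longlonglongrightarrow> indicator (box a b) x"
proof -
 have "(%n. hbump (real n * t)) \<longlonglongrightarrow> (if t > 0 then 1 else 0)" for t
 proof (cases "t > 0")
  case True
  have "(%n. exp (- (inverse (real n) * inverse t))) \<longlonglongrightarrow> exp (- (0 * inverse t))"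
   by (intro tendsto_intros lim_inverse_n)
  then have "(%n. exp (- inverse (real n * t))) \<longlonglongrightarrow> 1" by (simp add: mult.commute)
  then have "(%n. hbump (real n * t)) \<longlonglongrightarrow> 1"
   by (rule Lim_transform_eventually)
    (use True in \<open>auto simp: hbump_eq intro!: eventually_sequentiallyI[of 1]\<close>)
  then show ?thesis using True by simp
 next
  case False
  then have "hbump (real n * t) = 0" for n by (simp add: hbump_eq_0_iff mult_nonneg_nonpos)
  then show ?thesis using False by simp
 qed
 from tendsto_prod[OF tendsto_mult[OF this this]]
 have "(%n. box_bump (real n) a b x) \<longlonglongrightarrow>
   (\<Prod>i\<in>UNIV. (if x $ i - a $ i > 0 then 1 else 0) * (if b $ i - x $ i > 0 then 1 else 0))"
  unfolding box_bump_def .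
 also have "(\<Prod>i\<in>UNIV. (if x $ i - a $ i > 0 then 1 else 0) * (if b $ i - x $ i > 0 then 1 else 0::real))
   = indicator (box a b) x"
  by (auto simp: UNIV_2 indicator_def mem_box_cart forall_2)
 finally show ?thesis .
qed

lemma box_bump_test_function:
 assumes "cbox a b \<subseteq> \<Omega>" "n > 0"
 shows "(%x. complex_of_real (box_bump n a b x)) \<in> test_functions \<Omega>"
proof -
 have "closure {x. complex_of_real (box_bump n a b x) \<noteq> 0} \<subseteq> cbox a b"
  using box_bump_support[OF assms(2)] closed_cbox by (rule closure_minimal)
 moreover have "compact (closure {x. complex_of_real (box_bump n a b x) \<noteq> 0})"
  by (rule compact_closure[THEN iffD2], rule bounded_subset[OF bounded_cbox box_bump_support[OF assms(2)]])
 ultimately show ?thesis using assms(1) smooth_box_bump unfolding test_functions_def by blast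
qed

text \<open>In each coordinate the cutoff is p / (p + q), with p positive exactly for |x_i| < b and
  q positive exactly for |x_i| > a. As a < b, the two regions cover the line and the denominator
  never vanishes.\<close>

lemma smooth_cutoff_exists:
 assumes "0 < a1" "a1 < b1" "0 < a2" "a2 < b2"
 shows "\<exists>\<zeta>. smooth \<zeta> \<and> (\<forall>x. \<bar>x $ 1\<bar> <= a1 \<and> \<bar>x $ 2\<bar> <= a2 \<longrightarrow> \<zeta> x = 1) \<and>
  (\<forall>x. b1 <= \<bar>x $ 1\<bar> \<or> b2 <= \<bar>x $ 2\<bar> \<longrightarrow> \<zeta> x = 0)"
proof -
 define p where "p i b x = complex_of_real (hbump ((-1) * x $ i + b)) * complex_of_real (hbump (1 * x $ i + b))"
  for i :: 2 and b :: real and x :: "real^2"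
 define q where "q i a x = complex_of_real (hbump (1 * x $ i + (- a))) + complex_of_real (hbump ((-1) * x $ i + (- a)))"
  for i :: 2 and a :: real and x :: "real^2"
 define s where "s i a b x = p i b x * inverse (p i b x + q i a x)" for i a b and x :: "real^2"
 have nz: "p i b x + q i a x \<noteq> 0" if "0 < a" "a < b" for i a b x
 proof -
  have r: "p i b x + q i a x = complex_of_real (hbump (b - x $ i) * hbump (b + x $ i) + (hbump (x $ i - a) + hbump (- x $ i - a)))"
  proof -
   have e: "(-1) * x $ i + b = b - x $ i" "1 * x $ i + b = b + x $ i"
    "1 * x $ i + (- a) = x $ i - a" "(-1) * x $ i + (- a) = - x $ i - a" by auto
   show ?thesis unfolding p_def q_def e by simp
  qed
  have "hbump (b - x $ i) * hbump (b + x $ i) + (hbump (x $ i - a) + hbump (- x $ i - a)) > 0"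
  proof (cases "\<bar>x $ i\<bar> <= a")
   case True
   then have "0 < hbump (b - x $ i)" "0 < hbump (b + x $ i)" using that by (auto simp: hbump_pos_iff)
   then show ?thesis using hbump_nonneg by (intro add_pos_nonneg add_nonneg_nonneg mult_pos_pos) auto
  next
   case False
   then have "0 < hbump (x $ i - a) \<or> 0 < hbump (- x $ i - a)" by (auto simp: hbump_pos_iff abs_if split: if_splits)
   moreover have "0 <= hbump (b - x $ i) * hbump (b + x $ i)" by (simp add: hbump_nonneg)
   ultimately show ?thesis using hbump_nonneg[of "x $ i - a"] hbump_nonneg[of "- x $ i - a"] by linarith
  qed
  then show ?thesis unfolding r by (metis of_real_eq_0_iff less_irrefl)
 qed
 have sm: "smooth (s i a b)" if "0 < a" "a < b" for i a b
 proof -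
  have "smooth (%x. p i b x)" "smooth (%x. q i a x)"
   unfolding p_def q_def by (intro smooth_mult smooth_add smooth_hbump)+
  then show ?thesis unfolding s_def using nz[OF that] by (intro smooth_mult smooth_inverse smooth_add)
 qed
 have s1: "s i a b x = 1" if "0 < a" "a < b" "\<bar>x $ i\<bar> <= a" for i a b x
 proof -
  have q0: "q i a x = 0" using that by (auto simp: q_def hbump_eq)
  then have "p i b x \<noteq> 0" using nz[OF that(1,2), of i x] by simp
  then show ?thesis by (simp add: s_def q0)
 qed
 have s0: "s i a b x = 0" if "b <= \<bar>x $ i\<bar>" for i a b x
  using that by (auto simp: s_def p_def hbump_eq abs_if split: if_splits)
 show ?thesis
  by (rule exI[of _ "%x. s 1 a1 b1 x * s 2 a2 b2 x"]) (use assms sm s1 s0 in \<open>auto intro!: smooth_mult\<close>)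
qed

section \<open>Slicing the plane along coordinate lines, and integration by parts\<close>

text \<open>\<open>s\<close> runs along a line in direction \<open>i\<close> and \<open>t\<close>
  selects the line, so that both coordinate directions are covered by one set of lemmas.\<close>

definition pt :: "2 => real => real => real^2" where
 "pt i s t = (\<chi> j. if j = i then s else t)"

lemma pt_nth [simp]: "pt i s t $ i = s" "j \<noteq> i ==> pt i s t $ j = t"
 by (simp_all add: pt_def)

lemma continuous_on_pt [continuous_intros]:
 "continuous_on S f ==> continuous_on S g ==> continuous_on S (%p. pt i (f p) (g p))"
 unfolding pt_def
proof (rule continuous_on_vec_lambda)
 show "continuous_on S f ==> continuous_on S g ==> continuous_on S (%x. if j = i then f x else g x)" for j
  by (cases "j = i") auto
qed

lemma measurable_pt [measurable]: "(%(t, s). pt i s t) \<in> borel_measurable (borel \<Otimes>\<^sub>M borel)"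
 unfolding borel_prod by (intro borel_measurable_continuous_onI) (auto simp: case_prod_beta intro!: continuous_intros)

lemma measurable_pt1 [measurable]: "(%s. pt i s t) \<in> borel_measurable borel"
 by (intro borel_measurable_continuous_onI continuous_intros)

lemma prod_Basis_vec: "(\<Prod>b\<in>Basis. x \<bullet> b) = (\<Prod>i\<in>UNIV. x $ i)" for x :: "real^2"
proof -
 have "(Basis :: (real^2) set) = (%i. axis i 1) ` UNIV" by (auto simp: Basis_vec_def)
 moreover have "inj (%i::2. axis i (1::real))" by (auto simp: inj_def axis_eq_axis)
 ultimately have "(\<Prod>b\<in>Basis. x \<bullet> b) = (\<Prod>i\<in>UNIV. x \<bullet> axis i 1)"
  by (metis (no_types, lifting) prod.reindex_cong)
 then show ?thesis by (simp add: inner_axis)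
qed

lemma lborel_distr_pt: "distr (lborel \<Otimes>\<^sub>M lborel) borel (%(t, s). pt i s t) = lborel"
proof (rule lborel_eqI[symmetric])
 fix l u :: "real^2" assume lu: "\<And>b. b \<in> Basis ==> l \<bullet> b <= u \<bullet> b"
 have le: "l $ j <= u $ j" for j
  using lu[of "axis j 1"] by (simp add: axis_in_Basis_iff inner_axis)
 obtain j where j: "j \<noteq> i" "UNIV = {i, j}" by (metis UNIV_2 insert_commute exhaust_2 zero_neq_one)
 have "(%(t, s). pt i s t) -` box l u \<inter> space (lborel \<Otimes>\<^sub>M lborel) = box (l $ j) (u $ j) \<times> box (l $ i) (u $ i)"
  using j by (auto simp: mem_box_cart space_pair_measure) (metis UNIV_I insertE pt_nth singletonD)+
 then have "emeasure (distr (lborel \<Otimes>\<^sub>M lborel) borel (%(t, s). pt i s t)) (box l u)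
   = emeasure lborel (box (l $ j) (u $ j)) * emeasure lborel (box (l $ i) (u $ i))"
  by (simp add: emeasure_distr lborel.emeasure_pair_measure_Times)
 also have "\<dots> = ennreal (\<Prod>k\<in>UNIV. (u - l) $ k)"
 proof -
  have "(\<Prod>k\<in>UNIV. (u - l) $ k) = (\<Prod>k\<in>{i, j}. (u - l) $ k)" by (simp only: j(2))
  also have "\<dots> = (u $ i - l $ i) * (u $ j - l $ j)" using j(1) by simp
  finally show ?thesis using le by (simp add: ennreal_mult' mult.commute)
 qed
 finally show "emeasure (distr (lborel \<Otimes>\<^sub>M lborel) borel (%(t, s). pt i s t)) (box l u) = ennreal (\<Prod>b\<in>Basis. (u - l) \<bullet> b)"
  by (simp only: prod_Basis_vec)
qed simp

lemma nn_integral_lborel_pt: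
 fixes f :: "real^2 => ennreal"
 assumes [measurable]: "f \<in> borel_measurable borel"
 shows "(\<integral>\<^sup>+x. f x \<partial>lborel) = (\<integral>\<^sup>+t. (\<integral>\<^sup>+s. f (pt i s t) \<partial>lborel) \<partial>lborel)"
proof -
 have "(\<integral>\<^sup>+x. f x \<partial>lborel) = (\<integral>\<^sup>+x. f x \<partial>distr (lborel \<Otimes>\<^sub>M lborel) borel (%(t, s). pt i s t))"
  by (simp only: lborel_distr_pt)
 also have "\<dots> = (\<integral>\<^sup>+p. f (case p of (t, s) => pt i s t) \<partial>(lborel \<Otimes>\<^sub>M lborel))"
  by (rule nn_integral_distr) simp_all
 also have "\<dots> = (\<integral>\<^sup>+t. (\<integral>\<^sup>+s. f (pt i s t) \<partial>lborel) \<partial>lborel)"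
  by (subst lborel.nn_integral_fst[symmetric]) simp_all
 finally show ?thesis .
qed

lemma integral_lborel_pt:
 fixes f :: "real^2 => complex"
 assumes f: "integrable lborel f"
 shows "(LINT x|lborel. f x) = (LINT t|lborel. LINT s|lborel. f (pt i s t))"
proof -
 have [measurable]: "f \<in> borel_measurable borel" using f by auto
 have "integrable (distr (lborel \<Otimes>\<^sub>M lborel) borel (%(t, s). pt i s t)) f" using f by (simp only: lborel_distr_pt)
 then have i: "integrable (lborel \<Otimes>\<^sub>M lborel) (%p. f (case p of (t, s) => pt i s t))"
  by (subst (asm) integrable_distr_eq) simp_all
 have "(LINT x|lborel. f x) = (LINT x|distr (lborel \<Otimes>\<^sub>M lborel) borel (%(t, s). pt i s t). f x)"
  by (simp only: lborel_distr_pt)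
 also have "\<dots> = (LINT p|(lborel \<Otimes>\<^sub>M lborel). f (case p of (t, s) => pt i s t))"
  by (rule integral_distr) simp_all
 also have "\<dots> = (LINT t|lborel. LINT s|lborel. f (pt i s t))"
  using lborel_pair.integral_fst'[OF i] by simp
 finally show ?thesis .
qed

lemma smooth_has_vector_derivative_pt:
 assumes "smooth \<phi>"
 shows "((%s. \<phi> (pt i s t)) has_vector_derivative partial i \<phi> (pt i s t)) (at s within S)"
proof -
 have eq: "(%s. pt i s t) = (%s. pt i 0 t + s *\<^sub>R axis i 1)"
  by (rule ext) (auto simp: pt_def vec_eq_iff axis_def)
 have "((%s. pt i s t) has_derivative (%h. h *\<^sub>R axis i 1)) (at s within S)"
  unfolding eq by (auto intro!: derivative_eq_intros)
 from has_derivative_compose[OF this has_derivative_partials[OF smooth_differentiable[OF assms]]]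
 show ?thesis unfolding has_vector_derivative_def
  by (rule has_derivative_eq_rhs) (use exhaust_2[of i] in \<open>auto simp: axis_def fun_eq_iff sum_2\<close>)
qed

lemma smooth_cont_pt: "smooth \<phi> ==> continuous_on S (%s. \<phi> (pt i s t))"
 by (rule continuous_on_compose2[OF smooth_continuous_on[of \<phi> UNIV]]) (auto intro: continuous_intros)

text \<open>On each line in direction \<open>i\<close> the integral of the derivative is a
  difference of two values outside the support.\<close>

lemma integral_partial_compact_support:
 assumes "smooth \<phi>" "bounded {x. \<phi> x \<noteq> 0}"
 shows "integrable lborel (partial i \<phi>)" "(LINT x|lborel. partial i \<phi> x) = 0"
proof -
 obtain R where R: "R > 0" "\<And>x. \<phi> x \<noteq> 0 ==> norm x < R" using assms(2) by (auto simp: bounded_pos_less)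
 have z: "\<phi> x = 0" if "R <= norm x" for x using R(2)[of x] that by force
 have p0: "partial i \<phi> x = 0" if "norm x > R" for x
 proof -
  have "open (- cball (0::real^2) R)" by (simp add: open_Compl)
  then have "((%x. 0) has_derivative (%h. 0)) (at x) ==> (\<phi> has_derivative (%h. 0)) (at x)"
   by (rule has_derivative_transform_within_open[rotated]) (use that z in auto)
  then show ?thesis using partial_eq[of \<phi> "%h. 0" x i] by simp
 qed
 have "integrable lborel (%x. indicator (cball 0 R) x *\<^sub>R partial i \<phi> x)"
  by (intro borel_integrable_compact smooth_continuous_on smooth_partial assms) auto
 also have "(%x. indicator (cball 0 R) x *\<^sub>R partial i \<phi> x) = partial i \<phi>"
  using p0 by (auto simp: fun_eq_iff indicator_def)
 finally show int: "integrable lborel (partial i \<phi>)" .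
 have n: "\<bar>s\<bar> <= norm (pt i s t)" for s t
  using component_le_norm_cart[of "pt i s t" i] by simp
 have "(LINT s|lborel. partial i \<phi> (pt i s t)) = 0" for t
 proof -
  have "(LINT s|lborel. indicator {-R..R} s *\<^sub>R partial i \<phi> (pt i s t)) = \<phi> (pt i R t) - \<phi> (pt i (-R) t)"
   using R(1) by (intro integral_FTC_Icc smooth_has_vector_derivative_pt smooth_cont_pt smooth_partial assms) auto
  also have "\<dots> = 0" using z n[of R t] n[of "-R" t] R(1) by simp
  also have "(%s. indicator {-R..R} s *\<^sub>R partial i \<phi> (pt i s t)) = (%s. partial i \<phi> (pt i s t))"
  proof (rule ext)
   fix s show "indicator {-R..R} s *\<^sub>R partial i \<phi> (pt i s t) = partial i \<phi> (pt i s t)"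
    using p0[of "pt i s t"] n[of s t] by (cases "s \<in> {-R..R}") auto
  qed
  finally show ?thesis .
 qed
 then show "(LINT x|lborel. partial i \<phi> x) = 0" unfolding integral_lborel_pt[OF int, of i] by simp
qed

lemma borel_measurable_lebesgue_on: "f \<in> borel_measurable borel ==> f \<in> borel_measurable (lebesgue_on \<Omega>)"
 by (intro measurable_restrict_space1 measurable_completion) simp

lemma lebesgue_on_integral_supported:
 fixes f :: "real^2 => complex"
 assumes "open \<Omega>" "f \<in> borel_measurable borel" "\<And>x. x \<notin> \<Omega> ==> f x = 0"
 shows "(LINT x|lebesgue_on \<Omega>. f x) = (LINT x|lborel. f x)"
proof -
 have "(LINT x|lebesgue_on \<Omega>. f x) = (LINT x|lebesgue. indicator \<Omega> x *\<^sub>R f x)"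
  using assms(1) by (subst integral_restrict_space) auto
 also have "(%x. indicator \<Omega> x *\<^sub>R f x) = f" using assms(3) by (auto simp: fun_eq_iff indicator_def)
 also have "(LINT x|lebesgue. f x) = (LINT x|lborel. f x)"
  by (rule integral_completion) (use assms in simp)
 finally show ?thesis .
qed

lemma test_function_smooth: "\<psi> \<in> test_functions \<Omega> ==> smooth \<psi>"
 by (simp add: test_functions_def)

lemma test_function_bounded_support: "\<psi> \<in> test_functions \<Omega> ==> bounded {x. \<psi> x \<noteq> 0}"
 unfolding test_functions_def using bounded_subset[OF compact_imp_bounded closure_subset] by auto

lemma test_function_eq_0: "\<psi> \<in> test_functions \<Omega> ==> x \<notin> \<Omega> ==> \<psi> x = 0"
 unfolding test_functions_def using closure_subset[of "{x. \<psi> x \<noteq> 0}"] by auto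

lemma partial_test_function_eq_0:
 assumes "\<psi> \<in> test_functions \<Omega>" "x \<notin> \<Omega>"
 shows "partial i \<psi> x = 0"
proof -
 have x: "x \<in> - closure {x. \<psi> x \<noteq> 0}" using assms by (auto simp: test_functions_def)
 have "(\<psi> has_derivative (%h. 0)) (at x)"
  by (rule has_derivative_transform_within_open[OF has_derivative_const[of 0] _ x])
   (use closure_subset[of "{x. \<psi> x \<noteq> 0}"] in auto)
 then show ?thesis by (simp add: partial_eq)
qed

lemma continuous_compact_support_bounded:
 fixes \<psi> :: "real^2 => complex"
 assumes "continuous_on UNIV \<psi>" "\<And>x. x \<notin> K ==> \<psi> x = 0" "compact K"
 shows "\<exists>B\<ge>0. \<forall>x. cmod (\<psi> x) <= B"
proof -
 have "bounded (\<psi> ` K)" using assms by (intro compact_imp_bounded compact_continuous_image) (auto intro: continuous_on_subset)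
 then obtain B where "B > 0" "\<And>x. x \<in> K ==> cmod (\<psi> x) <= B" by (auto simp: bounded_pos)
 then show ?thesis using assms(2) by (intro exI[of _ B]) (metis less_imp_le norm_zero)
qed

text \<open>The product with a test function has compact support, so its derivative integrates to 0;
  \<open>\<phi>\<close> itself may be nonzero up to the boundary.\<close>

lemma integral_by_parts_test:
 assumes "open \<Omega>" "smooth \<phi>" "\<psi> \<in> test_functions \<Omega>"
 shows "(LINT x|lebesgue_on \<Omega>. \<phi> x * partial i \<psi> x) = - (LINT x|lebesgue_on \<Omega>. partial i \<phi> x * \<psi> x)"
proof -
 note \<psi> = test_function_smooth[OF assms(3)]
 have sm: "smooth (%x. \<phi> x * \<psi> x)" by (intro smooth_mult assms \<psi>)
 have bd: "bounded {x. \<phi> x * \<psi> x \<noteq> 0}"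
  by (rule bounded_subset[OF test_function_bounded_support[OF assms(3)]]) auto
 have P: "partial i (%x. \<phi> x * \<psi> x) = (%x. \<phi> x * partial i \<psi> x + partial i \<phi> x * \<psi> x)"
  by (intro partial_mult smooth_differentiable assms \<psi>)
 obtain K where K: "compact K" "\<And>x. x \<notin> K ==> \<psi> x = 0"
  using assms(3) closure_subset[of "{x. \<psi> x \<noteq> 0}"] unfolding test_functions_def by blast
 have i2: "integrable lborel (%x. partial i \<phi> x * \<psi> x)"
 proof -
  have "integrable lborel (%x. indicator K x *\<^sub>R (partial i \<phi> x * \<psi> x))"
   by (intro borel_integrable_compact K smooth_continuous_on smooth_mult smooth_partial assms \<psi>)
  also have "(%x. indicator K x *\<^sub>R (partial i \<phi> x * \<psi> x)) = (%x. partial i \<phi> x * \<psi> x)"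
   using K(2) by (auto simp: fun_eq_iff indicator_def)
  finally show ?thesis .
 qed
 note I = integral_partial_compact_support[OF sm bd, of i]
 have i1: "integrable lborel (%x. \<phi> x * partial i \<psi> x)"
  using Bochner_Integration.integrable_diff[OF I(1) i2] by (simp add: P)
 have "(LINT x|lborel. \<phi> x * partial i \<psi> x) + (LINT x|lborel. partial i \<phi> x * \<psi> x) = 0"
  using I(2) unfolding P Bochner_Integration.integral_add[OF i1 i2] .
 then have "(LINT x|lborel. \<phi> x * partial i \<psi> x) = - (LINT x|lborel. partial i \<phi> x * \<psi> x)"
  by (simp add: eq_neg_iff_add_eq_0)
 moreover have "(LINT x|lebesgue_on \<Omega>. \<phi> x * partial i \<psi> x) = (LINT x|lborel. \<phi> x * partial i \<psi> x)"
  by (rule lebesgue_on_integral_supported[OF assms(1)])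
   (use assms \<psi> in \<open>auto intro!: smooth_measurable smooth_mult smooth_partial simp: partial_test_function_eq_0\<close>)
 moreover have "(LINT x|lebesgue_on \<Omega>. partial i \<phi> x * \<psi> x) = (LINT x|lborel. partial i \<phi> x * \<psi> x)"
  by (rule lebesgue_on_integral_supported[OF assms(1)])
   (use assms \<psi> in \<open>auto intro!: smooth_measurable smooth_mult smooth_partial simp: test_function_eq_0\<close>)
 ultimately show ?thesis by simp
qed

section \<open>Uniqueness of the weak gradient\<close>

text \<open>Box bumps converge boundedly to indicators, so \<open>f\<close> integrates to 0 over
  every closed box in \<Omega>. Lebesgue differentiation over shrinking squares then gives f = 0
  almost everywhere.\<close>

lemma fundamental_lemma:
 fixes f :: "real^2 => complex"
 assumes \<Omega>: "open \<Omega>" and f: "integrable (lebesgue_on \<Omega>) f"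
  and 0: "\<And>\<psi>. \<psi> \<in> test_functions \<Omega> ==> (LINT x|lebesgue_on \<Omega>. f x * \<psi> x) = 0"
 shows "AE x in lebesgue_on \<Omega>. f x = 0"
proof -
 define F where "F x = indicator \<Omega> x *\<^sub>R f x" for x
 have \<Omega>s: "\<Omega> \<inter> space lebesgue \<in> sets lebesgue" using \<Omega> by simp
 have F: "integrable lebesgue F" unfolding F_def using f \<Omega>s by (simp add: integrable_restrict_space)
 have box: "(LINT x|lebesgue_on \<Omega>. f x * complex_of_real (indicator (box a b) x)) = 0" if ab: "cbox a b \<subseteq> \<Omega>" for a b
 proof -
  have "(%n. LINT x|lebesgue_on \<Omega>. f x * complex_of_real (box_bump (real n) a b x))
    \<longlonglongrightarrow> (LINT x|lebesgue_on \<Omega>. f x * complex_of_real (indicator (box a b) x))"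
  proof (rule integral_dominated_convergence[where w = "%x. norm (f x)"])
   show "(%x. f x * complex_of_real (box_bump (real n) a b x)) \<in> borel_measurable (lebesgue_on \<Omega>)" for n
    by (rule borel_measurable_times[OF borel_measurable_integrable[OF f]
       borel_measurable_lebesgue_on[OF smooth_measurable[OF smooth_box_bump]]])
   show "(%x. f x * complex_of_real (indicator (box a b) x)) \<in> borel_measurable (lebesgue_on \<Omega>)"
    by (rule borel_measurable_times[OF borel_measurable_integrable[OF f] borel_measurable_lebesgue_on]) measurable
   show "AE x in lebesgue_on \<Omega>. (%n. f x * complex_of_real (box_bump (real n) a b x)) \<longlonglongrightarrow> f x * complex_of_real (indicator (box a b) x)"
    by (intro AE_I2 tendsto_intros box_bump_limit)
   show "AE x in lebesgue_on \<Omega>. norm (f x * complex_of_real (box_bump (real n) a b x)) <= norm (f x)" for n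
    using box_bump_bounds by (intro AE_I2) (simp add: norm_mult mult_left_le)
  qed (use f in simp)
  moreover have "(%n. LINT x|lebesgue_on \<Omega>. f x * complex_of_real (box_bump (real n) a b x)) \<longlonglongrightarrow> 0"
   by (rule tendsto_eventually, rule eventually_sequentiallyI[of 1])
    (use ab in \<open>auto intro!: 0 box_bump_test_function\<close>)
  ultimately show ?thesis using LIMSEQ_unique by blast
 qed
 have si: "set_integrable lebesgue (cbox a b) F" for a b
  unfolding set_integrable_def by (intro integrable_mult_indicator F) simp
 have int0: "integral (cbox a b) F = 0" if ab: "cbox a b \<subseteq> \<Omega>" for a b
 proof -
  have "integral (cbox a b) F = (LINT x|lebesgue. indicator (cbox a b) x *\<^sub>R F x)"
   using set_lebesgue_integral_eq_integral(2)[OF si[of a b]] by (simp add: set_lebesgue_integral_def)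
  also have "\<dots> = (LINT x|lebesgue. indicator \<Omega> x *\<^sub>R (f x * complex_of_real (indicator (box a b) x)))"
  proof (rule integral_cong_AE)
   show "(%x. indicator (cbox a b) x *\<^sub>R F x) \<in> borel_measurable lebesgue"
    using si[of a b] unfolding set_integrable_def by auto
   have "(%x. indicator (box a b) x *\<^sub>R F x) \<in> borel_measurable lebesgue"
    by (rule borel_measurable_scaleR[OF borel_measurable_indicator borel_measurable_integrable[OF F]]) simp
   also have "(%x. indicator (box a b) x *\<^sub>R F x) = (%x. indicator \<Omega> x *\<^sub>R (f x * complex_of_real (indicator (box a b) x)))"
    by (auto simp: F_def fun_eq_iff indicator_def)
   finally show "(%x. indicator \<Omega> x *\<^sub>R (f x * complex_of_real (indicator (box a b) x))) \<in> borel_measurable lebesgue" .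
   \<comment> \<open>The faces of a box are a null set, so open and closed box may be
     exchanged.\<close>
   have "AE x in lebesgue. x \<notin> cbox a b - box a b"
    using negligible_frontier_interval[of a b] by (intro AE_not_in) (simp add: negligible_iff_null_sets)
   then show "AE x in lebesgue. indicator (cbox a b) x *\<^sub>R F x = indicator \<Omega> x *\<^sub>R (f x * complex_of_real (indicator (box a b) x))"
    by eventually_elim (use box_subset_cbox[of a b] in \<open>auto simp: F_def indicator_def\<close>)
  qed
  also have "\<dots> = (LINT x|lebesgue_on \<Omega>. f x * complex_of_real (indicator (box a b) x))"
   using \<Omega>s by (simp add: integral_restrict_space)
  finally show ?thesis using box[OF ab] by simp
 qed
 have "F integrable_on cbox a b" for a b using set_lebesgue_integral_eq_integral(1)[OF si[of a b]] .
 \<comment> \<open>Lebesgue differentiation for squares that have the point as lower corner.\<close>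
 then obtain N where N: "negligible N" "\<And>x e. x \<notin> N ==> 0 < e ==>
   \<exists>d>0. \<forall>h. 0 < h \<and> h < d \<longrightarrow> norm (integral (cbox x (x + h *\<^sub>R One)) F /\<^sub>R h ^ DIM(real^2) - F x) < e"
  using integrable_ccontinuous_explicit[of F] by metis
 have "f x = 0" if xN: "x \<in> \<Omega>" "x \<notin> N" for x
 proof (rule ccontr)
  assume "f x \<noteq> 0"
  then have "norm (F x) > 0" using xN by (simp add: F_def)
  from N(2)[OF xN(2) this] obtain d where d: "d > 0"
   "\<And>h. 0 < h ==> h < d ==> norm (integral (cbox x (x + h *\<^sub>R One)) F /\<^sub>R h ^ DIM(real^2) - F x) < norm (F x)" by auto
  obtain r where r: "r > 0" "cball x r \<subseteq> \<Omega>"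
   using open_contains_cball[THEN iffD1, OF \<Omega>, THEN bspec, OF xN(1)] by blast
  \<comment> \<open>A square of side \<open>h\<close> has l1-diameter 2 h and therefore stays in the
    ball of radius \<open>r\<close>.\<close>
  define h where "h = min (d / 2) (r / 2)"
  have h: "0 < h" "h < d" "2 * h <= r" using d r by (auto simp: h_def)
  have "cbox x (x + h *\<^sub>R One) \<subseteq> cball x r"
  proof
   fix y assume "y \<in> cbox x (x + h *\<^sub>R One)"
   then have yb: "\<forall>b\<in>Basis. x \<bullet> b <= y \<bullet> b \<and> y \<bullet> b <= (x + h *\<^sub>R One) \<bullet> b"
    unfolding mem_box .
   have y: "\<bar>(y - x) $ j\<bar> <= h" for j
   proof -
    have B: "axis j (1::real) \<in> Basis" by (simp only: axis_in_Basis_iff Basis_real_def singleton_iff)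
    have o: "One \<bullet> axis j (1::real) = 1" using inner_sum_left_Basis[OF B, of "%_. 1"] by simp
    have "x \<bullet> axis j 1 <= y \<bullet> axis j 1" "y \<bullet> axis j 1 <= x \<bullet> axis j 1 + h"
     using bspec[OF yb B] unfolding inner_add_left inner_scaleR_left o by simp_all
    then show ?thesis unfolding inner_axis vector_minus_component by simp
   qed
   have "norm (y - x) <= (\<Sum>j\<in>UNIV. \<bar>(y - x) $ j\<bar>)" by (rule norm_le_l1_cart)
   also have "\<dots> <= 2 * h" using y[of 1] y[of 2] by (simp add: UNIV_2)
   finally show "y \<in> cball x r" using h by (simp add: dist_norm norm_minus_commute)
  qed
  then have "integral (cbox x (x + h *\<^sub>R One)) F = 0" using r by (intro int0) auto
  with d(2)[OF h(1,2)] show False by simp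
 qed
 moreover have "AE x in lebesgue. x \<notin> N" using N(1) by (intro AE_not_in) (simp add: negligible_iff_null_sets)
 ultimately show ?thesis using \<Omega>s by (subst AE_restrict_space_iff) (auto elim: eventually_mono)
qed

lemma L2_integrable:
 assumes "finite_measure M" "f \<in> L2 M"
 shows "integrable M f"
proof -
 interpret finite_measure M by fact
 have "integrable M (%x. (cmod (f x))^2)" using assms(2) unfolding L2_def by (intro integrableI_bounded) auto
 then have "integrable M (%x. 1 + (cmod (f x))^2)" by simp
 then show ?thesis
 proof (rule Bochner_Integration.integrable_bound)
  have "cmod z <= 1 + (cmod z)^2" for z
   using sum_squares_bound[of "cmod z" 1] norm_ge_zero[of z] unfolding power2_eq_square by linarith
  then show "AE x in M. norm (f x) <= norm (1 + (cmod (f x))^2)" by (intro AE_I2) simp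
 qed (use assms(2) in \<open>simp add: L2_def\<close>)
qed

lemma bounded_open_finite_measure:
 fixes \<Omega> :: "(real^2) set"
 assumes "open \<Omega>" "bounded \<Omega>"
 shows "finite_measure (lebesgue_on \<Omega>)"
 by (rule finite_measure_lebesgue_on) (use assms in \<open>simp add: lmeasurable_open\<close>)

text \<open>\<open>wgrad\<close> is an arbitrary choice; this is what permits replacing it by any
  weak gradient found otherwise.\<close>

lemma weak_gradient_unique:
 assumes \<Omega>: "open \<Omega>" "bounded \<Omega>" and G: "weak_gradient \<Omega> u G" "weak_gradient \<Omega> u G'"
 shows "AE x in lebesgue_on \<Omega>. G x = G' x"
proof -
 note fin = bounded_open_finite_measure[OF \<Omega>]
 have "AE x in lebesgue_on \<Omega>. G x $ i - G' x $ i = 0" for i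
 proof (rule fundamental_lemma[OF \<Omega>(1)])
  have int: "integrable (lebesgue_on \<Omega>) (%x. G x $ i)" "integrable (lebesgue_on \<Omega>) (%x. G' x $ i)"
   using G by (auto intro!: L2_integrable[OF fin] simp: weak_gradient_def)
  then show "integrable (lebesgue_on \<Omega>) (%x. G x $ i - G' x $ i)" by simp
  fix \<psi> assume \<psi>: "\<psi> \<in> test_functions \<Omega>"
  then obtain B where B: "\<And>x. cmod (\<psi> x) <= B"
   using continuous_compact_support_bounded[OF smooth_continuous_on[OF test_function_smooth[OF \<psi>]], of "closure {x. \<psi> x \<noteq> 0}"]
    closure_subset[of "{x. \<psi> x \<noteq> 0}"] unfolding test_functions_def by blast
  have m: "integrable (lebesgue_on \<Omega>) (%x. h x * \<psi> x)" if "integrable (lebesgue_on \<Omega>) h" for h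
  proof (rule Bochner_Integration.integrable_bound)
   show "integrable (lebesgue_on \<Omega>) (%x. B * norm (h x))" using that by simp
   show "(%x. h x * \<psi> x) \<in> borel_measurable (lebesgue_on \<Omega>)"
    by (rule borel_measurable_times[OF borel_measurable_integrable[OF that]
       borel_measurable_lebesgue_on[OF smooth_measurable[OF test_function_smooth[OF \<psi>]]]])
   have "norm (h x * \<psi> x) <= B * norm (h x)" for x
    using mult_right_mono[OF B[of x], of "norm (h x)"] by (simp add: norm_mult mult.commute)
   then show "AE x in lebesgue_on \<Omega>. norm (h x * \<psi> x) <= norm (B * norm (h x))"
    by (intro AE_I2) (metis abs_ge_self order_trans real_norm_def)
  qed
  have "(LINT x|lebesgue_on \<Omega>. G x $ i * \<psi> x) = (LINT x|lebesgue_on \<Omega>. G' x $ i * \<psi> x)"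
  proof -
   have "(LINT x|lebesgue_on \<Omega>. u x * partial i \<psi> x) = - (LINT x|lebesgue_on \<Omega>. G x $ i * \<psi> x)"
    "(LINT x|lebesgue_on \<Omega>. u x * partial i \<psi> x) = - (LINT x|lebesgue_on \<Omega>. G' x $ i * \<psi> x)"
    using G \<psi> unfolding weak_gradient_def by blast+
   then show ?thesis by simp
  qed
  then show "(LINT x|lebesgue_on \<Omega>. (G x $ i - G' x $ i) * \<psi> x) = 0"
   unfolding left_diff_distrib Bochner_Integration.integral_diff[OF m[OF int(1)] m[OF int(2)]] by simp
 qed
 from this[of 1] this[of 2] show ?thesis by eventually_elim (simp add: vec_eq_iff forall_2)
qed

text \<open>Measurability is enough: a product that is not integrable has Bochner integral 0 by
  convention, and the inequality is then trivial.\<close>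

lemma nn_integral_cmod_mult_le:
 assumes [measurable]: "f \<in> borel_measurable M" "g \<in> borel_measurable M"
 shows "ennreal ((cmod (LINT x|M. f x * g x))^2)
  <= (\<integral>\<^sup>+x. ennreal ((cmod (f x))^2) \<partial>M) * (\<integral>\<^sup>+x. ennreal ((cmod (g x))^2) \<partial>M)"
proof (cases "integrable M (%x. f x * g x)")
 case True
 have "ennreal ((cmod (LINT x|M. f x * g x))^2) = (ennreal (cmod (LINT x|M. f x * g x)))^2"
  by (simp add: ennreal_power)
 also have "\<dots> <= (\<integral>\<^sup>+x. ennreal (cmod (f x * g x)) \<partial>M)^2"
  by (intro power_mono_ennreal integral_norm_bound_ennreal True)
 also have "\<dots> = (\<integral>\<^sup>+x. ennreal (cmod (f x)) * ennreal (cmod (g x)) \<partial>M)^2"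
  by (simp add: norm_mult ennreal_mult)
 also have "\<dots> <= (\<integral>\<^sup>+x. (ennreal (cmod (f x)))^2 \<partial>M) * (\<integral>\<^sup>+x. (ennreal (cmod (g x)))^2 \<partial>M)"
  by (rule Cauchy_Schwarz_nn_integral) measurable
 finally show ?thesis by (simp add: ennreal_power)
qed (simp add: not_integrable_integral_eq)

section \<open>Arclength measure on a finite set of edges\<close>

definition edge_points :: "((real^2) \<times> (real^2)) set => (real^2) set" where
 "edge_points E = (\<Union>(p,q)\<in>E. closed_segment p q)"

lemma closed_edge_points: "finite E ==> closed (edge_points E)"
 unfolding edge_points_def by (intro closed_UN) auto

lemma compact_edge_points: "finite E ==> compact (edge_points E)"
 unfolding edge_points_def by (intro compact_UN) auto

lemma edge_points_Un: "edge_points (E \<union> E') = edge_points E \<union> edge_points E'"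
 by (auto simp: edge_points_def)

lemma sets_edge_measure [simp, measurable_cong]: "sets (edge_measure e) = sets borel"
 by (simp add: edge_measure_def case_prod_beta)

lemma nn_integral_edge_measure:
 assumes [measurable]: "f \<in> borel_measurable borel"
 shows "(\<integral>\<^sup>+x. f x \<partial>edge_measure (p, q))
  = (\<integral>\<^sup>+t. f (p + (t / dist p q) *\<^sub>R (q - p)) * indicator {0..dist p q} t \<partial>lborel)"
proof -
 have "(%t. p + (t / dist p q) *\<^sub>R (q - p)) \<in> borel_measurable borel" by measurable
 then have [measurable]: "(%t. p + (t / dist p q) *\<^sub>R (q - p)) \<in> borel_measurable (restrict_space lborel {0..dist p q})"
  by (intro measurable_restrict_space1) simp
 show ?thesis unfolding edge_measure_def prod.case
  by (subst nn_integral_distr) (simp_all add: nn_integral_restrict_space)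
qed

lemma sets_arclength [simp, measurable_cong]: "sets (arclength E) = sets borel"
 unfolding arclength_def by (simp add: sets.sigma_sets_eq[of borel, simplified])

lemma space_arclength [simp]: "space (arclength E) = UNIV"
 using sets_eq_imp_space_eq[OF sets_arclength] by simp

lemma emeasure_arclength:
 assumes "S \<in> sets borel"
 shows "emeasure (arclength E) S = (\<Sum>e\<in>E. emeasure (edge_measure e) S)"
 unfolding arclength_def
proof (rule emeasure_measure_of_sigma)
 show "sigma_algebra UNIV (sets (borel :: (real^2) measure))"
  using sets.sigma_algebra_axioms[of "borel :: (real^2) measure"] by simp
 show "positive (sets borel) (%S. \<Sum>e\<in>E. emeasure (edge_measure e) S)"
  by (simp add: positive_def)
 show "countably_additive (sets borel) (%S. \<Sum>e\<in>E. emeasure (edge_measure e) S)"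
 proof (rule countably_additiveI)
  fix A :: "nat => (real^2) set" assume A: "range A \<subseteq> sets borel" "disjoint_family A"
  have "(\<Sum>i. \<Sum>e\<in>E. emeasure (edge_measure e) (A i)) = (\<Sum>e\<in>E. \<Sum>i. emeasure (edge_measure e) (A i))"
   by (rule suminf_sum) simp
  also have "\<dots> = (\<Sum>e\<in>E. emeasure (edge_measure e) (\<Union> (range A)))"
   using A by (intro sum.cong refl suminf_emeasure) auto
  finally show "(\<Sum>i. \<Sum>e\<in>E. emeasure (edge_measure e) (A i)) = (\<Sum>e\<in>E. emeasure (edge_measure e) (\<Union> (range A)))" .
 qed
qed (use assms in simp)

lemma nn_integral_arclength:
 assumes "finite E" "f \<in> borel_measurable borel"
 shows "(\<integral>\<^sup>+x. f x \<partial>arclength E) = (\<Sum>e\<in>E. \<integral>\<^sup>+x. f x \<partial>edge_measure e)"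
 using assms(2)
proof (induction rule: borel_measurable_induct)
 case (cong f g)
 then show ?case by simp
next
 case (set A)
 then show ?case by (simp add: emeasure_arclength)
next
 case (mult u c)
 then show ?case by (simp add: nn_integral_cmult sum_distrib_left)
next
 case (add u v)
 then show ?case by (simp add: nn_integral_add sum.distrib)
next
 case (seq U)
 have [measurable]: "U i \<in> borel_measurable borel" for i by (rule seq(1))
 have SUP: "(\<integral>\<^sup>+x. Sup (range U) x \<partial>M) = (SUP i. \<integral>\<^sup>+x. U i x \<partial>M)" if [measurable_cong]: "sets M = sets borel" for M :: "(real^2) measure"
 proof -
  have "(\<integral>\<^sup>+x. (SUP i. U i x) \<partial>M) = (SUP i. \<integral>\<^sup>+x. U i x \<partial>M)"
   by (rule nn_integral_monotone_convergence_SUP[OF \<open>incseq U\<close>]) measurable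
  then show ?thesis by (simp only: SUP_apply)
 qed
 have inc: "incseq (%i e. \<integral>\<^sup>+x. U i x \<partial>edge_measure e)"
  using \<open>incseq U\<close> by (auto simp: incseq_def le_fun_def intro!: nn_integral_mono)
 have "(\<integral>\<^sup>+x. Sup (range U) x \<partial>arclength E) = (SUP i. \<Sum>e\<in>E. \<integral>\<^sup>+x. U i x \<partial>edge_measure e)"
  unfolding SUP[OF sets_arclength] by (intro SUP_cong refl) (rule seq)
 \<comment> \<open>The finite sum is written as an integral over counting measure, so that monotone
   convergence exchanges it with the supremum.\<close>
 also have "\<dots> = (SUP i. \<integral>\<^sup>+e. (\<integral>\<^sup>+x. U i x \<partial>edge_measure e) \<partial>count_space E)"
  using assms(1) by (simp add: nn_integral_count_space_finite)
 also have "\<dots> = (\<integral>\<^sup>+e. (SUP i. \<integral>\<^sup>+x. U i x \<partial>edge_measure e) \<partial>count_space E)"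
  by (rule nn_integral_monotone_convergence_SUP[OF inc, symmetric]) simp
 also have "\<dots> = (\<Sum>e\<in>E. \<integral>\<^sup>+x. Sup (range U) x \<partial>edge_measure e)"
  unfolding nn_integral_count_space_finite[OF assms(1)]
  by (intro sum.cong refl SUP[symmetric] sets_edge_measure)
 finally show ?case .
qed

lemma nn_integral_edge_measure_cong:
 assumes [measurable]: "f \<in> borel_measurable borel" "h \<in> borel_measurable borel"
  and eq: "\<And>x. x \<in> closed_segment p q ==> f x = h x"
 shows "(\<integral>\<^sup>+x. f x \<partial>edge_measure (p, q)) = (\<integral>\<^sup>+x. h x \<partial>edge_measure (p, q))"
 unfolding nn_integral_edge_measure[OF assms(1)] nn_integral_edge_measure[OF assms(2)]
proof (rule nn_integral_cong)
 fix t :: real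
 have "p + (t / dist p q) *\<^sub>R (q - p) \<in> closed_segment p q" if "t \<in> {0..dist p q}"
 proof -
  have "0 <= t / dist p q" "t / dist p q <= 1" using that by (auto simp: divide_le_eq_1)
  then show ?thesis unfolding closed_segment_def
   by (intro CollectI exI[of _ "t / dist p q"]) (simp add: algebra_simps)
 qed
 then show "f (p + (t / dist p q) *\<^sub>R (q - p)) * indicator {0..dist p q} t = h (p + (t / dist p q) *\<^sub>R (q - p)) * indicator {0..dist p q} t"
  by (auto simp: eq indicator_def)
qed

text \<open>Used to alter boundary functions off the curve, and to identify a glued function with
  its pieces on the curve.\<close>

lemma nn_integral_arclength_cong:
 assumes "finite E" "f \<in> borel_measurable borel" "h \<in> borel_measurable borel"
  and eq: "\<And>x. x \<in> edge_points E ==> f x = h x"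
 shows "(\<integral>\<^sup>+x. f x \<partial>arclength E) = (\<integral>\<^sup>+x. h x \<partial>arclength E)"
 unfolding nn_integral_arclength[OF assms(1,2)] nn_integral_arclength[OF assms(1,3)]
proof (rule sum.cong[OF refl])
 fix e assume "e \<in> E"
 moreover obtain p q where "e = (p, q)" by force
 ultimately show "(\<integral>\<^sup>+x. f x \<partial>edge_measure e) = (\<integral>\<^sup>+x. h x \<partial>edge_measure e)"
  using assms(2,3) eq by (auto intro!: nn_integral_edge_measure_cong simp: edge_points_def)
qed

lemma AE_arclength_edge_points:
 assumes "finite E"
 shows "AE x in arclength E. x \<in> edge_points E"
proof -
 have m: "- edge_points E \<in> sets borel" using closed_edge_points[OF assms] by (simp add: borel_closed)
 have "emeasure (arclength E) (- edge_points E) = (\<integral>\<^sup>+x. indicator (- edge_points E) x \<partial>arclength E)"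
  using m by simp
 also have "\<dots> = (\<integral>\<^sup>+x. 0 \<partial>arclength E)"
  by (rule nn_integral_arclength_cong[OF assms]) (use m in \<open>auto\<close>)
 finally have "- edge_points E \<in> null_sets (arclength E)" using m by (auto simp: null_sets_def)
 from AE_not_in[OF this] show ?thesis by simp
qed

lemma emeasure_edge_measure_UNIV: "emeasure (edge_measure (p, q)) UNIV = ennreal (dist p q)"
 using nn_integral_edge_measure[of "%_. 1" p q] by (simp add: edge_measure_def)

lemma finite_measure_arclength:
 assumes "finite E"
 shows "finite_measure (arclength E)"
proof
 have "emeasure (arclength E) UNIV = (\<Sum>(p, q)\<in>E. ennreal (dist p q))"
  by (auto simp: emeasure_arclength emeasure_edge_measure_UNIV intro!: sum.cong)
 then show "emeasure (arclength E) (space (arclength E)) \<noteq> \<infinity>" using assms by (simp add: sum_ennreal case_prod_beta)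
qed

lemma nn_integral_arclength_Un:
 assumes "finite E" "finite E'" "E \<inter> E' = {}" "f \<in> borel_measurable borel"
 shows "(\<integral>\<^sup>+x. f x \<partial>arclength (E \<union> E')) = (\<integral>\<^sup>+x. f x \<partial>arclength E) + (\<integral>\<^sup>+x. f x \<partial>arclength E')"
 using assms by (simp add: nn_integral_arclength sum.union_disjoint)

lemma nn_integral_arclength_mono:
 assumes "finite E'" "E \<subseteq> E'" "f \<in> borel_measurable borel"
 shows "(\<integral>\<^sup>+x. f x \<partial>arclength E) <= (\<integral>\<^sup>+x. f x \<partial>arclength E')"
 using assms finite_subset[OF assms(2,1)] by (simp add: nn_integral_arclength sum_mono2)

section \<open>Jets, traces and their approximation by smooth functions\<close>

text \<open>Like \<open>sq_dist\<close>, but for any normed target, so that a function and its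
  gradient are measured by one distance. Extended real values spare integrability side
  conditions.\<close>

definition sqd :: "'a measure => ('a => 'b::real_normed_vector) => ('a => 'b) => ennreal" where
 "sqd M f g = (\<integral>\<^sup>+x. ennreal ((norm (f x - g x))^2) \<partial>M)"

lemma ennreal_le_twice_add:
 assumes "a <= 2 * b + 2 * c" "0 <= b" "0 <= c"
 shows "ennreal a <= 2 * ennreal b + 2 * ennreal c"
 using ennreal_leI[OF assms(1)] assms(2,3) by (simp add: ennreal_plus ennreal_mult)

lemma sqd_triangle:
 fixes f g h :: "'a => 'b::{real_normed_vector, second_countable_topology}"
 assumes [measurable]: "f \<in> borel_measurable M" "g \<in> borel_measurable M" "h \<in> borel_measurable M"
 shows "sqd M f h <= 2 * sqd M f g + 2 * sqd M g h"
proof -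
 have "sqd M f h <= (\<integral>\<^sup>+x. 2 * ennreal ((norm (f x - g x))^2) + 2 * ennreal ((norm (g x - h x))^2) \<partial>M)"
  unfolding sqd_def
 proof (rule nn_integral_mono)
  fix x
  have "(norm (f x - h x))^2 <= 2 * (norm (f x - g x))^2 + 2 * (norm (g x - h x))^2"
   using power2_norm_add_le[of "f x - g x" "g x - h x"] by simp
  from ennreal_le_twice_add[OF this]
  show "ennreal ((norm (f x - h x))^2) <= 2 * ennreal ((norm (f x - g x))^2) + 2 * ennreal ((norm (g x - h x))^2)"
   by simp
 qed
 also have "\<dots> = 2 * sqd M f g + 2 * sqd M g h"
  unfolding sqd_def by (simp add: nn_integral_add nn_integral_cmult)
 finally show ?thesis .
qed

lemma sqd_commute: "sqd M f g = sqd M g f"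
 by (simp add: sqd_def norm_minus_commute)

lemma sqd_AE_cong: "AE x in M. g x = g' x ==> sqd M f g = sqd M f g'"
 unfolding sqd_def by (rule nn_integral_cong_AE) auto

definition jet :: "(real^2 => complex) => real^2 => complex \<times> (complex^2)" where
 "jet \<phi> x = (\<phi> x, \<chi> i. partial i \<phi> x)"

lemma power2_norm_jet: "(norm (p :: complex \<times> (complex^2)))^2 = (cmod (fst p))^2 + (\<Sum>i\<in>UNIV. (cmod (snd p $ i))^2)"
 unfolding norm_prod_def norm_vec_def L2_set_def by (simp add: sum_nonneg)

lemma continuous_on_jet: "smooth \<phi> ==> continuous_on S (jet \<phi>)"
 unfolding jet_def by (intro continuous_on_Pair continuous_on_vec_lambda smooth_continuous_on smooth_partial)

lemma measurable_jet: "smooth \<phi> ==> jet \<phi> \<in> borel_measurable (lebesgue_on \<Omega>)"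
 by (intro borel_measurable_lebesgue_on borel_measurable_continuous_onI continuous_on_jet)

lemma measurable_smooth_arclength: "smooth \<phi> ==> \<phi> \<in> borel_measurable (arclength E)"
 using smooth_measurable by (simp add: measurable_cong_sets[OF sets_arclength refl])

lemma cmod_fst_le: "(cmod (fst p))^2 <= (norm p)^2" and cmod_snd_le: "(cmod (snd p $ i))^2 <= (norm p)^2"
 for p :: "complex \<times> (complex^2)"
 unfolding power2_norm_jet
 by (auto intro!: sum_nonneg add_increasing member_le_sum[of i UNIV "%i. (cmod (snd p $ i))^2"])

text \<open>The trace relation in \<epsilon>-form, for a field of jets. That the second component of
  \<open>U\<close> is the weak gradient of the first is a consequence and not part of the
  definition, which keeps the relation visibly closed under L2 limits.\<close>

definition jet_limit ::
 "(real^2) set => ((real^2) \<times> (real^2)) set => (real^2 => complex \<times> (complex^2)) => (real^2 => complex) => bool" where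
 "jet_limit \<Omega> E U g \<longleftrightarrow> U \<in> borel_measurable (lebesgue_on \<Omega>) \<and> g \<in> borel_measurable (arclength E) \<and>
  (\<forall>e>0. \<exists>\<phi>. smooth \<phi> \<and> sqd (lebesgue_on \<Omega>) (jet \<phi>) U <= ennreal e \<and> sqd (arclength E) \<phi> g <= ennreal e)"

lemma jet_limitD:
 assumes "jet_limit \<Omega> E U g" "e > 0"
 obtains \<phi> where "smooth \<phi>" "sqd (lebesgue_on \<Omega>) (jet \<phi>) U <= ennreal e" "sqd (arclength E) \<phi> g <= ennreal e"
 using assms unfolding jet_limit_def by blast

lemma measurable_pair_vec:
 fixes u :: "'a => complex"
 assumes "u \<in> borel_measurable M" "\<And>i. (%x. G x $ i) \<in> borel_measurable M"
 shows "(%x. (u x, G x :: complex^2)) \<in> borel_measurable M"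
proof -
 have ax: "continuous_on UNIV (%z :: complex. axis (i::2) z)" for i
  unfolding axis_def
 proof (rule continuous_on_vec_lambda)
  show "continuous_on UNIV (%z :: complex. if j = i then z else 0)" for j :: 2 by (cases "j = i") auto
 qed
 have "(%x. axis (1::2) (G x $ 1) + axis (2::2) (G x $ 2)) \<in> borel_measurable M"
  by (intro borel_measurable_add measurable_compose[OF assms(2) borel_measurable_continuous_onI[OF ax]])
 also have "(%x. axis (1::2) (G x $ 1) + axis (2::2) (G x $ 2)) = G"
  by (auto simp: fun_eq_iff vec_eq_iff forall_2 axis_def)
 finally have "G \<in> borel_measurable M" .
 from borel_measurable_Pair[OF assms(1) this] show ?thesis .
qed

lemma measurable_pair_vecD:
 assumes "U \<in> borel_measurable M"
 shows "(%x. fst (U x)) \<in> borel_measurable M" "(%x. snd (U x :: complex \<times> (complex^2)) $ i) \<in> borel_measurable M"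
proof -
 show "(%x. fst (U x)) \<in> borel_measurable M"
  by (rule measurable_compose[OF assms borel_measurable_continuous_onI]) (intro continuous_intros)
 show "(%x. snd (U x) $ i) \<in> borel_measurable M"
  by (rule measurable_compose[OF assms borel_measurable_continuous_onI]) (intro continuous_intros)
qed

lemma has_trace_imp_jet_limit:
 assumes "has_trace \<Omega> E u g"
 shows "jet_limit \<Omega> E (%x. (u x, wgrad \<Omega> u x)) g" "u \<in> L2 (lebesgue_on \<Omega>)"
  "weak_gradient \<Omega> u (wgrad \<Omega> u)"
proof -
 show u: "u \<in> L2 (lebesgue_on \<Omega>)" using assms unfolding has_trace_def H1_def by auto
 show W: "weak_gradient \<Omega> u (wgrad \<Omega> u)"
 proof -
  have "\<exists>G. weak_gradient \<Omega> u G" using assms unfolding has_trace_def H1_def by blast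
  then show ?thesis unfolding wgrad_def by (rule someI_ex)
 qed
 obtain \<phi> where \<phi>: "\<And>n. smooth (\<phi> n)" "(%n. sq_dist (lebesgue_on \<Omega>) (\<phi> n) u) \<longlonglongrightarrow> 0"
  "\<And>i. (%n. sq_dist (lebesgue_on \<Omega>) (partial i (\<phi> n)) (%x. wgrad \<Omega> u x $ i)) \<longlonglongrightarrow> 0"
  "(%n. sq_dist (arclength E) (\<phi> n) g) \<longlonglongrightarrow> 0"
  using assms unfolding has_trace_def by blast
 have mu: "u \<in> borel_measurable (lebesgue_on \<Omega>)" using u by (simp add: L2_def)
 have mW: "(%x. wgrad \<Omega> u x $ i) \<in> borel_measurable (lebesgue_on \<Omega>)" for i
  using W by (simp add: weak_gradient_def L2_def)
 have mp: "\<phi> n \<in> borel_measurable (lebesgue_on \<Omega>)" "partial i (\<phi> n) \<in> borel_measurable (lebesgue_on \<Omega>)" for i n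
  using \<phi>(1) by (auto intro!: borel_measurable_lebesgue_on smooth_measurable smooth_partial)
 have eq: "sqd (lebesgue_on \<Omega>) (jet (\<phi> n)) (%x. (u x, wgrad \<Omega> u x)) = sq_dist (lebesgue_on \<Omega>) (\<phi> n) u
   + (\<Sum>i\<in>UNIV. sq_dist (lebesgue_on \<Omega>) (partial i (\<phi> n)) (%x. wgrad \<Omega> u x $ i))" for n
 proof -
  note [measurable] = mu mW mp
  have "sqd (lebesgue_on \<Omega>) (jet (\<phi> n)) (%x. (u x, wgrad \<Omega> u x)) = (\<integral>\<^sup>+x. ennreal ((cmod (\<phi> n x - u x))^2) +
    (\<Sum>i\<in>UNIV. ennreal ((cmod (partial i (\<phi> n) x - wgrad \<Omega> u x $ i))^2)) \<partial>lebesgue_on \<Omega>)"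
   unfolding sqd_def power2_norm_jet by (simp add: jet_def sum_ennreal ennreal_plus[symmetric] sum_nonneg del: ennreal_plus)
  also have "\<dots> = sq_dist (lebesgue_on \<Omega>) (\<phi> n) u
   + (\<Sum>i\<in>UNIV. sq_dist (lebesgue_on \<Omega>) (partial i (\<phi> n)) (%x. wgrad \<Omega> u x $ i))"
  proof -
   have a: "(\<integral>\<^sup>+x. (\<Sum>i\<in>UNIV. ennreal ((cmod (partial i (\<phi> n) x - wgrad \<Omega> u x $ i))^2)) \<partial>lebesgue_on \<Omega>)
     = (\<Sum>i\<in>UNIV. \<integral>\<^sup>+x. ennreal ((cmod (partial i (\<phi> n) x - wgrad \<Omega> u x $ i))^2) \<partial>lebesgue_on \<Omega>)"
    by (rule nn_integral_sum) measurable
   show ?thesis unfolding sq_dist_def a[symmetric] by (rule nn_integral_add) measurable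
  qed
  finally show ?thesis .
 qed
 have "(%n. sqd (lebesgue_on \<Omega>) (jet (\<phi> n)) (%x. (u x, wgrad \<Omega> u x))) \<longlonglongrightarrow> 0 + (\<Sum>i\<in>(UNIV :: 2 set). 0)"
  unfolding eq by (intro tendsto_add tendsto_sum \<phi>)
 then have lim: "(%n. sqd (lebesgue_on \<Omega>) (jet (\<phi> n)) (%x. (u x, wgrad \<Omega> u x))) \<longlonglongrightarrow> 0" by simp
 have lim2: "(%n. sqd (arclength E) (\<phi> n) g) \<longlonglongrightarrow> 0" using \<phi>(4) by (simp add: sqd_def sq_dist_def)
 have "\<exists>\<phi>. smooth \<phi> \<and> sqd (lebesgue_on \<Omega>) (jet \<phi>) (%x. (u x, wgrad \<Omega> u x)) <= ennreal e \<and> sqd (arclength E) \<phi> g <= ennreal e"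
  if "e > 0" for e :: real
 proof -
  have "\<forall>\<^sub>F n in sequentially. sqd (lebesgue_on \<Omega>) (jet (\<phi> n)) (%x. (u x, wgrad \<Omega> u x)) < ennreal e \<and> sqd (arclength E) (\<phi> n) g < ennreal e"
   using that by (intro eventually_conj order_tendstoD(2)[OF lim] order_tendstoD(2)[OF lim2]) auto
  then obtain n where "sqd (lebesgue_on \<Omega>) (jet (\<phi> n)) (%x. (u x, wgrad \<Omega> u x)) < ennreal e" "sqd (arclength E) (\<phi> n) g < ennreal e"
   by (auto simp: eventually_sequentially)
  then show ?thesis using \<phi>(1) less_imp_le by blast
 qed
 then show "jet_limit \<Omega> E (%x. (u x, wgrad \<Omega> u x)) g"
  using assms unfolding jet_limit_def has_trace_def by (auto intro!: measurable_pair_vec mu mW simp: L2_def)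
qed

lemma nn_integral_bounded_finite:
 assumes "finite_measure M" "\<And>x. x \<in> space M ==> norm (f x) <= B"
 shows "(\<integral>\<^sup>+x. ennreal ((norm (f x))^2) \<partial>M) < \<infinity>"
proof -
 interpret finite_measure M by fact
 have "(\<integral>\<^sup>+x. ennreal ((norm (f x))^2) \<partial>M) <= (\<integral>\<^sup>+x. ennreal (B^2) \<partial>M)"
  using assms(2) by (intro nn_integral_mono ennreal_leI power_mono) auto
 also have "\<dots> < \<infinity>" by (simp add: emeasure_eq_measure ennreal_mult[symmetric])
 finally show ?thesis .
qed

lemma jet_limit_finite:
 assumes \<Omega>: "open \<Omega>" "bounded \<Omega>" and J: "jet_limit \<Omega> E U g"
 shows "(\<integral>\<^sup>+x. ennreal ((norm (U x))^2) \<partial>lebesgue_on \<Omega>) < \<infinity>"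
proof -
 obtain \<phi> where \<phi>: "smooth \<phi>" "sqd (lebesgue_on \<Omega>) (jet \<phi>) U <= ennreal 1"
  using jet_limitD[OF J, of 1] by auto
 have mU: "U \<in> borel_measurable (lebesgue_on \<Omega>)" using J by (simp add: jet_limit_def)
 have "bounded (jet \<phi> ` closure \<Omega>)"
  using \<Omega> \<phi>(1) by (intro compact_imp_bounded compact_continuous_image continuous_on_jet) auto
 then obtain B where "\<And>x. x \<in> closure \<Omega> ==> norm (jet \<phi> x) <= B" by (auto simp: bounded_iff)
 then have "sqd (lebesgue_on \<Omega>) (%x. 0) (jet \<phi>) < \<infinity>"
  unfolding sqd_def using closure_subset[of \<Omega>]
  by (intro nn_integral_bounded_finite[OF bounded_open_finite_measure[OF \<Omega>]]) (auto simp: space_restrict_space)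
 moreover have "sqd (lebesgue_on \<Omega>) (%x. 0) U <= 2 * sqd (lebesgue_on \<Omega>) (%x. 0) (jet \<phi>) + 2 * sqd (lebesgue_on \<Omega>) (jet \<phi>) U"
  by (intro sqd_triangle measurable_jet \<phi> mU) simp
 ultimately have "sqd (lebesgue_on \<Omega>) (%x. 0) U < \<infinity>"
  using \<phi>(2) by (auto intro!: le_less_trans simp: ennreal_mult_less_top le_less_trans)
 then show ?thesis by (simp add: sqd_def)
qed

text \<open>The defect \<open>z\<close> in the integration by parts formula is linear in the jet and
  vanishes for smooth functions. Cauchy-Schwarz bounds its square by 2 e C, where e measures the
  squared distance of \<open>U\<close> from a smooth jet and \<open>C\<close> is the energy of the
  test function.\<close>

lemma jet_limit_weak_gradient:
 assumes \<Omega>: "open \<Omega>" "bounded \<Omega>" and J: "jet_limit \<Omega> E U g"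
 shows "(%x. fst (U x)) \<in> L2 (lebesgue_on \<Omega>)" "weak_gradient \<Omega> (%x. fst (U x)) (%x. snd (U x))"
proof -
 let ?M = "lebesgue_on \<Omega>"
 note fin = jet_limit_finite[OF assms]
 have mU: "U \<in> borel_measurable ?M" using J by (simp add: jet_limit_def)
 note mU' = measurable_pair_vecD[OF mU]
 show L: "(%x. fst (U x)) \<in> L2 ?M"
 proof -
  have "(\<integral>\<^sup>+x. ennreal ((cmod (fst (U x)))^2) \<partial>?M) <= (\<integral>\<^sup>+x. ennreal ((norm (U x))^2) \<partial>?M)"
   by (intro nn_integral_mono ennreal_leI cmod_fst_le)
  from le_less_trans[OF this fin] show ?thesis using mU'(1) unfolding L2_def by blast
 qed
 have Li: "(%x. snd (U x) $ i) \<in> L2 ?M" for i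
 proof -
  have "(\<integral>\<^sup>+x. ennreal ((cmod (snd (U x) $ i))^2) \<partial>?M) <= (\<integral>\<^sup>+x. ennreal ((norm (U x))^2) \<partial>?M)"
   by (intro nn_integral_mono ennreal_leI cmod_snd_le)
  from le_less_trans[OF this fin] show ?thesis using mU'(2) unfolding L2_def by blast
 qed
 have "(LINT x|?M. fst (U x) * partial i \<psi> x) = - (LINT x|?M. snd (U x) $ i * \<psi> x)"
  if \<psi>: "\<psi> \<in> test_functions \<Omega>" for i \<psi>
 proof -
  note sm = test_function_smooth[OF \<psi>]
  have bd: "bounded (\<eta> ` closure \<Omega>)" if "smooth \<eta>" for \<eta>
   using \<Omega> that by (intro compact_imp_bounded compact_continuous_image smooth_continuous_on) auto
  have K: "(\<integral>\<^sup>+x. ennreal ((cmod (\<eta> x))^2) \<partial>?M) < \<infinity>" if sm: "smooth \<eta>" for \<eta>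
  proof -
   obtain B where "\<And>x. x \<in> closure \<Omega> ==> cmod (\<eta> x) <= B" using bd[OF sm] by (auto simp: bounded_iff)
   then show ?thesis using closure_subset[of \<Omega>]
    by (intro nn_integral_bounded_finite[OF bounded_open_finite_measure[OF \<Omega>]]) (auto simp: space_restrict_space)
  qed
  have int: "integrable ?M (%x. f x * \<eta> x)" if f: "f \<in> L2 ?M" and sm: "smooth \<eta>" for f \<eta>
  proof -
   obtain B where B: "\<And>x. x \<in> closure \<Omega> ==> cmod (\<eta> x) <= B" using bd[OF sm] by (auto simp: bounded_iff)
   have fi: "integrable ?M f" by (rule L2_integrable[OF bounded_open_finite_measure[OF \<Omega>] f])
   show ?thesis
   proof (rule Bochner_Integration.integrable_bound)
    show "integrable ?M (%x. B * norm (f x))" using fi by simp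
    show "(%x. f x * \<eta> x) \<in> borel_measurable ?M"
     by (rule borel_measurable_times[OF borel_measurable_integrable[OF fi] borel_measurable_lebesgue_on[OF smooth_measurable[OF sm]]])
    show "AE x in ?M. norm (f x * \<eta> x) <= norm (B * norm (f x))"
    proof (rule AE_I2)
     fix x assume "x \<in> space ?M"
     then have "x \<in> closure \<Omega>" using closure_subset[of \<Omega>] by (auto simp: space_restrict_space)
     from mult_right_mono[OF B[OF this], of "norm (f x)"] show "norm (f x * \<eta> x) <= norm (B * norm (f x))"
      by (simp add: norm_mult mult.commute)
    qed
   qed
  qed
  have smL2: "\<eta> \<in> L2 ?M" if "smooth \<eta>" for \<eta>
   using K[OF that] that unfolding L2_def by (auto intro: borel_measurable_lebesgue_on smooth_measurable)
  define z where "z = (LINT x|?M. fst (U x) * partial i \<psi> x) + (LINT x|?M. snd (U x) $ i * \<psi> x)"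
  define C where "C = (\<integral>\<^sup>+x. ennreal ((cmod (partial i \<psi> x))^2) \<partial>?M) + (\<integral>\<^sup>+x. ennreal ((cmod (\<psi> x))^2) \<partial>?M)"
  have C: "C < \<infinity>" unfolding C_def using K[OF sm] K[OF smooth_partial[OF sm]] by simp
  have key: "ennreal ((cmod z)^2) <= 2 * (ennreal e * C)" if "e > 0" for e :: real
  proof -
   obtain \<phi> where \<phi>: "smooth \<phi>" "sqd ?M (jet \<phi>) U <= ennreal e" using jet_limitD[OF J \<open>e > 0\<close>] by blast
   note pL2 = smL2[OF \<phi>(1)] smL2[OF smooth_partial[OF \<phi>(1)]]
   define z1 where "z1 = (LINT x|?M. (fst (U x) - \<phi> x) * partial i \<psi> x)"
   define z2 where "z2 = (LINT x|?M. (snd (U x) $ i - partial i \<phi> x) * \<psi> x)"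
   have "z = z1 + z2"
    unfolding z_def z1_def z2_def left_diff_distrib
     Bochner_Integration.integral_diff[OF int[OF L smooth_partial[OF sm]] int[OF pL2(1) smooth_partial[OF sm]]]
     Bochner_Integration.integral_diff[OF int[OF Li sm] int[OF pL2(2) sm]]
    using integral_by_parts_test[OF \<Omega>(1) \<phi>(1) \<psi>, of i] by simp
   then have "(cmod z)^2 <= 2 * (cmod z1)^2 + 2 * (cmod z2)^2" using power2_norm_add_le[of z1 z2] by simp
   then have "ennreal ((cmod z)^2) <= 2 * ennreal ((cmod z1)^2) + 2 * ennreal ((cmod z2)^2)"
    by (rule ennreal_le_twice_add) simp_all
   also have "\<dots> <= 2 * (ennreal e * (\<integral>\<^sup>+x. ennreal ((cmod (partial i \<psi> x))^2) \<partial>?M))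
     + 2 * (ennreal e * (\<integral>\<^sup>+x. ennreal ((cmod (\<psi> x))^2) \<partial>?M))"
   proof (intro add_mono mult_left_mono)
    have [measurable]: "\<phi> \<in> borel_measurable ?M" "partial i \<phi> \<in> borel_measurable ?M" "\<psi> \<in> borel_measurable ?M" "partial i \<psi> \<in> borel_measurable ?M"
     using \<phi>(1) sm by (auto intro!: borel_measurable_lebesgue_on smooth_measurable smooth_partial)
    note [measurable] = mU'
    have "ennreal ((cmod z1)^2) <= (\<integral>\<^sup>+x. ennreal ((cmod (fst (U x) - \<phi> x))^2) \<partial>?M) * (\<integral>\<^sup>+x. ennreal ((cmod (partial i \<psi> x))^2) \<partial>?M)"
     unfolding z1_def by (rule nn_integral_cmod_mult_le) measurable
    also have "(\<integral>\<^sup>+x. ennreal ((cmod (fst (U x) - \<phi> x))^2) \<partial>?M) <= sqd ?M U (jet \<phi>)"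
     unfolding sqd_def using cmod_fst_le[of "U x - jet \<phi> x" for x] by (intro nn_integral_mono ennreal_leI) (simp add: jet_def)
    also have "\<dots> <= ennreal e" using \<phi>(2) by (simp add: sqd_commute)
    finally show "ennreal ((cmod z1)^2) <= ennreal e * (\<integral>\<^sup>+x. ennreal ((cmod (partial i \<psi> x))^2) \<partial>?M)"
     by (simp add: mult_right_mono)
    have "ennreal ((cmod z2)^2) <= (\<integral>\<^sup>+x. ennreal ((cmod (snd (U x) $ i - partial i \<phi> x))^2) \<partial>?M) * (\<integral>\<^sup>+x. ennreal ((cmod (\<psi> x))^2) \<partial>?M)"
     unfolding z2_def by (rule nn_integral_cmod_mult_le) measurable
    also have "(\<integral>\<^sup>+x. ennreal ((cmod (snd (U x) $ i - partial i \<phi> x))^2) \<partial>?M) <= sqd ?M U (jet \<phi>)"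
     unfolding sqd_def using cmod_snd_le[of "U x - jet \<phi> x" i for x] by (intro nn_integral_mono ennreal_leI) (simp add: jet_def)
    also have "\<dots> <= ennreal e" using \<phi>(2) by (simp add: sqd_commute)
    finally show "ennreal ((cmod z2)^2) <= ennreal e * (\<integral>\<^sup>+x. ennreal ((cmod (\<psi> x))^2) \<partial>?M)"
     by (simp add: mult_right_mono)
   qed auto
   also have "\<dots> = 2 * (ennreal e * C)" by (simp add: C_def distrib_left)
   finally show ?thesis .
  qed
  have "z = 0"
  proof (rule ccontr)
   assume "z \<noteq> 0"
   obtain c where c: "C = ennreal c" "c \<ge> 0" using C by (cases C) auto
   \<comment> \<open>Chosen so that 2 e c is at most half of |z|^2; the summand 1 avoids division by
     0.\<close>
   define e where "e = (cmod z)^2 / 4 / (c + 1)"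
   have e: "e > 0" using \<open>z \<noteq> 0\<close> c by (simp add: e_def)
   have ec: "e * (c + 1) = (cmod z)^2 / 4" using c unfolding e_def by (subst nonzero_eq_divide_eq[symmetric]) auto
   have "ennreal ((cmod z)^2) <= ennreal (2 * (e * c))"
    using key[OF e] c e by (simp add: ennreal_mult)
   then have "(cmod z)^2 <= 2 * (e * c)" using e c by (subst (asm) ennreal_le_iff) auto
   also have "\<dots> <= 2 * (e * (c + 1))" using e by simp
   also have "\<dots> = (cmod z)^2 / 2" unfolding ec by simp
   finally show False using \<open>z \<noteq> 0\<close> by simp
  qed
  then show ?thesis by (simp add: z_def eq_neg_iff_add_eq_0)
 qed
 then show "weak_gradient \<Omega> (%x. fst (U x)) (%x. snd (U x))" unfolding weak_gradient_def using Li by blast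
qed

lemma jet_limit_wgrad:
 assumes \<Omega>: "open \<Omega>" "bounded \<Omega>" and J: "jet_limit \<Omega> E U g"
 shows "AE x in lebesgue_on \<Omega>. wgrad \<Omega> (%x. fst (U x)) x = snd (U x)"
proof (rule weak_gradient_unique[OF \<Omega>])
 show "weak_gradient \<Omega> (%x. fst (U x)) (wgrad \<Omega> (%x. fst (U x)))"
  unfolding wgrad_def by (rule someI[of "weak_gradient \<Omega> _", OF jet_limit_weak_gradient(2)[OF assms]])
qed (rule jet_limit_weak_gradient[OF assms])

text \<open>With \<open>has_trace_imp_jet_limit\<close> this makes the two relations
  interchangeable; the gradient chosen by \<open>wgrad\<close> agrees with the second component up
  to a null set.\<close>

lemma jet_limit_imp_has_trace:
 assumes \<Omega>: "open \<Omega>" "bounded \<Omega>" and E: "finite E" and J: "jet_limit \<Omega> E U g"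
 shows "has_trace \<Omega> E (%x. fst (U x)) g"
proof -
 let ?M = "lebesgue_on \<Omega>"
 have mg: "g \<in> borel_measurable (arclength E)" using J by (simp add: jet_limit_def)
 have "\<exists>\<phi>. smooth \<phi> \<and> sqd ?M (jet \<phi>) U <= ennreal (1 / real (Suc n)) \<and> sqd (arclength E) \<phi> g <= ennreal (1 / real (Suc n))" for n
  using jet_limitD[OF J, of "1 / real (Suc n)"] by (metis of_nat_0_less_iff zero_less_Suc zero_less_divide_1_iff)
 then obtain \<phi> where \<phi>: "\<And>n. smooth (\<phi> n)" "\<And>n. sqd ?M (jet (\<phi> n)) U <= ennreal (1 / real (Suc n))"
  "\<And>n. sqd (arclength E) (\<phi> n) g <= ennreal (1 / real (Suc n))" by metis
 have lim: "(%n. ennreal (1 / real (Suc n))) \<longlonglongrightarrow> 0"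
  using tendsto_ennrealI[OF LIMSEQ_inverse_real_of_nat] by (simp add: divide_inverse)
 have sq: "X \<longlonglongrightarrow> 0" if "\<And>n. X n <= ennreal (1 / real (Suc n))" for X
  by (rule tendsto_sandwich[OF _ _ tendsto_const lim]) (use that in \<open>auto intro!: always_eventually\<close>)
 have "(%n. sq_dist ?M (\<phi> n) (%x. fst (U x))) \<longlonglongrightarrow> 0"
 proof (rule sq)
  fix n
  have "sq_dist ?M (\<phi> n) (%x. fst (U x)) <= sqd ?M (jet (\<phi> n)) U" unfolding sq_dist_def sqd_def
   using cmod_fst_le[of "jet (\<phi> n) x - U x" for x] by (intro nn_integral_mono ennreal_leI) (simp add: jet_def)
  with \<phi>(2)[of n] show "sq_dist ?M (\<phi> n) (%x. fst (U x)) <= ennreal (1 / real (Suc n))" by (rule order_trans[rotated])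
 qed
 moreover have "(%n. sq_dist ?M (partial i (\<phi> n)) (%x. wgrad \<Omega> (%x. fst (U x)) x $ i)) \<longlonglongrightarrow> 0" for i
 proof (rule sq)
  fix n
  have "sq_dist ?M (partial i (\<phi> n)) (%x. wgrad \<Omega> (%x. fst (U x)) x $ i) = sq_dist ?M (partial i (\<phi> n)) (%x. snd (U x) $ i)"
   unfolding sq_dist_def by (rule nn_integral_cong_AE) (use jet_limit_wgrad[OF \<Omega> J] in \<open>eventually_elim, simp\<close>)
  also have "\<dots> <= sqd ?M (jet (\<phi> n)) U" unfolding sq_dist_def sqd_def
   using cmod_snd_le[of "jet (\<phi> n) x - U x" i for x] by (intro nn_integral_mono ennreal_leI) (simp add: jet_def)
  finally show "sq_dist ?M (partial i (\<phi> n)) (%x. wgrad \<Omega> (%x. fst (U x)) x $ i) <= ennreal (1 / real (Suc n))"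
   using \<phi>(2)[of n] by (rule order_trans)
 qed
 moreover have "(%n. sq_dist (arclength E) (\<phi> n) g) \<longlonglongrightarrow> 0"
  using \<phi>(3) by (intro sq) (simp add: sq_dist_def sqd_def)
 moreover have "g \<in> L2 (arclength E)"
 proof -
  have "bounded (\<phi> 0 ` edge_points E)"
   using compact_edge_points[OF E] \<phi>(1) by (intro compact_imp_bounded compact_continuous_image smooth_continuous_on)
  then obtain B where B: "\<And>x. x \<in> edge_points E ==> cmod (\<phi> 0 x) <= B" by (auto simp: bounded_iff)
  interpret finite_measure "arclength E" by (rule finite_measure_arclength[OF E])
  have "sqd (arclength E) (%x. 0) (\<phi> 0) <= (\<integral>\<^sup>+x. ennreal (B^2) \<partial>arclength E)"
   unfolding sqd_def
  proof (rule nn_integral_mono_AE, use AE_arclength_edge_points[OF E] in eventually_elim)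
   fix x assume "x \<in> edge_points E"
   from B[OF this] show "ennreal ((norm (0 - \<phi> 0 x))^2) <= ennreal (B^2)" by (intro ennreal_leI power_mono) auto
  qed
  also have "\<dots> < \<infinity>" by (simp add: emeasure_eq_measure ennreal_mult[symmetric])
  finally have 1: "sqd (arclength E) (%x. 0) (\<phi> 0) < \<infinity>" .
  have "sqd (arclength E) (%x. 0) g <= 2 * sqd (arclength E) (%x. 0) (\<phi> 0) + 2 * sqd (arclength E) (\<phi> 0) g"
   by (intro sqd_triangle[OF _ measurable_smooth_arclength[OF \<phi>(1)] mg]) simp
  also have "\<dots> < \<infinity>" using 1 \<phi>(3)[of 0] by (auto simp: ennreal_mult_less_top intro: le_less_trans)
  finally show ?thesis using mg by (simp add: L2_def sqd_def)
 qed
 ultimately show ?thesis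
  unfolding has_trace_def H1_def using \<phi>(1) jet_limit_weak_gradient[OF \<Omega> J] by blast
qed


lemma jet_limit_cong_AE:
 assumes J: "jet_limit \<Omega> E U g" and "U' \<in> borel_measurable (lebesgue_on \<Omega>)"
  and "AE x in lebesgue_on \<Omega>. U x = U' x"
 shows "jet_limit \<Omega> E U' g"
 using assms(1,2) unfolding jet_limit_def sqd_AE_cong[OF assms(3)] by blast

text \<open>The triangle inequality for squared distances costs a factor 2, hence the quarters of
  \<open>e\<close>. This is what makes the homogeneous space closed.\<close>

lemma jet_limit_closed:
 assumes "U \<in> borel_measurable (lebesgue_on \<Omega>)"
  and "\<And>e. e > 0 ==> \<exists>V. jet_limit \<Omega> E V g \<and> sqd (lebesgue_on \<Omega>) V U <= ennreal e"
 shows "jet_limit \<Omega> E U g"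
 unfolding jet_limit_def
proof (intro conjI allI impI)
 show "g \<in> borel_measurable (arclength E)" using assms(2)[of 1] by (auto simp: jet_limit_def)
 fix e :: real assume "e > 0"
 then obtain V where V: "jet_limit \<Omega> E V g" "sqd (lebesgue_on \<Omega>) V U <= ennreal (e/4)"
  using assms(2)[of "e/4"] by auto
 obtain \<phi> where \<phi>: "smooth \<phi>" "sqd (lebesgue_on \<Omega>) (jet \<phi>) V <= ennreal (e/4)" "sqd (arclength E) \<phi> g <= ennreal (e/4)"
  using jet_limitD[OF V(1), of "e/4"] \<open>e > 0\<close> by auto
 have "sqd (lebesgue_on \<Omega>) (jet \<phi>) U <= 2 * sqd (lebesgue_on \<Omega>) (jet \<phi>) V + 2 * sqd (lebesgue_on \<Omega>) V U"
  by (rule sqd_triangle[OF measurable_jet[OF \<phi>(1)] _ assms(1)]) (use V(1) in \<open>simp add: jet_limit_def\<close>)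
 also have "\<dots> <= 2 * ennreal (e/4) + 2 * ennreal (e/4)" by (intro add_mono mult_left_mono \<phi> V) auto
 also have "\<dots> = ennreal e" using \<open>e > 0\<close> by (simp add: ennreal_plus[symmetric] ennreal_mult[symmetric] ennreal_numeral[symmetric] del: ennreal_plus ennreal_numeral)
 finally have "sqd (lebesgue_on \<Omega>) (jet \<phi>) U <= ennreal e" .
 moreover have "sqd (arclength E) \<phi> g <= ennreal e"
  using \<phi>(3) by (rule order_trans) (use \<open>e > 0\<close> in \<open>simp add: ennreal_leI\<close>)
 ultimately show "\<exists>\<phi>. smooth \<phi> \<and> sqd (lebesgue_on \<Omega>) (jet \<phi>) U <= ennreal e \<and> sqd (arclength E) \<phi> g <= ennreal e"
  using \<phi>(1) by blast
qed (rule assms(1))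

definition cmul :: "complex => complex \<times> (complex^2) => complex \<times> (complex^2)" where
 "cmul c p = (c * fst p, \<chi> i. c * snd p $ i)"

lemma fst_cmul [simp]: "fst (cmul c p) = c * fst p" and snd_cmul [simp]: "snd (cmul c p) $ i = c * snd p $ i"
 by (simp_all add: cmul_def)

lemma norm_cmul: "norm (cmul c p) = cmod c * norm p"
proof -
 have "(norm (cmul c p))^2 = (cmod c * norm p)^2"
  unfolding power2_norm_jet power_mult_distrib
  by (simp add: norm_mult power_mult_distrib sum_distrib_left distrib_left)
 then show ?thesis by (simp add: power2_eq_iff_nonneg)
qed

lemma cmul_diff: "cmul c (p - q) = cmul c p - cmul c q"
 by (simp add: cmul_def algebra_simps vec_eq_iff)

lemma measurable_cmul: "U \<in> borel_measurable M ==> (%x. cmul c (U x)) \<in> borel_measurable M"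
 unfolding cmul_def by (rule measurable_pair_vec) (auto intro!: borel_measurable_times measurable_pair_vecD)

lemma jet_linear:
 assumes "smooth \<phi>" "smooth \<psi>"
 shows "jet (%x. \<phi> x + c * \<psi> x) x = jet \<phi> x + cmul c (jet \<psi> x)"
proof -
 have "partial i (%x. \<phi> x + c * \<psi> x) x = partial i \<phi> x + c * partial i \<psi> x" for i
 proof -
  have s: "smooth (%x. c * \<psi> x)" by (intro smooth_mult smooth_const assms)
  have "partial i (%x. c * \<psi> x) = (%x. c * partial i \<psi> x)"
   using partial_mult[of "%x. c" \<psi> i] assms by (simp add: smooth_differentiable partial_const)
  then show ?thesis using partial_add[of \<phi> "%x. c * \<psi> x" i] assms s by (simp add: smooth_differentiable)
 qed
 then show ?thesis by (simp add: jet_def cmul_def vec_eq_iff)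
qed

lemma jet_limit_linear:
 assumes "jet_limit \<Omega> E U g" "jet_limit \<Omega> E V h"
 shows "jet_limit \<Omega> E (%x. U x + cmul c (V x)) (%x. g x + c * h x)"
 unfolding jet_limit_def
proof (intro conjI allI impI)
 have m: "U \<in> borel_measurable (lebesgue_on \<Omega>)" "V \<in> borel_measurable (lebesgue_on \<Omega>)"
  "g \<in> borel_measurable (arclength E)" "h \<in> borel_measurable (arclength E)"
  using assms by (auto simp: jet_limit_def)
 show "(%x. U x + cmul c (V x)) \<in> borel_measurable (lebesgue_on \<Omega>)" by (intro borel_measurable_add measurable_cmul m)
 show "(%x. g x + c * h x) \<in> borel_measurable (arclength E)"
  by (rule borel_measurable_add[OF m(3) borel_measurable_times[OF borel_measurable_const m(4)]])
 fix e :: real assume "e > 0"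
 \<comment> \<open>The two squared errors enter as 2 d and 2 |c|^2 d, which add up to
   \<open>e\<close>.\<close>
 define d where "d = e / (2 * (1 + (cmod c)^2))"
 have pos: "1 + (cmod c)^2 > 0" by (simp add: add_pos_nonneg)
 then have d: "d > 0" using \<open>e > 0\<close> by (simp add: d_def)
 have de: "2 * ennreal d + 2 * (ennreal ((cmod c)^2) * ennreal d) = ennreal e"
 proof -
  have "2 * d + 2 * ((cmod c)^2 * d) = d * (2 * (1 + (cmod c)^2))" by (simp add: algebra_simps)
  also have "\<dots> = e" using pos by (simp add: d_def)
  finally have "ennreal (2 * d + 2 * ((cmod c)^2 * d)) = ennreal e" by simp
  then show ?thesis using d by (simp add: ennreal_plus ennreal_mult)
 qed
 obtain \<phi> where \<phi>: "smooth \<phi>" "sqd (lebesgue_on \<Omega>) (jet \<phi>) U <= ennreal d" "sqd (arclength E) \<phi> g <= ennreal d"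
  using jet_limitD[OF assms(1) d] by blast
 obtain \<psi> where \<psi>: "smooth \<psi>" "sqd (lebesgue_on \<Omega>) (jet \<psi>) V <= ennreal d" "sqd (arclength E) \<psi> h <= ennreal d"
  using jet_limitD[OF assms(2) d] by blast
 \<comment> \<open>Stated for a generic measure and target, since the same estimate serves the jets
   in \<Omega> and the values on the boundary.\<close>
 have gen: "(\<integral>\<^sup>+x. ennreal ((norm (z x))^2) \<partial>M) <= ennreal e"
  if z: "\<And>x. (norm (z x))^2 <= 2 * (norm (p x))^2 + 2 * ((cmod c)^2 * (norm (q x))^2)"
   and p: "p \<in> borel_measurable M" "q \<in> borel_measurable M"
   and b: "(\<integral>\<^sup>+x. ennreal ((norm (p x))^2) \<partial>M) <= ennreal d" "(\<integral>\<^sup>+x. ennreal ((norm (q x))^2) \<partial>M) <= ennreal d"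
  for z p q :: "real^2 => 'z::{real_normed_vector, second_countable_topology}" and M
 proof -
  have "(\<integral>\<^sup>+x. ennreal ((norm (z x))^2) \<partial>M)
    <= (\<integral>\<^sup>+x. 2 * ennreal ((norm (p x))^2) + 2 * (ennreal ((cmod c)^2) * ennreal ((norm (q x))^2)) \<partial>M)"
   using ennreal_le_twice_add[OF z] by (intro nn_integral_mono) (simp add: ennreal_mult)
  also have "\<dots> = 2 * (\<integral>\<^sup>+x. ennreal ((norm (p x))^2) \<partial>M) + 2 * (ennreal ((cmod c)^2) * (\<integral>\<^sup>+x. ennreal ((norm (q x))^2) \<partial>M))"
   using p by (simp add: nn_integral_add nn_integral_cmult)
  also have "\<dots> <= 2 * ennreal d + 2 * (ennreal ((cmod c)^2) * ennreal d)"
   by (intro add_mono mult_left_mono b) auto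
  finally show ?thesis by (simp only: de)
 qed
 have "sqd (lebesgue_on \<Omega>) (jet (%x. \<phi> x + c * \<psi> x)) (%x. U x + cmul c (V x)) <= ennreal e"
  unfolding sqd_def
 proof (rule gen)
  show "(norm (jet (%x. \<phi> x + c * \<psi> x) x - (U x + cmul c (V x))))^2
    <= 2 * (norm (jet \<phi> x - U x))^2 + 2 * ((cmod c)^2 * (norm (jet \<psi> x - V x))^2)" for x
  proof -
   have eq: "jet (%x. \<phi> x + c * \<psi> x) x - (U x + cmul c (V x)) = (jet \<phi> x - U x) + cmul c (jet \<psi> x - V x)"
    by (simp add: jet_linear[OF \<phi>(1) \<psi>(1)] cmul_diff)
   show ?thesis unfolding eq
    using power2_norm_add_le[of "jet \<phi> x - U x" "cmul c (jet \<psi> x - V x)"] by (simp add: norm_cmul power_mult_distrib)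
  qed
 qed (use \<phi> \<psi> m measurable_jet in \<open>auto simp: sqd_def intro!: borel_measurable_diff\<close>)
 moreover have "sqd (arclength E) (%x. \<phi> x + c * \<psi> x) (%x. g x + c * h x) <= ennreal e"
  unfolding sqd_def
 proof (rule gen)
  show "(norm (\<phi> x + c * \<psi> x - (g x + c * h x)))^2 <= 2 * (norm (\<phi> x - g x))^2 + 2 * ((cmod c)^2 * (norm (\<psi> x - h x))^2)" for x
  proof -
   have eq: "\<phi> x + c * \<psi> x - (g x + c * h x) = (\<phi> x - g x) + c * (\<psi> x - h x)" by (simp add: algebra_simps)
   show ?thesis unfolding eq using power2_norm_add_le[of "\<phi> x - g x" "c * (\<psi> x - h x)"] by (simp add: norm_mult power_mult_distrib)
  qed
  show "(%x. \<phi> x - g x) \<in> borel_measurable (arclength E)" "(%x. \<psi> x - h x) \<in> borel_measurable (arclength E)"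
   by (rule borel_measurable_diff[OF measurable_smooth_arclength[OF \<phi>(1)] m(3)],
     rule borel_measurable_diff[OF measurable_smooth_arclength[OF \<psi>(1)] m(4)])
 qed (use \<phi> \<psi> in \<open>auto simp: sqd_def\<close>)
 moreover have "smooth (%x. \<phi> x + c * \<psi> x)" by (intro smooth_add smooth_mult smooth_const \<phi> \<psi>)
 ultimately show "\<exists>\<phi>. smooth \<phi> \<and> sqd (lebesgue_on \<Omega>) (jet \<phi>) (%x. U x + cmul c (V x)) <= ennreal e \<and>
   sqd (arclength E) \<phi> (%x. g x + c * h x) <= ennreal e" by blast
qed

lemma jet_limit_zero: "jet_limit \<Omega> E (%x. 0) (%x. 0)"
proof -
 have "jet (%x. 0) = (%x. 0)" by (simp add: jet_def partial_const fun_eq_iff zero_prod_def vec_eq_iff)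
 then show ?thesis unfolding jet_limit_def
  by (intro conjI allI impI exI[of _ "%x. 0"]) (auto simp: sqd_def smooth_const)
qed

lemma jet_limit_subset:
 assumes "finite E'" "E \<subseteq> E'" "jet_limit \<Omega> E' U g'"
  and "g \<in> borel_measurable borel" "\<And>x. x \<in> edge_points E ==> g x = g' x"
 shows "jet_limit \<Omega> E U g"
 unfolding jet_limit_def
proof (intro conjI allI impI)
 show "U \<in> borel_measurable (lebesgue_on \<Omega>)" using assms(3) by (simp add: jet_limit_def)
 show "g \<in> borel_measurable (arclength E)" using assms(4) by (simp add: measurable_cong_sets[OF sets_arclength refl])
 have [measurable]: "g' \<in> borel_measurable borel" using assms(3) by (simp add: jet_limit_def measurable_cong_sets[OF sets_arclength refl])
 note [measurable] = assms(4)
 fix e :: real assume "e > 0"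
 then obtain \<phi> where \<phi>: "smooth \<phi>" "sqd (lebesgue_on \<Omega>) (jet \<phi>) U <= ennreal e" "sqd (arclength E') \<phi> g' <= ennreal e"
  using jet_limitD[OF assms(3)] by blast
 note [measurable] = smooth_measurable[OF \<phi>(1)]
 have "sqd (arclength E) \<phi> g = sqd (arclength E) \<phi> g'"
  unfolding sqd_def by (rule nn_integral_arclength_cong[OF finite_subset[OF assms(2,1)]]) (auto simp: assms(5))
 also have "\<dots> <= sqd (arclength E') \<phi> g'" unfolding sqd_def by (rule nn_integral_arclength_mono[OF assms(1,2)]) measurable
 finally show "\<exists>\<phi>. smooth \<phi> \<and> sqd (lebesgue_on \<Omega>) (jet \<phi>) U <= ennreal e \<and> sqd (arclength E) \<phi> g <= ennreal e"
  using \<phi> by (intro exI[of _ \<phi>]) (auto intro: order_trans)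
qed

text \<open>The two approximating sequences are glued by a cutoff that separates the two parts of the boundary.\<close>

lemma jet_limit_glue:
 assumes \<Omega>: "open \<Omega>" "bounded \<Omega>" and fin: "finite E" "finite E'" "E \<inter> E' = {}"
  and J: "jet_limit \<Omega> E U (%x. 0)" "jet_limit \<Omega> E' U (%x. 0)"
  and \<zeta>: "smooth \<zeta>" "\<And>x. x \<in> edge_points E ==> \<zeta> x = 1" "\<And>x. x \<in> edge_points E' ==> \<zeta> x = 0"
 shows "jet_limit \<Omega> (E \<union> E') U (%x. 0)"
 unfolding jet_limit_def
proof (intro conjI allI impI)
 let ?M = "lebesgue_on \<Omega>"
 show mU: "U \<in> borel_measurable ?M" using J by (simp add: jet_limit_def)
 have "bounded (jet \<zeta> ` closure \<Omega>)"
  using \<Omega> \<zeta>(1) by (intro compact_imp_bounded compact_continuous_image continuous_on_jet) auto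
 then obtain B where B: "B > 0" "\<And>x. x \<in> closure \<Omega> ==> norm (jet \<zeta> x) <= B" by (auto simp: bounded_pos)
 \<comment> \<open>Repeated use of |p + q|^2 <= 2 |p|^2 + 2 |q|^2 leads to factors of at most 16 B^2
   + 2, which \<open>C\<close> majorises.\<close>
 define C where "C = 24 * (B^2 + 1)"
 have C: "C > 0" by (simp add: C_def add_nonneg_pos)
 fix e :: real assume "e > 0"
 define d where "d = e / (2 * C + 2)"
 have d: "d > 0" using C \<open>e > 0\<close> by (simp add: d_def)
 obtain \<phi> where \<phi>: "smooth \<phi>" "sqd ?M (jet \<phi>) U <= ennreal d" "sqd (arclength E) \<phi> (%x. 0) <= ennreal d"
  using jet_limitD[OF J(1) d] by blast
 obtain \<psi> where \<psi>: "smooth \<psi>" "sqd ?M (jet \<psi>) U <= ennreal d" "sqd (arclength E') \<psi> (%x. 0) <= ennreal d"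
  using jet_limitD[OF J(2) d] by blast
 \<comment> \<open>The convex combination zeta phi + (1 - zeta) psi. The gradient of the cutoff
   multiplies only phi - psi, which is small in L2 because both functions approximate the same
   \<open>U\<close>.\<close>
 define \<eta> where "\<eta> x = \<psi> x + \<zeta> x * (\<phi> x - \<psi> x)" for x
 have sm: "smooth \<eta>" unfolding \<eta>_def by (intro smooth_add smooth_mult smooth_diff \<phi> \<psi> \<zeta>)
 have P: "partial i \<eta> x = partial i \<psi> x + (\<zeta> x * (partial i \<phi> x - partial i \<psi> x) + partial i \<zeta> x * (\<phi> x - \<psi> x))" for i x
 proof -
  have "smooth (%x. \<phi> x - \<psi> x)" by (intro smooth_diff \<phi> \<psi>)
  moreover have "partial i (%x. \<phi> x - \<psi> x) x = partial i \<phi> x - partial i \<psi> x"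
   using jet_linear[OF \<phi>(1) \<psi>(1), of "-1" x] by (simp add: jet_def cmul_def vec_eq_iff)
  ultimately show ?thesis
   unfolding \<eta>_def using partial_add[of \<psi> "%x. \<zeta> x * (\<phi> x - \<psi> x)" i] partial_mult[of \<zeta> "%x. \<phi> x - \<psi> x" i]
    smooth_mult[OF \<zeta>(1), of "%x. \<phi> x - \<psi> x"] \<phi>(1) \<psi>(1) \<zeta>(1)
   by (simp add: smooth_differentiable)
 qed
 have b: "(norm (jet \<eta> x - U x))^2 <= C * (norm (jet \<phi> x - U x))^2 + C * (norm (jet \<psi> x - U x))^2" if x: "x \<in> \<Omega>" for x
 proof -
  define p where "p = jet \<phi> x - U x"
  define q where "q = jet \<psi> x - U x"
  define r where "r = (0 :: complex, \<chi> i. partial i \<zeta> x * (\<phi> x - \<psi> x))"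
  have xc: "x \<in> closure \<Omega>" using x closure_subset by blast
  have eq: "jet \<eta> x - U x = q + (cmul (\<zeta> x) (p - q) + r)"
   unfolding p_def q_def r_def by (simp add: prod_eq_iff vec_eq_iff jet_def P \<eta>_def cmul_def algebra_simps)
  have z: "cmod (\<zeta> x) <= B" 
  proof (rule power2_le_imp_le)
   have "(cmod (\<zeta> x))^2 <= (norm (jet \<zeta> x))^2" using cmod_fst_le[of "jet \<zeta> x"] by (simp add: jet_def)
   also have "\<dots> <= B^2" using B(2)[OF xc] by (intro power_mono) auto
   finally show "(cmod (\<zeta> x))^2 <= B^2" .
  qed (use B in simp)
  have pq: "(norm (p - q))^2 <= 2 * (norm p)^2 + 2 * (norm q)^2" by (rule power2_norm_diff_le)
  have "(norm (cmul (\<zeta> x) (p - q)))^2 <= B^2 * (norm (p - q))^2"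
   unfolding norm_cmul power_mult_distrib using z by (intro mult_right_mono power_mono) auto
  moreover have "(norm r)^2 <= B^2 * (norm (p - q))^2"
  proof -
   have "\<phi> x - \<psi> x = fst (p - q)" by (simp add: p_def q_def jet_def)
   then have f: "(cmod (\<phi> x - \<psi> x))^2 <= (norm (p - q))^2" using cmod_fst_le[of "p - q"] by simp
   have "(norm r)^2 = (\<Sum>i\<in>UNIV. (cmod (partial i \<zeta> x))^2) * (cmod (\<phi> x - \<psi> x))^2"
    unfolding power2_norm_jet[of r] by (simp add: r_def norm_mult power_mult_distrib sum_distrib_right)
   also have "\<dots> <= (norm (jet \<zeta> x))^2 * (norm (p - q))^2"
    using f by (intro mult_mono) (auto simp: power2_norm_jet jet_def sum_nonneg)
   also have "\<dots> <= B^2 * (norm (p - q))^2" using B(2)[OF xc] by (intro mult_right_mono power_mono) auto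
   finally show ?thesis .
  qed
  moreover have "(norm (jet \<eta> x - U x))^2 <= 2 * (norm q)^2 + 2 * (norm (cmul (\<zeta> x) (p - q) + r))^2"
   unfolding eq by (rule power2_norm_add_le)
  moreover have "(norm (cmul (\<zeta> x) (p - q) + r))^2 <= 2 * (norm (cmul (\<zeta> x) (p - q)))^2 + 2 * (norm r)^2"
   by (rule power2_norm_add_le)
  ultimately have "(norm (jet \<eta> x - U x))^2 <= 2 * (norm q)^2 + 8 * (B^2 * (norm (p - q))^2)" by linarith
  also have "B^2 * (norm (p - q))^2 <= B^2 * (2 * (norm p)^2 + 2 * (norm q)^2)"
   using pq by (intro mult_left_mono) auto
  finally have "(norm (jet \<eta> x - U x))^2 <= 16 * (B^2 * (norm p)^2) + (16 * (B^2 * (norm q)^2) + 2 * (norm q)^2)"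
   by (simp add: algebra_simps)
  also have "\<dots> <= C * (norm p)^2 + C * (norm q)^2"
  proof -
   have "C * (norm p)^2 = 24 * (B^2 * (norm p)^2) + 24 * (norm p)^2"
    "C * (norm q)^2 = 24 * (B^2 * (norm q)^2) + 24 * (norm q)^2" by (simp_all add: C_def algebra_simps)
   moreover have "0 <= B^2 * (norm p)^2" "0 <= B^2 * (norm q)^2" "0 <= (norm p)^2" "0 <= (norm q)^2" by simp_all
   ultimately show ?thesis by linarith
  qed
  finally show ?thesis by (simp add: p_def q_def)
 qed
 have "sqd ?M (jet \<eta>) U <= (\<integral>\<^sup>+x. ennreal C * ennreal ((norm (jet \<phi> x - U x))^2) + ennreal C * ennreal ((norm (jet \<psi> x - U x))^2) \<partial>?M)"
  unfolding sqd_def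
 proof (rule nn_integral_mono)
  fix x assume "x \<in> space ?M"
  then have "x \<in> \<Omega>" by (simp add: space_restrict_space)
  from ennreal_leI[OF b[OF this]] C show "ennreal ((norm (jet \<eta> x - U x))^2)
    <= ennreal C * ennreal ((norm (jet \<phi> x - U x))^2) + ennreal C * ennreal ((norm (jet \<psi> x - U x))^2)"
   by (simp add: ennreal_plus ennreal_mult)
 qed
 also have "\<dots> = ennreal C * sqd ?M (jet \<phi>) U + ennreal C * sqd ?M (jet \<psi>) U"
 proof -
  note [measurable] = measurable_jet[OF \<phi>(1)] measurable_jet[OF \<psi>(1)] mU
  show ?thesis unfolding sqd_def by (simp add: nn_integral_add nn_integral_cmult)
 qed
 also have "\<dots> <= ennreal C * ennreal d + ennreal C * ennreal d" by (intro add_mono mult_left_mono \<phi> \<psi>) auto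
 also have "\<dots> = ennreal (2 * C * d)" using C d by (simp add: ennreal_mult[symmetric] ennreal_plus[symmetric] del: ennreal_plus)
 also have "\<dots> <= ennreal e"
 proof (rule ennreal_leI)
  have "2 * C * d <= (2 * C + 2) * d" using d by (simp add: algebra_simps)
  also have "\<dots> = e" using C by (simp add: d_def)
  finally show "2 * C * d <= e" .
 qed
 finally have 1: "sqd ?M (jet \<eta>) U <= ennreal e" .
 have "sqd (arclength (E \<union> E')) \<eta> (%x. 0) = sqd (arclength E) \<eta> (%x. 0) + sqd (arclength E') \<eta> (%x. 0)"
 proof -
  have m: "(%x. ennreal ((norm (\<eta> x - 0))^2)) \<in> borel_measurable borel" using smooth_measurable[OF sm] by simp
  show ?thesis unfolding sqd_def by (rule nn_integral_arclength_Un[OF fin m])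
 qed
 \<comment> \<open>On each part of the boundary the cutoff is constantly 1 or 0, so the combination
   coincides there with the approximant adapted to that part.\<close>
 also have "sqd (arclength E) \<eta> (%x. 0) = sqd (arclength E) \<phi> (%x. 0)"
  unfolding sqd_def
 proof (rule nn_integral_arclength_cong[OF fin(1)])
  show "(%x. ennreal ((norm (\<eta> x - 0))^2)) \<in> borel_measurable borel"
   "(%x. ennreal ((norm (\<phi> x - 0))^2)) \<in> borel_measurable borel"
   using smooth_measurable[OF sm] smooth_measurable[OF \<phi>(1)] by measurable
 qed (simp add: \<eta>_def \<zeta>)
 also have "sqd (arclength E') \<eta> (%x. 0) = sqd (arclength E') \<psi> (%x. 0)"
  unfolding sqd_def
 proof (rule nn_integral_arclength_cong[OF fin(2)])
  show "(%x. ennreal ((norm (\<eta> x - 0))^2)) \<in> borel_measurable borel"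
   "(%x. ennreal ((norm (\<psi> x - 0))^2)) \<in> borel_measurable borel"
   using smooth_measurable[OF sm] smooth_measurable[OF \<psi>(1)] by measurable
 qed (simp add: \<eta>_def \<zeta>)
 also have "sqd (arclength E) \<phi> (%x. 0) + sqd (arclength E') \<psi> (%x. 0) <= ennreal d + ennreal d"
  by (intro add_mono \<phi> \<psi>)
 also have "\<dots> <= ennreal e"
 proof -
  have "d + d <= (2 * C + 2) * d" using C d by (simp add: algebra_simps)
  also have "\<dots> = e" using C by (simp add: d_def)
  finally show ?thesis using d by (simp add: ennreal_plus[symmetric] ennreal_leI del: ennreal_plus)
 qed
 finally show "\<exists>\<phi>. smooth \<phi> \<and> sqd ?M (jet \<phi>) U <= ennreal e \<and> sqd (arclength (E \<union> E')) \<phi> (%x. 0) <= ennreal e"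
  using sm 1 by blast
qed (simp add: measurable_cong_sets[OF sets_arclength refl])

section \<open>Oscillation of a cut-off function along a line\<close>

lemma cmod_diff_le_nn_integral:
 fixes f f' :: "real => complex"
 assumes f: "\<And>s. (f has_vector_derivative f' s) (at s)" and cont: "continuous_on UNIV f'"
  and S: "{min s t<..<max s t} \<subseteq> S"
 shows "ennreal (cmod (f s - f t)) <= (\<integral>\<^sup>+r. ennreal (cmod (f' r)) * indicator S r \<partial>lborel)"
proof -
 define a b where "a = min s t" and "b = max s t"
 have ab: "a <= b" by (simp add: a_def b_def)
 have c: "continuous_on {a..b} f'" using cont continuous_on_subset by blast
 have v: "\<And>x. a <= x ==> x <= b ==> (f has_vector_derivative f' x) (at x within {a..b})"
  using f has_vector_derivative_at_within by blast
 have "cmod (f s - f t) = cmod (f b - f a)" unfolding a_def b_def min_def max_def by (simp add: norm_minus_commute)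
 also have "f b - f a = (LINT x|lborel. indicator {a..b} x *\<^sub>R f' x)"
  by (rule integral_FTC_Icc[symmetric, OF ab v c])
 also have "ennreal (cmod \<dots>) <= (\<integral>\<^sup>+x. ennreal (cmod (indicator {a..b} x *\<^sub>R f' x)) \<partial>lborel)"
  by (rule integral_norm_bound_ennreal, rule has_bochner_integral_FTC_Icc[OF ab v c, THEN integrable.intros])
 also have "\<dots> <= (\<integral>\<^sup>+r. ennreal (cmod (f' r)) * indicator S r \<partial>lborel)"
 proof (rule nn_integral_mono_AE)
  have "AE x in lborel. x \<noteq> a" "AE x in lborel. x \<noteq> b" by (rule AE_lborel_singleton)+
  then show "AE x in lborel. ennreal (cmod (indicator {a..b} x *\<^sub>R f' x)) <= ennreal (cmod (f' x)) * indicator S x"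
  proof eventually_elim
   case (elim x)
   show ?case
   proof (cases "x \<in> {a..b}")
    case True
    then have "x \<in> S" using elim S by (auto simp: a_def b_def)
    then show ?thesis using True by simp
   qed simp
  qed
 qed
 finally show ?thesis .
qed

text \<open>The point of the segment outside \<open>U\<close> nearest to \<open>s\<close>; it exists
  because the segment minus an open set is compact.\<close>

lemma first_exit_point:
 fixes U :: "real set"
 assumes "open U" "s \<in> U" "m \<notin> U"
 obtains y where "y \<in> closed_segment s m" "y \<in> frontier U" "{min s y<..<max s y} \<subseteq> U"
proof -
 let ?T = "closed_segment s m - U"
 have "compact ?T" using assms(1) by (simp add: compact_diff)
 moreover have "?T \<noteq> {}" using assms by auto
 ultimately obtain y where y: "y \<in> ?T" "\<And>z. z \<in> ?T ==> dist s y <= dist s z"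
  using continuous_attains_inf[of ?T "dist s"] continuous_on_dist[OF continuous_on_const continuous_on_id] by blast
 have "{min s y<..<max s y} \<subseteq> U"
 proof
  fix r assume r: "r \<in> {min s y<..<max s y}"
  then have "r \<in> closed_segment s m" using y(1) by (auto simp: closed_segment_eq_real_ivl min_def max_def split: if_splits)
  moreover have "dist s r < dist s y" using r by (auto simp: dist_real_def min_def max_def split: if_splits)
  ultimately show "r \<in> U" using y(2)[of r] by force
 qed
 moreover have "y \<in> frontier U"
 proof -
  have "s \<noteq> y" using y assms by auto
  have "open_segment s y \<subseteq> U" using \<open>{min s y<..<max s y} \<subseteq> U\<close> by (auto simp: open_segment_eq_real_ivl min_def max_def split: if_splits)
  then have "closure (open_segment s y) \<subseteq> closure U" by (rule closure_mono)
  then have "y \<in> closure U" using \<open>s \<noteq> y\<close> by (auto simp: closure_open_segment)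
  then show ?thesis using y(1) assms(1) by (simp add: frontier_def interior_open)
 qed
 ultimately show ?thesis using that y(1) by blast
qed

text \<open>One-dimensional core of the Poincare and Rellich inequalities: a function cut off to an open set
 varies along an interval by at most its derivative inside the set plus its boundary values.\<close>

lemma slice_oscillation:
 fixes f f' :: "real => complex"
 assumes U: "open U" and I: "convex I" "I \<in> sets borel" "emeasure lborel I <= ennreal h" "0 <= h"
  and f: "\<And>s. (f has_vector_derivative f' s) (at s)" and cont: "continuous_on UNIV f'"
  and b: "\<And>y. y \<in> frontier U ==> (cmod (f y))\<^sup>2 <= b"  "0 <= b"
  and st: "s \<in> I" "t \<in> I"
 shows "ennreal ((cmod (indicator U s *\<^sub>R f s - indicator U t *\<^sub>R f t))^2)
  <= 8 * ennreal b + 8 * ennreal h * (\<integral>\<^sup>+r. ennreal ((cmod (f' r))^2) * indicator (I \<inter> U) r \<partial>lborel)"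
proof -
 define P where "P = (\<integral>\<^sup>+r. ennreal (cmod (f' r)) * indicator (I \<inter> U) r \<partial>lborel)"
 define Q where "Q = (\<integral>\<^sup>+r. ennreal ((cmod (f' r))^2) * indicator (I \<inter> U) r \<partial>lborel)"
 have [measurable]: "f' \<in> borel_measurable borel" "U \<in> sets borel" "I \<in> sets borel"
  using cont U I by (auto intro: borel_measurable_continuous_onI)
 \<comment> \<open>Cauchy-Schwarz against the indicator of the interval, whose length is at most
   \<open>h\<close>.\<close>
 have PQ: "P^2 <= ennreal h * Q"
 proof -
  have "P = (\<integral>\<^sup>+r. (ennreal (cmod (f' r)) * indicator (I \<inter> U) r) * indicator I r \<partial>lborel)"
   unfolding P_def by (intro nn_integral_cong) (auto simp: indicator_def)
  also have "\<dots>^2 <= (\<integral>\<^sup>+r. (ennreal (cmod (f' r)) * indicator (I \<inter> U) r)^2 \<partial>lborel) * (\<integral>\<^sup>+r. (indicator I r)^2 \<partial>lborel)"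
   by (rule Cauchy_Schwarz_nn_integral) measurable
  also have "(\<integral>\<^sup>+r. (indicator I r)^2 \<partial>lborel) = (\<integral>\<^sup>+r. indicator I r \<partial>lborel)"
   by (intro nn_integral_cong) (auto simp: indicator_def)
  also have "\<dots> = emeasure lborel I" by simp
  also have "(\<integral>\<^sup>+r. (ennreal (cmod (f' r)) * indicator (I \<inter> U) r)^2 \<partial>lborel) = Q"
   unfolding Q_def by (intro nn_integral_cong) (auto simp: indicator_def ennreal_power)
  also have "Q * emeasure lborel I <= Q * ennreal h" by (intro mult_left_mono I) simp
  finally show ?thesis by (simp add: mult.commute)
 qed
 \<comment> \<open>Running from a point of \<open>U\<close> towards a point \<open>m\<close>
   outside, the first exit point is on the frontier, where \<open>b\<close> bounds the squared
   value.\<close>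
 have one: "ennreal (cmod (f s)) <= ennreal (sqrt b) + P" if sm: "s \<in> U" "m \<notin> U" "s \<in> I" "m \<in> I" for s m
 proof -
  obtain y where y: "y \<in> closed_segment s m" "y \<in> frontier U" "{min s y<..<max s y} \<subseteq> U"
   using first_exit_point[OF U sm(1,2)] by blast
  have yI: "y \<in> I" using y(1) sm I(1) by (meson closed_segment_subset subsetD)
  then have "closed_segment s y \<subseteq> I" using sm I(1) by (simp add: closed_segment_subset)
  then have "{min s y<..<max s y} \<subseteq> I \<inter> U" using y(3)
   by (auto simp: closed_segment_eq_real_ivl min_def max_def split: if_splits)
  from cmod_diff_le_nn_integral[OF f cont this] have "ennreal (cmod (f s - f y)) <= P" by (simp add: P_def)
  have "cmod (f y) <= sqrt b" using b(1)[OF y(2)] by (simp add: real_le_rsqrt)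
  moreover have "cmod (f s) <= cmod (f y) + cmod (f s - f y)"
   using norm_triangle_ineq[of "f y" "f s - f y"] by simp
  ultimately have "ennreal (cmod (f s)) <= ennreal (sqrt b + cmod (f s - f y))" by (intro ennreal_leI) simp
  also have "\<dots> = ennreal (sqrt b) + ennreal (cmod (f s - f y))" using b(2) by (simp add: ennreal_plus)
  also have "\<dots> <= ennreal (sqrt b) + P" by (intro add_left_mono) fact
  finally show ?thesis .
 qed
 have "ennreal (cmod (indicator U s *\<^sub>R f s - indicator U t *\<^sub>R f t)) <= 2 * (ennreal (sqrt b) + P)"
 proof -
  have tri: "ennreal (cmod (p - q)) <= ennreal (cmod p) + ennreal (cmod q)" for p q
   using norm_triangle_ineq4[of p q] by (simp add: ennreal_plus[symmetric] ennreal_leI del: ennreal_plus)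
  \<comment> \<open>Either the segment stays in \<open>U\<close> and the difference is an integral
    of the derivative, or each of the two values is bounded separately through an exit
    point.\<close>
  consider "closed_segment s t \<subseteq> U" | m where "m \<in> closed_segment s t" "m \<notin> U" by blast
  then show ?thesis
  proof cases
   case 1
   then have stU: "s \<in> U" "t \<in> U" by auto
   have "closed_segment s t \<subseteq> I \<inter> U" using 1 st I(1) by (simp add: closed_segment_subset)
   then have "{min s t<..<max s t} \<subseteq> I \<inter> U"
    by (auto simp: closed_segment_eq_real_ivl min_def max_def split: if_splits)
   from cmod_diff_le_nn_integral[OF f cont this] have "ennreal (cmod (f s - f t)) <= P" by (simp add: P_def)
   also have "P <= 2 * (ennreal (sqrt b) + P)" by (simp add: mult_2 distrib_left add_increasing add_increasing2)
   finally show ?thesis using stU by simp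
  next
   case 2
   then have mI: "m \<in> I" using st I(1) by (meson closed_segment_subset subsetD)
   have z: "ennreal (cmod (indicator U r *\<^sub>R f r)) <= ennreal (sqrt b) + P" if "r \<in> I" for r
    using one[OF _ 2(2) that mI] by (cases "r \<in> U") auto
   have "ennreal (cmod (indicator U s *\<^sub>R f s - indicator U t *\<^sub>R f t))
     <= (ennreal (sqrt b) + P) + (ennreal (sqrt b) + P)"
    by (rule order_trans[OF tri add_mono[OF z[OF st(1)] z[OF st(2)]]])
   then show ?thesis by (simp only: mult_2)
  qed
 qed
 then have "(ennreal (cmod (indicator U s *\<^sub>R f s - indicator U t *\<^sub>R f t)))^2 <= (2 * (ennreal (sqrt b) + P))^2"
  by (rule power_mono_ennreal)
 also have "\<dots> <= 8 * ennreal b + 8 * P^2"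
 proof (cases P)
  case (real p)
  have "(2 * (sqrt b + p))^2 <= 8 * b + 8 * p^2"
  proof -
   have "(sqrt b + p)^2 <= 2 * b + 2 * p^2" using power2_norm_add_le[of "sqrt b" p] b(2) by simp
   then show ?thesis unfolding power_mult_distrib by simp
  qed
  from ennreal_leI[OF this] show ?thesis using real b(2)
   by (simp add: ennreal_plus ennreal_mult ennreal_power[symmetric])
 qed (simp add: power2_eq_square ennreal_mult_top)
 also have "\<dots> <= 8 * ennreal b + 8 * (ennreal h * Q)" by (intro add_left_mono mult_left_mono PQ) simp
 finally show ?thesis by (simp add: Q_def ennreal_power mult.assoc)
qed

section \<open>Poincare and Rellich inequalities for smooth functions\<close>

definition other :: "2 => 2" where "other i = (if i = 1 then 2 else 1)"

lemma other_neq [simp]: "other i \<noteq> i"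
 using exhaust_2[of i] by (auto simp: other_def)

lemma pt_other [simp]: "pt i s t $ other i = t"
 by simp

text \<open>Squared value of \<open>\<phi>\<close> at the point where the line x_j = t meets the
  edge, and 0 if it misses it. An edge parallel to these lines also gets 0, which is harmless
  because only one of the lines contains it.\<close>

definition crossing_sq :: "2 => (real^2 => complex) => (real^2) \<times> (real^2) => real => real" where
 "crossing_sq j \<phi> = (%(p, q) t. if q $ j = p $ j then 0 else
  (cmod (\<phi> (p + ((t - p $ j) / (q $ j - p $ j)) *\<^sub>R (q - p))))\<^sup>2 * indicator {0..1} ((t - p $ j) / (q $ j - p $ j)))"

lemma crossing_sq_nonneg: "0 <= crossing_sq j \<phi> e t"
 by (auto simp: crossing_sq_def case_prod_beta)

lemma measurable_crossing_sq:
 assumes "smooth \<phi>"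
 shows "crossing_sq j \<phi> e \<in> borel_measurable borel"
proof -
 obtain p q where e: "e = (p, q)" by force
 have [measurable]: "(%t. \<phi> (p + ((t - p $ j) / (q $ j - p $ j)) *\<^sub>R (q - p))) \<in> borel_measurable borel"
  by (rule measurable_compose[OF _ smooth_measurable[OF assms]]) measurable
 show ?thesis unfolding e crossing_sq_def prod.case by measurable
qed

text \<open>Substituting the edge parameter for \<open>t\<close>: projection to the axis shortens
  lengths by the factor |q_j - p_j| / dist p q, which is at most 1.\<close>

lemma nn_integral_crossing_sq_le:
 assumes "smooth \<phi>"
 shows "(\<integral>\<^sup>+t. ennreal (crossing_sq j \<phi> (p, q) t) \<partial>lborel) <= (\<integral>\<^sup>+x. ennreal ((cmod (\<phi> x))^2) \<partial>edge_measure (p, q))"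
proof (cases "q $ j = p $ j")
 case True
 then show ?thesis by (simp add: crossing_sq_def)
next
 case False
 define c where "c = q $ j - p $ j"
 define d where "d = dist p q"
 have c: "c \<noteq> 0" using False by (simp add: c_def)
 have cd: "\<bar>c\<bar> <= d" using component_le_norm_cart[of "q - p" j] by (simp add: c_def d_def dist_norm norm_minus_commute)
 then have d: "d > 0" using c by linarith
 define k where "k \<tau> = ennreal ((cmod (\<phi> (p + \<tau> *\<^sub>R (q - p))))^2) * indicator {0..1} \<tau>" for \<tau> :: real
 have [measurable]: "\<phi> \<in> borel_measurable borel" by (rule smooth_measurable[OF assms])
 have "(\<integral>\<^sup>+t. ennreal (crossing_sq j \<phi> (p, q) t) \<partial>lborel)
   = ennreal \<bar>c\<bar> * (\<integral>\<^sup>+\<tau>. ennreal (crossing_sq j \<phi> (p, q) (p $ j + c * \<tau>)) \<partial>lborel)"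
  using measurable_crossing_sq[OF assms] by (intro nn_integral_real_affine c) simp
 also have "(%\<tau>. ennreal (crossing_sq j \<phi> (p, q) (p $ j + c * \<tau>))) = k"
  using c False by (auto simp: fun_eq_iff crossing_sq_def k_def c_def[symmetric] indicator_def)
 also have "ennreal \<bar>c\<bar> * integral\<^sup>N lborel k <= ennreal d * integral\<^sup>N lborel k"
  by (intro mult_right_mono ennreal_leI cd) simp
 also have "\<dots> = (\<integral>\<^sup>+x. ennreal ((cmod (\<phi> x))^2) \<partial>edge_measure (p, q))"
 proof -
  have m: "(%t. ennreal ((cmod (\<phi> (p + (t / d) *\<^sub>R (q - p))))^2) * indicator {0..d} t) \<in> borel_measurable borel"
   by measurable
  have i: "indicator {0..d} (d * \<tau>) = (indicator {0..1} \<tau> :: ennreal)" for \<tau>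
   using d by (auto simp: indicator_def zero_le_mult_iff)
  have "(\<integral>\<^sup>+x. ennreal ((cmod (\<phi> x))^2) \<partial>edge_measure (p, q))
    = (\<integral>\<^sup>+t. ennreal ((cmod (\<phi> (p + (t / d) *\<^sub>R (q - p))))^2) * indicator {0..d} t \<partial>lborel)"
   unfolding d_def by (rule nn_integral_edge_measure) measurable
  also have "\<dots> = ennreal \<bar>d\<bar> * (\<integral>\<^sup>+\<tau>. ennreal ((cmod (\<phi> (p + ((0 + d * \<tau>) / d) *\<^sub>R (q - p))))^2) * indicator {0..d} (0 + d * \<tau>) \<partial>lborel)"
   using d by (intro nn_integral_real_affine[OF m]) simp
  also have "\<dots> = ennreal d * integral\<^sup>N lborel k"
   using d by (simp add: k_def[abs_def] i)
  finally show ?thesis by simp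
 qed
 finally show ?thesis .
qed

text \<open>All that the estimates see of the domain. It is instantiated with the edges of the
  scatterer together with those of the outer rectangle.\<close>

locale edge_domain =
 fixes \<Omega> :: "(real^2) set" and E :: "((real^2) \<times> (real^2)) set" and R :: real
 assumes open_\<Omega>: "open \<Omega>" and finite_E: "finite E" and frontier_E: "frontier \<Omega> \<subseteq> edge_points E"
  and R: "R > 0" "\<And>x i. x \<in> \<Omega> ==> \<bar>x $ i\<bar> < R"
begin

lemma bounded_\<Omega>: "bounded \<Omega>"
proof (rule boundedI)
 fix x assume "x \<in> \<Omega>"
 then show "norm x <= R + R" using norm_le_l1_cart[of x] R(2)[of x 1] R(2)[of x 2] by (simp add: sum_2)
qed

text \<open>A line in direction \<open>i\<close> keeps the other coordinate fixed, whence
  \<open>other i\<close>.\<close>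

definition crossings :: "2 => (real^2 => complex) => real => real" where
 "crossings i \<phi> t = (\<Sum>e\<in>E. crossing_sq (other i) \<phi> e t)"

lemma crossings_nonneg: "0 <= crossings i \<phi> t"
 unfolding crossings_def by (intro sum_nonneg crossing_sq_nonneg)

lemma measurable_crossings: "smooth \<phi> ==> crossings i \<phi> \<in> borel_measurable borel"
 unfolding crossings_def by (intro borel_measurable_sum measurable_crossing_sq)

lemma nn_integral_crossings_le:
 assumes "smooth \<phi>"
 shows "(\<integral>\<^sup>+t. ennreal (crossings i \<phi> t) \<partial>lborel) <= (\<integral>\<^sup>+x. ennreal ((cmod (\<phi> x))^2) \<partial>arclength E)"
proof -
 have [measurable]: "crossing_sq j \<phi> e \<in> borel_measurable borel" "\<phi> \<in> borel_measurable borel" for j e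
  using assms by (rule measurable_crossing_sq smooth_measurable)+
 have "(\<integral>\<^sup>+t. ennreal (crossings i \<phi> t) \<partial>lborel) = (\<integral>\<^sup>+t. (\<Sum>e\<in>E. ennreal (crossing_sq (other i) \<phi> e t)) \<partial>lborel)"
  by (simp add: crossings_def crossing_sq_nonneg)
 also have "\<dots> = (\<Sum>e\<in>E. \<integral>\<^sup>+t. ennreal (crossing_sq (other i) \<phi> e t) \<partial>lborel)"
  by (rule nn_integral_sum) measurable
 also have "\<dots> <= (\<Sum>e\<in>E. \<integral>\<^sup>+x. ennreal ((cmod (\<phi> x))^2) \<partial>edge_measure e)"
 proof (rule sum_mono)
  fix e :: "(real^2) \<times> (real^2)"
  show "(\<integral>\<^sup>+t. ennreal (crossing_sq (other i) \<phi> e t) \<partial>lborel) <= (\<integral>\<^sup>+x. ennreal ((cmod (\<phi> x))^2) \<partial>edge_measure e)"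
   by (cases e) (simp only: nn_integral_crossing_sq_le[OF assms])
 qed
 also have "\<dots> = (\<integral>\<^sup>+x. ennreal ((cmod (\<phi> x))^2) \<partial>arclength E)"
  by (rule nn_integral_arclength[OF finite_E, symmetric]) measurable
 finally show ?thesis .
qed

text \<open>Zero extension, in general discontinuous across the frontier; the crossing terms account
  for its jumps.\<close>

definition cut :: "(real^2 => complex) => real^2 => complex" where
 "cut \<phi> x = indicator \<Omega> x *\<^sub>R \<phi> x"

lemma measurable_cut: "smooth \<phi> ==> cut \<phi> \<in> borel_measurable borel"
 unfolding cut_def using open_\<Omega> by (intro borel_measurable_scaleR borel_measurable_indicator smooth_measurable) auto

definition slice_energy :: "2 => (real^2 => complex) => real set => real => ennreal" where
 "slice_energy i \<phi> I t = (\<integral>\<^sup>+r. ennreal ((cmod (partial i \<phi> (pt i r t)))^2) * indicator \<Omega> (pt i r t) * indicator I r \<partial>lborel)"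

lemma measurable_slice_energy:
 assumes "smooth \<phi>" and [measurable]: "I \<in> sets borel"
 shows "slice_energy i \<phi> I \<in> borel_measurable borel"
proof -
 have [measurable]: "partial i \<phi> \<in> borel_measurable borel" "\<Omega> \<in> sets borel"
  using smooth_measurable[OF smooth_partial[OF assms(1)]] open_\<Omega> by auto
 have "(%t. \<integral>\<^sup>+r. ennreal ((cmod (partial i \<phi> (pt i r t)))^2) * indicator \<Omega> (pt i r t) * indicator I r \<partial>lborel) \<in> borel_measurable borel"
  by measurable
 then show ?thesis unfolding slice_energy_def[abs_def] .
qed

text \<open>Excluding the first end points suffices: an edge parallel to direction \<open>i\<close>
  lies in a line whose parameter is that of its first end point.\<close>

definition regular_line :: "2 => real => bool" where
 "regular_line i t \<longleftrightarrow> (\<forall>(p, q)\<in>E. t \<noteq> p $ other i)"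

lemma AE_regular_line: "AE t in lborel. regular_line i t"
proof -
 have "finite ((%(p, q). p $ other i) ` E)" using finite_E by simp
 then have "(%(p, q). p $ other i) ` E \<in> null_sets lborel" by (rule finite_imp_null_set_lborel)
 from AE_not_in[OF this] show ?thesis by eventually_elim (auto simp: regular_line_def)
qed

lemma boundary_value_le_crossings:
 assumes "regular_line i t" "pt i y t \<in> frontier \<Omega>"
 shows "(cmod (\<phi> (pt i y t)))^2 <= crossings i \<phi> t"
proof -
 let ?j = "other i"
 obtain p q where pq: "(p, q) \<in> E" "pt i y t \<in> closed_segment p q"
  using assms(2) frontier_E by (auto simp: edge_points_def)
 then obtain u where u: "0 <= u" "u <= 1" "pt i y t = (1 - u) *\<^sub>R p + u *\<^sub>R q" by (auto simp: closed_segment_def)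
 have eq: "pt i y t = p + u *\<^sub>R (q - p)" using u(3) by (simp add: algebra_simps)
 from arg_cong[OF eq, of "%x. x $ ?j"] have t: "t = p $ ?j + u * (q $ ?j - p $ ?j)" by simp
 have "t \<noteq> p $ ?j" using assms(1) pq(1) by (auto simp: regular_line_def)
 then have ne: "q $ ?j - p $ ?j \<noteq> 0" using t by auto
 then have "(t - p $ ?j) / (q $ ?j - p $ ?j) = u" using t by simp
 then have "crossing_sq ?j \<phi> (p, q) t = (cmod (\<phi> (pt i y t)))^2"
  using ne u(1,2) by (simp add: crossing_sq_def eq)
 then show ?thesis unfolding crossings_def
  using member_le_sum[OF pq(1), of "%e. crossing_sq ?j \<phi> e t"] crossing_sq_nonneg finite_E by simp
qed

lemma cut_oscillation:
 assumes \<phi>: "smooth \<phi>" and t: "regular_line i t"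
  and I: "convex I" "I \<in> sets borel" "emeasure lborel I <= ennreal h" "0 <= h" and s: "s \<in> I" "s' \<in> I"
 shows "ennreal ((cmod (cut \<phi> (pt i s t) - cut \<phi> (pt i s' t)))^2)
  <= 8 * ennreal (crossings i \<phi> t) + 8 * ennreal h * slice_energy i \<phi> I t"
proof -
 define U where "U = {r. pt i r t \<in> \<Omega>}"
 have cont: "continuous_on S (%r. pt i r t)" for S by (intro continuous_intros)
 have U: "open U" unfolding U_def using open_vimage[OF open_\<Omega> cont[of UNIV]] by (simp add: vimage_def)
 \<comment> \<open>The closure of the slice lies over the closure of \<Omega>, and points outside
   the slice lie outside \<Omega>, so frontier points of the slice come from frontier points of
   \<Omega>.\<close>
 have fr: "pt i y t \<in> frontier \<Omega>" if "y \<in> frontier U" for y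
 proof -
  have "y \<in> closure U" "y \<notin> U" using that U by (auto simp: frontier_def interior_open)
  have "(%r. pt i r t) ` closure U \<subseteq> closure ((%r. pt i r t) ` U)"
   by (rule image_closure_subset[OF cont]) (auto intro: closure_subset[THEN subsetD])
  also have "\<dots> \<subseteq> closure \<Omega>" by (intro closure_mono) (auto simp: U_def)
  finally have "pt i y t \<in> closure \<Omega>" using \<open>y \<in> closure U\<close> by auto
  then show ?thesis using \<open>y \<notin> U\<close> open_\<Omega> by (auto simp: frontier_def interior_open U_def)
 qed
 have "ennreal ((cmod (indicator U s *\<^sub>R \<phi> (pt i s t) - indicator U s' *\<^sub>R \<phi> (pt i s' t)))^2)
  <= 8 * ennreal (crossings i \<phi> t) + 8 * ennreal h * (\<integral>\<^sup>+r. ennreal ((cmod (partial i \<phi> (pt i r t)))^2) * indicator (I \<inter> U) r \<partial>lborel)"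
  by (rule slice_oscillation[OF U I smooth_has_vector_derivative_pt[OF \<phi>] smooth_cont_pt[OF smooth_partial[OF \<phi>]]
     boundary_value_le_crossings[OF t fr] crossings_nonneg s])
 also have "(\<integral>\<^sup>+r. ennreal ((cmod (partial i \<phi> (pt i r t)))^2) * indicator (I \<inter> U) r \<partial>lborel) = slice_energy i \<phi> I t"
  unfolding slice_energy_def by (intro nn_integral_cong) (auto simp: indicator_def U_def)
 finally show ?thesis by (simp add: cut_def U_def indicator_def)
qed

lemma nn_integral_slice_energy:
 assumes "smooth \<phi>" and [measurable]: "I \<in> sets borel" "J \<in> sets borel"
 shows "(\<integral>\<^sup>+t. slice_energy i \<phi> I t * indicator J t \<partial>lborel)
  = (\<integral>\<^sup>+x. ennreal ((cmod (partial i \<phi> x))^2) * indicator \<Omega> x * (indicator I (x $ i) * indicator J (x $ other i)) \<partial>lborel)"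
proof -
 have [measurable]: "partial i \<phi> \<in> borel_measurable borel" "\<Omega> \<in> sets borel"
  using smooth_measurable[OF smooth_partial[OF assms(1)]] open_\<Omega> by auto
 have "(\<integral>\<^sup>+x. ennreal ((cmod (partial i \<phi> x))^2) * indicator \<Omega> x * (indicator I (x $ i) * indicator J (x $ other i)) \<partial>lborel)
  = (\<integral>\<^sup>+t. (\<integral>\<^sup>+s. ennreal ((cmod (partial i \<phi> (pt i s t)))^2) * indicator \<Omega> (pt i s t) * (indicator I (pt i s t $ i) * indicator J (pt i s t $ other i)) \<partial>lborel) \<partial>lborel)"
  by (rule nn_integral_lborel_pt) measurable
 also have "\<dots> = (\<integral>\<^sup>+t. slice_energy i \<phi> I t * indicator J t \<partial>lborel)"
 proof (rule nn_integral_cong)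
  fix t
  have "(\<integral>\<^sup>+s. (ennreal ((cmod (partial i \<phi> (pt i s t)))^2) * indicator \<Omega> (pt i s t) * indicator I s) * indicator J t \<partial>lborel) = slice_energy i \<phi> I t * indicator J t"
   unfolding slice_energy_def by (rule nn_integral_multc) measurable
  then show "(\<integral>\<^sup>+s. ennreal ((cmod (partial i \<phi> (pt i s t)))^2) * indicator \<Omega> (pt i s t) * (indicator I (pt i s t $ i) * indicator J (pt i s t $ other i)) \<partial>lborel) = slice_energy i \<phi> I t * indicator J t"
   by (simp add: mult.assoc)
 qed
 finally show ?thesis ..
qed

text \<open>On each line in direction 1 the zero extension vanishes at the coordinate
  \<open>R\<close>, so its oscillation bounds its size. Integrating over the interval of length 2 R
  turns the factors 8 and 8 * 2 R of the oscillation bound into 16 R and 32 R^2.\<close>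

lemma poincare_smooth:
 assumes \<phi>: "smooth \<phi>"
 shows "(\<integral>\<^sup>+x. ennreal ((cmod (cut \<phi> x))^2) \<partial>lborel) <= ennreal (16 * R) * (\<integral>\<^sup>+x. ennreal ((cmod (\<phi> x))^2) \<partial>arclength E)
  + ennreal (32 * R^2) * (\<integral>\<^sup>+x. ennreal ((cmod (partial 1 \<phi> x))^2) * indicator \<Omega> x \<partial>lborel)"
proof -
 let ?I = "{-R..R}"
 note [measurable] = measurable_cut[OF \<phi>] measurable_crossings[OF \<phi>] measurable_slice_energy[OF \<phi>]
 define B where "B t = 8 * ennreal (crossings 1 \<phi> t) + 8 * ennreal (2 * R) * slice_energy 1 \<phi> ?I t" for t
 have [measurable]: "B \<in> borel_measurable borel" unfolding B_def by measurable
 have z: "cut \<phi> (pt 1 s t) = 0" if "s \<notin> {-R<..<R}" for s t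
 proof -
  have "pt 1 s t \<notin> \<Omega>" using R(2)[of "pt 1 s t" 1] that by auto
  then show ?thesis by (simp add: cut_def)
 qed
 have ptw: "ennreal ((cmod (cut \<phi> (pt 1 s t)))^2) <= B t * indicator ?I s" if "regular_line 1 t" for s t
 proof (cases "s \<in> ?I")
  case True
  have "ennreal ((cmod (cut \<phi> (pt 1 s t) - cut \<phi> (pt 1 R t)))^2) <= B t"
   unfolding B_def by (rule cut_oscillation[OF \<phi> that]) (use True R in auto)
  then show ?thesis using z[of R t] True by simp
 qed (use z in auto)
 have "(\<integral>\<^sup>+x. ennreal ((cmod (cut \<phi> x))^2) \<partial>lborel) = (\<integral>\<^sup>+t. (\<integral>\<^sup>+s. ennreal ((cmod (cut \<phi> (pt 1 s t)))^2) \<partial>lborel) \<partial>lborel)"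
  by (rule nn_integral_lborel_pt) measurable
 also have "\<dots> <= (\<integral>\<^sup>+t. (\<integral>\<^sup>+s. B t * indicator ?I s \<partial>lborel) \<partial>lborel)"
 proof (rule nn_integral_mono_AE)
  show "AE t in lborel. (\<integral>\<^sup>+s. ennreal ((cmod (cut \<phi> (pt 1 s t)))^2) \<partial>lborel) <= (\<integral>\<^sup>+s. B t * indicator ?I s \<partial>lborel)"
   using AE_regular_line[of 1] by eventually_elim (intro nn_integral_mono ptw)
 qed
 also have "\<dots> = (\<integral>\<^sup>+t. B t * ennreal (2 * R) \<partial>lborel)"
  using R by (intro nn_integral_cong) (simp add: nn_integral_cmult)
 also have "\<dots> = (\<integral>\<^sup>+t. B t \<partial>lborel) * ennreal (2 * R)"
  by (rule nn_integral_multc) measurable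
 also have "(\<integral>\<^sup>+t. B t \<partial>lborel) = 8 * (\<integral>\<^sup>+t. ennreal (crossings 1 \<phi> t) \<partial>lborel) + 8 * ennreal (2 * R) * (\<integral>\<^sup>+t. slice_energy 1 \<phi> ?I t \<partial>lborel)"
  unfolding B_def by (subst nn_integral_add) (simp_all add: nn_integral_cmult)
 also have "\<dots> <= 8 * (\<integral>\<^sup>+x. ennreal ((cmod (\<phi> x))^2) \<partial>arclength E) + 8 * ennreal (2 * R) * (\<integral>\<^sup>+x. ennreal ((cmod (partial 1 \<phi> x))^2) * indicator \<Omega> x \<partial>lborel)"
 proof (intro add_mono mult_left_mono nn_integral_crossings_le \<phi>)
  have "(\<integral>\<^sup>+t. slice_energy 1 \<phi> ?I t \<partial>lborel) = (\<integral>\<^sup>+t. slice_energy 1 \<phi> ?I t * indicator UNIV t \<partial>lborel)" by simp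
  also have "\<dots> <= (\<integral>\<^sup>+x. ennreal ((cmod (partial 1 \<phi> x))^2) * indicator \<Omega> x \<partial>lborel)"
   by (subst nn_integral_slice_energy[OF \<phi>]) (auto intro!: nn_integral_mono simp: indicator_def)
  finally show "(\<integral>\<^sup>+t. slice_energy 1 \<phi> ?I t \<partial>lborel) <= (\<integral>\<^sup>+x. ennreal ((cmod (partial 1 \<phi> x))^2) * indicator \<Omega> x \<partial>lborel)" .
 qed auto
 finally have "(\<integral>\<^sup>+x. ennreal ((cmod (cut \<phi> x))^2) \<partial>lborel) <= (8 * (\<integral>\<^sup>+x. ennreal ((cmod (\<phi> x))^2) \<partial>arclength E) + 8 * ennreal (2 * R) * (\<integral>\<^sup>+x. ennreal ((cmod (partial 1 \<phi> x))^2) * indicator \<Omega> x \<partial>lborel)) * ennreal (2 * R)"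
  by (simp add: mult_right_mono)
 also have "\<dots> = (8 * ennreal (2 * R)) * (\<integral>\<^sup>+x. ennreal ((cmod (\<phi> x))^2) \<partial>arclength E)
  + (8 * ennreal (2 * R) * ennreal (2 * R)) * (\<integral>\<^sup>+x. ennreal ((cmod (partial 1 \<phi> x))^2) * indicator \<Omega> x \<partial>lborel)"
  unfolding distrib_right by (simp only: mult_ac)
 also have "8 * ennreal (2 * R) = ennreal (16 * R)" using R by (simp add: ennreal_mult' ennreal_numeral[symmetric] mult.assoc[symmetric] del: ennreal_numeral) (simp add: ennreal_mult'[symmetric])
 also have "ennreal (16 * R) * ennreal (2 * R) = ennreal (32 * R^2)" using R by (simp add: ennreal_mult[symmetric] power2_eq_square)
 finally show ?thesis .
qed

lemma integrable_cut:
 assumes "smooth \<phi>"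
 shows "integrable lborel (cut \<phi>)"
proof -
 have "integrable lborel (%x. indicator (closure \<Omega>) x *\<^sub>R \<phi> x)"
  using bounded_\<Omega> by (intro borel_integrable_compact smooth_continuous_on assms) simp
 then have "integrable lborel (%x. indicator \<Omega> x *\<^sub>R indicator (closure \<Omega>) x *\<^sub>R \<phi> x)"
  by (rule integrable_mult_indicator[rotated]) (use open_\<Omega> in simp)
 also have "(%x. indicator \<Omega> x *\<^sub>R indicator (closure \<Omega>) x *\<^sub>R \<phi> x) = cut \<phi>"
  using closure_subset[of \<Omega>] by (auto simp: cut_def fun_eq_iff indicator_def)
 finally show ?thesis .
qed

text \<open>Two points of the square are joined by a horizontal move at height x_2 and a vertical
  move at abscissa y_1. Each bound depends on a single variable, and integrating out the other three
  gives h^3. The corner of the path may lie outside \<Omega>, since the zero extension is defined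
  everywhere.\<close>

lemma cell_oscillation:
 assumes \<phi>: "smooth \<phi>"
  and I: "convex I" "I \<in> sets borel" "emeasure lborel I = ennreal h" "0 <= h"
  and J: "convex J" "J \<in> sets borel" "emeasure lborel J = ennreal h"
 defines "Q \<equiv> (%x::real^2. indicator I (x $ 1) * indicator J (x $ 2) :: ennreal)"
  and "a \<equiv> (%t. 16 * ennreal (crossings 1 \<phi> t) + 16 * ennreal h * slice_energy 1 \<phi> I t)"
  and "b \<equiv> (%t. 16 * ennreal (crossings 2 \<phi> t) + 16 * ennreal h * slice_energy 2 \<phi> J t)"
 shows "(\<integral>\<^sup>+x. (\<integral>\<^sup>+y. ennreal ((cmod (cut \<phi> x - cut \<phi> y))^2) * Q y \<partial>lborel) * Q x \<partial>lborel)
  <= ennreal h ^ 3 * ((\<integral>\<^sup>+t. a t * indicator J t \<partial>lborel) + (\<integral>\<^sup>+t. b t * indicator I t \<partial>lborel))"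
proof -
 note [measurable] = measurable_cut[OF \<phi>] measurable_crossings[OF \<phi>] measurable_slice_energy[OF \<phi>] I(2) J(2)
 have [measurable]: "Q \<in> borel_measurable borel" "a \<in> borel_measurable borel" "b \<in> borel_measurable borel"
  unfolding Q_def a_def b_def by measurable
 define A where "A = (\<integral>\<^sup>+t. a t * indicator J t \<partial>lborel)"
 define B where "B = (\<integral>\<^sup>+t. b t * indicator I t \<partial>lborel)"
 define c where "c t = ennreal h * (ennreal h * a t) + ennreal h * B" for t
 have [measurable]: "c \<in> borel_measurable borel" unfolding c_def by measurable
 have Q1: "Q (pt 1 s t) = indicator I s * indicator J t" and Q2: "Q (pt 2 s t) = indicator I t * indicator J s" for s t
  unfolding Q_def by simp_all
 have pt12: "pt 2 t s = pt 1 s t" for s t by (simp add: pt_def vec_eq_iff forall_2)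
 have osc: "ennreal ((cmod (cut \<phi> (pt 1 x1 x2) - cut \<phi> (pt 2 y2 y1)))^2) <= a x2 + b y1"
  if r: "regular_line 1 x2" "regular_line 2 y1" and m: "x1 \<in> I" "y1 \<in> I" "x2 \<in> J" "y2 \<in> J" for x1 x2 y1 y2
 proof -
  define p where "p = cut \<phi> (pt 1 x1 x2) - cut \<phi> (pt 1 y1 x2)"
  define q where "q = cut \<phi> (pt 2 x2 y1) - cut \<phi> (pt 2 y2 y1)"
  have eq: "cut \<phi> (pt 1 x1 x2) - cut \<phi> (pt 2 y2 y1) = p + q" by (simp add: p_def q_def pt12)
  have "ennreal ((cmod (p + q))^2) <= 2 * ennreal ((cmod p)^2) + 2 * ennreal ((cmod q)^2)"
   by (rule ennreal_le_twice_add[OF power2_norm_add_le]) simp_all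
  also have "\<dots> <= 2 * (8 * ennreal (crossings 1 \<phi> x2) + 8 * ennreal h * slice_energy 1 \<phi> I x2)
    + 2 * (8 * ennreal (crossings 2 \<phi> y1) + 8 * ennreal h * slice_energy 2 \<phi> J y1)"
   unfolding p_def q_def
   by (intro add_mono mult_left_mono cut_oscillation[OF \<phi> r(1) I(1,2) _ I(4)] cut_oscillation[OF \<phi> r(2) J(1,2) _ I(4)] m)
    (simp_all add: I(3) J(3))
  also have "\<dots> = a x2 + b y1" by (simp add: a_def b_def distrib_left mult.assoc[symmetric])
  finally show ?thesis by (simp add: eq)
 qed
 have inner: "(\<integral>\<^sup>+y. ennreal ((cmod (cut \<phi> (pt 1 x1 x2) - cut \<phi> y))^2) * Q y \<partial>lborel) <= c x2"
  if r: "regular_line 1 x2" and m: "x1 \<in> I" "x2 \<in> J" for x1 x2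
 proof -
  have "(\<integral>\<^sup>+y. ennreal ((cmod (cut \<phi> (pt 1 x1 x2) - cut \<phi> y))^2) * Q y \<partial>lborel)
    = (\<integral>\<^sup>+y1. (\<integral>\<^sup>+y2. ennreal ((cmod (cut \<phi> (pt 1 x1 x2) - cut \<phi> (pt 2 y2 y1)))^2) * Q (pt 2 y2 y1) \<partial>lborel) \<partial>lborel)"
   by (rule nn_integral_lborel_pt) measurable
  also have "\<dots> <= (\<integral>\<^sup>+y1. (\<integral>\<^sup>+y2. ((a x2 + b y1) * indicator I y1) * indicator J y2 \<partial>lborel) \<partial>lborel)"
  proof (rule nn_integral_mono_AE)
   show "AE y1 in lborel. (\<integral>\<^sup>+y2. ennreal ((cmod (cut \<phi> (pt 1 x1 x2) - cut \<phi> (pt 2 y2 y1)))^2) * Q (pt 2 y2 y1) \<partial>lborel)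
     <= (\<integral>\<^sup>+y2. ((a x2 + b y1) * indicator I y1) * indicator J y2 \<partial>lborel)"
    using AE_regular_line[of 2]
   proof eventually_elim
    case (elim y1)
    show ?case
    proof (rule nn_integral_mono)
     fix y2
     show "ennreal ((cmod (cut \<phi> (pt 1 x1 x2) - cut \<phi> (pt 2 y2 y1)))^2) * Q (pt 2 y2 y1) <= ((a x2 + b y1) * indicator I y1) * indicator J y2"
      unfolding Q2 using osc[OF r elim m(1) _ m(2), of y2] by (simp split: split_indicator)
    qed
   qed
  qed
  also have "\<dots> = (\<integral>\<^sup>+y1. (a x2 * indicator I y1 + b y1 * indicator I y1) * ennreal h \<partial>lborel)"
  proof (rule nn_integral_cong)
   have Js: "J \<in> sets lborel" using J(2) by simp
   show "(\<integral>\<^sup>+y2. ((a x2 + b y1) * indicator I y1) * indicator J y2 \<partial>lborel) = (a x2 * indicator I y1 + b y1 * indicator I y1) * ennreal h" for y1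
    unfolding nn_integral_cmult_indicator[OF Js] J(3) by (simp only: distrib_right)
  qed
  also have "\<dots> = (a x2 * ennreal h + B) * ennreal h"
   by (simp add: nn_integral_multc nn_integral_add nn_integral_cmult I(3) B_def)
  also have "\<dots> = c x2" unfolding c_def distrib_right by (simp only: mult_ac)
  finally show ?thesis .
 qed
 have m2: "(%x. \<integral>\<^sup>+y. ennreal ((cmod (cut \<phi> x - cut \<phi> y))^2) * Q y \<partial>lborel) \<in> borel_measurable borel"
  by measurable
 have "(\<integral>\<^sup>+x. (\<integral>\<^sup>+y. ennreal ((cmod (cut \<phi> x - cut \<phi> y))^2) * Q y \<partial>lborel) * Q x \<partial>lborel)
   = (\<integral>\<^sup>+x2. (\<integral>\<^sup>+x1. (\<integral>\<^sup>+y. ennreal ((cmod (cut \<phi> (pt 1 x1 x2) - cut \<phi> y))^2) * Q y \<partial>lborel) * Q (pt 1 x1 x2) \<partial>lborel) \<partial>lborel)"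
  using m2 by (intro nn_integral_lborel_pt) simp
 also have "\<dots> <= (\<integral>\<^sup>+x2. (\<integral>\<^sup>+x1. (c x2 * indicator J x2) * indicator I x1 \<partial>lborel) \<partial>lborel)"
 proof (rule nn_integral_mono_AE)
  show "AE x2 in lborel. (\<integral>\<^sup>+x1. (\<integral>\<^sup>+y. ennreal ((cmod (cut \<phi> (pt 1 x1 x2) - cut \<phi> y))^2) * Q y \<partial>lborel) * Q (pt 1 x1 x2) \<partial>lborel)
    <= (\<integral>\<^sup>+x1. (c x2 * indicator J x2) * indicator I x1 \<partial>lborel)"
   using AE_regular_line[of 1]
  proof eventually_elim
   case (elim x2)
   show ?case
   proof (rule nn_integral_mono)
    fix x1
    show "(\<integral>\<^sup>+y. ennreal ((cmod (cut \<phi> (pt 1 x1 x2) - cut \<phi> y))^2) * Q y \<partial>lborel) * Q (pt 1 x1 x2)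
      <= (c x2 * indicator J x2) * indicator I x1"
     unfolding Q1 using inner[OF elim, of x1] by (simp split: split_indicator)
   qed
  qed
 qed
 also have "\<dots> = (\<integral>\<^sup>+x2. (c x2 * indicator J x2) * ennreal h \<partial>lborel)"
  by (intro nn_integral_cong) (simp add: nn_integral_cmult I(3))
 also have "\<dots> = (\<integral>\<^sup>+x2. c x2 * indicator J x2 \<partial>lborel) * ennreal h"
  by (rule nn_integral_multc) measurable
 also have "(\<integral>\<^sup>+x2. c x2 * indicator J x2 \<partial>lborel) = (\<integral>\<^sup>+x2. (ennreal h * ennreal h) * (a x2 * indicator J x2) + (ennreal h * B) * indicator J x2 \<partial>lborel)"
  by (intro nn_integral_cong) (simp add: c_def mult.assoc split: split_indicator)
 also have "\<dots> = (ennreal h * ennreal h) * A + (ennreal h * B) * ennreal h"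
  by (simp add: nn_integral_add nn_integral_cmult A_def J(3))
 also have "((ennreal h * ennreal h) * A + (ennreal h * B) * ennreal h) * ennreal h = ennreal h ^ 3 * (A + B)"
  unfolding distrib_right distrib_left power3_eq_cube by (simp only: mult_ac)
 finally show ?thesis by (simp only: A_def B_def)
qed

text \<open>Poincare inequality with mean value: h^2 times the value at x is the integral over the
  square plus the integral of the differences to x. After squaring and integrating in x, the
  differences are covered by \<open>cell_oscillation\<close>.\<close>

lemma cell_inequality:
 assumes \<phi>: "smooth \<phi>"
  and I: "convex I" "I \<in> sets borel" "emeasure lborel I = ennreal h" "0 < h"
  and J: "convex J" "J \<in> sets borel" "emeasure lborel J = ennreal h"
 shows "(\<integral>\<^sup>+x. ennreal ((cmod (cut \<phi> x))^2) * (indicator I (x $ 1) * indicator J (x $ 2)) \<partial>lborel)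
  <= ennreal (2 / h^2) * ennreal ((cmod (LINT x|lborel. cut \<phi> x * (indicator I (x $ 1) * indicator J (x $ 2))))^2)
   + ennreal (2 * h) * ((\<integral>\<^sup>+t. (16 * ennreal (crossings 1 \<phi> t) + 16 * ennreal h * slice_energy 1 \<phi> I t) * indicator J t \<partial>lborel)
    + (\<integral>\<^sup>+t. (16 * ennreal (crossings 2 \<phi> t) + 16 * ennreal h * slice_energy 2 \<phi> J t) * indicator I t \<partial>lborel))"
proof -
 define Q where "Q x = (indicator I (x $ 1) * indicator J (x $ 2) :: ennreal)" for x :: "real^2"
 define q where "q x = (indicator I (x $ 1) * indicator J (x $ 2) :: complex)" for x :: "real^2"
 define A where "A = (LINT x|lborel. cut \<phi> x * q x)"
 define T where "T = (\<integral>\<^sup>+t. (16 * ennreal (crossings 1 \<phi> t) + 16 * ennreal h * slice_energy 1 \<phi> I t) * indicator J t \<partial>lborel)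
    + (\<integral>\<^sup>+t. (16 * ennreal (crossings 2 \<phi> t) + 16 * ennreal h * slice_energy 2 \<phi> J t) * indicator I t \<partial>lborel)"
 define X where "X = (\<integral>\<^sup>+x. ennreal ((cmod (cut \<phi> x))^2) * Q x \<partial>lborel)"
 note [measurable] = measurable_cut[OF \<phi>] I(2) J(2)
 have [measurable]: "Q \<in> borel_measurable borel" "q \<in> borel_measurable borel"
  unfolding Q_def q_def by measurable
 have intQ: "(\<integral>\<^sup>+x. Q x \<partial>lborel) = ennreal h * ennreal h"
 proof -
  have "(\<integral>\<^sup>+x. Q x \<partial>lborel) = (\<integral>\<^sup>+t. (\<integral>\<^sup>+s. Q (pt 1 s t) \<partial>lborel) \<partial>lborel)" by (rule nn_integral_lborel_pt) measurable
  also have "\<dots> = (\<integral>\<^sup>+t. ennreal h * indicator J t \<partial>lborel)"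
   by (intro nn_integral_cong) (simp add: Q_def nn_integral_multc I(3))
  also have "\<dots> = ennreal h * ennreal h" by (simp add: nn_integral_cmult J(3))
  finally show ?thesis .
 qed
 have qQ: "ennreal ((cmod (q x))^2) = Q x" for x by (auto simp: q_def Q_def indicator_def)
 have iq: "integrable lborel q"
 proof (rule integrableI_bounded)
  have "(\<integral>\<^sup>+x. ennreal (norm (q x)) \<partial>lborel) = (\<integral>\<^sup>+x. Q x \<partial>lborel)"
   by (intro nn_integral_cong) (auto simp: q_def Q_def indicator_def)
  then show "(\<integral>\<^sup>+x. ennreal (norm (q x)) \<partial>lborel) < \<infinity>" by (simp add: intQ ennreal_mult_less_top)
 qed measurable
 have Iq: "(LINT x|lborel. q x) = complex_of_real (h * h)"
 proof -
  have "(LINT x|lborel. q x) = complex_of_real (LINT x|lborel. indicator I (x $ 1) * indicator J ((x :: real^2) $ 2))"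
   unfolding integral_complex_of_real[symmetric] by (intro Bochner_Integration.integral_cong) (auto simp: q_def indicator_def)
  also have "(LINT x|lborel. indicator I (x $ 1) * indicator J ((x :: real^2) $ 2) :: real) = enn2real (\<integral>\<^sup>+x. Q x \<partial>lborel)"
   by (subst integral_eq_nn_integral) (auto intro!: arg_cong[where f = enn2real] nn_integral_cong simp: Q_def indicator_def)
  also have "\<dots> = h * h" using I(4) by (simp add: intQ ennreal_mult[symmetric])
  finally show ?thesis .
 qed
 have icq: "integrable lborel (%x. cut \<phi> x * q x)"
 proof (rule Bochner_Integration.integrable_bound[OF integrable_cut[OF \<phi>]])
  show "AE x in lborel. norm (cut \<phi> x * q x) <= norm (cut \<phi> x)"
   by (intro AE_I2) (auto simp: q_def indicator_def)
 qed measurable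
 have pw: "ennreal (h ^ 4) * ennreal ((cmod (cut \<phi> x))^2)
   <= 2 * ((\<integral>\<^sup>+y. ennreal ((cmod (cut \<phi> x - cut \<phi> y))^2) * Q y \<partial>lborel) * (ennreal h * ennreal h)) + 2 * ennreal ((cmod A)^2)" for x
 proof -
  \<comment> \<open>The indicator is idempotent and is written twice: one copy localises the
    difference, the other is the second factor in Cauchy-Schwarz and contributes the area
    h^2.\<close>
  define z where "z = (LINT y|lborel. ((cut \<phi> x - cut \<phi> y) * q y) * q y)"
  have qq: "q y * q y = q y" for y by (auto simp: q_def indicator_def)
  have "z = (LINT y|lborel. cut \<phi> x * q y - cut \<phi> y * q y)"
   unfolding z_def by (intro Bochner_Integration.integral_cong) (simp_all add: mult.assoc qq left_diff_distrib)
  also have "\<dots> = cut \<phi> x * complex_of_real (h * h) - A"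
   using iq icq by (simp add: A_def Iq)
  finally have z: "complex_of_real (h * h) * cut \<phi> x = z + A" by simp
  have "h ^ 4 * (cmod (cut \<phi> x))^2 = (cmod (complex_of_real (h * h) * cut \<phi> x))^2"
   by (simp add: norm_mult power_mult_distrib power4_eq_xxxx power2_eq_square)
  also have "\<dots> <= 2 * (cmod z)^2 + 2 * (cmod A)^2" unfolding z by (rule power2_norm_add_le)
  finally have "ennreal (h ^ 4 * (cmod (cut \<phi> x))^2) <= 2 * ennreal ((cmod z)^2) + 2 * ennreal ((cmod A)^2)"
   by (rule ennreal_le_twice_add) simp_all
  also have "ennreal ((cmod z)^2) <= (\<integral>\<^sup>+y. ennreal ((cmod ((cut \<phi> x - cut \<phi> y) * q y))^2) \<partial>lborel) * (\<integral>\<^sup>+y. ennreal ((cmod (q y))^2) \<partial>lborel)"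
   unfolding z_def by (rule nn_integral_cmod_mult_le) measurable
  also have "(\<integral>\<^sup>+y. ennreal ((cmod (q y))^2) \<partial>lborel) = ennreal h * ennreal h" by (simp only: qQ intQ)
  also have "(\<integral>\<^sup>+y. ennreal ((cmod ((cut \<phi> x - cut \<phi> y) * q y))^2) \<partial>lborel) = (\<integral>\<^sup>+y. ennreal ((cmod (cut \<phi> x - cut \<phi> y))^2) * Q y \<partial>lborel)"
   by (intro nn_integral_cong) (simp add: norm_mult power_mult_distrib ennreal_mult qQ)
  finally show ?thesis using I(4) by (simp add: ennreal_mult add_right_mono mult_left_mono)
 qed
 have "ennreal (h ^ 4) * X = (\<integral>\<^sup>+x. (ennreal (h ^ 4) * ennreal ((cmod (cut \<phi> x))^2)) * Q x \<partial>lborel)"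
  unfolding X_def by (simp add: nn_integral_cmult mult.assoc)
 also have "\<dots> <= (\<integral>\<^sup>+x. (2 * ((\<integral>\<^sup>+y. ennreal ((cmod (cut \<phi> x - cut \<phi> y))^2) * Q y \<partial>lborel) * (ennreal h * ennreal h)) + 2 * ennreal ((cmod A)^2)) * Q x \<partial>lborel)"
  by (intro nn_integral_mono mult_right_mono pw) simp
 also have "\<dots> = (\<integral>\<^sup>+x. (2 * (ennreal h * ennreal h)) * ((\<integral>\<^sup>+y. ennreal ((cmod (cut \<phi> x - cut \<phi> y))^2) * Q y \<partial>lborel) * Q x) + (2 * ennreal ((cmod A)^2)) * Q x \<partial>lborel)"
  unfolding distrib_right by (intro nn_integral_cong) (simp only: mult_ac)
 also have "\<dots> = (2 * (ennreal h * ennreal h)) * (\<integral>\<^sup>+x. (\<integral>\<^sup>+y. ennreal ((cmod (cut \<phi> x - cut \<phi> y))^2) * Q y \<partial>lborel) * Q x \<partial>lborel) + (2 * ennreal ((cmod A)^2)) * (ennreal h * ennreal h)"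
  by (subst nn_integral_add) (simp_all add: nn_integral_cmult intQ)
 also have "\<dots> <= (2 * (ennreal h * ennreal h)) * (ennreal h ^ 3 * T) + (2 * ennreal ((cmod A)^2)) * (ennreal h * ennreal h)"
  unfolding Q_def T_def using I(4) by (intro add_right_mono mult_left_mono cell_oscillation[OF \<phi> I(1,2,3) _ J]) simp_all
 finally have main: "ennreal (h ^ 4) * X <= (2 * (ennreal h * ennreal h)) * (ennreal h ^ 3 * T) + (2 * ennreal ((cmod A)^2)) * (ennreal h * ennreal h)" .
 have "X = ennreal (1 / h ^ 4) * (ennreal (h ^ 4) * X)"
  using I(4) by (simp add: mult.assoc[symmetric] ennreal_mult[symmetric])
 also have "\<dots> <= ennreal (1 / h ^ 4) * ((2 * (ennreal h * ennreal h)) * (ennreal h ^ 3 * T) + (2 * ennreal ((cmod A)^2)) * (ennreal h * ennreal h))"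
  by (intro mult_left_mono main) simp
 also have "\<dots> = (ennreal (1 / h ^ 4) * 2 * (ennreal h * ennreal h) * ennreal h ^ 3) * T + (ennreal (1 / h ^ 4) * 2 * (ennreal h * ennreal h)) * ennreal ((cmod A)^2)"
  unfolding distrib_left by (simp only: mult_ac)
 also have "ennreal (1 / h ^ 4) * 2 * (ennreal h * ennreal h) = ennreal (2 / h^2)"
 proof -
  have p: "0 <= 1 / h ^ 4" "0 <= 1 / h ^ 4 * 2" "0 <= h" "0 <= h * h" "(0::real) <= 2" using I(4) by simp_all
  have "ennreal (1 / h ^ 4) * 2 * (ennreal h * ennreal h) = ennreal (1 / h ^ 4 * 2 * (h * h))"
   by (simp only: ennreal_mult[OF p(2,4)] ennreal_mult[OF p(1,5)] ennreal_mult[OF p(3,3)] ennreal_numeral)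
  also have "1 / h ^ 4 * 2 * (h * h) = 2 / h^2" using I(4) by (simp add: power4_eq_xxxx power2_eq_square)
  finally show ?thesis .
 qed
 also have "ennreal (2 / h^2) * ennreal h ^ 3 = ennreal (2 * h)"
 proof -
  have "ennreal (2 / h^2) * ennreal h ^ 3 = ennreal (2 / h^2 * h ^ 3)"
  proof -
   have p: "0 <= h" "0 <= 2 / h^2" "0 <= h ^ 3" using I(4) by simp_all
   show ?thesis by (simp only: ennreal_mult[OF p(2,3)] ennreal_power[OF p(1)])
  qed
  also have "2 / h^2 * h ^ 3 = 2 * h" using I(4) by (simp add: power3_eq_cube power2_eq_square)
  finally show ?thesis .
 qed
 finally show ?thesis unfolding X_def T_def A_def Q_def q_def by (simp add: add.commute)
qed

text \<open>Half-open intervals, so that the cells tile [-R, R) without overlap.\<close>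

definition cell :: "nat => nat => real set" where
 "cell N j = {- R + (2 * R / real N) * real j ..< - R + (2 * R / real N) * real (Suc j)}"

lemma cell_properties:
 assumes "N > 0"
 shows "convex (cell N j)" "cell N j \<in> sets borel" "emeasure lborel (cell N j) = ennreal (2 * R / real N)"
proof -
 have "- R + (2 * R / real N) * real j <= - R + (2 * R / real N) * real (Suc j)"
  by (intro add_left_mono mult_left_mono) (use R assms in auto)
 moreover have "(- R + c * real (Suc j)) - (- R + c * real j) = c" for c by (simp add: algebra_simps)
 ultimately show "emeasure lborel (cell N j) = ennreal (2 * R / real N)"
  unfolding cell_def by (simp only: emeasure_lborel_Ico)
qed (auto simp: cell_def)

lemma sum_indicator_cell:
 assumes "N > 0"
 shows "(\<Sum>j<n. indicator (cell N j) t) = (indicator {- R ..< - R + (2 * R / real N) * real n} t :: ennreal)"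
proof (induction n)
 case (Suc n)
 define a where "a = (2 * R / real N) * real n"
 define b where "b = (2 * R / real N) * real (Suc n)"
 have "0 <= a" using R assms by (simp add: a_def)
 moreover have "a <= b" unfolding a_def b_def by (intro mult_left_mono) (use R assms in auto)
 ultimately have ab: "0 <= a" "a <= b" .
 show ?case using ab Suc unfolding sum.lessThan_Suc cell_def a_def[symmetric] b_def[symmetric]
  by (auto simp: indicator_def)
qed simp

lemma sum_cells:
 assumes "N > 0"
 shows "(\<Sum>j<N. indicator (cell N j) t) = (indicator {-R..<R} t :: ennreal)"
 using sum_indicator_cell[OF assms, where n = N and t = t] assms by simp

text \<open>Sum of the cell inequalities. Each crossing term is counted once for every cell along
  its line, that is N times in each direction, so the boundary factor 2 h * 32 N = 128 R does not
  depend on the mesh, whereas the gradient factor 32 h^2 tends to 0.\<close>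

lemma rellich_smooth:
 assumes \<phi>: "smooth \<phi>" and N: "N > 0"
 defines "h \<equiv> 2 * R / real N"
 shows "(\<integral>\<^sup>+x. ennreal ((cmod (cut \<phi> x))^2) \<partial>lborel) \<le>
  (\<Sum>j<N. \<Sum>k<N. ennreal (2 / h^2) * ennreal ((cmod (LINT x|lborel. cut \<phi> x * (indicator (cell N j) (x $ 1) * indicator (cell N k) (x $ 2))))^2))
  + ennreal (128 * R) * (\<integral>\<^sup>+x. ennreal ((cmod (\<phi> x))^2) \<partial>arclength E)
  + ennreal (32 * h^2) * ((\<integral>\<^sup>+x. ennreal ((cmod (partial 1 \<phi> x))^2) * indicator \<Omega> x \<partial>lborel)
   + (\<integral>\<^sup>+x. ennreal ((cmod (partial 2 \<phi> x))^2) * indicator \<Omega> x \<partial>lborel))"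
proof -
 let ?I = "cell N"
 note cp = cell_properties[OF N, folded h_def]
 have h: "h > 0" using R N by (simp add: h_def)
 note [measurable] = measurable_cut[OF \<phi>] measurable_crossings[OF \<phi>] measurable_slice_energy[OF \<phi>] cp(2)
 have [measurable]: "partial i \<phi> \<in> borel_measurable borel" "\<Omega> \<in> sets borel" for i
  using smooth_measurable[OF smooth_partial[OF \<phi>]] open_\<Omega> by auto
 define Z where "Z = (\<integral>\<^sup>+x. ennreal ((cmod (\<phi> x))^2) \<partial>arclength E)"
 define D where "D i = (\<integral>\<^sup>+x. ennreal ((cmod (partial i \<phi> x))^2) * indicator \<Omega> x \<partial>lborel)" for i
 define M where "M j k = ennreal (2 / h^2) * ennreal ((cmod (LINT x|lborel. cut \<phi> x * (indicator (?I j) (x $ 1) * indicator (?I k) (x $ 2))))^2)" for j k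
 define C where "C i k = (\<integral>\<^sup>+t. ennreal (crossings i \<phi> t) * indicator (?I k) t \<partial>lborel)" for i k
 define G where "G i j k = (\<integral>\<^sup>+x. ennreal ((cmod (partial i \<phi> x))^2) * indicator \<Omega> x * (indicator (?I j) (x $ 1) * indicator (?I k) (x $ 2)) \<partial>lborel)" for i j k
 have sumC: "(\<Sum>k<N. C i k) <= Z" for i
 proof -
  have "(\<Sum>k<N. C i k) = (\<integral>\<^sup>+t. ennreal (crossings i \<phi> t) * (\<Sum>k<N. indicator (?I k) t) \<partial>lborel)"
   unfolding C_def sum_distrib_left by (rule nn_integral_sum[symmetric]) measurable
  also have "\<dots> <= (\<integral>\<^sup>+t. ennreal (crossings i \<phi> t) \<partial>lborel)"
   unfolding sum_cells[OF N] by (intro nn_integral_mono) (simp split: split_indicator)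
  also have "\<dots> <= Z" unfolding Z_def by (rule nn_integral_crossings_le[OF \<phi>])
  finally show ?thesis .
 qed
 have sum2: "(\<Sum>j<N. \<Sum>k<N. \<integral>\<^sup>+x. f x * (indicator (?I j) (x $ 1) * indicator (?I k) (x $ 2)) \<partial>lborel)
   = (\<integral>\<^sup>+x. f x * (indicator {-R..<R} (x $ 1) * indicator {-R..<R} (x $ 2)) \<partial>lborel)"
  if [measurable]: "f \<in> borel_measurable borel" for f :: "real^2 => ennreal"
 proof -
  have "(\<Sum>j<N. \<Sum>k<N. \<integral>\<^sup>+x. f x * (indicator (?I j) (x $ 1) * indicator (?I k) (x $ 2)) \<partial>lborel)
    = (\<integral>\<^sup>+x. (\<Sum>j<N. \<Sum>k<N. f x * (indicator (?I j) (x $ 1) * indicator (?I k) (x $ 2))) \<partial>lborel)"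
   by (subst nn_integral_sum, measurable, intro sum.cong refl, subst nn_integral_sum, measurable)
  also have "(%x. \<Sum>j<N. \<Sum>k<N. f x * (indicator (?I j) (x $ 1) * indicator (?I k) (x $ 2)))
    = (%x. f x * (indicator {-R..<R} (x $ 1) * indicator {-R..<R} (x $ 2)))"
   unfolding sum_distrib_left[symmetric] sum_distrib_right[symmetric] sum_cells[OF N] ..
  finally show ?thesis .
 qed
 have sumG: "(\<Sum>j<N. \<Sum>k<N. G i j k) <= D i" for i
 proof -
  have "(\<Sum>j<N. \<Sum>k<N. G i j k) = (\<integral>\<^sup>+x. ennreal ((cmod (partial i \<phi> x))^2) * indicator \<Omega> x * (indicator {-R..<R} (x $ 1) * indicator {-R..<R} (x $ 2)) \<partial>lborel)"
   unfolding G_def by (rule sum2) measurable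
  also have "\<dots> <= D i" unfolding D_def by (intro nn_integral_mono) (simp split: split_indicator)
  finally show ?thesis .
 qed
 have cellb: "(\<integral>\<^sup>+x. ennreal ((cmod (cut \<phi> x))^2) * (indicator (?I j) (x $ 1) * indicator (?I k) (x $ 2)) \<partial>lborel)
   <= M j k + ennreal (2 * h) * ((16 * C 1 k + 16 * ennreal h * G 1 j k) + (16 * C 2 j + 16 * ennreal h * G 2 j k))" for j k
 proof -
  have o: "other 1 = 2" "other 2 = 1" by (simp_all add: other_def)
  have 1: "(\<integral>\<^sup>+t. (16 * ennreal (crossings 1 \<phi> t) + 16 * ennreal h * slice_energy 1 \<phi> (?I j) t) * indicator (?I k) t \<partial>lborel)
    = 16 * C 1 k + 16 * ennreal h * G 1 j k"
  proof -
   have "(\<integral>\<^sup>+t. (16 * ennreal (crossings 1 \<phi> t) + 16 * ennreal h * slice_energy 1 \<phi> (?I j) t) * indicator (?I k) t \<partial>lborel)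
     = (\<integral>\<^sup>+t. 16 * (ennreal (crossings 1 \<phi> t) * indicator (?I k) t) + (16 * ennreal h) * (slice_energy 1 \<phi> (?I j) t * indicator (?I k) t) \<partial>lborel)"
    by (intro nn_integral_cong) (simp add: distrib_right mult.assoc)
   also have "\<dots> = 16 * C 1 k + 16 * ennreal h * (\<integral>\<^sup>+t. slice_energy 1 \<phi> (?I j) t * indicator (?I k) t \<partial>lborel)"
    unfolding C_def by (subst nn_integral_add) (simp_all add: nn_integral_cmult)
   finally show ?thesis by (simp add: nn_integral_slice_energy[OF \<phi> cp(2) cp(2)] G_def o)
  qed
  have 2: "(\<integral>\<^sup>+t. (16 * ennreal (crossings 2 \<phi> t) + 16 * ennreal h * slice_energy 2 \<phi> (?I k) t) * indicator (?I j) t \<partial>lborel)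
    = 16 * C 2 j + 16 * ennreal h * G 2 j k"
  proof -
   have "(\<integral>\<^sup>+t. (16 * ennreal (crossings 2 \<phi> t) + 16 * ennreal h * slice_energy 2 \<phi> (?I k) t) * indicator (?I j) t \<partial>lborel)
     = (\<integral>\<^sup>+t. 16 * (ennreal (crossings 2 \<phi> t) * indicator (?I j) t) + (16 * ennreal h) * (slice_energy 2 \<phi> (?I k) t * indicator (?I j) t) \<partial>lborel)"
    by (intro nn_integral_cong) (simp add: distrib_right mult.assoc)
   also have "\<dots> = 16 * C 2 j + 16 * ennreal h * (\<integral>\<^sup>+t. slice_energy 2 \<phi> (?I k) t * indicator (?I j) t \<partial>lborel)"
    unfolding C_def by (subst nn_integral_add) (simp_all add: nn_integral_cmult)
   also have "(\<integral>\<^sup>+t. slice_energy 2 \<phi> (?I k) t * indicator (?I j) t \<partial>lborel) = G 2 j k"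
    unfolding nn_integral_slice_energy[OF \<phi> cp(2) cp(2)] G_def o
    by (intro nn_integral_cong) (simp only: mult.commute[of "indicator (?I k) _"])
   finally show ?thesis .
  qed
  show ?thesis
   using cell_inequality[OF \<phi> cp(1,2,3) h cp(1,2,3), of j k] unfolding 1 2 M_def .
 qed
 have "(\<integral>\<^sup>+x. ennreal ((cmod (cut \<phi> x))^2) \<partial>lborel)
   = (\<integral>\<^sup>+x. ennreal ((cmod (cut \<phi> x))^2) * (indicator {-R..<R} (x $ 1) * indicator {-R..<R} (x $ 2)) \<partial>lborel)"
 proof (rule nn_integral_cong)
  fix x
  show "ennreal ((cmod (cut \<phi> x))^2) = ennreal ((cmod (cut \<phi> x))^2) * (indicator {-R..<R} (x $ 1) * indicator {-R..<R} (x $ 2))"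
   using R(2)[of x 1] R(2)[of x 2] by (cases "x \<in> \<Omega>") (auto simp: cut_def abs_less_iff)
 qed
 also have "\<dots> = (\<Sum>j<N. \<Sum>k<N. \<integral>\<^sup>+x. ennreal ((cmod (cut \<phi> x))^2) * (indicator (?I j) (x $ 1) * indicator (?I k) (x $ 2)) \<partial>lborel)"
  by (rule sum2[symmetric]) measurable
 also have "\<dots> <= (\<Sum>j<N. \<Sum>k<N. M j k + ennreal (2 * h) * ((16 * C 1 k + 16 * ennreal h * G 1 j k) + (16 * C 2 j + 16 * ennreal h * G 2 j k)))"
  by (intro sum_mono cellb)
 also have "\<dots> = (\<Sum>j<N. \<Sum>k<N. M j k) + ennreal (2 * h) * (((\<Sum>j<N. 16 * (\<Sum>k<N. C 1 k)) + 16 * ennreal h * (\<Sum>j<N. \<Sum>k<N. G 1 j k))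
   + ((\<Sum>k<N. 16 * (\<Sum>j<N. C 2 j)) + 16 * ennreal h * (\<Sum>j<N. \<Sum>k<N. G 2 j k)))"
 proof -
  have sw: "(\<Sum>j<N. \<Sum>k<N. C 2 j) = (\<Sum>k<N. \<Sum>j<N. C 2 j)" by (rule sum.swap)
  show ?thesis by (simp only: sum.distrib sum_distrib_left[symmetric] sw)
 qed
 also have "\<dots> <= (\<Sum>j<N. \<Sum>k<N. M j k) + ennreal (2 * h) * (((\<Sum>j<N. 16 * Z) + 16 * ennreal h * D 1) + ((\<Sum>k<N. 16 * Z) + 16 * ennreal h * D 2))"
  by (intro add_mono mult_left_mono sum_mono sumC sumG order_refl) auto
 also have "\<dots> = (\<Sum>j<N. \<Sum>k<N. M j k) + (ennreal (2 * h) * (32 * ennreal (real N)) * Z + ennreal (2 * h) * (16 * ennreal h) * (D 1 + D 2))"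
 proof -
  have s: "(\<Sum>j<N. 16 * Z) = 16 * ennreal (real N) * Z" by (simp add: ennreal_of_nat_eq_real_of_nat mult_ac)
  have "(16 * ennreal (real N) * Z + 16 * ennreal h * D 1) + (16 * ennreal (real N) * Z + 16 * ennreal h * D 2)
    = 32 * ennreal (real N) * Z + 16 * ennreal h * (D 1 + D 2)"
  proof -
   have "32 * x = 16 * x + 16 * x" for x :: ennreal by (simp add: distrib_right[symmetric])
   then show ?thesis unfolding distrib_left mult.assoc by (simp add: add_ac)
  qed
  then show ?thesis unfolding s by (simp only: distrib_left mult.assoc)
 qed
 also have "ennreal (2 * h) * (32 * ennreal (real N)) = ennreal (128 * R)"
 proof -
  have "ennreal (2 * h) * (32 * ennreal (real N)) = ennreal (2 * h * (32 * real N))"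
  proof -
   have p: "0 <= 2 * h" "0 <= 32 * real N" "(0::real) <= 32" "0 <= real N" using h by simp_all
   show ?thesis by (simp only: ennreal_mult[OF p(1,2)] ennreal_mult[OF p(3,4)] ennreal_numeral)
  qed
  also have "2 * h * (32 * real N) = 128 * R" using N by (simp add: h_def)
  finally show ?thesis .
 qed
 also have "ennreal (2 * h) * (16 * ennreal h) = ennreal (32 * h^2)"
 proof -
  have "ennreal (2 * h) * (16 * ennreal h) = ennreal (2 * h * (16 * h))"
  proof -
   have p: "0 <= 2 * h" "0 <= 16 * h" "(0::real) <= 16" "0 <= h" using h by simp_all
   show ?thesis by (simp only: ennreal_mult[OF p(1,2)] ennreal_mult[OF p(3,4)] ennreal_numeral)
  qed
  then show ?thesis by (simp add: power2_eq_square)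
 qed
 finally show ?thesis unfolding M_def Z_def D_def by (simp add: add.assoc)
qed

end

section \<open>Smoothness of kernel integrals\<close>

text \<open>Rational kernels whose numerator has at most the degree of the denominator. They are
  bounded for e > 0 and stable under differentiation, since differentiating the denominator raises
  the degrees by 1 above and by 2 below; hence all their derivatives are bounded too.\<close>

inductive_set bounded_kernels :: "real => (real^2 => real) set" for e :: real where
 monomial: "a + b <= 2 * n ==> (%v. (v $ 1) ^ a * (v $ 2) ^ b * inverse (v \<bullet> v + e) ^ n) \<in> bounded_kernels e"
| add: "k \<in> bounded_kernels e ==> l \<in> bounded_kernels e ==> (%v. k v + l v) \<in> bounded_kernels e"
| scale: "k \<in> bounded_kernels e ==> (%v. c * k v) \<in> bounded_kernels e"

lemma inner_vec2: "v \<bullet> w = v $ 1 * w $ 1 + v $ 2 * w $ 2" for v w :: "real^2"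
 by (simp add: inner_vec_def sum_2)

lemma bounded_kernels_bounded:
 assumes "e > 0" "k \<in> bounded_kernels e"
 shows "\<exists>C\<ge>0. \<forall>v. \<bar>k v\<bar> <= C"
 using assms(2)
proof induction
 case (monomial a b n)
 have "\<bar>(v $ 1) ^ a * (v $ 2) ^ b * inverse (v \<bullet> v + e) ^ n\<bar> <= 1 + inverse e ^ n" for v :: "real^2"
 proof -
  define r where "r = norm v"
  define Q where "Q = v \<bullet> v + e"
  have Q: "Q = r^2 + e" "Q > 0" "r \<ge> 0" using assms(1) by (auto simp: Q_def r_def power2_norm_eq_inner intro: add_nonneg_pos)
  have "\<bar>(v $ 1) ^ a * (v $ 2) ^ b\<bar> <= r ^ a * r ^ b"
   unfolding abs_mult power_abs r_def by (intro mult_mono power_mono component_le_norm_cart) auto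
  then have "\<bar>(v $ 1) ^ a * (v $ 2) ^ b * inverse Q ^ n\<bar> <= r ^ (a + b) * inverse Q ^ n"
   using Q(2) by (simp add: abs_mult power_add mult_right_mono)
  also have "\<dots> <= 1 + inverse e ^ n"
  proof (cases "r <= 1")
   case True
   have "r ^ (a + b) * inverse Q ^ n <= 1 * inverse e ^ n"
    using True Q assms(1) by (intro mult_mono power_le_one power_mono le_imp_inverse_le) auto
   then show ?thesis by simp
  next
   case False
   have "r ^ (a + b) <= r ^ (2 * n)" using False monomial by (intro power_increasing) auto
   also have "\<dots> = (r^2) ^ n" by (simp add: power_mult)
   also have "\<dots> <= Q ^ n" using Q assms(1) by (intro power_mono) auto
   finally have "r ^ (a + b) * inverse Q ^ n <= Q ^ n * inverse Q ^ n" using Q(2) by (intro mult_right_mono) auto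
   also have "\<dots> = 1" using Q(2) by (simp add: power_mult_distrib[symmetric])
   finally show ?thesis using assms(1) by (simp add: add_increasing2)
  qed
  finally show ?thesis by (simp add: Q_def)
 qed
 then show ?case using assms(1) by (intro exI[of _ "1 + inverse e ^ n"]) auto
next
 case (add k l)
 then obtain C D where "C \<ge> 0" "D \<ge> 0" "\<And>v. \<bar>k v\<bar> <= C" "\<And>v. \<bar>l v\<bar> <= D" by blast
 then show ?case by (intro exI[of _ "C + D"]) (auto intro: order_trans[OF abs_triangle_ineq] add_mono)
next
 case (scale k c)
 then obtain C where "C \<ge> 0" "\<And>v. \<bar>k v\<bar> <= C" by blast
 then show ?case by (intro exI[of _ "\<bar>c\<bar> * C"]) (auto simp: abs_mult intro: mult_left_mono)
qed

lemma bounded_kernels_derivative: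
 assumes "e > 0" "k \<in> bounded_kernels e"
 shows "\<exists>k1\<in>bounded_kernels e. \<exists>k2\<in>bounded_kernels e. \<forall>v. (k has_derivative (%h. h $ 1 * k1 v + h $ 2 * k2 v)) (at v)"
 using assms(2)
proof induction
 case (monomial a b n)
 define m where "m a b n v = (v $ 1) ^ a * (v $ 2) ^ b * inverse (v \<bullet> v + e) ^ n" for a b n and v :: "real^2"
 have mem: "m a b n \<in> bounded_kernels e" if "a + b <= 2 * n" for a b n
  unfolding m_def using that by (rule bounded_kernels.monomial)
 \<comment> \<open>For \<open>a = 0\<close> the truncated exponent \<open>a - 1\<close> is harmless
   because its coefficient vanishes.\<close>
 define k1 where "k1 v = real a * m (a - 1) b n v + (- 2 * real n) * m (a + 1) b (n + 1) v" for v
 define k2 where "k2 v = real b * m a (b - 1) n v + (- 2 * real n) * m a (b + 1) (n + 1) v" for v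
 have "k1 \<in> bounded_kernels e" "k2 \<in> bounded_kernels e"
  unfolding k1_def k2_def using monomial by (intro bounded_kernels.add bounded_kernels.scale mem; simp)+
 moreover have "(m a b n has_derivative (%h. h $ 1 * k1 v + h $ 2 * k2 v)) (at v)" for v
 proof -
  have Q: "v \<bullet> v + e \<noteq> 0" using assms(1) inner_ge_zero[of v] by linarith
  have c: "((%v. v $ i) has_derivative (%h. h $ i)) (at v)" for i :: 2
   by (intro bounded_linear_imp_has_derivative bounded_linear_vec_nth)
  have q: "((%v. v \<bullet> v + e) has_derivative (%h. 2 * (h \<bullet> v))) (at v)"
   by (auto intro!: derivative_eq_intros simp: inner_commute)
  define i where "i = inverse (v \<bullet> v + e)"
  have i1: "((%v. inverse (v \<bullet> v + e)) has_derivative (%h. - (i * (2 * (h \<bullet> v)) * i))) (at v)"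
   unfolding i_def by (rule Deriv.has_derivative_inverse[OF Q q])
  have inv: "((%v. inverse (v \<bullet> v + e) ^ n) has_derivative
    (%h. h \<bullet> v * (- 2 * real n * inverse (v \<bullet> v + e) ^ (n + 1)))) (at v)"
   supply [[simproc del: defined_all]]
   by (rule has_derivative_eq_rhs[OF has_derivative_power[OF i1]], unfold i_def[symmetric], cases n)
    (simp_all add: fun_eq_iff algebra_simps)
  show ?thesis unfolding m_def[abs_def]
   by (rule has_derivative_eq_rhs[OF has_derivative_mult[OF has_derivative_mult[OF has_derivative_power[OF c] has_derivative_power[OF c]] inv]])
    (simp add: fun_eq_iff k1_def k2_def m_def inner_vec2[of _ v] algebra_simps)
 qed
 ultimately show ?case unfolding m_def[abs_def] by blast
next
 case (add k l)
 then obtain k1 k2 l1 l2 where *: "k1 \<in> bounded_kernels e" "k2 \<in> bounded_kernels e" "l1 \<in> bounded_kernels e" "l2 \<in> bounded_kernels e"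
  "\<And>v. (k has_derivative (%h. h $ 1 * k1 v + h $ 2 * k2 v)) (at v)"
  "\<And>v. (l has_derivative (%h. h $ 1 * l1 v + h $ 2 * l2 v)) (at v)" by blast
 have "((%v. k v + l v) has_derivative (%h. h $ 1 * (k1 v + l1 v) + h $ 2 * (k2 v + l2 v))) (at v)" for v
  by (rule has_derivative_eq_rhs[OF has_derivative_add[OF *(5,6)]]) (simp add: fun_eq_iff algebra_simps)
 then show ?case
  by (intro bexI[OF _ bounded_kernels.add[OF *(1,3)]] bexI[OF _ bounded_kernels.add[OF *(2,4)]] allI)
next
 case (scale k c)
 then obtain k1 k2 where *: "k1 \<in> bounded_kernels e" "k2 \<in> bounded_kernels e"
  "\<And>v. (k has_derivative (%h. h $ 1 * k1 v + h $ 2 * k2 v)) (at v)" by blast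
 have "((%v. c * k v) has_derivative (%h. h $ 1 * (c * k1 v) + h $ 2 * (c * k2 v))) (at v)" for v
  by (rule has_derivative_eq_rhs[OF has_derivative_mult_right[OF *(3)]]) (simp add: fun_eq_iff algebra_simps)
 then show ?case
  by (intro bexI[OF _ bounded_kernels.scale[OF *(1)]] bexI[OF _ bounded_kernels.scale[OF *(2)]] allI)
qed

lemma bounded_kernels_continuous:
 assumes "e > 0" "k \<in> bounded_kernels e"
 shows "continuous_on UNIV k"
 using bounded_kernels_derivative[OF assms] has_derivative_continuous
 by (meson continuous_at_imp_continuous_on)

lemma onorm_two_le:
 fixes a b :: real
 assumes "\<bar>a\<bar> <= C" "\<bar>b\<bar> <= C"
 shows "onorm (%h :: real^2. h $ 1 * a + h $ 2 * b) <= 2 * C"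
proof (rule onorm_le)
 fix h :: "real^2"
 have "\<bar>h $ 1 * a + h $ 2 * b\<bar> <= \<bar>h $ 1\<bar> * \<bar>a\<bar> + \<bar>h $ 2\<bar> * \<bar>b\<bar>" using abs_triangle_ineq[of "h $ 1 * a" "h $ 2 * b"] by (simp add: abs_mult)
 also have "\<dots> <= norm h * C + norm h * C" using assms by (intro add_mono mult_mono component_le_norm_cart) auto
 finally show "norm (h $ 1 * a + h $ 2 * b) <= 2 * C * norm h" by (simp add: algebra_simps)
qed

lemma bounded_kernels_lipschitz:
 assumes "e > 0" "k \<in> bounded_kernels e"
 shows "\<exists>C\<ge>0. \<forall>v w. \<bar>k v - k w\<bar> <= C * norm (v - w)"
proof -
 obtain k1 k2 where k: "k1 \<in> bounded_kernels e" "k2 \<in> bounded_kernels e"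
  "\<And>v. (k has_derivative (%h. h $ 1 * k1 v + h $ 2 * k2 v)) (at v)"
  using bounded_kernels_derivative[OF assms] by blast
 obtain C1 C2 where C: "C1 \<ge> 0" "C2 \<ge> 0" "\<And>v. \<bar>k1 v\<bar> <= C1" "\<And>v. \<bar>k2 v\<bar> <= C2"
  using bounded_kernels_bounded[OF assms(1) k(1)] bounded_kernels_bounded[OF assms(1) k(2)] by blast
 define C where "C = 2 * max C1 C2"
 have "norm (k v - k w) <= C * norm (v - w)" for v w
 proof (rule differentiable_bound[OF convex_UNIV])
  show "(k has_derivative (%h. h $ 1 * k1 x + h $ 2 * k2 x)) (at x within UNIV)" for x using k(3) by simp
  show "onorm (%h :: real^2. h $ 1 * k1 x + h $ 2 * k2 x) <= C" for x
   unfolding C_def using C(3,4)[of x] by (intro onorm_two_le) auto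
 qed auto
 then show ?thesis using C by (intro exI[of _ C]) (auto simp: C_def)
qed

text \<open>The remainder is uniform in the base point because the first derivatives are again
  bounded kernels and therefore Lipschitz.\<close>

lemma bounded_kernels_taylor:
 assumes "e > 0" "k \<in> bounded_kernels e"
 shows "\<exists>k1\<in>bounded_kernels e. \<exists>k2\<in>bounded_kernels e. \<exists>C\<ge>0. \<forall>v h. \<bar>k (v + h) - k v - (h $ 1 * k1 v + h $ 2 * k2 v)\<bar> <= C * (norm h)^2"
proof -
 obtain k1 k2 where k: "k1 \<in> bounded_kernels e" "k2 \<in> bounded_kernels e"
  "\<And>v. (k has_derivative (%h. h $ 1 * k1 v + h $ 2 * k2 v)) (at v)"
  using bounded_kernels_derivative[OF assms] by blast
 obtain C1 C2 where C: "C1 \<ge> 0" "C2 \<ge> 0" "\<And>v w. \<bar>k1 v - k1 w\<bar> <= C1 * norm (v - w)" "\<And>v w. \<bar>k2 v - k2 w\<bar> <= C2 * norm (v - w)"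
  using bounded_kernels_lipschitz[OF assms(1) k(1)] bounded_kernels_lipschitz[OF assms(1) k(2)] by blast
 define C where "C = max C1 C2"
 have "\<bar>k (v + h) - k v - (h $ 1 * k1 v + h $ 2 * k2 v)\<bar> <= 2 * C * (norm h)^2" for v h
 proof -
  have "norm (k (v + h) - k v - (((v + h) - v) $ 1 * k1 v + ((v + h) - v) $ 2 * k2 v)) <= norm ((v + h) - v) * (2 * (C * norm h))"
  proof (rule differentiable_bound_linearization[where S = "closed_segment v (v + h)" and f' = "%w h. h $ 1 * k1 w + h $ 2 * k2 w"])
   show "v + t *\<^sub>R (v + h - v) \<in> closed_segment v (v + h)" if "t \<in> {0..1}" for t
    using that unfolding closed_segment_def by (intro CollectI exI[of _ t]) (auto simp: algebra_simps)
   show "(k has_derivative (%h. h $ 1 * k1 w + h $ 2 * k2 w)) (at w within closed_segment v (v + h))" for w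
    using k(3) has_derivative_at_withinI by blast
   show "onorm ((%h. h $ 1 * k1 w + h $ 2 * k2 w) - (%h :: real^2. h $ 1 * k1 v + h $ 2 * k2 v)) <= 2 * (C * norm h)"
    if "w \<in> closed_segment v (v + h)" for w
   proof -
    have "norm (w - v) <= norm h" using segment_bound(1)[OF that] by simp
    then have "C1 * norm (w - v) <= C * norm h" "C2 * norm (w - v) <= C * norm h"
     using C(1,2) by (auto simp: C_def intro!: mult_mono)
    then have "\<bar>k1 w - k1 v\<bar> <= C * norm h" "\<bar>k2 w - k2 v\<bar> <= C * norm h"
     using C(3)[of w v] C(4)[of w v] by linarith+
    from onorm_two_le[OF this] show ?thesis by (simp add: fun_diff_def algebra_simps)
   qed
  qed auto
  then show ?thesis by (simp add: power2_eq_square algebra_simps)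
 qed
 then show ?thesis using k C by (intro bexI[of _ k1] bexI[of _ k2] exI[of _ "2 * C"]) (auto simp: C_def)
qed

lemma integrable_kernel:
 fixes g :: "real^2 => complex"
 assumes "e > 0" "k \<in> bounded_kernels e" and g: "integrable M g" and M: "sets M = sets borel"
 shows "integrable M (%z. g z * complex_of_real (k (x - z)))"
proof -
 obtain C where C: "\<And>v. \<bar>k v\<bar> <= C" using bounded_kernels_bounded[OF assms(1,2)] by blast
 have m: "(%z. complex_of_real (k (x - z))) \<in> borel_measurable M"
  unfolding measurable_cong_sets[OF M refl]
  by (intro borel_measurable_continuous_onI continuous_intros continuous_on_compose2[OF bounded_kernels_continuous[OF assms(1,2)]]) auto
 show ?thesis
 proof (rule Bochner_Integration.integrable_bound)
  show "integrable M (%z. C * norm (g z))" using g by simp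
  show "(%z. g z * complex_of_real (k (x - z))) \<in> borel_measurable M"
   by (rule borel_measurable_times[OF borel_measurable_integrable[OF g] m])
  show "AE z in M. norm (g z * complex_of_real (k (x - z))) <= norm (C * norm (g z))"
  proof (rule AE_I2)
   fix z
   have "norm (g z) * \<bar>k (x - z)\<bar> <= norm (g z) * \<bar>C\<bar>" using C[of "x - z"] by (intro mult_left_mono) auto
   then show "norm (g z * complex_of_real (k (x - z))) <= norm (C * norm (g z))"
    by (simp add: norm_mult abs_mult mult.commute)
  qed
 qed
qed

text \<open>The uniform quadratic remainder survives integration against \<open>g\<close>, which
  gives differentiation under the integral directly. Returning the derivative kernels as members of
  the same family allows iteration.\<close>

lemma kernel_integral_derivative:
 fixes g :: "real^2 => complex"
 assumes "e > 0" "k \<in> bounded_kernels e" and g: "integrable M g" and M: "sets M = sets borel"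
 shows "\<exists>k1\<in>bounded_kernels e. \<exists>k2\<in>bounded_kernels e. (\<forall>v. (k has_derivative (%h. h $ 1 * k1 v + h $ 2 * k2 v)) (at v)) \<and>
  (\<forall>x. ((%x. LINT z|M. g z * complex_of_real (k (x - z))) has_derivative
   (%h. h $ 1 *\<^sub>R (LINT z|M. g z * complex_of_real (k1 (x - z))) + h $ 2 *\<^sub>R (LINT z|M. g z * complex_of_real (k2 (x - z))))) (at x))"
proof -
 obtain k1 k2 C where k: "k1 \<in> bounded_kernels e" "k2 \<in> bounded_kernels e" "C \<ge> 0"
  "\<And>v h. \<bar>k (v + h) - k v - (h $ 1 * k1 v + h $ 2 * k2 v)\<bar> <= C * (norm h)^2"
  using bounded_kernels_taylor[OF assms(1,2)] by blast
 note int = integrable_kernel[OF assms(1) _ g M]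
 have lin: "bounded_linear (%h :: real^2. h $ 1 *\<^sub>R a + h $ 2 *\<^sub>R b)" for a b :: "'z::real_normed_vector"
  by (intro bounded_linear_add bounded_linear_compose[OF bounded_linear_scaleR_left bounded_linear_vec_nth])
 have sq: "((%h. (norm (f h)) / norm h) \<longlongrightarrow> 0) (at (0::real^2))"
  if "\<And>h. norm (f h) <= B * (norm h)^2" for f :: "real^2 => 'z::real_normed_vector" and B
 proof (rule tendsto_sandwich[OF _ _ tendsto_const])
  have "((%h :: real^2. \<bar>B\<bar> * norm h) \<longlongrightarrow> \<bar>B\<bar> * norm (0 :: real^2)) (at 0)" by (intro tendsto_intros)
  then show "((%h :: real^2. \<bar>B\<bar> * norm h) \<longlongrightarrow> 0) (at 0)" by simp
  show "\<forall>\<^sub>F h in at 0. norm (f h) / norm h <= \<bar>B\<bar> * norm h"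
  proof (rule always_eventually, rule allI)
   fix h :: "real^2"
   have "norm (f h) <= \<bar>B\<bar> * (norm h)^2" using that[of h] by (meson abs_ge_self dual_order.trans mult_right_mono zero_le_power2)
   then show "norm (f h) / norm h <= \<bar>B\<bar> * norm h" by (cases "h = 0") (auto simp: divide_le_eq power2_eq_square mult.assoc)
  qed
 qed (auto intro!: always_eventually)
 have dk: "(k has_derivative (%h. h $ 1 * k1 v + h $ 2 * k2 v)) (at v)" for v
  unfolding has_derivative_at
 proof
  show "bounded_linear (%h :: real^2. h $ 1 * k1 v + h $ 2 * k2 v)" using lin[of "k1 v" "k2 v"] by simp
  show "((%h. norm (k (v + h) - k v - (h $ 1 * k1 v + h $ 2 * k2 v)) / norm h) \<longlongrightarrow> 0) (at 0)"
   by (rule sq[of _ C]) (use k(4)[of v] in simp)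
 qed
 define F where "F k x = (LINT z|M. g z * complex_of_real (k (x - z)))" for k x
 have "(F k has_derivative (%h. h $ 1 *\<^sub>R F k1 x + h $ 2 *\<^sub>R F k2 x)) (at x)" for x
  unfolding has_derivative_at
 proof
  show "bounded_linear (%h :: real^2. h $ 1 *\<^sub>R F k1 x + h $ 2 *\<^sub>R F k2 x)" by (rule lin)
  show "((%h. norm (F k (x + h) - F k x - (h $ 1 *\<^sub>R F k1 x + h $ 2 *\<^sub>R F k2 x)) / norm h) \<longlongrightarrow> 0) (at 0)"
  proof (rule sq[of _ "C * (LINT z|M. norm (g z))"])
   fix h :: "real^2"
   have "F k (x + h) - F k x - (h $ 1 *\<^sub>R F k1 x + h $ 2 *\<^sub>R F k2 x)
     = (LINT z|M. g z * complex_of_real (k (x + h - z)) - g z * complex_of_real (k (x - z))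
       - (h $ 1 *\<^sub>R (g z * complex_of_real (k1 (x - z))) + h $ 2 *\<^sub>R (g z * complex_of_real (k2 (x - z)))))"
    unfolding F_def using int[OF assms(2)] int[OF k(1)] int[OF k(2)] by simp
   also have "norm \<dots> <= (LINT z|M. C * (norm h)^2 * norm (g z))"
   proof (rule Bochner_Integration.integral_norm_bound_integral)
    show "integrable M (%z. g z * complex_of_real (k (x + h - z)) - g z * complex_of_real (k (x - z))
       - (h $ 1 *\<^sub>R (g z * complex_of_real (k1 (x - z))) + h $ 2 *\<^sub>R (g z * complex_of_real (k2 (x - z)))))"
     using int[OF assms(2)] int[OF k(1)] int[OF k(2)] by simp
    show "integrable M (%z. C * (norm h)^2 * norm (g z))" using g by simp
    fix z
    have eq: "g z * complex_of_real (k (x + h - z)) - g z * complex_of_real (k (x - z))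
       - (h $ 1 *\<^sub>R (g z * complex_of_real (k1 (x - z))) + h $ 2 *\<^sub>R (g z * complex_of_real (k2 (x - z))))
      = g z * complex_of_real (k ((x - z) + h) - k (x - z) - (h $ 1 * k1 (x - z) + h $ 2 * k2 (x - z)))"
     by (simp add: scaleR_conv_of_real algebra_simps)
    have "norm (g z) * \<bar>k ((x - z) + h) - k (x - z) - (h $ 1 * k1 (x - z) + h $ 2 * k2 (x - z))\<bar> <= norm (g z) * (C * (norm h)^2)"
     by (intro mult_left_mono k(4)) simp
    then show "norm (g z * complex_of_real (k (x + h - z)) - g z * complex_of_real (k (x - z))
       - (h $ 1 *\<^sub>R (g z * complex_of_real (k1 (x - z))) + h $ 2 *\<^sub>R (g z * complex_of_real (k2 (x - z)))))
      <= C * (norm h)^2 * norm (g z)"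
     unfolding eq norm_mult norm_of_real by (simp add: mult.commute)
   qed
   also have "\<dots> = C * (LINT z|M. norm (g z)) * (norm h)^2" by simp
   finally show "norm (F k (x + h) - F k x - (h $ 1 *\<^sub>R F k1 x + h $ 2 *\<^sub>R F k2 x)) <= C * (LINT z|M. norm (g z)) * (norm h)^2" .
  qed
 qed
 then show ?thesis using k(1,2) dk unfolding F_def by blast
qed

lemma smooth_kernel_integral:
 fixes g :: "real^2 => complex"
 assumes "e > 0" "k \<in> bounded_kernels e" and g: "integrable M g" and M: "sets M = sets borel"
 shows "smooth (%x. LINT z|M. g z * complex_of_real (k (x - z)))"
proof (rule smooth_coinduct[where X = "{%x. LINT z|M. g z * complex_of_real (k (x - z)) |k. k \<in> bounded_kernels e}"])
 fix \<phi> x assume "\<phi> \<in> {%x. LINT z|M. g z * complex_of_real (k (x - z)) |k. k \<in> bounded_kernels e}"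
 then obtain k where k: "k \<in> bounded_kernels e" "\<phi> = (%x. LINT z|M. g z * complex_of_real (k (x - z)))" by blast
 show "\<phi> differentiable (at x)"
  using kernel_integral_derivative[OF assms(1) k(1) g M] unfolding k(2) differentiable_def by blast
next
 fix \<phi> and i :: 2 assume "\<phi> \<in> {%x. LINT z|M. g z * complex_of_real (k (x - z)) |k. k \<in> bounded_kernels e}"
 then obtain k where k: "k \<in> bounded_kernels e" "\<phi> = (%x. LINT z|M. g z * complex_of_real (k (x - z)))" by blast
 obtain k1 k2 where k12: "k1 \<in> bounded_kernels e" "k2 \<in> bounded_kernels e" and
  d: "\<And>x. (\<phi> has_derivative (%h. h $ 1 *\<^sub>R (LINT z|M. g z * complex_of_real (k1 (x - z))) + h $ 2 *\<^sub>R (LINT z|M. g z * complex_of_real (k2 (x - z))))) (at x)"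
  using kernel_integral_derivative[OF assms(1) k(1) g M] unfolding k(2) by blast
 consider "i = 1" | "i = 2" using exhaust_2[of i] by blast
 then show "partial i \<phi> \<in> {%x. LINT z|M. g z * complex_of_real (k (x - z)) |k. k \<in> bounded_kernels e}"
 proof cases
  case 1
  have "partial i \<phi> = (%x. LINT z|M. g z * complex_of_real (k1 (x - z)))"
   using partial_eq[OF d, of i] by (simp add: 1 axis_def fun_eq_iff)
  then show ?thesis using k12 by blast
 next
  case 2
  have "partial i \<phi> = (%x. LINT z|M. g z * complex_of_real (k2 (x - z)))"
   using partial_eq[OF d, of i] by (simp add: 2 axis_def fun_eq_iff)
  then show ?thesis using k12 by blast
 qed
qed (use assms(2) in blast)

text \<open>Regularised |v|^(-4). It is the square of the regularised |v|^(-2) and so splits evenly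
  in Cauchy-Schwarz.\<close>

definition kap :: "real => real^2 => real" where "kap e v = inverse ((v \<bullet> v + e)^2)"

definition dkap :: "2 => real => real^2 => real" where "dkap i e v = - 4 * v $ i * inverse ((v \<bullet> v + e) ^ 3)"

lemma kap_nonneg: "0 <= kap e v"
 by (simp add: kap_def)

lemma kap_bounded_kernel: "kap e \<in> bounded_kernels e"
 using bounded_kernels.monomial[of 0 0 2 e] by (simp add: kap_def[abs_def] power_inverse)

lemma has_derivative_kap:
 assumes "e > 0"
 shows "(kap e has_derivative (%h. h $ 1 * dkap 1 e v + h $ 2 * dkap 2 e v)) (at v)"
proof -
 have Q: "v \<bullet> v + e \<noteq> 0" using assms inner_ge_zero[of v] by linarith
 have q: "((%v. v \<bullet> v + e) has_derivative (%h. 2 * (h \<bullet> v))) (at v)"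
  by (auto intro!: derivative_eq_intros simp: inner_commute)
 have q2: "((%v. (v \<bullet> v + e)^2) has_derivative (%h. 4 * (h \<bullet> v) * (v \<bullet> v + e))) (at v)"
  by (rule has_derivative_eq_rhs[OF has_derivative_power[OF q]]) (simp add: fun_eq_iff)
 have Q2: "(v \<bullet> v + e)^2 \<noteq> 0" using Q by simp
 have c3: "inverse (Q^2) * (4 * d * Q) * inverse (Q^2) = 4 * d * inverse (Q ^ 3)" if "Q \<noteq> 0" for Q d :: real
  using that by (simp add: power2_eq_square power3_eq_cube)
 show ?thesis unfolding kap_def[abs_def]
  by (rule has_derivative_eq_rhs[OF Deriv.has_derivative_inverse[OF Q2 q2]])
   (simp only: fun_eq_iff c3[OF Q] dkap_def, simp add: inner_vec2[of _ v] algebra_simps)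
qed

lemma partial_kap_integral:
 fixes g :: "real^2 => complex"
 assumes "e > 0" and g: "integrable M g" and M: "sets M = sets borel"
 shows "partial i (%x. LINT z|M. g z * complex_of_real (kap e (x - z))) x = (LINT z|M. g z * complex_of_real (dkap i e (x - z)))"
  "integrable M (%z. g z * complex_of_real (dkap i e (x - z)))"
proof -
 obtain k1 k2 where k12: "k1 \<in> bounded_kernels e" "k2 \<in> bounded_kernels e"
  and dk: "\<And>v. (kap e has_derivative (%h. h $ 1 * k1 v + h $ 2 * k2 v)) (at v)"
  and d: "\<And>x. ((%x. LINT z|M. g z * complex_of_real (kap e (x - z))) has_derivative (%h. h $ 1 *\<^sub>R (LINT z|M. g z * complex_of_real (k1 (x - z))) + h $ 2 *\<^sub>R (LINT z|M. g z * complex_of_real (k2 (x - z))))) (at x)"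
  using kernel_integral_derivative[OF assms(1) kap_bounded_kernel g M] by blast
 have eq: "h $ 1 * k1 v + h $ 2 * k2 v = h $ 1 * dkap 1 e v + h $ 2 * dkap 2 e v" for h :: "real^2" and v
  using has_derivative_unique[OF dk has_derivative_kap[OF assms(1)], of v] by (simp add: fun_eq_iff)
 have k: "k1 = dkap 1 e" "k2 = dkap 2 e"
  using eq[of "axis 1 1"] eq[of "axis 2 1"] by (auto simp: fun_eq_iff axis_def)
 consider "i = 1" | "i = 2" using exhaust_2[of i] by blast
 then show "partial i (%x. LINT z|M. g z * complex_of_real (kap e (x - z))) x = (LINT z|M. g z * complex_of_real (dkap i e (x - z)))"
  using partial_eq[OF d, of i x] by cases (simp_all add: k axis_def)
 show "integrable M (%z. g z * complex_of_real (dkap i e (x - z)))"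
  using exhaust_2[of i] integrable_kernel[OF assms(1) k12(1) g M, of x] integrable_kernel[OF assms(1) k12(2) g M, of x] by (auto simp: k)
qed

section \<open>Integrals of the kernels over the plane\<close>

lemma nn_integral_even_le:
 fixes f :: "real => ennreal"
 assumes [measurable]: "f \<in> borel_measurable borel" and "\<And>s. f (- s) = f s"
 shows "(\<integral>\<^sup>+s. f (s - m) \<partial>lborel) <= 2 * (\<integral>\<^sup>+s. f s * indicator {0..} s \<partial>lborel)"
proof -
 have "(\<integral>\<^sup>+s. f (s - m) \<partial>lborel) = (\<integral>\<^sup>+s. f s \<partial>lborel)"
  using nn_integral_real_affine[of "%s. f (s - m)" 1 m] by simp
 also have "\<dots> <= (\<integral>\<^sup>+s. f s * indicator {0..} s + f (- s) * indicator {0..} (- s) \<partial>lborel)"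
  by (intro nn_integral_mono) (auto simp: assms(2) indicator_def)
 also have "\<dots> = (\<integral>\<^sup>+s. f s * indicator {0..} s \<partial>lborel) + (\<integral>\<^sup>+s. f (- s) * indicator {0..} (- s) \<partial>lborel)"
  by (rule nn_integral_add) measurable
 also have "(\<integral>\<^sup>+s. f (- s) * indicator {0..} (- s) \<partial>lborel) = (\<integral>\<^sup>+s. f s * indicator {0..} s \<partial>lborel)"
  using nn_integral_real_affine[of "%s. f s * indicator {0..} s" "-1" 0] by simp
 finally show ?thesis by (simp add: mult_2)
qed

text \<open>The exact value is pi / sqrt beta; 4 is used in place of pi.\<close>

lemma nn_integral_inverse_square_plus_le:
 assumes "\<beta> > 0"
 shows "(\<integral>\<^sup>+s. ennreal (1 / ((s - m)^2 + \<beta>)) \<partial>lborel) <= ennreal (4 / sqrt \<beta>)"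
proof -
 have "(\<integral>\<^sup>+s. ennreal (1 / (s^2 + \<beta>)) * indicator {0..} s \<partial>lborel) = ennreal (pi / 2 / sqrt \<beta> - arctan (0 / sqrt \<beta>) / sqrt \<beta>)"
 proof (rule nn_integral_FTC_atLeast)
  fix s :: real
  have "(1 + (s / sqrt \<beta>)^2) * \<beta> = s^2 + \<beta>" using assms by (simp add: power_divide algebra_simps)
  then have "1 / (1 + (s / sqrt \<beta>)^2) / (sqrt \<beta> * sqrt \<beta>) = 1 / (s^2 + \<beta>)" using assms by simp
  moreover have "DERIV (%s. arctan (s / sqrt \<beta>) / sqrt \<beta>) s :> inverse (1 + (s / sqrt \<beta>)^2) * (1 / sqrt \<beta>) / sqrt \<beta>"
   by (rule DERIV_cdivide[OF DERIV_chain2[OF DERIV_arctan DERIV_cdivide[OF DERIV_ident]]])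
  moreover have "inverse (1 + (s / sqrt \<beta>)^2) * (1 / sqrt \<beta>) / sqrt \<beta> = 1 / (1 + (s / sqrt \<beta>)^2) / (sqrt \<beta> * sqrt \<beta>)"
   by (simp only: divide_inverse mult_1 inverse_mult_distrib mult.assoc)
  ultimately show "DERIV (%s. arctan (s / sqrt \<beta>) / sqrt \<beta>) s :> 1 / (s^2 + \<beta>)"
   by (simp only:)
  show "0 <= 1 / (s^2 + \<beta>)" using assms by simp
 next
  have "filterlim (%s. s / sqrt \<beta>) at_top at_top"
   using filterlim_tendsto_pos_mult_at_top[OF tendsto_const[of "inverse (sqrt \<beta>)"] _ filterlim_ident] assms
   by (simp add: divide_inverse mult.commute)
  then show "((%s. arctan (s / sqrt \<beta>) / sqrt \<beta>) \<longlongrightarrow> pi / 2 / sqrt \<beta>) at_top"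
   by (intro tendsto_divide tendsto_const filterlim_compose[OF tendsto_arctan_at_top]) (use assms in auto)
 qed simp
 also have "\<dots> <= ennreal (2 / sqrt \<beta>)"
 proof (rule ennreal_leI)
  have "pi / 2 / sqrt \<beta> <= 2 / sqrt \<beta>" using pi_less_4 assms by (intro divide_right_mono) auto
  then show "pi / 2 / sqrt \<beta> - arctan (0 / sqrt \<beta>) / sqrt \<beta> <= 2 / sqrt \<beta>" by simp
 qed
 finally have "2 * (\<integral>\<^sup>+s. ennreal (1 / (s^2 + \<beta>)) * indicator {0..} s \<partial>lborel) <= 2 * ennreal (2 / sqrt \<beta>)"
  by (rule mult_left_mono) simp
 also have "\<dots> = ennreal (4 / sqrt \<beta>)"
  using assms ennreal_mult[of 2 "2 / sqrt \<beta>"] by simp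
 finally show ?thesis
  using order_trans[OF nn_integral_even_le[of "%s. ennreal (1 / (s^2 + \<beta>))" m]] by simp
qed

lemma nn_integral_product_pt:
 assumes [measurable]: "a \<in> borel_measurable borel" "b \<in> borel_measurable borel" "f \<in> borel_measurable borel"
  and le: "\<And>s t. f (pt 1 s t) <= a s * b t" and A: "(\<integral>\<^sup>+s. a s \<partial>lborel) <= A" and B: "(\<integral>\<^sup>+t. b t \<partial>lborel) <= B"
 shows "(\<integral>\<^sup>+x. f x \<partial>lborel) <= A * B"
proof -
 have "(\<integral>\<^sup>+x. f x \<partial>lborel) = (\<integral>\<^sup>+t. (\<integral>\<^sup>+s. f (pt 1 s t) \<partial>lborel) \<partial>lborel)" by (rule nn_integral_lborel_pt) fact
 also have "\<dots> <= (\<integral>\<^sup>+t. (\<integral>\<^sup>+s. a s * b t \<partial>lborel) \<partial>lborel)" by (intro nn_integral_mono le)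
 also have "\<dots> = (\<integral>\<^sup>+s. a s \<partial>lborel) * (\<integral>\<^sup>+t. b t \<partial>lborel)" by (simp add: nn_integral_multc nn_integral_cmult)
 also have "\<dots> <= A * B" by (intro mult_mono A B) auto
 finally show ?thesis .
qed

lemma inner_pt_diff: "(pt 1 s t - y) \<bullet> (pt 1 s t - y) = (s - y $ 1)^2 + (t - y $ 2)^2"
 by (simp add: inner_vec2 power2_eq_square)

text \<open>The variables separate because (X + Y + beta)^2 is at least (X + beta) (Y + beta) for
  nonnegative X and Y.\<close>

lemma nn_integral_kernel_plane:
 assumes "\<beta> > 0"
 shows "(\<integral>\<^sup>+x. ennreal (1 / ((x - y) \<bullet> (x - y) + \<beta>)^2) \<partial>(lborel :: (real^2) measure)) <= ennreal (16 / \<beta>)"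
proof -
 have "(\<integral>\<^sup>+x. ennreal (1 / ((x - y) \<bullet> (x - y) + \<beta>)^2) \<partial>(lborel :: (real^2) measure)) <= ennreal (4 / sqrt \<beta>) * ennreal (4 / sqrt \<beta>)"
 proof (rule nn_integral_product_pt[OF _ _ _ _ nn_integral_inverse_square_plus_le[OF assms] nn_integral_inverse_square_plus_le[OF assms]])
  fix s t :: real
  let ?X = "(s - y $ 1)^2" and ?Y = "(t - y $ 2)^2"
  have "(?X + \<beta>) * (?Y + \<beta>) <= (?X + ?Y + \<beta>) * (?X + ?Y + \<beta>)" using assms by (intro mult_mono) auto
  then have "1 / (?X + ?Y + \<beta>)^2 <= 1 / ((?X + \<beta>) * (?Y + \<beta>))"
   using assms by (intro divide_left_mono) (auto simp: power2_eq_square intro!: mult_pos_pos add_nonneg_pos)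
  then show "ennreal (1 / ((pt 1 s t - y) \<bullet> (pt 1 s t - y) + \<beta>)^2) <= ennreal (1 / (?X + \<beta>)) * ennreal (1 / (?Y + \<beta>))"
   unfolding inner_pt_diff using assms by (subst ennreal_mult[symmetric]) (auto intro!: ennreal_leI)
 qed measurable
 also have "\<dots> = ennreal (16 / \<beta>)" using assms by (subst ennreal_mult[symmetric]) auto
 finally show ?thesis .
qed

text \<open>With a and b the coordinate distances, |x - z| is at least sqrt (a b), so the
  singularity separates into two integrable inverse square roots.\<close>

lemma nn_integral_inverse_norm:
 assumes "\<rho> > 0"
 shows "(\<integral>\<^sup>+x. ennreal (1 / norm (x - z)) * indicator {x. \<forall>i. \<bar>x $ i - z $ i\<bar> <= \<rho>} x \<partial>(lborel :: (real^2) measure)) <= ennreal (16 * \<rho>)"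
proof -
 \<comment> \<open>The value at 0 is infinite so that the product bound also holds on the two axes
   through \<open>z\<close>; the integral does not see this null set.\<close>
 define f where "f s = (if \<bar>s\<bar> <= \<rho> then if s = 0 then \<infinity> else ennreal (\<bar>s\<bar> powr (- 1 / 2)) else 0)" for s :: real
 have [measurable]: "f \<in> borel_measurable borel" unfolding f_def by measurable
 have "(\<integral>\<^sup>+s. f s * indicator {0..} s \<partial>lborel) = (\<integral>\<^sup>+s. ennreal (s powr (- 1 / 2)) * indicator {0..\<rho>} s \<partial>lborel)"
  by (rule nn_integral_cong_AE, use AE_lborel_singleton[of "0::real"] in eventually_elim) (auto simp: f_def indicator_def)
 also have "\<dots> = ennreal (\<rho> powr (- 1 / 2 + 1) / (- 1 / 2 + 1))"
  by (rule nn_integral_has_integral_lebesgue'[OF _ has_integral_powr_from_0]) (use assms in auto)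
 also have "\<rho> powr (- 1 / 2 + 1) / (- 1 / 2 + 1) = 2 * sqrt \<rho>" using assms by (simp add: powr_half_sqrt)
 finally have "2 * (\<integral>\<^sup>+s. f s * indicator {0..} s \<partial>lborel) = ennreal (4 * sqrt \<rho>)"
  using ennreal_mult[of 2 "2 * sqrt \<rho>"] assms by simp
 then have I: "(\<integral>\<^sup>+s. f (s - m) \<partial>lborel) <= ennreal (4 * sqrt \<rho>)" for m
  using nn_integral_even_le[of f m] by (auto simp: f_def)
 have m: "{x :: real^2. \<forall>i. \<bar>x $ i - z $ i\<bar> <= \<rho>} \<in> sets borel"
  unfolding forall_2 by measurable
 have "(\<integral>\<^sup>+x. ennreal (1 / norm (x - z)) * indicator {x. \<forall>i. \<bar>x $ i - z $ i\<bar> <= \<rho>} x \<partial>(lborel :: (real^2) measure))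
   <= ennreal (4 * sqrt \<rho>) * ennreal (4 * sqrt \<rho>)"
 proof (rule nn_integral_product_pt[OF _ _ _ _ I I])
  fix s t :: real
  define a b where "a = \<bar>s - z $ 1\<bar>" and "b = \<bar>t - z $ 2\<bar>"
  have n: "norm (pt 1 s t - z) = sqrt (a^2 + b^2)"
   unfolding norm_eq_sqrt_inner inner_pt_diff by (simp add: a_def b_def)
  consider "a > \<rho> \<or> b > \<rho>" | "a <= \<rho>" "b <= \<rho>" "a = 0 \<or> b = 0" | "a <= \<rho>" "b <= \<rho>" "0 < a" "0 < b"
   unfolding a_def b_def by fastforce
  then show "ennreal (1 / norm (pt 1 s t - z)) * indicator {x. \<forall>i. \<bar>x $ i - z $ i\<bar> <= \<rho>} (pt 1 s t) <= f (s - z $ 1) * f (t - z $ 2)"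
  proof cases
   case 1
   then show ?thesis by (auto simp: forall_2 a_def b_def)
  next
   case 2
   then have "f (s - z $ 1) * f (t - z $ 2) = \<infinity>"
    by (auto simp: a_def b_def f_def ennreal_mult_top ennreal_top_mult)
   then show ?thesis by simp
  next
   case 3
   have "a * b <= a^2 + b^2" using 3 sum_squares_bound[of a b] by (simp add: order_trans[OF _ sum_squares_bound])
   then have "sqrt (a * b) <= norm (pt 1 s t - z)" unfolding n by simp
   then have "1 / norm (pt 1 s t - z) <= 1 / sqrt (a * b)" using 3 by (intro divide_left_mono) (auto simp: n intro!: mult_pos_pos add_pos_pos)
   also have "\<dots> = a powr (- 1 / 2) * b powr (- 1 / 2)"
    using 3 by (simp add: powr_minus powr_half_sqrt real_sqrt_mult field_simps)
   finally have "ennreal (1 / norm (pt 1 s t - z)) <= ennreal (a powr (- 1 / 2)) * ennreal (b powr (- 1 / 2))"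
    by (subst ennreal_mult[symmetric]) (auto intro!: ennreal_leI)
   moreover have "f (s - z $ 1) = ennreal (a powr (- 1 / 2))" "f (t - z $ 2) = ennreal (b powr (- 1 / 2))"
    using 3 by (auto simp: f_def a_def b_def)
   ultimately show ?thesis by (auto simp: indicator_def)
  qed
 qed (use m in measurable)
 also have "\<dots> = ennreal (16 * \<rho>)" using assms by (subst ennreal_mult[symmetric]) auto
 finally show ?thesis .
qed

text \<open>The parameter interval of radius \<open>r\<close> about that of \<open>y\<close>,
  clipped to the edge, keeps length at least \<open>min r (dist p q)\<close>, the worst case being
  an end point.\<close>

lemma emeasure_edge_measure_cball:
 assumes "p \<noteq> q" "y \<in> closed_segment p q" "r > 0"
 shows "ennreal (min r (dist p q)) <= emeasure (edge_measure (p, q)) (cball y r)"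
proof -
 define L where "L = dist p q"
 have L: "L > 0" using assms(1) by (simp add: L_def)
 obtain u where u: "0 <= u" "u <= 1" "y = (1 - u) *\<^sub>R p + u *\<^sub>R q"
  using assms(2) by (auto simp: closed_segment_def)
 define t0 where "t0 = u * L"
 have t0: "0 <= t0" "t0 <= L" using u L by (auto simp: t0_def mult_left_le_one_le)
 have d: "dist y (p + (t / L) *\<^sub>R (q - p)) = \<bar>t - t0\<bar>" for t
 proof -
  have "y - (p + (t / L) *\<^sub>R (q - p)) = (u - t / L) *\<^sub>R (q - p)" by (simp add: u(3) algebra_simps)
  then have "dist y (p + (t / L) *\<^sub>R (q - p)) = \<bar>u - t / L\<bar> * L" by (simp add: dist_norm L_def norm_minus_commute)
  also have "\<dots> = \<bar>(u - t / L) * L\<bar>" using L by (simp add: abs_mult)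
  also have "(u - t / L) * L = t0 - t" using L by (simp add: t0_def field_simps)
  finally show ?thesis by simp
 qed
 define a b where "a = max 0 (t0 - r)" and "b = min L (t0 + r)"
 have ab: "min r L <= b - a" "a <= b" using assms(3) L t0 by (auto simp: a_def b_def)
 have "ennreal (min r L) <= emeasure lborel {a..b}" using ab by (simp add: ennreal_leI)
 also have "\<dots> = (\<integral>\<^sup>+t. indicator {a..b} t \<partial>lborel)" by simp
 also have "\<dots> <= (\<integral>\<^sup>+t. indicator (cball y r) (p + (t / L) *\<^sub>R (q - p)) * indicator {0..L} t \<partial>lborel)"
  by (intro nn_integral_mono) (auto simp: indicator_def d a_def b_def)
 also have "\<dots> = (\<integral>\<^sup>+x. indicator (cball y r) x \<partial>edge_measure (p, q))"
  unfolding L_def by (rule nn_integral_edge_measure[symmetric]) (auto intro!: borel_measurable_indicator borel_closed)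
 also have "\<dots> = emeasure (edge_measure (p, q)) (cball y r)" by (simp add: borel_closed)
 finally show ?thesis by (simp add: L_def)
qed

lemma negligible_edge_points:
 assumes "finite E"
 shows "negligible (edge_points E)"
 unfolding edge_points_def case_prod_beta
proof (rule negligible_Union)
 have "negligible (closed_segment p q)" for p q :: "real^2"
  by (subst negligible_convex_interior) (auto intro!: interior_closed_segment_ge2)
 then show "negligible T" if "T \<in> (%e. closed_segment (fst e) (snd e)) ` E" for T using that by blast
qed (use assms in simp)

section \<open>Extension of the boundary datum into the plane\<close>

text \<open>The mass condition is the lower half of one-dimensional Ahlfors regularity, at scales up
  to \<open>R\<close>. It is the only quantitative geometric input to the extension; corners and the
  way in which edges meet do not enter.\<close>

locale regular_measure =
 fixes M :: "(real^2) measure" and S :: "(real^2) set" and c R :: real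
 assumes sets_M [simp, measurable_cong]: "sets M = sets borel" and fin: "finite_measure M"
  and AE_S: "AE z in M. z \<in> S" and S: "closed S" "negligible S" "S \<noteq> {}"
  and c: "c > 0" and R: "R > 0"
  and mass: "\<And>y r. y \<in> S ==> 0 < r ==> r <= R ==> ennreal (c * r) <= emeasure M (cball y r)"

lemma regular_measure_arclength:
 assumes E: "finite E" "E \<noteq> {}" "\<And>p q. (p, q) \<in> E ==> p \<noteq> q" and R: "R > 0"
 shows "\<exists>c. regular_measure (arclength E) (edge_points E) c R"
proof -
 define L where "L = Min ((%(p, q). dist p q) ` E)"
 have L: "L > 0" using E unfolding L_def by (subst Min_gr_iff) auto
 have Le: "L <= dist p q" if "(p, q) \<in> E" for p q
  unfolding L_def using that E(1) by (intro Min_le) (auto intro!: image_eqI[of _ _ "(p, q)"])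
 \<comment> \<open>For r <= R both \<open>r\<close> and the shortest edge length \<open>L\<close>
   are then at least c r.\<close>
 define c where "c = min 1 (L / R)"
 have "regular_measure (arclength E) (edge_points E) c R"
 proof (rule regular_measure.intro)
  show "sets (arclength E) = sets borel" by simp
  show "finite_measure (arclength E)" by (rule finite_measure_arclength[OF E(1)])
  show "AE z in arclength E. z \<in> edge_points E" by (rule AE_arclength_edge_points[OF E(1)])
  show "closed (edge_points E)" "negligible (edge_points E)" using closed_edge_points[OF E(1)] negligible_edge_points[OF E(1)] by auto
  show "edge_points E \<noteq> {}" using E(2) by (force simp: edge_points_def)
  show "c > 0" "R > 0" using R L by (auto simp: c_def)
  fix y r assume y: "y \<in> edge_points E" and r: "0 < r" "r <= R"
  obtain p q where pq: "(p, q) \<in> E" "y \<in> closed_segment p q" using y by (auto simp: edge_points_def)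
  have "c * r <= r" using r by (simp add: c_def mult_le_cancel_right1)
  moreover have "c * r <= dist p q"
  proof -
   have "c * r <= L / R * R" using r R L by (intro mult_mono) (auto simp: c_def)
   with Le[OF pq(1)] R show ?thesis by simp
  qed
  ultimately have "ennreal (c * r) <= ennreal (min r (dist p q))" by (intro ennreal_leI) simp
  also have "\<dots> <= emeasure (edge_measure (p, q)) (cball y r)"
   by (rule emeasure_edge_measure_cball[OF E(3)[OF pq(1)] pq(2) r(1)])
  also have "\<dots> <= (\<Sum>e\<in>E. emeasure (edge_measure e) (cball y r))"
   using E(1) pq(1) by (rule member_le_sum[rotated 2]) simp
  also have "\<dots> = emeasure (arclength E) (cball y r)" by (rule emeasure_arclength[symmetric]) (simp add: borel_closed)
  finally show "ennreal (c * r) <= emeasure (arclength E) (cball y r)" .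
 qed
 then show ?thesis ..
qed

lemma measurable_vec_nth2 [measurable]: "(%v :: real^2. v $ i) \<in> borel_measurable borel"
 by (intro borel_measurable_continuous_onI continuous_intros)

lemma measurable_kap [measurable]: "kap e \<in> borel_measurable borel" "dkap i e \<in> borel_measurable borel"
 unfolding kap_def[abs_def] dkap_def[abs_def] by measurable

lemma kap_eq_square: "kap e v = (inverse (v \<bullet> v + e))^2"
 by (simp add: kap_def power_inverse)

lemma component_square_le: "(v $ i)^2 <= v \<bullet> v" for v :: "real^2"
 unfolding inner_vec2 using exhaust_2[of i] by (auto simp: power2_eq_square)

lemma kap_bound:
 assumes "d > 0" "d <= v \<bullet> v + e" "e \<ge> 0"
 shows "\<bar>kap e v\<bar> <= 4 * (inverse d ^ 2 + inverse d ^ 3)" "\<bar>dkap i e v\<bar> <= 4 * (inverse d ^ 2 + inverse d ^ 3)"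
proof -
 define Q where "Q = v \<bullet> v + e"
 define j where "j = inverse Q"
 have Q: "Q > 0" "Q \<ge> d" using assms by (auto simp: Q_def)
 have j: "0 < j" "j <= inverse d" "Q * j = 1" using Q assms(1) by (auto simp: j_def intro: le_imp_inverse_le)
 have p: "j ^ 2 <= inverse d ^ 2" "j ^ 3 <= inverse d ^ 3" using j by (auto intro: power_mono)
 have d0: "0 <= inverse d ^ 2" "0 <= inverse d ^ 3" using assms(1) by auto
 have le: "a <= 4 * (b + c)" if "a <= b" "0 <= b" "0 <= c" for a b c :: real using that by simp
 have k: "kap e v = j^2" by (simp add: kap_eq_square j_def Q_def)
 show "\<bar>kap e v\<bar> <= 4 * (inverse d ^ 2 + inverse d ^ 3)" 
  by (simp only: k abs_of_nonneg[OF zero_le_power2] le[OF p(1) d0])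
 have dk: "dkap i e v = - 4 * v $ i * j ^ 3" by (simp add: dkap_def j_def Q_def power_inverse)
 have "\<bar>v $ i\<bar> <= 1 + (v $ i)^2"
  using zero_le_power2[of "\<bar>v $ i\<bar> - 1"] by (simp add: power2_diff)
 also have "\<dots> <= 1 + Q" using component_square_le[of v i] assms(3) by (simp add: Q_def)
 finally have "\<bar>v $ i\<bar> * j ^ 3 <= (1 + Q) * j ^ 3" using j by (intro mult_right_mono) auto
 also have "\<dots> = j ^ 3 + (Q * j) * j ^ 2" by (simp add: algebra_simps power3_eq_cube power2_eq_square)
 also have "\<dots> = j ^ 3 + j ^ 2" by (simp add: j)
 finally show "\<bar>dkap i e v\<bar> <= 4 * (inverse d ^ 2 + inverse d ^ 3)" using p j(1) by (simp add: dk abs_mult)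
qed

text \<open>\<open>A\<close> and \<open>B\<close> stand for the regularised squared distances from x
  to y and to z, \<open>w\<close> for the total weight and \<open>T\<close> for the final
  denominator. The bound w^(-2) <= C^2 X^3 is used with X the smaller of \<open>A\<close> and
  \<open>B\<close>; the larger one is at least T / 4.\<close>

lemma kernel_weight_le:
 fixes A B w T C :: real
 assumes "A > 0" "B > 0" "w > 0" "T > 0" "T <= 2 * (A + B)" "1 <= C * sqrt A ^ 3 * w" "1 <= C * sqrt B ^ 3 * w"
 shows "16 * inverse A ^ 3 * inverse B ^ 2 / w^2 <= 256 * C^2 / T^2"
proof -
 have sq: "inverse w ^ 2 <= C^2 * X ^ 3" if "X > 0" "1 <= C * sqrt X ^ 3 * w" for X
 proof -
  have "1^2 <= (C * sqrt X ^ 3 * w)^2" by (rule power_mono[OF that(2)]) simp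
  also have "\<dots> = C^2 * X ^ 3 * w^2"
  proof -
   have "(sqrt X ^ 3)^2 = ((sqrt X)^2) ^ 3" by (simp only: power_mult[symmetric] mult.commute)
   then show ?thesis using that(1) by (simp add: power_mult_distrib)
  qed
  finally have "1 * inverse w ^ 2 <= C^2 * X ^ 3 * w^2 * inverse w ^ 2" by (intro mult_right_mono) auto
  also have "\<dots> = C^2 * X ^ 3" using assms(3) by (simp add: power_inverse)
  finally show ?thesis by simp
 qed
 have T: "inverse X ^ 2 <= 16 / T^2" if "X > 0" "T <= 4 * X" for X
 proof -
  have "T^2 <= (4 * X)^2" using that assms by (intro power_mono) auto
  then show ?thesis using that assms(4) by (simp add: field_simps power_inverse power_mult_distrib)
 qed
 have "inverse A ^ 3 * inverse B ^ 2 * inverse w ^ 2 <= C^2 * (16 / T^2)"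
 proof (cases "A <= B")
  case True
  have "inverse A ^ 3 * inverse B ^ 2 * inverse w ^ 2 <= inverse A ^ 3 * inverse B ^ 2 * (C^2 * A ^ 3)"
   using assms by (intro mult_left_mono sq) auto
  also have "\<dots> = C^2 * inverse B ^ 2" using assms by (simp add: power_inverse)
  also have "\<dots> <= C^2 * (16 / T^2)" using assms True by (intro mult_left_mono T) auto
  finally show ?thesis .
 next
  case False
  have "inverse A ^ 3 * inverse B ^ 2 * inverse w ^ 2 <= inverse A ^ 3 * inverse B ^ 2 * (C^2 * B ^ 3)"
   using assms by (intro mult_left_mono sq) auto
  also have "\<dots> = C^2 * (inverse A ^ 3 * B)"
  proof -
   have "inverse B ^ 2 * B ^ 3 = B" using assms(2) by (simp add: field_simps power2_eq_square power3_eq_cube)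
   then show ?thesis by (simp only: mult.assoc mult.left_commute[of "inverse B ^ 2"]) (simp only: mult.left_commute)
  qed
  also have "\<dots> <= C^2 * (inverse A ^ 3 * A)" using assms False by (intro mult_left_mono) auto
  also have "\<dots> = C^2 * inverse A ^ 2" using assms by (simp add: power3_eq_cube power2_eq_square)
  also have "\<dots> <= C^2 * (16 / T^2)" using assms False by (intro mult_left_mono T) auto
  finally show ?thesis .
 qed
 then show ?thesis by (simp add: divide_inverse power_inverse)
qed

context regular_measure
begin

sublocale finite_measure M by (rule fin)

definition wt :: "real => real^2 => real" where "wt e x = (LINT z|M. kap e (x - z))"

definition ext :: "(real^2 => complex) => real => real^2 => complex" where
 "ext g e x = (LINT z|M. g z * complex_of_real (kap e (x - z))) / complex_of_real (wt e x)"

text \<open>The quotient rule for \<open>ext\<close>, arranged so that \<open>g\<close> enters only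
  through differences from its average; this is what later exposes the H^{1/2} density.\<close>

definition dext :: "2 => (real^2 => complex) => real => real^2 => complex" where
 "dext i g e x = (LINT y|M. (g y - ext g e x) * complex_of_real (dkap i e (x - y))) / complex_of_real (wt e x)"

text \<open>The kernel seen from \<open>x\<close> is nonsingular on \<open>S\<close>: either e > 0,
  or e = 0 and \<open>x\<close> keeps a distance from \<open>S\<close>. The companion
  \<open>near\<close> says that the scales involved do not exceed \<open>R\<close>, up to which the
  mass bound holds.\<close>

definition good :: "real => real^2 => bool" where
 "good e x \<longleftrightarrow> 0 <= e \<and> (\<exists>d>0. \<forall>z\<in>S. d <= (x - z) \<bullet> (x - z) + e)"

definition near :: "real => real^2 => bool" where
 "near e x \<longleftrightarrow> (\<forall>y\<in>S. (x - y) \<bullet> (x - y) + e <= R^2)"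

lemma good_pos: "e > 0 ==> good e x"
 unfolding good_def by (auto intro!: exI[of _ e])

lemma off_S:
 assumes "x \<notin> S"
 obtains d where "d > 0" "\<And>z e. z \<in> S ==> 0 <= e ==> d <= (x - z) \<bullet> (x - z) + e"
proof -
 obtain r where r: "r > 0" "ball x r \<subseteq> - S"
  using assms S(1) open_Compl[of S] by (metis ComplI open_contains_ball)
 have "r^2 <= (x - z) \<bullet> (x - z) + e" if "z \<in> S" "0 <= e" for z e
 proof -
  have "r <= norm (x - z)" using r(2) that(1) by (force simp: dist_norm subset_iff not_less)
  then have "r^2 <= (norm (x - z))^2" using r(1) by (intro power_mono) auto
  then show ?thesis using that(2) by (simp add: power2_norm_eq_inner)
 qed
 with r(1) show thesis by (intro that[of "r^2"]) auto
qed

lemma good_off: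
 assumes "x \<notin> S" "0 <= e"
 shows "good e x"
proof (rule off_S[OF assms(1)])
 fix d :: real assume "d > 0" "\<And>z e. z \<in> S ==> 0 <= e ==> d <= (x - z) \<bullet> (x - z) + e"
 then show "good e x" unfolding good_def using assms(2) by blast
qed

lemma integrable_mult_bounded:
 fixes g :: "real^2 => complex"
 assumes g: "integrable M g" and [measurable]: "k \<in> borel_measurable borel" and B: "\<And>z. z \<in> S ==> \<bar>k z\<bar> <= B"
 shows "integrable M (%z. g z * complex_of_real (k z))"
proof (rule Bochner_Integration.integrable_bound)
 show "integrable M (%z. B * norm (g z))" using g by simp
 have [measurable]: "g \<in> borel_measurable M" using g by auto
 show "(%z. g z * complex_of_real (k z)) \<in> borel_measurable M" by measurable
 show "AE z in M. norm (g z * complex_of_real (k z)) <= norm (B * norm (g z))"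
  using AE_S
 proof eventually_elim
  fix z assume "z \<in> S"
  have "norm (g z) * \<bar>k z\<bar> <= norm (g z) * \<bar>B\<bar>" using B[OF \<open>z \<in> S\<close>] by (intro mult_left_mono) auto
  then show "norm (g z * complex_of_real (k z)) <= norm (B * norm (g z))" by (simp add: norm_mult abs_mult mult.commute)
 qed
qed

lemma integrable_kap:
 assumes "good e x" "integrable M g"
 shows "integrable M (%z. g z * complex_of_real (kap e (x - z)))" "integrable M (%z. g z * complex_of_real (dkap i e (x - z)))"
proof -
 obtain d where d: "d > 0" "\<And>z. z \<in> S ==> d <= (x - z) \<bullet> (x - z) + e" "0 <= e" using assms(1) by (auto simp: good_def)
 have m: "(%z. kap e (x - z)) \<in> borel_measurable borel" "(%z. dkap i e (x - z)) \<in> borel_measurable borel" by measurable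
 show "integrable M (%z. g z * complex_of_real (kap e (x - z)))"
  by (rule integrable_mult_bounded[OF assms(2) m(1)]) (rule kap_bound(1)[OF d(1) d(2,3)])
 show "integrable M (%z. g z * complex_of_real (dkap i e (x - z)))"
  by (rule integrable_mult_bounded[OF assms(2) m(2)]) (rule kap_bound(2)[OF d(1) d(2,3)])
qed

lemma integrable_kap_real: "good e x ==> integrable M (%z. kap e (x - z))" 
 using integrable_kap(1)[of e x "%_. 1"] by (simp add: complex_of_real_integrable_eq)

lemma of_real_wt: "complex_of_real (wt e x) = (LINT z|M. 1 * complex_of_real (kap e (x - z)))"
 unfolding wt_def by simp

lemma nn_integral_kap: "good e x ==> (\<integral>\<^sup>+z. ennreal (kap e (x - z)) \<partial>M) = ennreal (wt e x)"
 unfolding wt_def by (intro nn_integral_eq_integral integrable_kap_real) (auto simp: kap_nonneg)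

text \<open>With q^2 = |x - y|^2 + e the kernel is at least (4 q^2)^(-2) at the points of
  \<open>S\<close> in the ball of radius q about \<open>y\<close>, whose mass is at least c q; the
  product is c / (16 q^3).\<close>

lemma wt_lower:
 assumes g: "good e x" and n: "near e x" and y: "y \<in> S"
 shows "1 <= 16 / c * sqrt ((x - y) \<bullet> (x - y) + e) ^ 3 * wt e x"
proof -
 define Q where "Q = (x - y) \<bullet> (x - y) + e"
 define q where "q = sqrt Q"
 have Q: "0 < Q" "Q <= R^2" "0 <= e" using g n y by (force simp: good_def near_def Q_def)+
 have q: "0 < q" "q <= R" "q^2 = Q" using Q R by (auto simp: q_def intro: real_le_lsqrt)
 have k: "inverse ((4 * q^2)^2) <= kap e (x - z)" if z: "z \<in> S" "z \<in> cball y q" for z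
 proof -
  obtain d where d: "d > 0" "\<And>z. z \<in> S ==> d <= (x - z) \<bullet> (x - z) + e" using g by (auto simp: good_def)
  have "(norm (x - z))^2 <= 2 * (norm (x - y))^2 + 2 * (norm (y - z))^2"
   using power2_norm_add_le[of "x - y" "y - z"] by simp
  also have "(norm (y - z))^2 <= q^2" using z(2) by (intro power_mono) (auto simp: dist_norm)
  finally have "(x - z) \<bullet> (x - z) + e <= 4 * q^2"
   using Q(3) by (simp add: q(3) Q_def power2_norm_eq_inner)
  moreover have "0 < (x - z) \<bullet> (x - z) + e" using d(1) d(2)[OF z(1)] by linarith
  ultimately show ?thesis unfolding kap_def by (intro le_imp_inverse_le power_mono) auto
 qed
 have "ennreal (inverse ((4 * q^2)^2)) * ennreal (c * q) <= ennreal (inverse ((4 * q^2)^2)) * emeasure M (cball y q)"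
  by (intro mult_left_mono mass y q) simp
 also have "\<dots> = (\<integral>\<^sup>+z. ennreal (inverse ((4 * q^2)^2)) * indicator (cball y q) z \<partial>M)"
  by (rule nn_integral_cmult_indicator[symmetric]) (simp add: borel_closed)
 also have "\<dots> <= (\<integral>\<^sup>+z. ennreal (kap e (x - z)) \<partial>M)"
  by (rule nn_integral_mono_AE, use AE_S in eventually_elim) (use k in \<open>auto simp del: mem_cball simp: indicator_def intro!: ennreal_leI\<close>)
 also have "\<dots> = ennreal (wt e x)" by (rule nn_integral_kap[OF g])
 finally have "ennreal (inverse ((4 * q^2)^2) * (c * q)) <= ennreal (wt e x)"
  by (subst ennreal_mult) (use c q in auto)
 moreover have "wt e x \<ge> 0" unfolding wt_def by (rule integral_nonneg_AE) (simp add: kap_nonneg)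
 ultimately have "inverse ((4 * q^2)^2) * (c * q) <= wt e x" by simp
 then have "16 / c * q ^ 3 * (inverse ((4 * q^2)^2) * (c * q)) <= 16 / c * q ^ 3 * wt e x"
  using c q by (intro mult_left_mono) auto
 moreover have "16 / c * q ^ 3 * (inverse ((4 * q^2)^2) * (c * q)) = 1"
  using c q(1) by (simp add: field_simps power2_eq_square power3_eq_cube)
 ultimately show ?thesis by (simp add: q_def Q_def)
qed

lemma wt_pos:
 assumes "good e x" "near e x"
 shows "wt e x > 0"
proof (rule ccontr)
 obtain y where y: "y \<in> S" using S(3) by blast
 have e: "0 <= e" using assms(1) by (simp add: good_def)
 assume "\<not> wt e x > 0"
 then have "16 / c * sqrt ((x - y) \<bullet> (x - y) + e) ^ 3 * wt e x <= 0"
  using c e by (intro mult_nonneg_nonpos) auto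
 with wt_lower[OF assms y] show False by linarith
qed

text \<open>Jensen's inequality for the average with density kap / wt, obtained from Cauchy-Schwarz
  by splitting the kernel as a square.\<close>

lemma ext_deviation:
 assumes good: "good e x" and w: "wt e x > 0" and g: "integrable M g"
 shows "ennreal ((cmod (ext g e x - a))^2) <= (\<integral>\<^sup>+z. ennreal ((cmod (g z - a))^2 * kap e (x - z) / wt e x) \<partial>M)"
proof -
 define w where "w = wt e x"
 have w: "w > 0" using assms(2) by (simp add: w_def)
 define s where "s z = inverse ((x - z) \<bullet> (x - z) + e)" for z
 have [measurable]: "s \<in> borel_measurable borel" unfolding s_def by measurable
 have [measurable]: "g \<in> borel_measurable borel" using g by (auto simp: measurable_cong_sets[OF sets_M refl])
 have k: "kap e (x - z) = (s z)^2" for z by (simp add: kap_eq_square s_def)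
 define I where "I = (LINT z|M. (g z - a) * complex_of_real (s z) * complex_of_real (s z))"
 have "I = (LINT z|M. g z * complex_of_real (kap e (x - z)) - a * (1 * complex_of_real (kap e (x - z))))"
  unfolding I_def by (intro Bochner_Integration.integral_cong) (auto simp: k power2_eq_square algebra_simps)
 also have "\<dots> = (LINT z|M. g z * complex_of_real (kap e (x - z))) - a * complex_of_real w"
  unfolding w_def of_real_wt
  by (subst Bochner_Integration.integral_diff) (use integrable_kap(1)[OF good g] integrable_kap(1)[OF good, of "%_. 1"] in auto)
 finally have I: "ext g e x - a = I / complex_of_real w" using w by (simp add: ext_def w_def[symmetric] field_simps)
 have "ennreal ((cmod I)^2) <= (\<integral>\<^sup>+z. ennreal ((cmod ((g z - a) * complex_of_real (s z)))^2) \<partial>M) * (\<integral>\<^sup>+z. ennreal ((cmod (complex_of_real (s z)))^2) \<partial>M)"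
  unfolding I_def by (rule nn_integral_cmod_mult_le) measurable
 also have "(\<integral>\<^sup>+z. ennreal ((cmod (complex_of_real (s z)))^2) \<partial>M) = ennreal w"
  unfolding w_def nn_integral_kap[OF good, symmetric] by (simp add: k)
 also have "(\<integral>\<^sup>+z. ennreal ((cmod ((g z - a) * complex_of_real (s z)))^2) \<partial>M) = (\<integral>\<^sup>+z. ennreal ((cmod (g z - a))^2 * (s z)^2) \<partial>M)"
  by (simp add: norm_mult power_mult_distrib)
 finally have CS: "ennreal ((cmod I)^2) <= (\<integral>\<^sup>+z. ennreal ((cmod (g z - a))^2 * (s z)^2) \<partial>M) * ennreal w" .
 have "ennreal ((cmod (ext g e x - a))^2) = ennreal ((cmod I)^2) * ennreal (1 / w^2)"
  unfolding I using w by (subst ennreal_mult[symmetric]) (auto simp: norm_divide power_divide)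
 also have "\<dots> <= (\<integral>\<^sup>+z. ennreal ((cmod (g z - a))^2 * (s z)^2) \<partial>M) * ennreal w * ennreal (1 / w^2)"
  by (intro mult_right_mono CS) simp
 also have "\<dots> = (\<integral>\<^sup>+z. ennreal ((cmod (g z - a))^2 * (s z)^2) \<partial>M) * ennreal (1 / w)"
 proof -
  have "ennreal w * ennreal (1 / w^2) = ennreal (1 / w)"
   using w by (subst ennreal_mult[symmetric]) (auto simp: power2_eq_square)
  then show ?thesis by (simp only: mult.assoc)
 qed
 also have "\<dots> = (\<integral>\<^sup>+z. ennreal ((cmod (g z - a))^2 * (s z)^2) * ennreal (1 / w) \<partial>M)"
  by (rule nn_integral_multc[symmetric]) measurable
 also have "\<dots> = (\<integral>\<^sup>+z. ennreal ((cmod (g z - a))^2 * kap e (x - z) / wt e x) \<partial>M)"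
  unfolding k w_def[symmetric] using w by (intro nn_integral_cong, subst ennreal_mult[symmetric]) auto
 finally show ?thesis .
qed

text \<open>Cauchy-Schwarz in y comes first; \<open>ext_deviation\<close> with a = g y then replaces
  the average by the values g z, and \<open>kernel_weight_le\<close> removes \<open>e\<close> and
  the weight from the kernel.\<close>

lemma dext_bound:
 assumes good: "good e x" and near: "near e x" and g: "integrable M g"
 shows "ennreal ((cmod (dext i g e x))^2) <= (\<integral>\<^sup>+y. (\<integral>\<^sup>+z.
  ennreal (256 * (16 / c)^2 * (cmod (g z - g y))^2 / ((x - y) \<bullet> (x - y) + (y - z) \<bullet> (y - z) / 2)^2) \<partial>M) \<partial>M)"
proof -
 define w where "w = wt e x"
 have wt: "wt e x > 0" by (rule wt_pos[OF good near])
 then have w: "w > 0" by (simp add: w_def)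
 have e: "0 <= e" using good by (simp add: good_def)
 define a where "a = ext g e x"
 define Q where "Q z = (x - z) \<bullet> (x - z) + e" for z
 define s where "s z = inverse (Q z)" for z
 have Qpos: "Q z > 0" if "z \<in> S" for z using good that by (force simp: good_def Q_def)
 have [measurable]: "Q \<in> borel_measurable borel" unfolding Q_def by measurable
 have [measurable]: "s \<in> borel_measurable borel" unfolding s_def by measurable
 have [measurable]: "g \<in> borel_measurable borel" using g by (auto simp: measurable_cong_sets[OF sets_M refl])
 have k: "kap e (x - z) = (s z)^2" for z by (simp add: kap_eq_square s_def Q_def)
 \<comment> \<open>One factor \<open>s\<close> is split off; its square is the kernel
   \<open>kap\<close>, whose integral is the weight.\<close>
 have dk: "dkap i e (x - z) = (- 4 * (x - z) $ i * (s z)^2) * s z" for z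
  by (simp add: dkap_def s_def Q_def power_inverse power2_eq_square power3_eq_cube)
 define I where "I = (LINT y|M. (g y - a) * complex_of_real (- 4 * (x - y) $ i * (s y)^2) * complex_of_real (s y))"
 have I: "dext i g e x = I / complex_of_real w"
  unfolding dext_def I_def a_def w_def dk by (simp only: of_real_mult mult.assoc)
 have sq: "(- 4 * r * t^2)^2 = 16 * (r^2 * t ^ 4)" for r t :: real
  by (simp add: power_mult_distrib power_mult[symmetric])
 have "ennreal ((cmod I)^2) <= (\<integral>\<^sup>+y. ennreal ((cmod ((g y - a) * complex_of_real (- 4 * (x - y) $ i * (s y)^2)))^2) \<partial>M)
   * (\<integral>\<^sup>+z. ennreal ((cmod (complex_of_real (s z)))^2) \<partial>M)"
  unfolding I_def by (rule nn_integral_cmod_mult_le) measurable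
 also have "(\<integral>\<^sup>+z. ennreal ((cmod (complex_of_real (s z)))^2) \<partial>M) = ennreal w"
  unfolding w_def nn_integral_kap[OF good, symmetric] by (simp add: k)
 also have "(\<integral>\<^sup>+y. ennreal ((cmod ((g y - a) * complex_of_real (- 4 * (x - y) $ i * (s y)^2)))^2) \<partial>M)
   <= (\<integral>\<^sup>+y. ennreal (16 * s y ^ 3) * ennreal ((cmod (a - g y))^2) \<partial>M)"
 proof (rule nn_integral_mono_AE, use AE_S in eventually_elim)
  fix y assume y: "y \<in> S"
  have sp: "s y > 0" "s y * Q y = 1" using Qpos[OF y] by (auto simp: s_def)
  \<comment> \<open>The squared component is at most 1 / s, which leaves s^3.\<close>
  have "((x - y) $ i)^2 * s y ^ 4 <= Q y * s y ^ 4"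
   using component_square_le[of "x - y" i] e sp by (intro mult_right_mono) (auto simp: Q_def)
  also have "\<dots> = (s y * Q y) * s y ^ 3" by (simp add: power_numeral_reduce)
  finally have "16 * (((x - y) $ i)^2 * s y ^ 4) <= 16 * s y ^ 3" using sp by simp
  then have "(cmod (g y - a))^2 * (16 * (((x - y) $ i)^2 * s y ^ 4)) <= (cmod (g y - a))^2 * (16 * s y ^ 3)"
   by (intro mult_left_mono) auto
  moreover have "(cmod ((g y - a) * complex_of_real (- 4 * (x - y) $ i * (s y)^2)))^2 = (cmod (g y - a))^2 * (16 * (((x - y) $ i)^2 * s y ^ 4))"
  proof -
   have "(cmod (complex_of_real r))^2 = r^2" for r by simp
   then have "(cmod ((g y - a) * complex_of_real (- 4 * (x - y) $ i * (s y)^2)))^2 = (cmod (g y - a))^2 * (- 4 * (x - y) $ i * (s y)^2)^2"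
    by (simp only: norm_mult power_mult_distrib)
   also have "(- 4 * (x - y) $ i * (s y)^2)^2 = 16 * (((x - y) $ i)^2 * s y ^ 4)"
    by (rule sq)
   finally show ?thesis .
  qed
  ultimately show "ennreal ((cmod ((g y - a) * complex_of_real (- 4 * (x - y) $ i * (s y)^2)))^2)
    <= ennreal (16 * s y ^ 3) * ennreal ((cmod (a - g y))^2)"
   using sp by (subst ennreal_mult[symmetric]) (auto intro!: ennreal_leI simp: norm_minus_commute mult.commute)
 qed
 also have "\<dots> <= (\<integral>\<^sup>+y. ennreal (16 * s y ^ 3) * (\<integral>\<^sup>+z. ennreal ((cmod (g z - g y))^2 * kap e (x - z) / w) \<partial>M) \<partial>M)"
  unfolding a_def w_def by (intro nn_integral_mono mult_left_mono ext_deviation good g wt) simp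
 also have "\<dots> = (\<integral>\<^sup>+y. (\<integral>\<^sup>+z. ennreal (16 * s y ^ 3) * ennreal ((cmod (g z - g y))^2 * kap e (x - z) / w) \<partial>M) \<partial>M)"
  by (intro nn_integral_cong nn_integral_cmult[symmetric]) measurable
 finally have CS: "ennreal ((cmod I)^2) <= (\<integral>\<^sup>+y. (\<integral>\<^sup>+z. ennreal (16 * s y ^ 3) * ennreal ((cmod (g z - g y))^2 * kap e (x - z) / w) \<partial>M) \<partial>M) * ennreal w"
  by (simp add: mult_right_mono)
 have "ennreal ((cmod (dext i g e x))^2) = ennreal ((cmod I)^2) * ennreal (1 / w^2)"
  unfolding I using w by (subst ennreal_mult[symmetric]) (auto simp: norm_divide power_divide)
 also have "\<dots> <= (\<integral>\<^sup>+y. (\<integral>\<^sup>+z. ennreal (16 * s y ^ 3) * ennreal ((cmod (g z - g y))^2 * kap e (x - z) / w) \<partial>M) \<partial>M) * ennreal w * ennreal (1 / w^2)"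
  by (intro mult_right_mono CS) simp
 also have "\<dots> = (\<integral>\<^sup>+y. (\<integral>\<^sup>+z. ennreal (16 * s y ^ 3) * ennreal ((cmod (g z - g y))^2 * kap e (x - z) / w) \<partial>M) \<partial>M) * ennreal (1 / w)"
 proof -
  have "ennreal w * ennreal (1 / w^2) = ennreal (1 / w)"
   using w by (subst ennreal_mult[symmetric]) (auto simp: power2_eq_square)
  then show ?thesis by (simp only: mult.assoc)
 qed
 also have "\<dots> = (\<integral>\<^sup>+y. (\<integral>\<^sup>+z. ennreal (16 * s y ^ 3) * ennreal ((cmod (g z - g y))^2 * kap e (x - z) / w) * ennreal (1 / w) \<partial>M) \<partial>M)"
  by (simp add: nn_integral_multc)
 also have "\<dots> <= (\<integral>\<^sup>+y. (\<integral>\<^sup>+z.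
  ennreal (256 * (16 / c)^2 * (cmod (g z - g y))^2 / ((x - y) \<bullet> (x - y) + (y - z) \<bullet> (y - z) / 2)^2) \<partial>M) \<partial>M)"
 proof (rule nn_integral_mono_AE, use AE_S in eventually_elim, rule nn_integral_mono_AE, use AE_S in eventually_elim)
  fix y z assume y: "y \<in> S" and z: "z \<in> S"
  define T where "T = (x - y) \<bullet> (x - y) + (y - z) \<bullet> (y - z) / 2"
  have sp: "s y > 0" "s z > 0" using Qpos y z by (auto simp: s_def)
  have "16 * s y ^ 3 * (s z)^2 / w^2 * (cmod (g z - g y))^2 <= 256 * (16 / c)^2 / T^2 * (cmod (g z - g y))^2"
  proof (cases "y = z")
   case False
   then have T: "T > 0" by (auto simp: T_def intro!: add_nonneg_pos)
   have "(norm (y - z))^2 <= 2 * (norm (x - z))^2 + 2 * (norm (x - y))^2"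
    using power2_norm_diff_le[of "x - z" "x - y"] by simp
   moreover have "t + yz / 2 <= 2 * (t + e + (s + e))" if "yz <= 2 * s + 2 * t" "0 <= s" for s t yz :: real
    using that e by simp
   ultimately have "T <= 2 * (Q y + Q z)"
    unfolding T_def Q_def power2_norm_eq_inner by (meson inner_ge_zero)
   from kernel_weight_le[OF Qpos[OF y] Qpos[OF z] w T this wt_lower[OF good near y, folded Q_def w_def] wt_lower[OF good near z, folded Q_def w_def]]
   show ?thesis unfolding s_def by (rule mult_right_mono) simp
  qed simp
  moreover have "16 * s y ^ 3 * ((cmod (g z - g y))^2 * kap e (x - z) / w) * (1 / w) = 16 * s y ^ 3 * (s z)^2 / w^2 * (cmod (g z - g y))^2"
   by (simp add: k power2_eq_square)
  ultimately have "16 * s y ^ 3 * ((cmod (g z - g y))^2 * kap e (x - z) / w) * (1 / w) <= 256 * (16 / c)^2 * (cmod (g z - g y))^2 / T^2" by simp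
  then show "ennreal (16 * s y ^ 3) * ennreal ((cmod (g z - g y))^2 * kap e (x - z) / w) * ennreal (1 / w)
    <= ennreal (256 * (16 / c)^2 * (cmod (g z - g y))^2 / ((x - y) \<bullet> (x - y) + (y - z) \<bullet> (y - z) / 2)^2)"
   using sp w kap_nonneg[of e "x - z"] by (simp only: T_def[symmetric] ennreal_mult[symmetric] zero_le_mult_iff) (auto simp: ennreal_mult[symmetric] intro!: ennreal_leI)
 qed
 finally show ?thesis .
qed

end

context regular_measure
begin

lemma smooth_ext:
 assumes e: "e > 0" and g: "integrable M g" and w: "\<And>x. wt e x \<noteq> 0"
 shows "smooth (ext g e)" "partial i (ext g e) x = dext i g e x"
proof -
 define N where "N x = (LINT z|M. g z * complex_of_real (kap e (x - z)))" for x
 define W where "W x = (LINT z|M. 1 * complex_of_real (kap e (x - z)))" for x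
 have W: "W x = complex_of_real (wt e x)" for x unfolding W_def of_real_wt ..
 have nz: "W x \<noteq> 0" for x using w by (simp add: W)
 have one: "integrable M (%z. 1 :: complex)" by simp
 have sm: "smooth N" "smooth W" unfolding N_def W_def
  using smooth_kernel_integral[OF e kap_bounded_kernel g sets_M] smooth_kernel_integral[OF e kap_bounded_kernel one sets_M] by auto
 have ext: "ext g e = (%x. N x * inverse (W x))" by (simp add: ext_def N_def W fun_eq_iff divide_inverse)
 show "smooth (ext g e)" unfolding ext by (intro smooth_mult smooth_inverse sm nz)
 have "partial i N x = (LINT z|M. g z * complex_of_real (dkap i e (x - z)))" "partial i W x = (LINT z|M. 1 * complex_of_real (dkap i e (x - z)))"
  unfolding N_def W_def using partial_kap_integral(1)[OF e g sets_M] partial_kap_integral(1)[OF e one sets_M] by auto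
 note p = this
 have "(LINT y|M. (g y - ext g e x) * complex_of_real (dkap i e (x - y)))
   = (LINT y|M. g y * complex_of_real (dkap i e (x - y)) - ext g e x * (1 * complex_of_real (dkap i e (x - y))))"
  by (intro Bochner_Integration.integral_cong) (auto simp: algebra_simps)
 also have "\<dots> = partial i N x - ext g e x * partial i W x"
  unfolding p using partial_kap_integral(2)[OF e g sets_M] partial_kap_integral(2)[OF e one sets_M]
  by (subst Bochner_Integration.integral_diff) auto
 finally have "dext i g e x = (partial i N x - ext g e x * partial i W x) * inverse (W x)"
  by (simp add: dext_def W divide_inverse)
 moreover have "partial i (ext g e) = (%x. N x * (- (inverse (W x) * partial i W x * inverse (W x))) + partial i N x * inverse (W x))"
  unfolding ext using sm nz smooth_inverse[OF sm(2) nz]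
  by (subst partial_mult) (auto simp: smooth_differentiable partial_inverse)
 ultimately show "partial i (ext g e) x = dext i g e x" by (simp add: ext algebra_simps)
qed

lemma measurable_ext:
 assumes "integrable M g"
 shows "ext g e \<in> borel_measurable borel" "dext i g e \<in> borel_measurable borel"
proof -
 have [measurable]: "g \<in> borel_measurable borel" using assms by (auto simp: measurable_cong_sets[OF sets_M refl])
 have [measurable]: "wt e \<in> borel_measurable borel" unfolding wt_def[abs_def] by measurable
 show [measurable]: "ext g e \<in> borel_measurable borel" unfolding ext_def[abs_def] by measurable
 show "dext i g e \<in> borel_measurable borel" unfolding dext_def[abs_def] by measurable
qed

lemma tendsto_kernel_integral:
 fixes g :: "real^2 => complex"
 assumes x: "x \<notin> S" and \<epsilon>: "\<epsilon> \<longlonglongrightarrow> 0" "\<And>n. \<epsilon> n \<ge> 0" and g: "integrable M g"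
 shows "(%n. LINT z|M. g z * complex_of_real (kap (\<epsilon> n) (x - z))) \<longlonglongrightarrow> (LINT z|M. g z * complex_of_real (kap 0 (x - z)))"
  and "(%n. LINT z|M. g z * complex_of_real (dkap i (\<epsilon> n) (x - z))) \<longlonglongrightarrow> (LINT z|M. g z * complex_of_real (dkap i 0 (x - z)))"
proof -
 have [measurable]: "g \<in> borel_measurable borel" using g by (auto simp: measurable_cong_sets[OF sets_M refl])
 obtain d where d: "d > 0" "\<And>z e. z \<in> S ==> 0 <= e ==> d <= (x - z) \<bullet> (x - z) + e" using off_S[OF x] by blast
 define B where "B = 4 * (inverse d ^ 2 + inverse d ^ 3)"
 have lim: "(%n. LINT z|M. g z * complex_of_real (k (\<epsilon> n) (x - z))) \<longlonglongrightarrow> (LINT z|M. g z * complex_of_real (k 0 (x - z)))"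
  if m: "\<And>e. k e \<in> borel_measurable borel" and b: "\<And>z e. z \<in> S ==> 0 <= e ==> \<bar>k e (x - z)\<bar> <= B"
   and l: "\<And>z. z \<in> S ==> (%n. k (\<epsilon> n) (x - z)) \<longlonglongrightarrow> k 0 (x - z)" for k :: "real => real^2 => real"
 proof (rule integral_dominated_convergence[where w = "%z. norm (g z) * B"])
  note [measurable] = m
  show "(%z. g z * complex_of_real (k 0 (x - z))) \<in> borel_measurable M"
   "(%z. g z * complex_of_real (k (\<epsilon> n) (x - z))) \<in> borel_measurable M" for n by measurable
  show "integrable M (%z. norm (g z) * B)" using g by simp
  show "AE z in M. (%n. g z * complex_of_real (k (\<epsilon> n) (x - z))) \<longlonglongrightarrow> g z * complex_of_real (k 0 (x - z))"
   using AE_S by eventually_elim (intro tendsto_intros l)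
  show "AE z in M. norm (g z * complex_of_real (k (\<epsilon> n) (x - z))) <= norm (g z) * B" for n
   using AE_S by eventually_elim (auto simp: norm_mult intro!: mult_left_mono b \<epsilon>(2))
 qed
 have nz: "(x - z) \<bullet> (x - z) + 0 \<noteq> 0" if "z \<in> S" for z using d(1) d(2)[OF that, of 0] by linarith
 show "(%n. LINT z|M. g z * complex_of_real (kap (\<epsilon> n) (x - z))) \<longlonglongrightarrow> (LINT z|M. g z * complex_of_real (kap 0 (x - z)))"
 proof (rule lim)
  show "(%n. kap (\<epsilon> n) (x - z)) \<longlonglongrightarrow> kap 0 (x - z)" if "z \<in> S" for z
   unfolding kap_def using nz[OF that] by (intro tendsto_intros \<epsilon>(1)) simp
 qed (use kap_bound(1)[OF d(1) d(2)] in \<open>auto simp: B_def\<close>)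
 show "(%n. LINT z|M. g z * complex_of_real (dkap i (\<epsilon> n) (x - z))) \<longlonglongrightarrow> (LINT z|M. g z * complex_of_real (dkap i 0 (x - z)))"
 proof (rule lim)
  show "(%n. dkap i (\<epsilon> n) (x - z)) \<longlonglongrightarrow> dkap i 0 (x - z)" if "z \<in> S" for z
   unfolding dkap_def using nz[OF that] by (intro tendsto_intros \<epsilon>(1)) simp
 qed (use kap_bound(2)[OF d(1) d(2)] in \<open>auto simp: B_def\<close>)
qed

text \<open>Off \<open>S\<close> the kernels are bounded uniformly in the parameter, so the formulas
  with e = 0 are pointwise limits.\<close>

lemma tendsto_ext:
 assumes x: "x \<notin> S" and w: "wt 0 x > 0" and \<epsilon>: "\<epsilon> \<longlonglongrightarrow> 0" "\<And>n. \<epsilon> n \<ge> 0" and g: "integrable M g"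
 shows "(%n. ext g (\<epsilon> n) x) \<longlonglongrightarrow> ext g 0 x" "(%n. dext i g (\<epsilon> n) x) \<longlonglongrightarrow> dext i g 0 x"
proof -
 note t = tendsto_kernel_integral[OF x \<epsilon>]
 have one: "integrable M (%z. 1 :: complex)" by simp
 have W: "(%n. complex_of_real (wt (\<epsilon> n) x)) \<longlonglongrightarrow> complex_of_real (wt 0 x)"
  unfolding of_real_wt by (rule t(1)[OF one])
 show E: "(%n. ext g (\<epsilon> n) x) \<longlonglongrightarrow> ext g 0 x"
  unfolding ext_def by (rule tendsto_divide[OF t(1)[OF g] W]) (use w in simp)
 have D: "(LINT y|M. (g y - ext g e x) * complex_of_real (dkap i e (x - y)))
   = (LINT y|M. g y * complex_of_real (dkap i e (x - y))) - ext g e x * (LINT y|M. 1 * complex_of_real (dkap i e (x - y)))" if "e \<ge> 0" for e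
 proof -
  have "(LINT y|M. (g y - ext g e x) * complex_of_real (dkap i e (x - y)))
   = (LINT y|M. g y * complex_of_real (dkap i e (x - y)) - ext g e x * (1 * complex_of_real (dkap i e (x - y))))"
   by (intro Bochner_Integration.integral_cong) (auto simp: algebra_simps)
  also have "\<dots> = (LINT y|M. g y * complex_of_real (dkap i e (x - y))) - ext g e x * (LINT y|M. 1 * complex_of_real (dkap i e (x - y)))"
   using integrable_kap(2)[OF good_off[OF x that] g] integrable_kap(2)[OF good_off[OF x that] one]
   by (subst Bochner_Integration.integral_diff) auto
  finally show ?thesis .
 qed
 have "(%n. ((LINT y|M. g y * complex_of_real (dkap i (\<epsilon> n) (x - y))) - ext g (\<epsilon> n) x * (LINT y|M. 1 * complex_of_real (dkap i (\<epsilon> n) (x - y)))) / complex_of_real (wt (\<epsilon> n) x))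
  \<longlonglongrightarrow> ((LINT y|M. g y * complex_of_real (dkap i 0 (x - y))) - ext g 0 x * (LINT y|M. 1 * complex_of_real (dkap i 0 (x - y)))) / complex_of_real (wt 0 x)"
  by (intro tendsto_divide tendsto_diff tendsto_mult t g one W E) (use w in simp)
 then show "(%n. dext i g (\<epsilon> n) x) \<longlonglongrightarrow> dext i g 0 x"
  unfolding dext_def by (simp only: D[OF \<epsilon>(2)] D[OF order_refl])
qed

text \<open>Majorant of |ext|^2 free of \<open>e\<close>: it comes from kap / wt <= 16 / (c |x -
  z|), and the indicator from |x - z| <= R.\<close>

definition value_majorant :: "(real^2 => complex) => real^2 => ennreal" where
 "value_majorant g x = (\<integral>\<^sup>+z. ennreal (16 / c * (cmod (g z))^2) * (ennreal (1 / norm (x - z)) * indicator {x. \<forall>i. \<bar>x $ i - z $ i\<bar> <= R} x) \<partial>M)"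

definition gradient_majorant :: "(real^2 => complex) => real^2 => ennreal" where
 "gradient_majorant g x = (\<integral>\<^sup>+y. (\<integral>\<^sup>+z.
  ennreal (256 * (16 / c)^2 * (cmod (g z - g y))^2 / ((x - y) \<bullet> (x - y) + (y - z) \<bullet> (y - z) / 2)^2) \<partial>M) \<partial>M)"

lemma ext_le_majorant:
 assumes x: "x \<notin> S" and e: "e \<ge> 0" and near: "near e x" and g: "integrable M g"
 shows "ennreal ((cmod (ext g e x))^2) <= value_majorant g x"
proof -
 have good: "good e x" by (rule good_off[OF x e])
 have w: "wt e x > 0" by (rule wt_pos[OF good near])
 have "ennreal ((cmod (ext g e x - 0))^2) <= (\<integral>\<^sup>+z. ennreal ((cmod (g z - 0))^2 * kap e (x - z) / wt e x) \<partial>M)"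
  by (rule ext_deviation[OF good w g])
 also have "\<dots> <= value_majorant g x"
  unfolding value_majorant_def
 proof (rule nn_integral_mono_AE, use AE_S in eventually_elim)
  fix z assume z: "z \<in> S"
  define B where "B = (x - z) \<bullet> (x - z) + e"
  have xz: "norm (x - z) > 0" using x z by auto
  have nB: "(norm (x - z))^2 <= B" using e by (simp add: B_def power2_norm_eq_inner)
  have B: "B > 0" using nB xz by (meson less_le_trans zero_less_power)
  have "norm (x - z) <= sqrt B" using nB by (rule real_le_rsqrt)
  have BR: "B <= R^2" using near z by (simp add: near_def B_def)
  have "inverse B ^ 2 <= inverse B ^ 2 * (16 / c * sqrt B ^ 3 * wt e x)"
   using mult_left_mono[OF wt_lower[OF good near z], of "inverse B ^ 2"] by (simp add: B_def)
  also have "\<dots> = 16 / c * (inverse B ^ 2 * sqrt B ^ 4) / sqrt B * wt e x" using B by (simp add: power_numeral_reduce)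
  also have "sqrt B ^ 4 = B ^ 2" using B by (metis abs_of_pos mult_2 numeral_Bit0 power_add power2_eq_square real_sqrt_mult_self)
  also have "inverse B ^ 2 * B ^ 2 = 1" using B by (simp add: power_inverse)
  finally have "inverse B ^ 2 / wt e x <= 16 / c / sqrt B" using w by (simp add: divide_le_eq)
  also have "\<dots> <= 16 / c / norm (x - z)" using \<open>norm (x - z) <= sqrt B\<close> xz c B by (intro divide_left_mono) auto
  finally have "(cmod (g z))^2 * (inverse B ^ 2 / wt e x) <= (cmod (g z))^2 * (16 / c / norm (x - z))"
   by (intro mult_left_mono) auto
  then have "ennreal ((cmod (g z - 0))^2 * kap e (x - z) / wt e x) <= ennreal (16 / c * (cmod (g z))^2) * ennreal (1 / norm (x - z))"
   using c by (subst ennreal_mult[symmetric]) (auto intro!: ennreal_leI simp: kap_eq_square B_def mult.commute)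
  moreover have "\<bar>x $ i - z $ i\<bar> <= R" for i
  proof -
   have "\<bar>x $ i - z $ i\<bar> <= norm (x - z)" using component_le_norm_cart[of "x - z" i] by simp
   also have "\<dots> <= R" using order_trans[OF nB BR] R by (intro power2_le_imp_le[of "norm (x - z)" R]) auto
   finally show ?thesis .
  qed
  ultimately show "ennreal ((cmod (g z - 0))^2 * kap e (x - z) / wt e x)
   <= ennreal (16 / c * (cmod (g z))^2) * (ennreal (1 / norm (x - z)) * indicator {x. \<forall>i. \<bar>x $ i - z $ i\<bar> <= R} x)"
   by simp
 qed
 finally show ?thesis by simp
qed

lemma dext_le_majorant:
 assumes "good e x" "near e x" "integrable M g"
 shows "ennreal ((cmod (dext i g e x))^2) <= gradient_majorant g x"
 unfolding gradient_majorant_def by (rule dext_bound[OF assms])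

lemma measurable_majorants:
 assumes [measurable]: "g \<in> borel_measurable borel"
 shows "value_majorant g \<in> borel_measurable borel" "gradient_majorant g \<in> borel_measurable borel"
 unfolding value_majorant_def[abs_def] gradient_majorant_def[abs_def] forall_2 by measurable

lemma nn_integral_value_majorant:
 assumes [measurable]: "g \<in> borel_measurable borel" and fin: "(\<integral>\<^sup>+z. ennreal ((cmod (g z))^2) \<partial>M) < \<infinity>"
 shows "(\<integral>\<^sup>+x. value_majorant g x \<partial>lborel) < \<infinity>"
proof -
 interpret pair_sigma_finite M "lborel :: (real^2) measure" ..
 have "(\<integral>\<^sup>+x. value_majorant g x \<partial>lborel) = (\<integral>\<^sup>+z. (\<integral>\<^sup>+x. ennreal (16 / c * (cmod (g z))^2) * (ennreal (1 / norm (x - z)) * indicator {x. \<forall>i. \<bar>x $ i - z $ i\<bar> <= R} x) \<partial>lborel) \<partial>M)"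
  unfolding value_majorant_def forall_2 by (rule Fubini') measurable
 also have "\<dots> = (\<integral>\<^sup>+z. ennreal (16 / c * (cmod (g z))^2) * (\<integral>\<^sup>+x. ennreal (1 / norm (x - z)) * indicator {x. \<forall>i. \<bar>x $ i - z $ i\<bar> <= R} x \<partial>lborel) \<partial>M)"
  unfolding forall_2 by (intro nn_integral_cong nn_integral_cmult) measurable
 also have "\<dots> <= (\<integral>\<^sup>+z. ennreal (16 / c * (cmod (g z))^2) * ennreal (16 * R) \<partial>M)"
  by (intro nn_integral_mono mult_left_mono nn_integral_inverse_norm R) auto
 also have "\<dots> = (\<integral>\<^sup>+z. ennreal (16 / c * (16 * R)) * ennreal ((cmod (g z))^2) \<partial>M)"
 proof (rule nn_integral_cong)
  fix z
  show "ennreal (16 / c * (cmod (g z))^2) * ennreal (16 * R) = ennreal (16 / c * (16 * R)) * ennreal ((cmod (g z))^2)"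
   using c R by (subst (1 2) ennreal_mult[symmetric]) (auto simp: mult_ac)
 qed
 also have "\<dots> = ennreal (16 / c * (16 * R)) * (\<integral>\<^sup>+z. ennreal ((cmod (g z))^2) \<partial>M)"
  by (rule nn_integral_cmult) measurable
 also have "\<dots> < \<infinity>" using fin by (simp add: ennreal_mult_less_top)
 finally show ?thesis .
qed

text \<open>After Tonelli the plane integral of the kernel is at most 16 / beta with beta = |y -
  z|^2 / 2, and the H^{1/2} energy appears.\<close>

lemma nn_integral_gradient_majorant:
 assumes [measurable]: "g \<in> borel_measurable borel"
  and fin: "(\<integral>\<^sup>+y. (\<integral>\<^sup>+z. ennreal ((cmod (g y - g z))^2 / (dist y z)^2) \<partial>M) \<partial>M) < \<infinity>"
 shows "(\<integral>\<^sup>+x. gradient_majorant g x \<partial>lborel) < \<infinity>"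
proof -
 interpret pair_sigma_finite M "lborel :: (real^2) measure" ..
 define K where "K = 256 * (16 / c)^2"
 have K: "K \<ge> 0" by (simp add: K_def)
 define H where "H x y z = ennreal (K * (cmod (g z - g y))^2 / ((x - y) \<bullet> (x - y) + (y - z) \<bullet> (y - z) / 2)^2)" for x y z
 have "(\<integral>\<^sup>+x. gradient_majorant g x \<partial>lborel) = (\<integral>\<^sup>+x. (\<integral>\<^sup>+y. (\<integral>\<^sup>+z. H x y z \<partial>M) \<partial>M) \<partial>lborel)"
  unfolding gradient_majorant_def H_def K_def ..
 also have "\<dots> = (\<integral>\<^sup>+y. (\<integral>\<^sup>+x. (\<integral>\<^sup>+z. H x y z \<partial>M) \<partial>lborel) \<partial>M)"
  unfolding H_def by (rule Fubini') measurable
 also have "\<dots> = (\<integral>\<^sup>+y. (\<integral>\<^sup>+z. (\<integral>\<^sup>+x. H x y z \<partial>lborel) \<partial>M) \<partial>M)"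
  unfolding H_def by (intro nn_integral_cong Fubini') measurable
 also have "\<dots> <= (\<integral>\<^sup>+y. (\<integral>\<^sup>+z. ennreal (32 * K) * ennreal ((cmod (g y - g z))^2 / (dist y z)^2) \<partial>M) \<partial>M)"
 proof (intro nn_integral_mono)
  fix y z
  show "(\<integral>\<^sup>+x. H x y z \<partial>lborel) <= ennreal (32 * K) * ennreal ((cmod (g y - g z))^2 / (dist y z)^2)"
  proof (cases "y = z")
   case False
   define \<beta> where "\<beta> = (y - z) \<bullet> (y - z) / 2"
   have \<beta>: "\<beta> > 0" using False by (simp add: \<beta>_def)
   have "(\<integral>\<^sup>+x. H x y z \<partial>lborel) = (\<integral>\<^sup>+x. ennreal (K * (cmod (g z - g y))^2) * ennreal (1 / ((x - y) \<bullet> (x - y) + \<beta>)^2) \<partial>lborel)"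
    unfolding H_def \<beta>_def[symmetric] using K by (intro nn_integral_cong) (subst ennreal_mult[symmetric], auto)
   also have "\<dots> = ennreal (K * (cmod (g z - g y))^2) * (\<integral>\<^sup>+x. ennreal (1 / ((x - y) \<bullet> (x - y) + \<beta>)^2) \<partial>lborel)"
    by (rule nn_integral_cmult) measurable
   also have "\<dots> <= ennreal (K * (cmod (g z - g y))^2) * ennreal (16 / \<beta>)"
    by (intro mult_left_mono nn_integral_kernel_plane \<beta>) simp
   also have "\<dots> = ennreal (K * (cmod (g z - g y))^2 * (16 / \<beta>))" using K \<beta> by (subst ennreal_mult) auto
   also have "K * (cmod (g z - g y))^2 * (16 / \<beta>) = 32 * K * ((cmod (g y - g z))^2 / (dist y z)^2)"
    by (simp add: \<beta>_def dist_norm power2_norm_eq_inner norm_minus_commute)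
   also have "ennreal \<dots> = ennreal (32 * K) * ennreal ((cmod (g y - g z))^2 / (dist y z)^2)" using K by (intro ennreal_mult) auto
   finally show ?thesis .
  qed (simp add: H_def)
 qed
 also have "\<dots> = ennreal (32 * K) * (\<integral>\<^sup>+y. (\<integral>\<^sup>+z. ennreal ((cmod (g y - g z))^2 / (dist y z)^2) \<partial>M) \<partial>M)"
  by (simp add: nn_integral_cmult)
 also have "\<dots> < \<infinity>" using fin by (simp add: ennreal_mult_less_top)
 finally show ?thesis .
qed

text \<open>At a point x of \<open>S\<close> the weight is at least of order e^(-3/2), while e |x -
  z|^2 <= (|x - z|^2 + e)^2 bounds the kernel by 1 / (e |x - z|^2). Their quotient leaves sqrt e
  times the H^{1/2} density.\<close>

lemma ext_trace_error:
 assumes e: "e > 0" and near: "\<And>x. x \<in> S ==> near e x" and g: "integrable M g"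
 shows "(\<integral>\<^sup>+x. ennreal ((cmod (ext g e x - g x))^2) \<partial>M)
  <= ennreal (16 / c * sqrt e) * (\<integral>\<^sup>+x. (\<integral>\<^sup>+z. ennreal ((cmod (g x - g z))^2 / (dist x z)^2) \<partial>M) \<partial>M)"
proof -
 have [measurable]: "g \<in> borel_measurable borel" using g by (auto simp: measurable_cong_sets[OF sets_M refl])
 have "(\<integral>\<^sup>+x. ennreal ((cmod (ext g e x - g x))^2) \<partial>M)
   <= (\<integral>\<^sup>+x. (\<integral>\<^sup>+z. ennreal (16 / c * sqrt e) * ennreal ((cmod (g x - g z))^2 / (dist x z)^2) \<partial>M) \<partial>M)"
 proof (rule nn_integral_mono_AE, use AE_S in eventually_elim)
  fix x assume x: "x \<in> S"
  have good: "good e x" by (rule good_pos[OF e])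
  have w: "wt e x > 0" by (rule wt_pos[OF good near[OF x]])
  have "1 <= 16 / c * sqrt e ^ 3 * wt e x" using wt_lower[OF good near[OF x] x] by simp
  then have w1: "1 / wt e x <= 16 / c * sqrt e ^ 3" using w by (simp add: divide_le_eq)
  have "ennreal ((cmod (ext g e x - g x))^2) <= (\<integral>\<^sup>+z. ennreal ((cmod (g z - g x))^2 * kap e (x - z) / wt e x) \<partial>M)"
   by (rule ext_deviation[OF good w g])
  also have "\<dots> <= (\<integral>\<^sup>+z. ennreal (16 / c * sqrt e) * ennreal ((cmod (g x - g z))^2 / (dist x z)^2) \<partial>M)"
  proof (rule nn_integral_mono)
   fix z
   define r where "r = (x - z) \<bullet> (x - z)"
   show "ennreal ((cmod (g z - g x))^2 * kap e (x - z) / wt e x) <= ennreal (16 / c * sqrt e) * ennreal ((cmod (g x - g z))^2 / (dist x z)^2)"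
   proof (cases "x = z")
    case False
    then have r: "r > 0" by (simp add: r_def)
    have "e * r <= (r + e)^2" using e r by (simp add: power2_eq_square algebra_simps)
    then have "kap e (x - z) <= inverse (e * r)" unfolding kap_def r_def[symmetric] using e r by (intro le_imp_inverse_le) auto
    then have "kap e (x - z) * (1 / wt e x) <= inverse (e * r) * (16 / c * sqrt e ^ 3)"
     using w1 w e r by (intro mult_mono) auto
    also have "\<dots> = 16 / c * sqrt e / r"
    proof -
     have "sqrt e ^ 3 = e * sqrt e" using e by (simp add: power3_eq_cube)
     then show ?thesis using e r by (simp add: field_simps)
    qed
    finally have "(cmod (g z - g x))^2 * (kap e (x - z) * (1 / wt e x)) <= (cmod (g z - g x))^2 * (16 / c * sqrt e / r)"
     by (intro mult_left_mono) auto
    moreover have "(dist x z)^2 = r" by (simp add: r_def dist_norm power2_norm_eq_inner)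
    ultimately have le: "(cmod (g z - g x))^2 * kap e (x - z) / wt e x <= 16 / c * sqrt e * ((cmod (g x - g z))^2 / (dist x z)^2)"
     by (simp add: norm_minus_commute mult_ac)
    have "0 <= 16 / c * sqrt e" using c e by simp
    then show ?thesis using ennreal_leI[OF le] by (subst ennreal_mult[symmetric]) auto
   qed simp
  qed
  finally show "ennreal ((cmod (ext g e x - g x))^2) <= (\<integral>\<^sup>+z. ennreal (16 / c * sqrt e) * ennreal ((cmod (g x - g z))^2 / (dist x z)^2) \<partial>M)" .
 qed
 also have "\<dots> = ennreal (16 / c * sqrt e) * (\<integral>\<^sup>+x. (\<integral>\<^sup>+z. ennreal ((cmod (g x - g z))^2 / (dist x z)^2) \<partial>M) \<partial>M)"
  by (simp add: nn_integral_cmult)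
 finally show ?thesis .
qed

text \<open>The approximants are \<open>ext g\<close> with parameters 1 / (n + 1); the limit jet is
  the same formula with parameter 0, singular only on the null set \<open>S\<close>. The majorants
  give convergence in \<Omega> by domination, and \<open>ext_trace_error\<close> gives convergence
  on the boundary.\<close>

theorem extension_exists:
 assumes g: "integrable M g" and L2: "(\<integral>\<^sup>+z. ennreal ((cmod (g z))^2) \<partial>M) < \<infinity>"
  and half: "(\<integral>\<^sup>+y. (\<integral>\<^sup>+z. ennreal ((cmod (g y - g z))^2 / (dist y z)^2) \<partial>M) \<partial>M) < \<infinity>"
  and \<Omega>: "\<Omega> \<in> sets lebesgue" and near: "\<And>x e. x \<in> \<Omega> \<union> S ==> e <= 1 ==> near e x"
 shows "\<exists>U\<in>borel_measurable (lebesgue_on \<Omega>). \<forall>\<eta>>0. \<exists>\<phi>. smooth \<phi> \<and> sqd (lebesgue_on \<Omega>) (jet \<phi>) U <= ennreal \<eta> \<and> sqd M \<phi> g <= ennreal \<eta>"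
proof -
 define \<epsilon> where "\<epsilon> n = 1 / real (Suc n)" for n
 have \<epsilon>: "\<epsilon> \<longlonglongrightarrow> 0" "\<And>n. 0 < \<epsilon> n" "\<And>n. 0 <= \<epsilon> n" "\<And>n. \<epsilon> n <= 1"
  unfolding \<epsilon>_def using LIMSEQ_inverse_real_of_nat by (auto simp: divide_inverse inverse_le_1_iff)
 have [measurable]: "g \<in> borel_measurable borel" using g by (auto simp: measurable_cong_sets[OF sets_M refl])
 define U where "U e x = (ext g e x, \<chi> i. dext i g e x)" for e x
 have mU: "U e \<in> borel_measurable (lebesgue_on \<Omega>)" for e
  unfolding U_def by (intro measurable_pair_vec borel_measurable_lebesgue_on) (simp_all add: measurable_ext[OF g])
 \<comment> \<open>Smoothness on the whole plane needs a nonzero weight also at points far from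
   \<open>S\<close>, which \<open>wt_lower\<close> does not reach; a crude bound from one ball of
   radius \<open>R\<close> is enough.\<close>
 have w: "wt e x \<noteq> 0" if "e > 0" for e x
 proof -
  obtain y where y: "y \<in> S" using S(3) by blast
  define k where "k = inverse (((norm (x - y) + R)^2 + e)^2)"
  have k: "k > 0" unfolding k_def
   by (rule positive_imp_inverse_positive[OF zero_less_power[OF add_nonneg_pos[OF zero_le_power2 that]]])
  have le: "k <= kap e (x - z)" if z: "z \<in> cball y R" for z
  proof -
   have "norm (x - z) <= norm (x - y) + R"
    using norm_triangle_ineq[of "x - y" "y - z"] z by (simp add: dist_norm)
   then have "(norm (x - z))^2 <= (norm (x - y) + R)^2" by (intro power_mono) auto
   moreover have "0 < (x - z) \<bullet> (x - z) + e" by (rule add_nonneg_pos[OF inner_ge_zero \<open>e > 0\<close>])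
   ultimately show ?thesis unfolding k_def kap_def
    by (intro le_imp_inverse_le power_mono) (auto simp: power2_norm_eq_inner)
  qed
  have "ennreal k * ennreal (c * R) <= ennreal k * emeasure M (cball y R)"
   by (intro mult_left_mono mass y R) auto
  also have "\<dots> = (\<integral>\<^sup>+z. ennreal k * indicator (cball y R) z \<partial>M)"
   by (rule nn_integral_cmult_indicator[symmetric]) (simp add: borel_closed)
  also have "\<dots> <= (\<integral>\<^sup>+z. ennreal (kap e (x - z)) \<partial>M)"
   using le by (intro nn_integral_mono) (auto simp del: mem_cball simp: indicator_def intro!: ennreal_leI)
  also have "\<dots> = ennreal (wt e x)" by (rule nn_integral_kap[OF good_pos[OF that]])
  finally have "ennreal (k * (c * R)) <= ennreal (wt e x)" using k c R by (subst ennreal_mult) auto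
  moreover have "0 < k * (c * R)" using k c R by simp
  ultimately show ?thesis by (auto simp: ennreal_le_iff2)
 qed
 have jet: "jet (ext g e) = U e" "smooth (ext g e)" if "e > 0" for e
  using smooth_ext[OF that g w[OF that]] by (auto simp: jet_def U_def fun_eq_iff)
 have null: "AE x in lebesgue_on \<Omega>. x \<notin> S"
 proof -
  have "AE x in lebesgue. x \<notin> S" using S(2) by (simp add: negligible_iff_null_sets AE_not_in)
  then show ?thesis using \<Omega> by (auto simp: AE_restrict_space_iff elim: eventually_mono)
 qed
 define G where "G x = value_majorant g x + 2 * gradient_majorant g x" for x
 have [measurable]: "G \<in> borel_measurable borel" unfolding G_def using measurable_majorants[of g] by measurable
 have G: "ennreal ((norm (U e x))^2) <= G x" if "x \<in> \<Omega>" "x \<notin> S" "0 <= e" "e <= 1" for x e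
 proof -
  have n: "near e x" using near that by blast
  have "ennreal ((norm (U e x))^2) = ennreal ((cmod (ext g e x))^2) + (ennreal ((cmod (dext 1 g e x))^2) + ennreal ((cmod (dext 2 g e x))^2))"
   unfolding power2_norm_jet[of "U e x"] by (simp add: U_def sum_2 ennreal_plus)
  also have "\<dots> <= value_majorant g x + (gradient_majorant g x + gradient_majorant g x)"
   by (intro add_mono ext_le_majorant dext_le_majorant good_off that n g)
  finally show ?thesis by (simp add: G_def mult_2)
 qed
 have D: "(\<integral>\<^sup>+x. 4 * G x \<partial>lebesgue_on \<Omega>) < \<infinity>"
 proof -
  have "(\<integral>\<^sup>+x. 4 * G x \<partial>lebesgue_on \<Omega>) = (\<integral>\<^sup>+x. 4 * G x * indicator \<Omega> x \<partial>lebesgue)"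
   by (rule nn_integral_restrict_space) (use \<Omega> in simp)
  also have "\<dots> <= (\<integral>\<^sup>+x. 4 * G x \<partial>lebesgue)" by (intro nn_integral_mono) (auto simp: indicator_def)
  also have "\<dots> = (\<integral>\<^sup>+x. 4 * G x \<partial>lborel)" by (rule nn_integral_completion) 
  also have "\<dots> = 4 * ((\<integral>\<^sup>+x. value_majorant g x \<partial>lborel) + 2 * (\<integral>\<^sup>+x. gradient_majorant g x \<partial>lborel))"
   unfolding G_def using measurable_majorants[of g] by (simp add: nn_integral_cmult nn_integral_add)
  also have "\<dots> < \<infinity>"
   using nn_integral_value_majorant[OF _ L2] nn_integral_gradient_majorant[OF _ half] by (simp add: ennreal_mult_less_top)
  finally show ?thesis .
 qed
 have lim: "(%n. sqd (lebesgue_on \<Omega>) (U (\<epsilon> n)) (U 0)) \<longlonglongrightarrow> (\<integral>\<^sup>+x. 0 \<partial>lebesgue_on \<Omega>)"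
  unfolding sqd_def
 proof (rule nn_integral_dominated_convergence[where w = "%x. 4 * G x"])
  note [measurable] = mU
  show "(%x. ennreal ((norm (U (\<epsilon> n) x - U 0 x))^2)) \<in> borel_measurable (lebesgue_on \<Omega>)" for n by measurable
  show "(%x. 4 * G x) \<in> borel_measurable (lebesgue_on \<Omega>)" by (rule borel_measurable_lebesgue_on) measurable
  show "AE x in lebesgue_on \<Omega>. ennreal ((norm (U (\<epsilon> n) x - U 0 x))^2) <= 4 * G x" for n
   using null AE_space
  proof eventually_elim
   fix x assume x: "x \<notin> S" "x \<in> space (lebesgue_on \<Omega>)"
   then have x\<Omega>: "x \<in> \<Omega>" by (simp add: space_restrict_space)
   have "ennreal ((norm (U (\<epsilon> n) x - U 0 x))^2) <= 2 * ennreal ((norm (U (\<epsilon> n) x))^2) + 2 * ennreal ((norm (U 0 x))^2)"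
    using power2_norm_diff_le[of "U (\<epsilon> n) x" "U 0 x"] by (intro ennreal_le_twice_add) auto
   also have "\<dots> <= 2 * G x + 2 * G x" by (intro add_mono mult_left_mono G x\<Omega> x \<epsilon>) auto
   also have "\<dots> = 4 * G x" by (simp flip: distrib_right)
   finally show "ennreal ((norm (U (\<epsilon> n) x - U 0 x))^2) <= 4 * G x" .
  qed
  show "AE x in lebesgue_on \<Omega>. (%n. ennreal ((norm (U (\<epsilon> n) x - U 0 x))^2)) \<longlonglongrightarrow> 0"
   using null AE_space
  proof eventually_elim
   fix x assume x: "x \<notin> S" "x \<in> space (lebesgue_on \<Omega>)"
   then have "near 0 x" using near[of x 0] by (simp add: space_restrict_space)
   then have w0: "wt 0 x > 0" using good_off[OF x(1)] by (intro wt_pos) auto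
   have "(%n. U (\<epsilon> n) x) \<longlonglongrightarrow> U 0 x" unfolding U_def
    by (intro tendsto_Pair tendsto_vec_lambda tendsto_ext[OF x(1) w0 \<epsilon>(1,3) g])
   then have "(%n. (norm (U (\<epsilon> n) x - U 0 x))^2) \<longlonglongrightarrow> (norm (U 0 x - U 0 x))\<^sup>2" by (intro tendsto_intros)
   from tendsto_ennrealI[OF this] show "(%n. ennreal ((norm (U (\<epsilon> n) x - U 0 x))^2)) \<longlonglongrightarrow> 0" by simp
  qed
 qed (use D in auto)
 then have lim0: "(%n. sqd (lebesgue_on \<Omega>) (U (\<epsilon> n)) (U 0)) \<longlonglongrightarrow> 0" by simp
 have tr: "(%n. sqd M (ext g (\<epsilon> n)) g) \<longlonglongrightarrow> 0"
 proof (rule tendsto_sandwich[OF _ _ tendsto_const])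
  define h where "h = (\<integral>\<^sup>+y. (\<integral>\<^sup>+z. ennreal ((cmod (g y - g z))^2 / (dist y z)^2) \<partial>M) \<partial>M)"
  show "\<forall>\<^sub>F n in sequentially. sqd M (ext g (\<epsilon> n)) g <= ennreal (16 / c * sqrt (\<epsilon> n)) * h"
   unfolding sqd_def h_def using near \<epsilon> by (intro always_eventually allI ext_trace_error g) auto
  have "(%n. ennreal (16 / c * sqrt (\<epsilon> n))) \<longlonglongrightarrow> ennreal (16 / c * sqrt 0)" by (intro tendsto_intros \<epsilon>(1))
  then have "(%n. ennreal (16 / c * sqrt (\<epsilon> n)) * h) \<longlonglongrightarrow> ennreal (16 / c * sqrt 0) * h"
   using half by (intro tendsto_mult_ennreal tendsto_const) (auto simp: h_def)
  then show "(%n. ennreal (16 / c * sqrt (\<epsilon> n)) * h) \<longlonglongrightarrow> 0" by simp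
 qed auto
 show ?thesis
 proof (rule bexI[OF _ mU[of 0]], intro allI impI)
  fix \<eta> :: real assume "\<eta> > 0"
  then have "\<forall>\<^sub>F n in sequentially. sqd (lebesgue_on \<Omega>) (U (\<epsilon> n)) (U 0) < ennreal \<eta>" "\<forall>\<^sub>F n in sequentially. sqd M (ext g (\<epsilon> n)) g < ennreal \<eta>"
   using order_tendstoD(2)[OF lim0, of "ennreal \<eta>"] order_tendstoD(2)[OF tr, of "ennreal \<eta>"] by auto
  then have "\<forall>\<^sub>F n in sequentially. sqd (lebesgue_on \<Omega>) (U (\<epsilon> n)) (U 0) < ennreal \<eta> \<and> sqd M (ext g (\<epsilon> n)) g < ennreal \<eta>"
   by (rule eventually_conj)
  then obtain n where "sqd (lebesgue_on \<Omega>) (U (\<epsilon> n)) (U 0) < ennreal \<eta>" "sqd M (ext g (\<epsilon> n)) g < ennreal \<eta>"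
   using eventually_happens'[OF sequentially_bot] by blast
  then show "\<exists>\<phi>. smooth \<phi> \<and> sqd (lebesgue_on \<Omega>) (jet \<phi>) (U 0) <= ennreal \<eta> \<and> sqd M \<phi> g <= ennreal \<eta>"
   using jet[OF \<epsilon>(2)[of n]] by (intro exI[of _ "ext g (\<epsilon> n)"]) (auto simp: less_imp_le)
 qed
qed

end

section \<open>The Hilbert space of jets with zero trace\<close>

definition cip :: "complex \<times> (complex^2) => complex \<times> (complex^2) => complex" where
 "cip p q = fst p * cnj (fst q) + (\<Sum>i\<in>UNIV. snd p $ i * cnj (snd q $ i))"

lemma Re_cip: "Re (cip p q) = p \<bullet> q"
 by (simp add: cip_def inner_prod_def inner_vec_def inner_complex_def)

lemma cip_cmul: "cip p (cmul c q) = cnj c * cip p q"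
 by (simp add: cip_def sum_2 algebra_simps)

text \<open>The imaginary part is the real inner product with i q, because \<open>cip\<close> is
  conjugate-linear in its second argument.\<close>

lemma cip_eq: "cip p q = complex_of_real (p \<bullet> q) + \<i> * complex_of_real (p \<bullet> cmul \<i> q)"
 by (simp add: complex_eq_iff Re_cip[symmetric] cip_cmul)

lemma cip_diff_left: "cip (p - p') q = cip p q - cip p' q"
 by (simp add: cip_def sum_2 algebra_simps)

lemma cmul_minus_one: "cmul (- 1) p = - p"
 by (simp add: cmul_def prod_eq_iff vec_eq_iff)

context edge_domain
begin

definition sqi :: "(real^2 => complex \<times> (complex^2)) => bool" where
 "sqi U \<longleftrightarrow> U \<in> borel_measurable (lebesgue_on \<Omega>) \<and> (\<integral>\<^sup>+x. ennreal ((norm (U x))^2) \<partial>lebesgue_on \<Omega>) < \<infinity>"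

text \<open>Fields on \<Omega> enter the L2 type of the whole plane through their zero extension, so
  one type serves every domain.\<close>

definition cls :: "(real^2 => complex \<times> (complex^2)) => (real^2, complex \<times> (complex^2)) l2" where
 "cls U = abs_l2 (%x. indicator \<Omega> x *\<^sub>R U x)"

lemma sets_\<Omega> [measurable]: "\<Omega> \<in> sets lebesgue" "\<Omega> \<in> sets borel"
 using open_\<Omega> by auto

lemma AE_on: "AE x in lebesgue. P x ==> AE x in lebesgue_on \<Omega>. P x"
 by (auto simp: AE_restrict_space_iff elim: eventually_mono)

lemma sqi_sq_integrable:
 assumes "sqi U"
 shows "sq_integrable (%x. indicator \<Omega> x *\<^sub>R U x)"
proof -
 have "(\<integral>\<^sup>+x. ennreal ((norm (indicator \<Omega> x *\<^sub>R U x))^2) \<partial>lebesgue) = (\<integral>\<^sup>+x. ennreal ((norm (U x))^2) \<partial>lebesgue_on \<Omega>)"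
  by (subst nn_integral_restrict_space) (auto simp: indicator_def intro!: nn_integral_cong)
 then show ?thesis using assms unfolding sqi_def sq_integrable_def
  by (subst (asm) borel_measurable_restrict_space_iff) auto
qed

lemma fun_of_cls: "sqi U ==> AE x in lebesgue. fun_of (cls U) x = indicator \<Omega> x *\<^sub>R U x"
 unfolding cls_def by (intro fun_of_abs sqi_sq_integrable)

lemma fun_of_cls_on:
 assumes "sqi U"
 shows "AE x in lebesgue_on \<Omega>. fun_of (cls U) x = U x"
proof -
 have "AE x in lebesgue. x \<in> \<Omega> \<longrightarrow> fun_of (cls U) x = U x"
  using fun_of_cls[OF assms] by eventually_elim simp
 then show ?thesis by (simp add: AE_restrict_space_iff)
qed

lemma integral_cls:
 assumes "sqi U" "sqi V"
 shows "integrable (lebesgue_on \<Omega>) (%x. U x \<bullet> V x)" "(LINT x|lebesgue_on \<Omega>. U x \<bullet> V x) = cls U \<bullet> cls V"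
proof -
 have ae: "AE x in lebesgue. fun_of (cls U) x \<bullet> fun_of (cls V) x = indicator \<Omega> x *\<^sub>R (U x \<bullet> V x)"
  using fun_of_cls[OF assms(1)] fun_of_cls[OF assms(2)] by eventually_elim (auto simp: indicator_def)
 have m: "(%x. indicator \<Omega> x *\<^sub>R (U x \<bullet> V x)) \<in> borel_measurable lebesgue"
  using assms by (subst borel_measurable_restrict_space_iff[symmetric]) (auto simp: sqi_def)
 have "integrable lebesgue (%x. indicator \<Omega> x *\<^sub>R (U x \<bullet> V x))"
  by (rule integrable_cong_AE_imp[OF integrable_inner_l2[of "cls U" "cls V"] m]) (use ae in auto)
 then show "integrable (lebesgue_on \<Omega>) (%x. U x \<bullet> V x)" by (simp add: integrable_restrict_space)
 show "(LINT x|lebesgue_on \<Omega>. U x \<bullet> V x) = cls U \<bullet> cls V"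
  unfolding inner_l2_def by (subst integral_restrict_space) (use m ae in \<open>auto intro!: integral_cong_AE\<close>)
qed

lemma sqi_cmul: "sqi U ==> sqi (%x. cmul c (U x))"
 unfolding sqi_def norm_cmul power_mult_distrib
 by (auto simp: ennreal_mult nn_integral_cmult ennreal_mult_less_top intro!: measurable_cmul)

lemma sqi_add: "sqi U ==> sqi V ==> sqi (%x. U x + V x)"
proof -
 assume *: "sqi U" "sqi V"
 then have [measurable]: "U \<in> borel_measurable (lebesgue_on \<Omega>)" "V \<in> borel_measurable (lebesgue_on \<Omega>)" by (auto simp: sqi_def)
 have "(\<integral>\<^sup>+x. ennreal ((norm (U x + V x))^2) \<partial>lebesgue_on \<Omega>)
   <= (\<integral>\<^sup>+x. 2 * ennreal ((norm (U x))^2) + 2 * ennreal ((norm (V x))^2) \<partial>lebesgue_on \<Omega>)"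
  by (intro nn_integral_mono ennreal_le_twice_add power2_norm_add_le) auto
 also have "\<dots> < \<infinity>" using * by (auto simp: sqi_def nn_integral_add nn_integral_cmult ennreal_mult_less_top)
 finally show ?thesis unfolding sqi_def by simp
qed

lemma sqi_diff: "sqi U ==> sqi V ==> sqi (%x. U x - V x)"
 using sqi_add[OF _ sqi_cmul[of V "-1"], of U] by (simp add: cmul_minus_one)

lemma sqi_jet_limit: "jet_limit \<Omega> E' U g ==> sqi U"
 unfolding sqi_def using jet_limit_finite[OF open_\<Omega> bounded_\<Omega>] by (auto simp: jet_limit_def)

lemma sqi_jet:
 assumes "smooth \<phi>"
 shows "sqi (jet \<phi>)"
proof (rule sqi_jet_limit)
 show "jet_limit \<Omega> {} (jet \<phi>) \<phi>" unfolding jet_limit_def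
  using assms by (auto intro!: measurable_jet measurable_smooth_arclength exI[of _ \<phi>] simp: sqd_def)
qed

lemma sqi_fun_of: "sqi (fun_of X)"
 unfolding sqi_def
proof
 show "fun_of X \<in> borel_measurable (lebesgue_on \<Omega>)" by (rule measurable_restrict_space1) simp
 have "(\<integral>\<^sup>+x. ennreal ((norm (fun_of X x))^2) \<partial>lebesgue_on \<Omega>) <= (\<integral>\<^sup>+x. ennreal ((norm (fun_of X x))^2) \<partial>lebesgue)"
  by (subst nn_integral_restrict_space) (auto intro!: nn_integral_mono simp: indicator_def)
 also have "\<dots> < \<infinity>" by (simp add: ennreal_norm_l2[symmetric])
 finally show "(\<integral>\<^sup>+x. ennreal ((norm (fun_of X x))^2) \<partial>lebesgue_on \<Omega>) < \<infinity>" .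
qed

lemma integral_cip:
 assumes "sqi U" "sqi V"
 shows "integrable (lebesgue_on \<Omega>) (%x. cip (U x) (V x))"
  "(LINT x|lebesgue_on \<Omega>. cip (U x) (V x)) = complex_of_real (cls U \<bullet> cls V) + \<i> * complex_of_real (cls U \<bullet> cls (%x. cmul \<i> (V x)))"
 unfolding cip_eq using integral_cls[OF assms] integral_cls[OF assms(1) sqi_cmul[OF assms(2), of \<i>]]
 by (simp_all flip: integral_complex_of_real)

lemma norm_cls_diff:
 assumes "sqi U" "sqi V"
 shows "ennreal ((norm (cls U - cls V))^2) = sqd (lebesgue_on \<Omega>) U V"
proof -
 have "ennreal ((norm (cls U - cls V))^2) = (\<integral>\<^sup>+x. ennreal ((norm (U x - V x))^2) * indicator \<Omega> x \<partial>lebesgue)"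
  unfolding ennreal_norm_diff_l2
  by (rule nn_integral_cong_AE, use fun_of_cls[OF assms(1)] fun_of_cls[OF assms(2)] in eventually_elim) (auto simp: indicator_def)
 then show ?thesis unfolding sqd_def by (subst nn_integral_restrict_space) auto
qed

text \<open>The second condition selects the zero extension; the class outside \<Omega> would
  otherwise be arbitrary, and one field on \<Omega> would correspond to many elements.\<close>

definition H :: "(real^2, complex \<times> (complex^2)) l2 set" where
 "H = {X. jet_limit \<Omega> E (fun_of X) (%x. 0) \<and> (AE x in lebesgue. x \<notin> \<Omega> \<longrightarrow> fun_of X x = 0)}"

lemma measurable_fun_of_on: "fun_of X \<in> borel_measurable (lebesgue_on \<Omega>)"
 by (rule measurable_restrict_space1) simp

lemma cls_in_H:
 assumes "jet_limit \<Omega> E V (%x. 0)"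
 shows "cls V \<in> H"
proof -
 note sq = sqi_jet_limit[OF assms]
 have "jet_limit \<Omega> E (fun_of (cls V)) (%x. 0)"
  by (rule jet_limit_cong_AE[OF assms measurable_fun_of_on]) (use fun_of_cls_on[OF sq] in auto)
 moreover have "AE x in lebesgue. x \<notin> \<Omega> \<longrightarrow> fun_of (cls V) x = 0"
  using fun_of_cls[OF sq] by eventually_elim simp
 ultimately show ?thesis by (simp add: H_def)
qed

lemma cls_fun_of:
 assumes "X \<in> H"
 shows "cls (fun_of X) = X"
proof (rule l2_eqI)
 have "AE x in lebesgue. x \<notin> \<Omega> \<longrightarrow> fun_of X x = 0" using assms by (simp add: H_def)
 then show "AE x in lebesgue. fun_of (cls (fun_of X)) x = fun_of X x"
  using fun_of_cls[OF sqi_fun_of[of X]] by eventually_elim (auto simp: indicator_def)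
qed

lemma subspace_H: "subspace H"
proof (rule subspaceI)
 show "0 \<in> H" unfolding H_def
 proof (intro CollectI conjI)
  show "jet_limit \<Omega> E (fun_of 0) (%x. 0)"
   by (rule jet_limit_cong_AE[OF jet_limit_zero measurable_fun_of_on]) (use AE_on[OF fun_of_zero] in auto)
 qed (use fun_of_zero in auto)
next
 fix X Y assume "X \<in> H" "Y \<in> H"
 then have XY: "jet_limit \<Omega> E (fun_of X) (%x. 0)" "jet_limit \<Omega> E (fun_of Y) (%x. 0)"
  "AE x in lebesgue. x \<notin> \<Omega> \<longrightarrow> fun_of X x = 0" "AE x in lebesgue. x \<notin> \<Omega> \<longrightarrow> fun_of Y x = 0" by (auto simp: H_def)
 have c1: "cmul 1 p = p" for p by (simp add: cmul_def)
 have "jet_limit \<Omega> E (%x. fun_of X x + fun_of Y x) (%x. 0)"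
  using jet_limit_linear[OF XY(1,2), of 1] by (simp add: c1)
 from jet_limit_cong_AE[OF this measurable_fun_of_on] have "jet_limit \<Omega> E (fun_of (X + Y)) (%x. 0)"
  using AE_on[OF fun_of_add[of X Y]] by (simp add: eq_commute)
 moreover have "AE x in lebesgue. x \<notin> \<Omega> \<longrightarrow> fun_of (X + Y) x = 0"
  using XY(3,4) fun_of_add[of X Y] by eventually_elim simp
 ultimately show "X + Y \<in> H" by (simp add: H_def)
next
 fix r :: real and X assume "X \<in> H"
 then have X: "jet_limit \<Omega> E (fun_of X) (%x. 0)" "AE x in lebesgue. x \<notin> \<Omega> \<longrightarrow> fun_of X x = 0" by (auto simp: H_def)
 have cr: "cmul (complex_of_real r) p = r *\<^sub>R p" for p by (simp add: cmul_def prod_eq_iff vec_eq_iff scaleR_conv_of_real[where 'a = complex])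
 have "jet_limit \<Omega> E (%x. r *\<^sub>R fun_of X x) (%x. 0)"
  using jet_limit_linear[OF jet_limit_zero X(1), of "complex_of_real r"] by (simp add: cr)
 from jet_limit_cong_AE[OF this measurable_fun_of_on] have "jet_limit \<Omega> E (fun_of (r *\<^sub>R X)) (%x. 0)"
  using AE_on[OF fun_of_scaleR[of r X]] by (simp add: eq_commute)
 moreover have "AE x in lebesgue. x \<notin> \<Omega> \<longrightarrow> fun_of (r *\<^sub>R X) x = 0"
  using X(2) fun_of_scaleR[of r X] by eventually_elim simp
 ultimately show "r *\<^sub>R X \<in> H" by (simp add: H_def)
qed

text \<open>The first condition passes to limits by \<open>jet_limit_closed\<close>, the second
  because the L2 norm of the limit off \<Omega> is at most its distance to any element of the
  space.\<close>

lemma closed_H: "closed H"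
proof -
 have "X \<in> H" if Xn: "\<And>n. Xn n \<in> H" and lim: "Xn \<longlonglongrightarrow> X" for Xn X
 proof -
  have small: "\<exists>n. (norm (Xn n - X))^2 <= e" if "e > 0" for e
  proof -
   have "(%n. (norm (Xn n - X))^2) \<longlonglongrightarrow> (norm (X - X))\<^sup>2" by (intro tendsto_intros lim)
   then have "\<forall>\<^sub>F n in sequentially. (norm (Xn n - X))^2 < e" using that by (intro order_tendstoD(2)) auto
   then show ?thesis using eventually_happens'[OF sequentially_bot] by (meson less_imp_le)
  qed
  have "jet_limit \<Omega> E (fun_of X) (%x. 0)"
  proof (rule jet_limit_closed[OF measurable_fun_of_on])
   fix e :: real assume "e > 0"
   then obtain n where n: "(norm (Xn n - X))^2 <= e" using small by blast
   have "sqd (lebesgue_on \<Omega>) (fun_of (Xn n)) (fun_of X) <= ennreal ((norm (Xn n - X))^2)"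
    unfolding ennreal_norm_diff_l2 sqd_def
    by (subst nn_integral_restrict_space) (auto intro!: nn_integral_mono simp: indicator_def)
   also have "\<dots> <= ennreal e" using n by (rule ennreal_leI)
   finally show "\<exists>V. jet_limit \<Omega> E V (%x. 0) \<and> sqd (lebesgue_on \<Omega>) V (fun_of X) <= ennreal e"
    using Xn[of n] by (auto simp: H_def)
  qed
  moreover have "AE x in lebesgue. x \<notin> \<Omega> \<longrightarrow> fun_of X x = 0"
  proof -
   define I where "I = (\<integral>\<^sup>+x. ennreal ((norm (fun_of X x))^2) * indicator (- \<Omega>) x \<partial>lebesgue)"
   have "I <= ennreal e" if "e > 0" for e
   proof -
    obtain n where n: "(norm (Xn n - X))^2 <= e" using small[OF \<open>e > 0\<close>] by blast
    have z: "AE x in lebesgue. x \<notin> \<Omega> \<longrightarrow> fun_of (Xn n) x = 0" using Xn[of n] by (simp add: H_def)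
    have "I <= ennreal ((norm (Xn n - X))^2)"
     unfolding I_def ennreal_norm_diff_l2
     by (rule nn_integral_mono_AE, use z in eventually_elim) (auto simp: indicator_def)
    also have "\<dots> <= ennreal e" using n by (rule ennreal_leI)
    finally show ?thesis .
   qed
   then have "I = 0" by (metis ennreal_le_epsilon add.left_neutral le_zero_eq)
   then have "AE x in lebesgue. ennreal ((norm (fun_of X x))^2) * indicator (- \<Omega>) x = 0"
    unfolding I_def by (subst (asm) nn_integral_0_iff_AE) measurable
   then show ?thesis by eventually_elim (auto simp: ennreal_eq_0_iff indicator_def)
  qed
  ultimately show ?thesis by (simp add: H_def)
 qed
 then show ?thesis by (auto simp: closed_sequential_limits)
qed

definition value_sq :: "(real^2, complex \<times> (complex^2)) l2 => real" where
 "value_sq F = (LINT x|lebesgue. fst (fun_of F x) \<bullet> fst (fun_of F x))"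

definition slope_sq :: "2 => (real^2, complex \<times> (complex^2)) l2 => real" where
 "slope_sq i F = (LINT x|lebesgue. snd (fun_of F x) $ i \<bullet> snd (fun_of F x) $ i)"

lemma fst_inner_le: "\<bar>fst p \<bullet> fst q\<bar> <= 1 * norm p * norm q"
 and snd_inner_le: "\<bar>snd p $ i \<bullet> snd q $ i\<bar> <= 1 * norm p * norm q" for p q :: "complex \<times> (complex^2)"
proof -
 have f: "norm (fst p) <= norm p" "norm (snd p $ i) <= norm p" for p :: "complex \<times> (complex^2)"
  using cmod_fst_le[of p] cmod_snd_le[of p i] by (auto intro: power2_le_imp_le)
 show "\<bar>fst p \<bullet> fst q\<bar> <= 1 * norm p * norm q" "\<bar>snd p $ i \<bullet> snd q $ i\<bar> <= 1 * norm p * norm q"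
  using Cauchy_Schwarz_ineq2[of "fst p" "fst q"] Cauchy_Schwarz_ineq2[of "snd p $ i" "snd q $ i"]
   mult_mono[OF f(1) f(1), of p q] mult_mono[OF f(2) f(2), of p q] by (auto intro: order_trans)
qed

lemma measurable_fst_fun_of [measurable]: "(%x. fst (fun_of F x)) \<in> borel_measurable lebesgue"
 and measurable_snd_fun_of [measurable]: "(%x. snd (fun_of F x) $ i) \<in> borel_measurable lebesgue"
 for F :: "(real^2, complex \<times> (complex^2)) l2"
 using measurable_pair_vecD[OF measurable_fun_of[of F]] by auto

lemma bounded_bilinear_value: "bounded_bilinear (%(F :: (real^2, complex \<times> (complex^2)) l2) (G :: (real^2, complex \<times> (complex^2)) l2). LINT x|lebesgue. fst (fun_of F x) \<bullet> fst (fun_of G x))"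
 by (rule bounded_bilinear_l2[where C = 1 and b = "%(x :: real^2) p q. fst p \<bullet> fst (q :: complex \<times> (complex^2))"])
  (simp_all only: fst_inner_le fst_add fst_scaleR inner_add_left inner_add_right inner_scaleR_left inner_scaleR_right real_scaleR_def
   borel_measurable_inner measurable_pair_vecD)

lemma bounded_bilinear_slope: "bounded_bilinear (%(F :: (real^2, complex \<times> (complex^2)) l2) (G :: (real^2, complex \<times> (complex^2)) l2). LINT x|lebesgue. snd (fun_of F x) $ i \<bullet> snd (fun_of G x) $ i)"
 by (rule bounded_bilinear_l2[where C = 1 and b = "%(x :: real^2) p q. snd p $ i \<bullet> snd (q :: complex \<times> (complex^2)) $ i"])
  (simp_all only: snd_inner_le snd_add snd_scaleR vector_add_component vector_scaleR_component inner_add_left inner_add_right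
   inner_scaleR_left inner_scaleR_right real_scaleR_def borel_measurable_inner measurable_pair_vecD)

lemma tendsto_value_sq: "(Fn \<longlongrightarrow> F) net ==> ((%n. value_sq (Fn n)) \<longlongrightarrow> value_sq F) net"
 unfolding value_sq_def by (rule bounded_bilinear.tendsto[OF bounded_bilinear_value])

lemma tendsto_slope_sq: "(Fn \<longlongrightarrow> F) net ==> ((%n. slope_sq i (Fn n)) \<longlongrightarrow> slope_sq i F) net"
 unfolding slope_sq_def by (rule bounded_bilinear.tendsto[OF bounded_bilinear_slope])

lemma ennreal_value_sq: "ennreal (value_sq F) = (\<integral>\<^sup>+x. ennreal ((cmod (fst (fun_of F x)))^2) \<partial>lebesgue)"
proof -
 have "integrable lebesgue (%x. fst (fun_of F x) \<bullet> fst (fun_of F x))"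
  by (rule integrable_bilinear_field[where b = "%(x :: real^2) p q. fst p \<bullet> fst q", OF _ _ fst_inner_le]) (simp_all, measurable)
 then show ?thesis unfolding value_sq_def power2_norm_eq_inner by (simp add: nn_integral_eq_integral)
qed

lemma ennreal_slope_sq: "ennreal (slope_sq i F) = (\<integral>\<^sup>+x. ennreal ((cmod (snd (fun_of F x) $ i))^2) \<partial>lebesgue)"
proof -
 have "integrable lebesgue (%x. snd (fun_of F x) $ i \<bullet> snd (fun_of F x) $ i)"
  by (rule integrable_bilinear_field[where b = "%(x :: real^2) p q. snd p $ i \<bullet> snd q $ i", OF _ _ snd_inner_le]) (simp_all, measurable)
 then show ?thesis unfolding slope_sq_def power2_norm_eq_inner by (simp add: nn_integral_eq_integral)
qed

lemma value_sq_nonneg: "0 <= value_sq F" and slope_sq_nonneg: "0 <= slope_sq i F"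
 unfolding value_sq_def slope_sq_def by (simp_all add: integral_nonneg_AE)

lemma norm_sq_split: "(norm F)^2 = value_sq F + slope_sq 1 F + slope_sq 2 F"
proof -
 have m: "(%x. ennreal ((cmod (fst (fun_of F x)))^2)) \<in> borel_measurable lebesgue" "(%x. ennreal ((cmod (snd (fun_of F x) $ i))^2)) \<in> borel_measurable lebesgue" for i
  by measurable
 have "ennreal ((norm F)^2) = (\<integral>\<^sup>+x. ennreal ((cmod (fst (fun_of F x)))^2) + (ennreal ((cmod (snd (fun_of F x) $ 1))^2) + ennreal ((cmod (snd (fun_of F x) $ 2))^2)) \<partial>lebesgue)"
  unfolding ennreal_norm_l2 power2_norm_jet by (simp add: sum_2 ennreal_plus)
 also have "\<dots> = ennreal (value_sq F) + (ennreal (slope_sq 1 F) + ennreal (slope_sq 2 F))"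
  unfolding ennreal_value_sq ennreal_slope_sq using m by (simp add: nn_integral_add)
 also have "\<dots> = ennreal (value_sq F + slope_sq 1 F + slope_sq 2 F)"
  by (simp add: ennreal_plus value_sq_nonneg slope_sq_nonneg add.assoc)
 finally show ?thesis by (subst (asm) ennreal_inj) (auto simp: value_sq_nonneg slope_sq_nonneg intro!: add_nonneg_nonneg)
qed

lemma value_sq_jet:
 assumes "smooth \<phi>"
 shows "(\<integral>\<^sup>+x. ennreal ((cmod (cut \<phi> x))^2) \<partial>lborel) = ennreal (value_sq (cls (jet \<phi>)))"
  "(\<integral>\<^sup>+x. ennreal ((cmod (partial i \<phi> x))^2) * indicator \<Omega> x \<partial>lborel) = ennreal (slope_sq i (cls (jet \<phi>)))"
proof -
 note ae = fun_of_cls[OF sqi_jet[OF assms]]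
 note [measurable] = measurable_cut[OF assms] smooth_measurable[OF smooth_partial[OF assms]]
 have "(\<integral>\<^sup>+x. ennreal ((cmod (cut \<phi> x))^2) \<partial>lborel) = (\<integral>\<^sup>+x. ennreal ((cmod (cut \<phi> x))^2) \<partial>lebesgue)"
  by (rule nn_integral_completion[symmetric])
 also have "\<dots> = ennreal (value_sq (cls (jet \<phi>)))" unfolding ennreal_value_sq
  by (rule nn_integral_cong_AE, use ae in eventually_elim) (simp add: cut_def jet_def)
 finally show "(\<integral>\<^sup>+x. ennreal ((cmod (cut \<phi> x))^2) \<partial>lborel) = ennreal (value_sq (cls (jet \<phi>)))" .
 have "(\<integral>\<^sup>+x. ennreal ((cmod (partial i \<phi> x))^2) * indicator \<Omega> x \<partial>lborel) = (\<integral>\<^sup>+x. ennreal ((cmod (partial i \<phi> x))^2) * indicator \<Omega> x \<partial>lebesgue)"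
  by (rule nn_integral_completion[symmetric])
 also have "\<dots> = ennreal (slope_sq i (cls (jet \<phi>)))" unfolding ennreal_slope_sq
  by (rule nn_integral_cong_AE, use ae in eventually_elim) (auto simp: jet_def indicator_def)
 finally show "(\<integral>\<^sup>+x. ennreal ((cmod (partial i \<phi> x))^2) * indicator \<Omega> x \<partial>lborel) = ennreal (slope_sq i (cls (jet \<phi>)))" .
qed

lemma null_sequence_le:
 fixes X :: "nat => real"
 assumes "\<And>n. 0 <= X n" "\<And>n. X n <= 1 / real (Suc n)"
 shows "X \<longlonglongrightarrow> 0"
proof (rule tendsto_sandwich[of "%n. 0" X sequentially "%n. inverse (real (Suc n))"])
 show "\<forall>\<^sub>F n in sequentially. X n <= inverse (real (Suc n))"
  using assms(2) by (simp add: divide_inverse del: of_nat_Suc)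
qed (use assms(1) LIMSEQ_inverse_real_of_nat in auto)

lemma H_approximation:
 assumes "X \<in> H"
 obtains \<phi> where "\<And>n. smooth (\<phi> n)" "(%n. cls (jet (\<phi> n))) \<longlonglongrightarrow> X"
  "\<And>n. (\<integral>\<^sup>+x. ennreal ((cmod (\<phi> n x))^2) \<partial>arclength E) <= ennreal (1 / real (Suc n))"
proof -
 have J: "jet_limit \<Omega> E (fun_of X) (%x. 0)" using assms by (simp add: H_def)
 have "\<exists>\<phi>. smooth \<phi> \<and> sqd (lebesgue_on \<Omega>) (jet \<phi>) (fun_of X) <= ennreal (1 / real (Suc n)) \<and> sqd (arclength E) \<phi> (%x. 0) <= ennreal (1 / real (Suc n))" for n
  using jet_limitD[OF J, of "1 / real (Suc n)"] by (metis of_nat_0_less_iff zero_less_Suc zero_less_divide_1_iff)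
 then obtain \<phi> where \<phi>: "\<And>n. smooth (\<phi> n)" "\<And>n. sqd (lebesgue_on \<Omega>) (jet (\<phi> n)) (fun_of X) <= ennreal (1 / real (Suc n))"
  "\<And>n. sqd (arclength E) (\<phi> n) (%x. 0) <= ennreal (1 / real (Suc n))" by metis
 have "(norm (cls (jet (\<phi> n)) - X))^2 <= 1 / real (Suc n)" for n

 proof -
  have "ennreal ((norm (cls (jet (\<phi> n)) - cls (fun_of X)))^2) <= ennreal (1 / real (Suc n))"
   using \<phi>(2)[of n] by (simp only: norm_cls_diff[OF sqi_jet[OF \<phi>(1)[of n]] sqi_fun_of[of X]])
  then show ?thesis unfolding cls_fun_of[OF assms] by (subst (asm) ennreal_le_iff) auto
 qed
 then have "(%n. (norm (cls (jet (\<phi> n)) - X))^2) \<longlonglongrightarrow> 0"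
  by (rule null_sequence_le[rotated]) simp
 then have "(%n. sqrt ((norm (cls (jet (\<phi> n)) - X))^2)) \<longlonglongrightarrow> sqrt 0" by (rule tendsto_real_sqrt)
 then have "(%n. norm (cls (jet (\<phi> n)) - X)) \<longlonglongrightarrow> 0" by simp
 then have "(%n. cls (jet (\<phi> n)) - X) \<longlonglongrightarrow> 0" by (rule tendsto_norm_zero_cancel)
 then have "(%n. cls (jet (\<phi> n))) \<longlonglongrightarrow> X" by (rule LIM_zero_cancel)
 then show thesis using \<phi>(1,3) by (intro that[of \<phi>]) (simp_all add: sqd_def)
qed

text \<open>The smooth inequality is used along approximants with boundary energy at most 1 / (n +
  1): that term vanishes, and the others are continuous in the L2 norm.\<close>

lemma poincare:
 assumes "X \<in> H"
 shows "value_sq X <= 32 * R^2 * slope_sq 1 X"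
proof -
 obtain \<phi> where \<phi>: "\<And>n. smooth (\<phi> n)" "(%n. cls (jet (\<phi> n))) \<longlonglongrightarrow> X"
  "\<And>n. (\<integral>\<^sup>+x. ennreal ((cmod (\<phi> n x))^2) \<partial>arclength E) <= ennreal (1 / real (Suc n))" using H_approximation[OF assms] by blast
 have "value_sq (cls (jet (\<phi> n))) <= 16 * R * inverse (real (Suc n)) + 32 * R^2 * slope_sq 1 (cls (jet (\<phi> n)))" for n
 proof -
  have "ennreal (value_sq (cls (jet (\<phi> n)))) <= ennreal (16 * R) * ennreal (1 / real (Suc n)) + ennreal (32 * R^2) * ennreal (slope_sq 1 (cls (jet (\<phi> n))))"
   using poincare_smooth[OF \<phi>(1)[of n]] unfolding value_sq_jet[OF \<phi>(1)]
   by (rule order_trans) (intro add_mono mult_left_mono \<phi>(3) order_refl, simp)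
  also have "\<dots> = ennreal (16 * R * inverse (real (Suc n)) + 32 * R^2 * slope_sq 1 (cls (jet (\<phi> n))))"
   using R slope_sq_nonneg by (subst ennreal_plus) (auto simp: ennreal_mult[symmetric] divide_inverse simp del: of_nat_Suc)
  finally show ?thesis using R slope_sq_nonneg by (subst (asm) ennreal_le_iff) (auto intro!: add_nonneg_nonneg mult_nonneg_nonneg)
 qed
 note le = this
 have "(%n. 16 * R * inverse (real (Suc n)) + 32 * R^2 * slope_sq 1 (cls (jet (\<phi> n)))) \<longlonglongrightarrow> 16 * R * 0 + 32 * R^2 * slope_sq 1 X"
  by (intro tendsto_add tendsto_mult tendsto_const LIMSEQ_inverse_real_of_nat tendsto_slope_sq \<phi>(2))
 from LIMSEQ_le[OF tendsto_value_sq[OF \<phi>(2)] this] le show ?thesis by simp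
qed

text \<open>The field whose inner product with a jet is the integral of the value component over one
  cell; the gradient slots are 0.\<close>

definition cell_vector :: "nat => nat => nat => real^2 => complex \<times> (complex^2)" where
 "cell_vector N j k x = (indicator (cell N j) (x $ 1) * indicator (cell N k) (x $ 2), 0)"

text \<open>Squared modulus of the cell integral, whose real and imaginary parts are two real inner
  products. In this form it is continuous on the L2 type.\<close>

definition cell_value :: "nat => nat => nat => (real^2, complex \<times> (complex^2)) l2 => real" where
 "cell_value N j k F = (F \<bullet> cls (cell_vector N j k))^2 + (F \<bullet> cls (%x. cmul \<i> (cell_vector N j k x)))^2"

lemma sqi_cell_vector:
 assumes "N > 0"
 shows "sqi (cell_vector N j k)"
 unfolding sqi_def
proof
 note [measurable] = cell_properties(2)[OF assms]
 show "cell_vector N j k \<in> borel_measurable (lebesgue_on \<Omega>)"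
  unfolding cell_vector_def by (intro borel_measurable_lebesgue_on measurable_pair_vec) measurable
 show "(\<integral>\<^sup>+x. ennreal ((norm (cell_vector N j k x))^2) \<partial>lebesgue_on \<Omega>) < \<infinity>"
  by (rule nn_integral_bounded_finite[OF bounded_open_finite_measure[OF open_\<Omega> bounded_\<Omega>], where B = 1])
   (auto simp: cell_vector_def norm_Pair indicator_def)
qed

lemma cell_value_jet:
 assumes \<phi>: "smooth \<phi>" and N: "N > 0"
 shows "(cmod (LINT x|lborel. cut \<phi> x * (indicator (cell N j) (x $ 1) * indicator (cell N k) (x $ 2))))^2 = cell_value N j k (cls (jet \<phi>))"
proof -
 note [measurable] = measurable_cut[OF \<phi>] cell_properties(2)[OF N]
 have "(LINT x|lborel. cut \<phi> x * (indicator (cell N j) (x $ 1) * indicator (cell N k) (x $ 2)))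
   = (LINT x|lebesgue. cut \<phi> x * (indicator (cell N j) (x $ 1) * indicator (cell N k) (x $ 2)))"
  by (rule integral_completion[symmetric]) measurable
 also have "\<dots> = (LINT x|lebesgue. indicator \<Omega> x *\<^sub>R cip (jet \<phi> x) (cell_vector N j k x))"
  by (intro Bochner_Integration.integral_cong) (auto simp: cut_def cip_def jet_def cell_vector_def indicator_def)
 also have "\<dots> = (LINT x|lebesgue_on \<Omega>. cip (jet \<phi> x) (cell_vector N j k x))"
  by (subst integral_restrict_space) auto
 finally show ?thesis unfolding integral_cip(2)[OF sqi_jet[OF \<phi>] sqi_cell_vector[OF N]] cell_value_def
  by (simp add: cmod_power2)
qed

lemma rellich:
 assumes "X \<in> H" and N: "N > 0"
 defines "h \<equiv> 2 * R / real N"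
 shows "value_sq X <= (\<Sum>j<N. \<Sum>k<N. 2 / h^2 * cell_value N j k X) + 32 * h^2 * (slope_sq 1 X + slope_sq 2 X)"
proof -
 obtain \<phi> where \<phi>: "\<And>n. smooth (\<phi> n)" "(%n. cls (jet (\<phi> n))) \<longlonglongrightarrow> X"
  "\<And>n. (\<integral>\<^sup>+x. ennreal ((cmod (\<phi> n x))^2) \<partial>arclength E) <= ennreal (1 / real (Suc n))" using H_approximation[OF assms(1)] by blast
 have cv: "0 <= cell_value N j k F" for j k F by (simp add: cell_value_def)
 define Q where "Q F = (\<Sum>j<N. \<Sum>k<N. 2 / h^2 * cell_value N j k F)" for F
 define P where "P F = 32 * h^2 * (slope_sq 1 F + slope_sq 2 F)" for F
 have Q0: "0 <= Q F" and P0: "0 <= P F" for F unfolding Q_def P_def by (auto intro!: sum_nonneg divide_nonneg_nonneg mult_nonneg_nonneg cv add_nonneg_nonneg slope_sq_nonneg)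
 have "value_sq (cls (jet (\<phi> n))) <= Q (cls (jet (\<phi> n))) + 128 * R * inverse (real (Suc n)) + P (cls (jet (\<phi> n)))" for n
 proof -
  let ?F = "cls (jet (\<phi> n))"
  have "ennreal (value_sq ?F) <= (\<Sum>j<N. \<Sum>k<N. ennreal (2 / h^2) * ennreal (cell_value N j k ?F))
    + ennreal (128 * R) * ennreal (1 / real (Suc n)) + ennreal (32 * h^2) * (ennreal (slope_sq 1 ?F) + ennreal (slope_sq 2 ?F))"
   using rellich_smooth[OF \<phi>(1)[of n] N, folded h_def] unfolding value_sq_jet[OF \<phi>(1)] cell_value_jet[OF \<phi>(1) N]
   by (rule order_trans) (intro add_mono mult_left_mono \<phi>(3) order_refl, simp)
  also have "(\<Sum>j<N. \<Sum>k<N. ennreal (2 / h^2) * ennreal (cell_value N j k ?F)) = ennreal (Q ?F)"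
   unfolding Q_def using cv by (simp add: ennreal_mult[symmetric] sum_ennreal sum_nonneg)
  also have "ennreal (32 * h^2) * (ennreal (slope_sq 1 ?F) + ennreal (slope_sq 2 ?F)) = ennreal (P ?F)"
   unfolding P_def using slope_sq_nonneg by (subst ennreal_mult) (auto simp: ennreal_plus)
  also have "ennreal (128 * R) * ennreal (1 / real (Suc n)) = ennreal (128 * R * inverse (real (Suc n)))"
   using R by (subst ennreal_mult[symmetric]) (auto simp: divide_inverse simp del: of_nat_Suc)
  also have "ennreal (Q ?F) + ennreal (128 * R * inverse (real (Suc n))) + ennreal (P ?F) = ennreal (Q ?F + 128 * R * inverse (real (Suc n)) + P ?F)"
   using Q0 P0 R by (simp add: ennreal_plus del: of_nat_Suc)
  finally show ?thesis using Q0 P0 R by (subst (asm) ennreal_le_iff) (auto intro!: add_nonneg_nonneg)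
 qed
 note le = this
 have "(%n. Q (cls (jet (\<phi> n)))) \<longlonglongrightarrow> Q X" unfolding Q_def cell_value_def by (intro tendsto_intros \<phi>(2))
 moreover have "(%n. P (cls (jet (\<phi> n)))) \<longlonglongrightarrow> P X" unfolding P_def by (intro tendsto_intros tendsto_slope_sq \<phi>(2))
 moreover have "(%n. 128 * R * inverse (real (Suc n))) \<longlonglongrightarrow> 128 * R * 0" by (intro tendsto_mult tendsto_const LIMSEQ_inverse_real_of_nat)
 ultimately have "(%n. Q (cls (jet (\<phi> n))) + 128 * R * inverse (real (Suc n)) + P (cls (jet (\<phi> n)))) \<longlonglongrightarrow> Q X + 128 * R * 0 + P X"
  by (intro tendsto_add)
 from LIMSEQ_le[OF tendsto_value_sq[OF \<phi>(2)] this] le show ?thesis by (simp add: Q_def P_def)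
qed

end

section \<open>Compactness of the zero order term and the complex Fredholm alternative\<close>

lemma finite_inner_convergent_subsequence:
 fixes u :: "nat => 'a::real_inner"
 assumes "finite W" "\<And>n. norm (u n) <= 1"
 shows "\<exists>r::nat=>nat. strict_mono r \<and> (\<forall>w\<in>W. convergent (%n. u (r n) \<bullet> w))"
 using assms(1)
proof induction
 case empty
 show ?case by (intro exI[of _ id] conjI strict_mono_id) simp
next
 case (insert w W)
 then obtain r :: "nat => nat" where r: "strict_mono r" "\<And>w. w \<in> W ==> convergent (%n. u (r n) \<bullet> w)" by blast
 have "bounded (range (%n. u (r n) \<bullet> w))"
 proof (rule boundedI)
  fix x assume "x \<in> range (%n. u (r n) \<bullet> w)"
  then obtain n where n: "x = u (r n) \<bullet> w" by blast
  have "\<bar>u (r n) \<bullet> w\<bar> <= norm (u (r n)) * norm w" by (rule Cauchy_Schwarz_ineq2)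
  also have "\<dots> <= 1 * norm w" by (intro mult_right_mono assms(2)) simp
  finally show "norm x <= norm w" by (simp add: n)
 qed
 then obtain l s where s: "strict_mono s" "((%n. u (r n) \<bullet> w) \<circ> s) \<longlonglongrightarrow> l"
  using bounded_imp_convergent_subsequence by blast
 have "convergent (%n. u (r (s n)) \<bullet> v)" if "v \<in> insert w W" for v
 proof (cases "v = w")
  case True
  then show ?thesis using s(2) by (auto simp: convergent_def o_def)
 next
  case False
  then show ?thesis using convergent_subseq_convergent[OF r(2) s(1), of v] that by (simp add: o_def)
 qed
 moreover have "strict_mono (%n. r (s n))" using strict_mono_o[OF r(1) s(1)] by (simp add: o_def)
 ultimately show ?case by (intro exI[of _ "%n. r (s n)"]) blast
qed

text \<open>Finitely many bounded scalar sequences converge along a common subsequence; dropping an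
  initial part makes all differences small at once.\<close>

lemma finite_inner_small_subsequence:
 fixes u :: "nat => 'a::real_inner"
 assumes W: "finite W" and u: "\<And>n. norm (u n) <= 1" and \<delta>: "\<delta> > 0"
 shows "\<exists>r::nat=>nat. strict_mono r \<and> (\<forall>w\<in>W. \<forall>n k. \<bar>(u (r n) - u (r k)) \<bullet> w\<bar> <= \<delta>)"
proof -
 obtain r :: "nat => nat" where r: "strict_mono r" "\<And>w. w \<in> W ==> convergent (%n. u (r n) \<bullet> w)"
  using finite_inner_convergent_subsequence[OF W, of u] u by blast
 have "\<forall>w\<in>W. \<forall>\<^sub>F n in sequentially. \<bar>u (r n) \<bullet> w - lim (%n. u (r n) \<bullet> w)\<bar> < \<delta> / 2"
 proof
  fix w assume "w \<in> W"
  from r(2)[OF this] have "(%n. u (r n) \<bullet> w) \<longlonglongrightarrow> lim (%n. u (r n) \<bullet> w)" by (simp add: convergent_LIMSEQ_iff)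
  from tendstoD[OF this, of "\<delta> / 2"] show "\<forall>\<^sub>F n in sequentially. \<bar>u (r n) \<bullet> w - lim (%n. u (r n) \<bullet> w)\<bar> < \<delta> / 2"
   using \<delta> by (simp add: dist_real_def)
 qed
 from eventually_ball_finite[OF W this]
 obtain n0 where n0: "\<And>n w. n \<ge> n0 ==> w \<in> W ==> \<bar>u (r n) \<bullet> w - lim (%n. u (r n) \<bullet> w)\<bar> < \<delta> / 2"
  unfolding eventually_sequentially by blast
 have "\<bar>(u (r (n + n0)) - u (r (k + n0))) \<bullet> w\<bar> <= \<delta>" if "w \<in> W" for w n k
  using n0[OF _ that, of "n + n0"] n0[OF _ that, of "k + n0"] unfolding inner_diff_left by linarith
 moreover have "strict_mono (%n. r (n + n0))" using r(1) by (simp add: strict_mono_def)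
 ultimately show ?thesis by (intro exI[of _ "%n. r (n + n0)"]) blast
qed

text \<open>The coefficient matrix is diagonal, so the principal and the zero order part act on jets
  as one diagonal multiplier.\<close>

definition dg :: "complex => (2 => complex) => complex \<times> (complex^2) => complex \<times> (complex^2)" where
 "dg a b p = (a * fst p, \<chi> i. b i * snd p $ i)"

lemma norm_dg_le:
 assumes "cmod a <= K" "\<And>i. cmod (b i) <= K"
 shows "norm (dg a b p) <= K * norm p"
proof -
 have K: "K \<ge> 0" using assms(1) norm_ge_zero[of a] by linarith
 have cm: "(cmod (x * y))^2 <= K^2 * (cmod y)^2" if "cmod x <= K" for x y
  unfolding norm_mult power_mult_distrib using that by (intro mult_right_mono power_mono) auto
 have "(norm (dg a b p))^2 = (cmod (a * fst p))^2 + ((cmod (b 1 * snd p $ 1))^2 + (cmod (b 2 * snd p $ 2))^2)"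
  unfolding power2_norm_jet by (simp add: dg_def sum_2)
 also have "\<dots> <= K^2 * (cmod (fst p))^2 + (K^2 * (cmod (snd p $ 1))^2 + K^2 * (cmod (snd p $ 2))^2)"
  by (rule add_mono[OF cm[OF assms(1)] add_mono[OF cm[OF assms(2)] cm[OF assms(2)]]])
 also have "\<dots> = K^2 * (norm p)^2"
  unfolding power2_norm_jet[of p] by (simp add: sum_2 distrib_left)
 finally have "(norm (dg a b p))^2 <= (K * norm p)^2" by (simp only: power_mult_distrib)
 then show ?thesis by (rule power2_le_imp_le) (simp add: K)
qed

lemma dg_linear:
 "dg a b (p + q) = dg a b p + dg a b q" "dg a b (r *\<^sub>R p) = r *\<^sub>R dg a b p" "dg a b (p - q) = dg a b p - dg a b q"
 by (simp_all add: dg_def prod_eq_iff vec_eq_iff algebra_simps)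

lemma measurable_dg:
 assumes "a \<in> borel_measurable M" "\<And>i. b i \<in> borel_measurable M" "U \<in> borel_measurable M"
 shows "(%x. dg (a x) (%i. b i x) (U x)) \<in> borel_measurable M"
 unfolding dg_def
 by (rule measurable_pair_vec) (use measurable_pair_vecD[OF assms(3)] assms(1,2) in auto)

context edge_domain
begin

text \<open>In the Rellich inequality the gradient term is small by the choice of the mesh; the rest
  depends on finitely many inner products, which a subsequence makes small.\<close>

lemma value_compactness:
 assumes u: "\<And>n. u n \<in> H" "\<And>n. norm (u n) <= 1" and \<epsilon>: "\<epsilon> > 0"
 shows "\<exists>r::nat=>nat. strict_mono r \<and> (\<forall>n k. value_sq (u (r n) - u (r k)) <= \<epsilon>)"
proof -
 \<comment> \<open>A difference of two elements of the unit ball has squared norm at most 4, so 32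
   h^2 * 4 = 512 R^2 / N^2 has to be at most half of \<epsilon>. The summand 1 ensures N >=
   1.\<close>
 obtain N :: nat where N: "real N > 1024 * R^2 / \<epsilon> + 1" using reals_Archimedean2 by blast
 have "1024 * R^2 / \<epsilon> \<ge> 0" using \<epsilon> by simp
 then have N1: "real N \<ge> 1" "real N \<ge> 1024 * R^2 / \<epsilon>" using N by linarith+
 then have N0: "N > 0" by (cases N) auto
 define h where "h = 2 * R / real N"
 have h: "h > 0" using R N0 by (simp add: h_def)
 have h2: "32 * h^2 * 4 <= \<epsilon> / 2"
 proof -
  have "1024 * R^2 <= \<epsilon> * real N" using N1(2) \<epsilon> by (simp add: pos_divide_le_eq mult.commute)
  also have "\<dots> <= \<epsilon> * (real N)^2" using \<epsilon> N1(1) by (intro mult_left_mono self_le_power) auto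
  finally have "1024 * R^2 / (real N)^2 <= \<epsilon>" using N0 by (simp add: pos_divide_le_eq)
  then show ?thesis by (simp add: h_def power_divide power_mult_distrib)
 qed
 \<comment> \<open>Each of the N^2 cells then contributes at most (2 / h^2) * 2 delta^2, which is
   \<epsilon> / (2 N^2).\<close>
 define \<delta> where "\<delta> = h * sqrt \<epsilon> / (sqrt 8 * real N)"
 have \<delta>: "\<delta> > 0" "\<delta>^2 = h^2 * \<epsilon> / (8 * (real N)^2)"
  using h \<epsilon> N0 by (auto simp: \<delta>_def power_divide power_mult_distrib)
 define W where "W = (%(j, k). cls (cell_vector N j k)) ` ({..<N} \<times> {..<N}) \<union> (%(j, k). cls (%x. cmul \<i> (cell_vector N j k x))) ` ({..<N} \<times> {..<N})"
 have "finite W" by (simp add: W_def)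
 from finite_inner_small_subsequence[where u = u, OF this u(2) \<delta>(1)]
 obtain r :: "nat => nat" where r: "strict_mono r" "\<And>w n k. w \<in> W ==> \<bar>(u (r n) - u (r k)) \<bullet> w\<bar> <= \<delta>" by blast
 have "value_sq (u (r n) - u (r k)) <= \<epsilon>" for n k
 proof -
  define X where "X = u (r n) - u (r k)"
  have XH: "X \<in> H" unfolding X_def by (intro subspace_diff subspace_H u)
  have cv: "2 / h^2 * cell_value N j l X <= \<epsilon> / (2 * (real N)^2)" if "j < N" "l < N" for j l
  proof -
   have "\<bar>X \<bullet> cls (cell_vector N j l)\<bar> <= \<delta>" "\<bar>X \<bullet> cls (%x. cmul \<i> (cell_vector N j l x))\<bar> <= \<delta>"
    unfolding X_def using that by (auto intro!: r(2) simp: W_def)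
   then have "(X \<bullet> cls (cell_vector N j l))^2 <= \<delta>^2" "(X \<bullet> cls (%x. cmul \<i> (cell_vector N j l x)))^2 <= \<delta>^2"
    using \<delta>(1) by (auto simp: abs_le_square_iff[symmetric])
   then have "cell_value N j l X <= 2 * \<delta>^2" by (simp add: cell_value_def)
   then have "2 / h^2 * cell_value N j l X <= 2 / h^2 * (2 * \<delta>^2)" by (intro mult_left_mono) auto
   also have "\<dots> = \<epsilon> / (2 * (real N)^2)" unfolding \<delta>(2) using h by simp
   finally show ?thesis .
  qed
  have "(\<Sum>j<N. \<Sum>l<N. 2 / h^2 * cell_value N j l X) <= (\<Sum>j<N. \<Sum>l<N. \<epsilon> / (2 * (real N)^2))"
   by (intro sum_mono cv) auto
  also have "\<dots> = \<epsilon> / 2" using N0 by (simp add: power2_eq_square)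
  finally have "(\<Sum>j<N. \<Sum>l<N. 2 / h^2 * cell_value N j l X) <= \<epsilon> / 2" .
  moreover have "32 * h^2 * (slope_sq 1 X + slope_sq 2 X) <= 32 * h^2 * 4"
  proof (rule mult_left_mono)
   have "norm X <= norm (u (r n)) + norm (u (r k))" unfolding X_def by (rule norm_triangle_ineq4)
   also have "\<dots> <= 2" using u(2)[of "r n"] u(2)[of "r k"] by simp
   finally have "(norm X)^2 <= 2^2" by (rule power_mono) simp
   then show "slope_sq 1 X + slope_sq 2 X <= 4" using norm_sq_split[of X] value_sq_nonneg[of X] by simp
  qed simp
  ultimately show ?thesis using rellich[OF XH N0, folded h_def] h2 unfolding X_def by linarith
 qed
 then show ?thesis using r(1) by blast
qed

lemma cls_add:
 assumes "sqi U" "sqi V"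
 shows "cls (%x. U x + V x) = cls U + cls V"
 by (rule l2_eqI)
  (use fun_of_cls[OF sqi_add[OF assms]] fun_of_cls[OF assms(1)] fun_of_cls[OF assms(2)] fun_of_add[of "cls U" "cls V"] in
   \<open>eventually_elim, simp add: scaleR_add_right\<close>)

lemma cls_diff:
 assumes "sqi U" "sqi V"
 shows "cls (%x. U x - V x) = cls U - cls V"
 by (rule l2_eqI)
  (use fun_of_cls[OF sqi_diff[OF assms]] fun_of_cls[OF assms(1)] fun_of_cls[OF assms(2)] fun_of_diff[of "cls U" "cls V"] in
   \<open>eventually_elim, simp add: scaleR_diff_right\<close>)

lemma cls_cmul_in_H:
 assumes "Y \<in> H"
 shows "cls (%x. cmul c (fun_of Y x)) \<in> H"
 using jet_limit_linear[OF jet_limit_zero, of \<Omega> E "fun_of Y" "%x. 0" c] assms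
 by (intro cls_in_H) (simp add: H_def)

end

text \<open>The entries of the principal part have uniformly positive real part; for
  \<open>J\<close> a bound suffices, because its term is compact relative to the principal
  part.\<close>

locale coercive_form = edge_domain +
 fixes A :: "2 => real^2 => complex" and J :: "real^2 => complex" and K \<alpha> :: real
 assumes A_meas: "\<And>i. A i \<in> borel_measurable borel" and J_meas: "J \<in> borel_measurable borel"
  and A_le: "\<And>i x. cmod (A i x) <= K" and J_le: "\<And>x. cmod (J x) <= K"
  and \<alpha>: "\<alpha> > 0" and A_ge: "\<And>i x. \<alpha> <= Re (A i x)"
begin

definition T :: "real => real^2 => complex \<times> (complex^2) => complex \<times> (complex^2)" where
 "T \<mu> x = dg (- (complex_of_real \<mu> * J x)) (%i. A i x)"

definition stiff :: "(real^2, complex \<times> (complex^2)) l2 => (real^2, complex \<times> (complex^2)) l2 => real" where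
 "stiff F G = (LINT x|lebesgue. dg 0 (%i. A i x) (fun_of F x) \<bullet> fun_of G x)"

definition mass :: "(real^2, complex \<times> (complex^2)) l2 => (real^2, complex \<times> (complex^2)) l2 => real" where
 "mass F G = (LINT x|lebesgue. dg (J x) (%i. 0) (fun_of F x) \<bullet> fun_of G x)"

lemma K_nonneg: "K \<ge> 0"
 using J_le[of 0] norm_ge_zero[of "J 0"] by linarith

lemma lebesgue_meas: "A i \<in> borel_measurable lebesgue" "J \<in> borel_measurable lebesgue"
 using A_meas[of i] J_meas by (auto intro: measurable_completion)

lemma dg_inner_le:
 assumes "cmod a <= K" "\<And>i. cmod (b i) <= K"
 shows "\<bar>dg a b p \<bullet> q\<bar> <= K * norm p * norm q"
proof -
 have "\<bar>dg a b p \<bullet> q\<bar> <= norm (dg a b p) * norm q" by (rule Cauchy_Schwarz_ineq2)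
 also have "\<dots> <= K * norm p * norm q" by (intro mult_right_mono norm_dg_le assms) auto
 finally show ?thesis .
qed

lemma stiff_bound: "\<bar>dg 0 (%i. A i x) p \<bullet> q\<bar> <= K * norm p * norm q"
 and mass_bound: "\<bar>dg (J x) (%i. 0) p \<bullet> q\<bar> <= K * norm p * norm q"
 using K_nonneg A_le J_le by (auto intro!: dg_inner_le)

lemma bounded_bilinear_stiff: "bounded_bilinear stiff"
 unfolding stiff_def[abs_def]
 by (rule bounded_bilinear_l2[where C = K and b = "%(x :: real^2) p q. dg 0 (%i. A i x) p \<bullet> q", OF _ _ _ _ stiff_bound])
  (auto simp: dg_linear inner_add_left inner_add_right lebesgue_meas intro!: borel_measurable_inner measurable_dg)

lemma bounded_bilinear_mass: "bounded_bilinear mass"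
 unfolding mass_def[abs_def]
 by (rule bounded_bilinear_l2[where C = K and b = "%(x :: real^2) p q. dg (J x) (%i. 0) p \<bullet> q", OF _ _ _ _ mass_bound])
  (auto simp: dg_linear inner_add_left inner_add_right lebesgue_meas intro!: borel_measurable_inner measurable_dg)

lemma integrable_stiff: "integrable lebesgue (%x. dg 0 (%i. A i x) (fun_of F x) \<bullet> fun_of G x)"
 by (rule integrable_bilinear_field[where b = "%(x :: real^2) p q. dg 0 (%i. A i x) p \<bullet> q", OF _ _ stiff_bound])
  (auto simp: lebesgue_meas intro!: borel_measurable_inner measurable_dg)

lemma integrable_mass: "integrable lebesgue (%x. dg (J x) (%i. 0) (fun_of F x) \<bullet> fun_of G x)"
 by (rule integrable_bilinear_field[where b = "%(x :: real^2) p q. dg (J x) (%i. 0) p \<bullet> q", OF _ _ mass_bound])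
  (auto simp: lebesgue_meas intro!: borel_measurable_inner measurable_dg)

lemma sqi_T:
 assumes "sqi U"
 shows "sqi (%x. T \<mu> x (U x))"
proof -
 define C where "C = K + \<bar>\<mu>\<bar> * K"
 have C: "norm (T \<mu> x p) <= C * norm p" for x p
  unfolding T_def C_def
 proof (rule norm_dg_le)
  show "cmod (A i x) <= K + \<bar>\<mu>\<bar> * K" for i using A_le[of i x] K_nonneg by (simp add: add_increasing2)
  show "cmod (- (complex_of_real \<mu> * J x)) <= K + \<bar>\<mu>\<bar> * K"
   using mult_left_mono[OF J_le[of x], of "\<bar>\<mu>\<bar>"] K_nonneg by (simp add: norm_mult)
 qed
 have "(\<integral>\<^sup>+x. ennreal ((norm (T \<mu> x (U x)))^2) \<partial>lebesgue_on \<Omega>) <= (\<integral>\<^sup>+x. ennreal (C^2) * ennreal ((norm (U x))^2) \<partial>lebesgue_on \<Omega>)"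
 proof (rule nn_integral_mono)
  fix x
  have "(norm (T \<mu> x (U x)))^2 <= (C * norm (U x))^2" using C by (intro power_mono) auto
  then show "ennreal ((norm (T \<mu> x (U x)))^2) <= ennreal (C^2) * ennreal ((norm (U x))^2)"
   by (subst ennreal_mult[symmetric]) (auto simp: power_mult_distrib intro!: ennreal_leI)
 qed
 also have "\<dots> < \<infinity>" using assms by (auto simp: sqi_def nn_integral_cmult ennreal_mult_less_top)
 finally have "(\<integral>\<^sup>+x. ennreal ((norm (T \<mu> x (U x)))^2) \<partial>lebesgue_on \<Omega>) < \<infinity>" .
 moreover have "(%x. T \<mu> x (U x)) \<in> borel_measurable (lebesgue_on \<Omega>)"
  unfolding T_def
 proof (rule measurable_dg)
  show "(%x. - (complex_of_real \<mu> * J x)) \<in> borel_measurable (lebesgue_on \<Omega>)"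
   using J_meas by (intro borel_measurable_lebesgue_on) measurable
  show "A i \<in> borel_measurable (lebesgue_on \<Omega>)" for i by (rule borel_measurable_lebesgue_on[OF A_meas])
 qed (use assms in \<open>simp add: sqi_def\<close>)
 ultimately show ?thesis by (simp add: sqi_def)
qed

lemma T_diff: "T \<mu> x (p - q) = T \<mu> x p - T \<mu> x q" and T_add: "T \<mu> x (p + q) = T \<mu> x p + T \<mu> x q"
 by (simp_all add: T_def dg_linear)

text \<open>Turns the pencil into an inner product with the class of the transformed field;
  \<open>Y\<close> vanishes off \<Omega>, so the coefficients there do not contribute.\<close>

lemma form_eq:
 assumes "Y \<in> H"
 shows "stiff X Y - \<mu> * mass X Y = cls (%x. T \<mu> x (fun_of X x)) \<bullet> Y"
proof -
 have Y: "AE x in lebesgue. x \<notin> \<Omega> \<longrightarrow> fun_of Y x = 0" using assms by (simp add: H_def)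
 have "stiff X Y - \<mu> * mass X Y = (LINT x|lebesgue. dg 0 (%i. A i x) (fun_of X x) \<bullet> fun_of Y x - \<mu> * (dg (J x) (%i. 0) (fun_of X x) \<bullet> fun_of Y x))"
  unfolding stiff_def mass_def using integrable_stiff integrable_mass by simp
 also have "\<dots> = (LINT x|lebesgue. fun_of (cls (%x. T \<mu> x (fun_of X x))) x \<bullet> fun_of Y x)"
 proof (rule integral_cong_AE)
  show "(%x. dg 0 (%i. A i x) (fun_of X x) \<bullet> fun_of Y x - \<mu> * (dg (J x) (%i. 0) (fun_of X x) \<bullet> fun_of Y x)) \<in> borel_measurable lebesgue"
   using integrable_stiff[of X Y] integrable_mass[of X Y] by auto
  show "AE x in lebesgue. dg 0 (%i. A i x) (fun_of X x) \<bullet> fun_of Y x - \<mu> * (dg (J x) (%i. 0) (fun_of X x) \<bullet> fun_of Y x)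
    = fun_of (cls (%x. T \<mu> x (fun_of X x))) x \<bullet> fun_of Y x"
   using Y fun_of_cls[OF sqi_T[OF sqi_fun_of[of X], of \<mu>]]
  proof eventually_elim
   fix x assume x: "x \<notin> \<Omega> \<longrightarrow> fun_of Y x = 0" "fun_of (cls (%x. T \<mu> x (fun_of X x))) x = indicator \<Omega> x *\<^sub>R T \<mu> x (fun_of X x)"
   have "T \<mu> x p = dg 0 (%i. A i x) p - \<mu> *\<^sub>R dg (J x) (%i. 0) p" for p
    by (simp add: T_def dg_def prod_eq_iff vec_eq_iff scaleR_conv_of_real[where 'a = complex])
   then show "dg 0 (%i. A i x) (fun_of X x) \<bullet> fun_of Y x - \<mu> * (dg (J x) (%i. 0) (fun_of X x) \<bullet> fun_of Y x)
     = fun_of (cls (%x. T \<mu> x (fun_of X x))) x \<bullet> fun_of Y x"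
    using x by (cases "x \<in> \<Omega>") (simp_all add: inner_diff_left)
  qed
 qed (auto intro!: borel_measurable_inner)
 finally show ?thesis by (simp add: inner_l2_def)
qed

text \<open>The Poincare inequality bounds the value part by a slope, so the slopes control the full
  norm with the factor 32 R^2 + 1. On the diagonal the imaginary part of the coefficients drops
  out.\<close>

lemma coercive:
 assumes "X \<in> H"
 shows "\<alpha> / (32 * R^2 + 1) * (norm X)^2 <= stiff X X"
proof -
 have "0 <= 32 * R^2 * slope_sq 2 X" by (intro mult_nonneg_nonneg slope_sq_nonneg) simp_all
 then have "(norm X)^2 <= (32 * R^2 + 1) * (slope_sq 1 X + slope_sq 2 X)"
  using poincare[OF assms] unfolding norm_sq_split by (simp add: algebra_simps)
 moreover have "0 < 32 * R^2 + 1" by (simp add: add_nonneg_pos)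
 ultimately have "(norm X)^2 / (32 * R^2 + 1) <= slope_sq 1 X + slope_sq 2 X" by (simp add: pos_divide_le_eq mult.commute)
 then have "\<alpha> * ((norm X)^2 / (32 * R^2 + 1)) <= \<alpha> * (slope_sq 1 X + slope_sq 2 X)" using \<alpha> by (intro mult_left_mono) auto
 also have "\<dots> <= stiff X X"
 proof -
  have int: "integrable lebesgue (%x. snd (fun_of X x) $ i \<bullet> snd (fun_of X x) $ i)" for i
   by (rule integrable_bilinear_field[where b = "%x p q. snd p $ i \<bullet> snd q $ i", OF _ _ snd_inner_le]) (simp_all, measurable)
  have "\<alpha> * (slope_sq 1 X + slope_sq 2 X) = (LINT x|lebesgue. \<alpha> * (snd (fun_of X x) $ 1 \<bullet> snd (fun_of X x) $ 1 + snd (fun_of X x) $ 2 \<bullet> snd (fun_of X x) $ 2))"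
   unfolding slope_sq_def using int by simp
  also have "\<dots> <= stiff X X" unfolding stiff_def
  proof (rule integral_mono[OF _ integrable_stiff])
   show "integrable lebesgue (%x. \<alpha> * (snd (fun_of X x) $ 1 \<bullet> snd (fun_of X x) $ 1 + snd (fun_of X x) $ 2 \<bullet> snd (fun_of X x) $ 2))"
    using int by simp
   fix x
   define p where "p = snd (fun_of X x)"
   have "\<alpha> * (p $ i \<bullet> p $ i) <= (A i x * p $ i) \<bullet> p $ i" for i
   proof -
    have "(A i x * p $ i) \<bullet> p $ i = Re (A i x) * (p $ i \<bullet> p $ i)" by (simp add: inner_complex_def algebra_simps)
    then show ?thesis using mult_right_mono[OF A_ge[of i x], of "p $ i \<bullet> p $ i"] by simp
   qed
   from add_mono[OF this[of 1] this[of 2]]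
   show "\<alpha> * (snd (fun_of X x) $ 1 \<bullet> snd (fun_of X x) $ 1 + snd (fun_of X x) $ 2 \<bullet> snd (fun_of X x) $ 2) <= dg 0 (%i. A i x) (fun_of X x) \<bullet> fun_of X x"
    unfolding p_def by (simp add: dg_def inner_prod_def inner_vec_def sum_2 distrib_left)
  qed
  finally show ?thesis .
 qed
 finally show ?thesis by (simp add: mult_ac)
qed

text \<open>The mass form sees only the value component of its first argument, so the gradient slots
  may be set to 0 before Cauchy-Schwarz. In this way compactness in the value seminorm becomes
  compactness in the dual norm.\<close>

lemma mass_le_value: "mass F G <= K * sqrt (value_sq F) * norm G"
proof -
 define f where "f x = (fst (fun_of F x), 0 :: complex^2)" for x
 have m: "f \<in> borel_measurable lebesgue" unfolding f_def by (rule measurable_pair_vec) auto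
 have nf: "(norm (f x))^2 = (cmod (fst (fun_of F x)))^2" for x by (simp add: power2_norm_jet f_def)
 have sq: "sq_integrable f" unfolding sq_integrable_def nf ennreal_value_sq[symmetric] using m by simp
 have "ennreal ((norm (abs_l2 f))^2) = ennreal (value_sq F)" unfolding ennreal_norm_abs_l2[OF sq] nf ennreal_value_sq ..
 then have n: "norm (abs_l2 f) = sqrt (value_sq F)" by (simp add: ennreal_inj value_sq_nonneg real_sqrt_unique)
 have sqn: "sq_integrable (%x. norm (fun_of P x))" for P :: "(real^2, complex \<times> (complex^2)) l2"
  using sq_integrable_fun_of[of P] by (simp add: sq_integrable_def)
 have "mass F G = (LINT x|lebesgue. dg (J x) (%i. 0) (fun_of (abs_l2 f) x) \<bullet> fun_of G x)"
  unfolding mass_def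
 proof (rule integral_cong_AE)
  show "AE x in lebesgue. dg (J x) (%i. 0) (fun_of F x) \<bullet> fun_of G x = dg (J x) (%i. 0) (fun_of (abs_l2 f) x) \<bullet> fun_of G x"
   using fun_of_abs[OF sq] by eventually_elim (simp add: dg_def f_def)
 qed (use integrable_mass[of F G] integrable_mass[of "abs_l2 f" G] in auto)
 also have "\<dots> <= (LINT x|lebesgue. K * (norm (fun_of (abs_l2 f) x) * norm (fun_of G x)))"
 proof (rule integral_mono[OF integrable_mass])
  show "integrable lebesgue (%x. K * (norm (fun_of (abs_l2 f) x) * norm (fun_of G x)))"
   using integrable_bilinear_field[OF sqn[of "abs_l2 f"] sqn[of G], of "%x. (*)" 1] sqn by (auto simp: abs_mult sq_integrable_def)
  show "dg (J x) (%i. 0) (fun_of (abs_l2 f) x) \<bullet> fun_of G x <= K * (norm (fun_of (abs_l2 f) x) * norm (fun_of G x))" for x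
   using mass_bound[of x "fun_of (abs_l2 f) x" "fun_of G x"] by (simp add: mult.assoc)
 qed
 also have "\<dots> = K * (LINT x|lebesgue. norm (fun_of (abs_l2 f) x) * norm (fun_of G x))" by simp
 also have "\<dots> <= K * (norm (abs_l2 f) * norm G)" by (intro mult_left_mono integral_norm_mult_le K_nonneg)
 finally show ?thesis by (simp add: n mult.assoc)
qed

text \<open>The real alternative is applied with right-hand side V minus the operator on the lift
  \<open>U\<close>. Equal real parts against all of \<open>H\<close> give equal complex integrals,
  since \<open>H\<close> is stable under multiplication by i; for uniqueness the real parts alone
  suffice.\<close>

theorem complex_fredholm:
 "\<exists>\<Lambda>::real set. (\<forall>r. finite (\<Lambda> \<inter> {-r..r})) \<and> (\<forall>\<mu>. \<mu> \<notin> \<Lambda> \<longrightarrow>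
  (\<forall>U V. sqi U \<longrightarrow> sqi V \<longrightarrow> (\<exists>X\<in>H. \<forall>Y\<in>H.
   (LINT x|lebesgue_on \<Omega>. cip (T \<mu> x (U x + fun_of X x)) (fun_of Y x)) = (LINT x|lebesgue_on \<Omega>. cip (V x) (fun_of Y x)))) \<and>
  (\<forall>X\<in>H. (\<forall>Y\<in>H. (LINT x|lebesgue_on \<Omega>. cip (T \<mu> x (fun_of X x)) (fun_of Y x)) = 0) \<longrightarrow> X = 0))"
proof -
 have comp: "\<exists>r::nat=>nat. strict_mono r \<and> (\<forall>n k. \<forall>v\<in>H. mass (u (r n) - u (r k)) v <= \<epsilon> * norm v)"
  if u: "\<And>n. u n \<in> H" "\<And>n. norm (u n) <= 1" and \<epsilon>: "\<epsilon> > 0" for u :: "nat => _" and \<epsilon>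
 proof -
  define \<eta> where "\<eta> = \<epsilon> / (K + 1)"
  have \<eta>: "\<eta> > 0" using \<epsilon> K_nonneg by (simp add: \<eta>_def)
  have "K * \<eta> <= (K + 1) * \<eta>" using \<eta> by simp
  also have "\<dots> = \<epsilon>" using K_nonneg by (simp add: \<eta>_def)
  finally have K\<eta>: "K * \<eta> <= \<epsilon>" .
  obtain r :: "nat => nat" where r: "strict_mono r" "\<And>n k. value_sq (u (r n) - u (r k)) <= \<eta>^2"
   using value_compactness[where u = u, OF u, of "\<eta>^2"] \<eta> by auto
  have "mass (u (r n) - u (r k)) v <= \<epsilon> * norm v" for n k v
  proof -
   have "sqrt (value_sq (u (r n) - u (r k))) <= \<eta>" using r(2)[of n k] \<eta> by (intro real_le_lsqrt) (auto simp: value_sq_nonneg)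
   then have "K * sqrt (value_sq (u (r n) - u (r k))) <= K * \<eta>" using K_nonneg by (rule mult_left_mono)
   then have "K * sqrt (value_sq (u (r n) - u (r k))) * norm v <= \<epsilon> * norm v" using K\<eta> by (intro mult_right_mono) auto
   with mass_le_value show ?thesis by (rule order_trans)
  qed
  with r(1) show ?thesis by blast
 qed
 have pos: "\<alpha> / (32 * R^2 + 1) > 0" using \<alpha> by (simp add: add_nonneg_pos)
 have "\<exists>\<Lambda>::real set. (\<forall>r. finite (\<Lambda> \<inter> {-r..r})) \<and>
  (\<forall>\<mu>. \<mu> \<notin> \<Lambda> \<longrightarrow> (\<forall>F. bounded_linear F \<longrightarrow> (\<exists>u\<in>H. \<forall>v\<in>H. stiff u v - \<mu> * mass u v = F v)) \<and>
   (\<forall>u\<in>H. (\<forall>v\<in>H. stiff u v - \<mu> * mass u v = 0) \<longrightarrow> u = 0))"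
 proof (rule fredholm_alternative_pencil[OF closed_H subspace_H bounded_bilinear_stiff bounded_bilinear_mass pos])
  show "\<alpha> / (32 * R^2 + 1) * (norm u)^2 <= stiff u u" if "u \<in> H" for u by (rule coercive[OF that])
  fix u :: "nat => (real^2, complex \<times> (complex^2)) l2" and \<epsilon> :: real
  assume "\<And>n. u n \<in> H" "\<And>n. norm (u n) <= 1" "0 < \<epsilon>"
  then show "\<exists>r::nat=>nat. strict_mono r \<and> (\<forall>n k. \<forall>v\<in>H. mass (u (r n) - u (r k)) v <= \<epsilon> * norm v)" by (rule comp)
 qed
 then obtain \<Lambda> :: "real set" where \<Lambda>: "\<forall>r. finite (\<Lambda> \<inter> {-r..r})" and
  alt: "\<forall>\<mu>. \<mu> \<notin> \<Lambda> \<longrightarrow> (\<forall>F. bounded_linear F \<longrightarrow> (\<exists>u\<in>H. \<forall>v\<in>H. stiff u v - \<mu> * mass u v = F v)) \<and>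
   (\<forall>u\<in>H. (\<forall>v\<in>H. stiff u v - \<mu> * mass u v = 0) \<longrightarrow> u = 0)"
  by (elim exE conjE) (rule that)
 have ex: "\<exists>u\<in>H. \<forall>v\<in>H. stiff u v - \<mu> * mass u v = F v" if "\<mu> \<notin> \<Lambda>" "bounded_linear F" for \<mu> F
  using alt that by blast
 have un: "u = 0" if "\<mu> \<notin> \<Lambda>" "u \<in> H" "\<forall>v\<in>H. stiff u v - \<mu> * mass u v = 0" for \<mu> u
  using alt that by blast
 have solvable: "\<exists>X\<in>H. \<forall>Y\<in>H. (LINT x|lebesgue_on \<Omega>. cip (T \<mu> x (U x + fun_of X x)) (fun_of Y x)) = (LINT x|lebesgue_on \<Omega>. cip (V x) (fun_of Y x))"
  if \<mu>: "\<mu> \<notin> \<Lambda>" and U: "sqi U" and V: "sqi V" for \<mu> U V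
 proof -
  have "bounded_linear (%Y. (cls V - cls (%x. T \<mu> x (U x))) \<bullet> Y)" by (rule bounded_linear_inner_right)
  from ex[OF \<mu> this] obtain X where X: "X \<in> H" "\<And>Y. Y \<in> H ==> stiff X Y - \<mu> * mass X Y = (cls V - cls (%x. T \<mu> x (U x))) \<bullet> Y" by blast
  have sT: "sqi (%x. T \<mu> x (U x + fun_of X x))" by (intro sqi_T sqi_add U sqi_fun_of)
  \<comment> \<open>The residual; the real alternative makes its class orthogonal to
    \<open>H\<close>.\<close>
  define P where "P x = T \<mu> x (U x + fun_of X x) - V x" for x
  have P: "sqi P" unfolding P_def by (intro sqi_diff sT V)
  have clsP: "cls P = cls (%x. T \<mu> x (U x)) + cls (%x. T \<mu> x (fun_of X x)) - cls V"
   unfolding P_def cls_diff[OF sT V] unfolding T_add by (subst cls_add[OF sqi_T[OF U] sqi_T[OF sqi_fun_of]]) simp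
  have zero: "cls P \<bullet> Y = 0" if "Y \<in> H" for Y
   using X(2)[OF that] unfolding form_eq[OF that] clsP by (simp add: inner_diff_left inner_add_left)
  have "(LINT x|lebesgue_on \<Omega>. cip (T \<mu> x (U x + fun_of X x)) (fun_of Y x)) = (LINT x|lebesgue_on \<Omega>. cip (V x) (fun_of Y x))" if Y: "Y \<in> H" for Y
  proof -
   have "(LINT x|lebesgue_on \<Omega>. cip (P x) (fun_of Y x)) = 0"
    unfolding integral_cip(2)[OF P sqi_fun_of] cls_fun_of[OF Y] zero[OF Y] zero[OF cls_cmul_in_H[OF Y]] by simp
   then show ?thesis unfolding P_def cip_diff_left
    by (subst (asm) Bochner_Integration.integral_diff) (auto intro: integral_cip(1) sT V sqi_fun_of)
  qed
  with X(1) show ?thesis by blast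
 qed
 have unique: "X = 0" if \<mu>: "\<mu> \<notin> \<Lambda>" and X: "X \<in> H" and z: "\<forall>Y\<in>H. (LINT x|lebesgue_on \<Omega>. cip (T \<mu> x (fun_of X x)) (fun_of Y x)) = 0" for \<mu> X
 proof (rule un[OF \<mu> X], intro ballI)
  fix Y assume Y: "Y \<in> H"
  have "Re (LINT x|lebesgue_on \<Omega>. cip (T \<mu> x (fun_of X x)) (fun_of Y x)) = cls (%x. T \<mu> x (fun_of X x)) \<bullet> Y"
   unfolding integral_cip(2)[OF sqi_T[OF sqi_fun_of] sqi_fun_of] cls_fun_of[OF Y] by simp
  then show "stiff X Y - \<mu> * mass X Y = 0" using z Y unfolding form_eq[OF Y] by simp
 qed
 show ?thesis
 proof (intro exI[of _ \<Lambda>] conjI allI impI ballI)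
  show "finite (\<Lambda> \<inter> {-r..r})" for r using \<Lambda> by blast
 qed (assumption | rule solvable unique)+
qed

end

section \<open>Geometry of the outer rectangle\<close>

lemma component_in_closed_segment: "x \<in> closed_segment p q ==> x $ i \<in> closed_segment (p $ i) (q $ i)" for x :: "real^2"
proof -
 assume "x \<in> closed_segment p q"
 then obtain u where u: "0 <= u" "u <= 1" "x = (1 - u) *\<^sub>R p + u *\<^sub>R q" unfolding in_segment by blast
 then have "x $ i = (1 - u) *\<^sub>R p $ i + u *\<^sub>R q $ i" by simp
 with u(1,2) show ?thesis unfolding in_segment by blast
qed

lemma horizontal_segment:
 assumes "x $ 2 = c" "x $ 1 \<in> closed_segment s t"
 shows "x \<in> closed_segment (vector [s, c]) (vector [t, c] :: real^2)"
proof -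
 obtain u where "0 <= u" "u <= 1" "x $ 1 = (1 - u) *\<^sub>R s + u *\<^sub>R t" using assms(2) unfolding in_segment by blast
 with assms(1) show ?thesis unfolding in_segment
  by (intro exI[of _ u]) (simp add: vec_eq_iff forall_2 vector_2 algebra_simps)
qed

lemma vertical_segment:
 assumes "x $ 1 = c" "x $ 2 \<in> closed_segment s t"
 shows "x \<in> closed_segment (vector [c, s]) (vector [c, t] :: real^2)"
proof -
 obtain u where "0 <= u" "u <= 1" "x $ 2 = (1 - u) *\<^sub>R s + u *\<^sub>R t" using assms(2) unfolding in_segment by blast
 with assms(1) show ?thesis unfolding in_segment
  by (intro exI[of _ u]) (simp add: vec_eq_iff forall_2 vector_2 algebra_simps)
qed

lemma edge_points_rect_subset:
 assumes "0 < b1" "0 < b2" "x \<in> edge_points (rect_edges b1 b2)"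
 shows "\<bar>x $ 1\<bar> <= b1" "\<bar>x $ 2\<bar> <= b2" "\<bar>x $ 1\<bar> = b1 \<or> \<bar>x $ 2\<bar> = b2"
proof -
 obtain p q where "(p, q) \<in> rect_edges b1 b2" "x \<in> closed_segment p q" using assms(3) by (auto simp: edge_points_def)
 then have "\<bar>x $ 1\<bar> <= b1 \<and> \<bar>x $ 2\<bar> <= b2 \<and> (\<bar>x $ 1\<bar> = b1 \<or> \<bar>x $ 2\<bar> = b2)"
  using component_in_closed_segment[of x p q 1] component_in_closed_segment[of x p q 2] assms(1,2)
  unfolding rect_edges_def by (auto simp: closed_segment_eq_real_ivl split: if_splits)
 then show "\<bar>x $ 1\<bar> <= b1" "\<bar>x $ 2\<bar> <= b2" "\<bar>x $ 1\<bar> = b1 \<or> \<bar>x $ 2\<bar> = b2" by auto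
qed

lemma edge_points_rectI:
 assumes "0 < b1" "0 < b2" "\<bar>x $ 1\<bar> <= b1" "\<bar>x $ 2\<bar> <= b2" "\<bar>x $ 1\<bar> = b1 \<or> \<bar>x $ 2\<bar> = b2"
 shows "x \<in> edge_points (rect_edges b1 b2)"
proof -
 have c: "x $ 1 \<in> closed_segment (- b1) b1" "x $ 1 \<in> closed_segment b1 (- b1)" "x $ 2 \<in> closed_segment (- b2) b2" "x $ 2 \<in> closed_segment b2 (- b2)"
  using assms by (auto simp: closed_segment_eq_real_ivl)
 consider "x $ 1 = b1" | "x $ 1 = - b1" | "x $ 2 = b2" | "x $ 2 = - b2" using assms(5) by linarith
 then show ?thesis
  unfolding edge_points_def rect_edges_def
  by cases (use c in \<open>auto intro: horizontal_segment vertical_segment\<close>)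
qed

lemma finite_rect_edges: "finite (rect_edges b1 b2)"
 by (simp add: rect_edges_def)

lemma cmul_one: "cmul 1 p = p"
 by (simp add: cmul_def)

lemma cip_fst: "cip (z, 0) q = z * cnj (fst q)"
 by (simp add: cip_def)

context edge_domain
begin

lemma sqi_value:
 assumes "f \<in> L2 (lebesgue_on \<Omega>)"
 shows "sqi (%x. (f x, 0))"
proof -
 have "(%x. (f x, 0 :: complex^2)) \<in> borel_measurable (lebesgue_on \<Omega>)"
  using assms by (intro measurable_pair_vec) (auto simp: L2_def)
 then show ?thesis using assms by (simp add: sqi_def L2_def power2_norm_jet)
qed

end

context coercive_form
begin

lemma integral_cip_cong:
 assumes "sqi U" "sqi U'" "sqi V" "sqi V'"
  and "AE x in lebesgue_on \<Omega>. U x = U' x" "AE x in lebesgue_on \<Omega>. V x = V' x"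
 shows "(LINT x|lebesgue_on \<Omega>. cip (T \<mu> x (U x)) (V x)) = (LINT x|lebesgue_on \<Omega>. cip (T \<mu> x (U' x)) (V' x))"
proof (rule integral_cong_AE)
 show "(%x. cip (T \<mu> x (U x)) (V x)) \<in> borel_measurable (lebesgue_on \<Omega>)" "(%x. cip (T \<mu> x (U' x)) (V' x)) \<in> borel_measurable (lebesgue_on \<Omega>)"
  using integral_cip(1)[OF sqi_T[OF assms(1)] assms(3)] integral_cip(1)[OF sqi_T[OF assms(2)] assms(4)] by auto
 show "AE x in lebesgue_on \<Omega>. cip (T \<mu> x (U x)) (V x) = cip (T \<mu> x (U' x)) (V' x)"
  using assms(5,6) by eventually_elim simp
qed

end

section \<open>The PML problem: coefficients, boundary lift and well-posedness\<close>

locale pml =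
 fixes a1 a2 b1 b2 :: real and D :: "(real^2) set" and E :: "((real^2) \<times> (real^2)) set" and \<sigma>1 \<sigma>2 :: "real => real"
 assumes a: "0 < a1" "a1 < b1" "0 < a2" "a2 < b2" and poly: "polygonal_domain D E"
  and D_box: "D \<subseteq> {x. - a1 <= x$1 \<and> x$1 <= a1 \<and> - a2 <= x$2 \<and> x$2 <= a2}"
  and bdd: "bounded (range \<sigma>1)" "bounded (range \<sigma>2)"
  and cont: "continuous_on UNIV \<sigma>1" "continuous_on UNIV \<sigma>2"
  and nonneg: "\<And>t. 0 <= \<sigma>1 t" "\<And>t. 0 <= \<sigma>2 t"
begin

abbreviation "\<Omega> \<equiv> pml_domain b1 b2 D"
abbreviation "E' \<equiv> rect_edges b1 b2"

lemma b: "0 < b1" "0 < b2" using a by auto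

lemma E: "finite E" "\<And>p q. (p, q) \<in> E ==> p \<noteq> q" "edge_points E = frontier D"
 using poly by (auto simp: polygonal_domain_def edge_set_def edge_points_def)

lemma closure_D_box:
 assumes "x \<in> closure D"
 shows "\<bar>x $ 1\<bar> <= a1" "\<bar>x $ 2\<bar> <= a2"
proof -
 have "closed {x :: real^2. - a1 <= x$1 \<and> x$1 <= a1 \<and> - a2 <= x$2 \<and> x$2 <= a2}"
  by (intro closed_Collect_conj closed_Collect_le continuous_intros)
 from closure_minimal[OF D_box this] assms show "\<bar>x $ 1\<bar> <= a1" "\<bar>x $ 2\<bar> <= a2" by (auto simp: abs_le_iff)
qed

lemma edge_points_E_box: "x \<in> edge_points E ==> \<bar>x $ 1\<bar> <= a1 \<and> \<bar>x $ 2\<bar> <= a2"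
 using closure_D_box[of x] by (simp add: E(3) frontier_def)

lemma E_nonempty: "E \<noteq> {}"
proof
 assume "E = {}"
 then have "frontier D = {}" using E(3) by (simp add: edge_points_def)
 moreover have "D \<noteq> {}" "bounded D" using poly by (auto simp: polygonal_domain_def)
 ultimately show False using frontier_eq_empty not_bounded_UNIV by metis
qed

lemma disjoint_points: "edge_points E \<inter> edge_points E' = {}"
 using edge_points_E_box edge_points_rect_subset(3)[OF b] a by fastforce

lemma disjoint_E: "E \<inter> E' = {}"
proof (rule ccontr)
 assume "E \<inter> E' \<noteq> {}"
 then obtain p q where "(p, q) \<in> E" "(p, q) \<in> E'" by auto
 then have "p \<in> edge_points E" "p \<in> edge_points E'" by (auto simp: edge_points_def)
 with disjoint_points show False by blast
qed

sublocale edge_domain \<Omega> "E \<union> E'" "max b1 b2"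
proof
 define B where "B = {x :: real^2. - b1 < x$1 \<and> x$1 < b1 \<and> - b2 < x$2 \<and> x$2 < b2}"
 have B: "open B" unfolding B_def by (intro open_Collect_conj open_Collect_less continuous_intros)
 have \<Omega>: "\<Omega> = B \<inter> - closure D" by (auto simp: pml_domain_def B_def)
 show "open \<Omega>" unfolding \<Omega> using B by (intro open_Int) (auto simp: open_Compl)
 show "finite (E \<union> E')" using E(1) finite_rect_edges by simp
 \<comment> \<open>Passing to the closure of the scatterer adds no frontier points, so the frontier
   of \<Omega> is covered by the given edges and those of the rectangle.\<close>
 have "frontier (closure D) \<subseteq> frontier D"
  using interior_mono[OF closure_subset[of D]] by (auto simp: frontier_def)
 moreover have "frontier B \<subseteq> edge_points E'"
 proof
  fix x assume x: "x \<in> frontier B"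
  have "closed {x :: real^2. - b1 <= x$1 \<and> x$1 <= b1 \<and> - b2 <= x$2 \<and> x$2 <= b2}"
   by (intro closed_Collect_conj closed_Collect_le continuous_intros)
  then have "closure B \<subseteq> {x. - b1 <= x$1 \<and> x$1 <= b1 \<and> - b2 <= x$2 \<and> x$2 <= b2}"
   by (intro closure_minimal) (auto simp: B_def)
  moreover have "x \<in> closure B" "x \<notin> B" using x B by (auto simp: frontier_def interior_open)
  ultimately have "\<bar>x $ 1\<bar> <= b1" "\<bar>x $ 2\<bar> <= b2" "\<bar>x $ 1\<bar> = b1 \<or> \<bar>x $ 2\<bar> = b2" by (auto simp: B_def abs_if)
  then show "x \<in> edge_points E'" by (rule edge_points_rectI[OF b])
 qed
 ultimately show "frontier \<Omega> \<subseteq> edge_points (E \<union> E')"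
  using frontier_Int_subset[of B "- closure D"] unfolding \<Omega> frontier_complement edge_points_Un E(3) by blast
 show "0 < max b1 b2" using b by simp
 show "\<bar>x $ i\<bar> < max b1 b2" if "x \<in> \<Omega>" for x i
  using that exhaust_2[of i] by (auto simp: pml_domain_def abs_less_iff)
qed

definition A :: "2 => real^2 => complex" where
 "A i x = (if i = 1 then pml_stretch \<sigma>2 (x$2) / pml_stretch \<sigma>1 (x$1) else pml_stretch \<sigma>1 (x$1) / pml_stretch \<sigma>2 (x$2))"

lemma stretch_bounds:
 obtains K where "K \<ge> 0" "\<And>t. cmod (pml_stretch \<sigma>1 t) <= 1 + K" "\<And>t. cmod (pml_stretch \<sigma>2 t) <= 1 + K"
  "\<And>t. \<sigma>1 t <= K" "\<And>t. \<sigma>2 t <= K"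
proof -
 obtain K1 K2 where K: "\<And>t. norm (\<sigma>1 t) <= K1" "\<And>t. norm (\<sigma>2 t) <= K2" using bdd unfolding bounded_iff by auto
 have m: "cmod (pml_stretch \<sigma> t) <= 1 + \<bar>\<sigma> t\<bar>" for \<sigma> t
  unfolding pml_stretch_def using norm_triangle_ineq[of 1 "\<i> * complex_of_real (\<sigma> t)"] by (simp add: norm_mult)
 show thesis
 proof (rule that[of "max K1 K2"])
  show "0 <= max K1 K2" using K(1)[of 0] norm_ge_zero[of "\<sigma>1 0"] by linarith
  fix t
  show "cmod (pml_stretch \<sigma>1 t) <= 1 + max K1 K2" "cmod (pml_stretch \<sigma>2 t) <= 1 + max K1 K2"
   using m[of \<sigma>1 t] m[of \<sigma>2 t] K[of t] by (auto simp: max_def)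
  show "\<sigma>1 t <= max K1 K2" "\<sigma>2 t <= max K1 K2" using K[of t] by (auto simp: max_def)
 qed
qed

lemma stretch_ge: "1 <= cmod (pml_stretch \<sigma> t)"
 using abs_Re_le_cmod[of "pml_stretch \<sigma> t"] by (simp add: pml_stretch_def)

text \<open>The real part is (1 + t s) / (1 + s^2); nonnegativity of both damping values keeps the
  product t s from reducing the numerator.\<close>

lemma Re_stretch_quotient:
 assumes "0 <= s" "0 <= t" "s <= K" "t <= K"
 shows "1 / (1 + K^2) <= Re ((1 + \<i> * complex_of_real t) / (1 + \<i> * complex_of_real s))"
proof -
 have "Re ((1 + \<i> * complex_of_real t) / (1 + \<i> * complex_of_real s)) = (1 + t * s) / (1 + s^2)"
  by (simp add: Re_divide power2_eq_square)
 moreover have "1 / (1 + K^2) <= 1 / (1 + s^2)" using assms by (intro divide_left_mono add_left_mono power_mono) (auto simp: add_pos_nonneg)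
 moreover have "1 / (1 + s^2) <= (1 + t * s) / (1 + s^2)" using assms by (intro divide_right_mono) auto
 ultimately show ?thesis by linarith
qed

lemma coercive_form_pml: "\<exists>K \<alpha>. coercive_form \<Omega> (E \<union> E') (max b1 b2) A (pml_J \<sigma>1 \<sigma>2) K \<alpha>"
proof -
 obtain K where K: "K \<ge> 0" "\<And>t. cmod (pml_stretch \<sigma>1 t) <= 1 + K" "\<And>t. cmod (pml_stretch \<sigma>2 t) <= 1 + K"
  "\<And>t. \<sigma>1 t <= K" "\<And>t. \<sigma>2 t <= K" using stretch_bounds by blast
 have m: "(%x :: real^2. pml_stretch \<sigma> (x $ i)) \<in> borel_measurable borel" if "continuous_on UNIV \<sigma>" for \<sigma> i
  unfolding pml_stretch_def
  by (intro borel_measurable_continuous_onI continuous_intros continuous_on_compose2[OF that]) auto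
 note [measurable] = m[OF cont(1)] m[OF cont(2)]
 have "coercive_form \<Omega> (E \<union> E') (max b1 b2) A (pml_J \<sigma>1 \<sigma>2) ((1 + K) * (1 + K)) (1 / (1 + K^2))"
 proof
  show "A i \<in> borel_measurable borel" for i unfolding A_def[abs_def] by (cases "i = 1") simp_all
  show "pml_J \<sigma>1 \<sigma>2 \<in> borel_measurable borel" unfolding pml_J_def[abs_def] by measurable
  have q: "cmod (z / w) <= (1 + K) * (1 + K)" if "cmod z <= 1 + K" "1 <= cmod w" for z w
  proof -
   have "cmod z / cmod w <= (1 + K) / 1" using that K(1) by (intro frac_le) auto
   also have "(1 + K) / 1 <= (1 + K) * (1 + K)" using K(1) by (simp add: algebra_simps)
   finally show ?thesis by (simp add: norm_divide)
  qed
  show "cmod (A i x) <= (1 + K) * (1 + K)" for i x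
   unfolding A_def using q[OF K(2) stretch_ge] q[OF K(3) stretch_ge] by auto
  show "cmod (pml_J \<sigma>1 \<sigma>2 x) <= (1 + K) * (1 + K)" for x
   unfolding pml_J_def norm_mult using K by (intro mult_mono) auto
  show "0 < 1 / (1 + K^2)" by (simp add: add_pos_nonneg)
  show "1 / (1 + K^2) <= Re (A i x)" for i x
   unfolding A_def pml_stretch_def using Re_stretch_quotient nonneg K(4,5) by auto
 qed
 then show ?thesis by blast
qed

text \<open>The datum is continued by 0 to the outer rectangle and both curves are treated as one,
  so a single extension has both prescribed traces. The curves are a positive distance apart, which
  makes the mixed terms of the H^{1/2} energy finite.\<close>

lemma boundary_extension:
 assumes "g \<in> H_half E"
 obtains U where "jet_limit \<Omega> E U g" "jet_limit \<Omega> E' U (%x. 0)"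
proof -
 have gm [measurable]: "g \<in> borel_measurable borel" and gL: "(\<integral>\<^sup>+x. ennreal ((cmod (g x))^2) \<partial>arclength E) < \<infinity>"
  and gE: "(\<integral>\<^sup>+x. (\<integral>\<^sup>+y. ennreal ((cmod (g x - g y))^2 / (dist x y)^2) \<partial>arclength E) \<partial>arclength E) < \<infinity>"
  using assms by (auto simp: H_half_def L2_def measurable_cong_sets[OF sets_arclength refl])
 have [measurable]: "edge_points E \<in> sets borel" using closed_edge_points[OF E(1)] by (rule borel_closed)
 \<comment> \<open>Values of \<open>g\<close> off its curve are arbitrary; \<open>h\<close> is 0
   there, in particular on the outer rectangle.\<close>
 define h where "h x = (if x \<in> edge_points E then g x else 0)" for x
 have [measurable]: "h \<in> borel_measurable borel" unfolding h_def by measurable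
 have hE: "h x = g x" if "x \<in> edge_points E" for x using that by (simp add: h_def)
 have hE': "h x = 0" if "x \<in> edge_points E'" for x using that disjoint_points by (auto simp: h_def)
 interpret M1: finite_measure "arclength E" by (rule finite_measure_arclength[OF E(1)])
 interpret M2: finite_measure "arclength E'" by (rule finite_measure_arclength[OF finite_rect_edges])
 note Un = nn_integral_arclength_Un[OF E(1) finite_rect_edges disjoint_E]
 note cE = nn_integral_arclength_cong[OF E(1)] and cE' = nn_integral_arclength_cong[OF finite_rect_edges]
 let ?M = "arclength (E \<union> E')"
 have fin: "finite (E \<union> E')" using E(1) finite_rect_edges by simp
 interpret M: finite_measure ?M by (rule finite_measure_arclength[OF fin])
 have "(\<integral>\<^sup>+x. ennreal ((cmod (h x))^2) \<partial>arclength E) = (\<integral>\<^sup>+x. ennreal ((cmod (g x))^2) \<partial>arclength E)"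
  by (rule cE) (auto simp: hE)
 moreover have "(\<integral>\<^sup>+x. ennreal ((cmod (h x))^2) \<partial>arclength E') = (\<integral>\<^sup>+x. 0 \<partial>arclength E')"
  by (rule cE') (auto simp: hE')
 ultimately have hL: "(\<integral>\<^sup>+x. ennreal ((cmod (h x))^2) \<partial>?M) < \<infinity>"
  using gL by (simp add: Un)
 \<comment> \<open>A lower bound for the distance between the two curves, read off
   coordinatewise.\<close>
 define d where "d = min (b1 - a1) (b2 - a2)"
 have d: "d > 0" using a by (simp add: d_def)
 have sep: "d <= dist y z" if "y \<in> edge_points E" "z \<in> edge_points E'" for y z
 proof -
  have "d <= \<bar>y $ 1 - z $ 1\<bar> \<or> d <= \<bar>y $ 2 - z $ 2\<bar>"
   using edge_points_E_box[OF that(1)] edge_points_rect_subset(3)[OF b that(2)] by (auto simp: d_def)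
  then show ?thesis using component_le_norm_cart[of "y - z" 1] component_le_norm_cart[of "y - z" 2] by (auto simp: dist_norm)
 qed
 define q where "q x y = ennreal ((cmod (h x - h y))^2 / (dist x y)^2)" for x y
 have qm [measurable]: "(%(x, y). q x y) \<in> borel_measurable (borel \<Otimes>\<^sub>M borel)" unfolding q_def by measurable
 have q1 [measurable]: "(%y. q x y) \<in> borel_measurable borel" "(%y. q y x) \<in> borel_measurable borel" for x unfolding q_def by measurable
 have q_sep: "q x y <= ennreal (1 / d^2) * ennreal ((cmod (h x))^2)" "q y x <= ennreal (1 / d^2) * ennreal ((cmod (h x))^2)"
  if "x \<in> edge_points E" "y \<in> edge_points E'" for x y
 proof -
  have "(cmod (h x))^2 / (dist x y)^2 <= (cmod (h x))^2 / d^2"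
   using sep[OF that] d by (intro divide_left_mono power_mono) (auto intro!: mult_pos_pos)
  then show "q x y <= ennreal (1 / d^2) * ennreal ((cmod (h x))^2)" "q y x <= ennreal (1 / d^2) * ennreal ((cmod (h x))^2)"
   unfolding q_def using hE'[OF that(2)] by (auto simp: ennreal_mult[symmetric] dist_commute intro!: ennreal_leI)
 qed
 have AE1: "AE x in arclength E. x \<in> edge_points E" and AE2: "AE x in arclength E'. x \<in> edge_points E'"
  by (rule AE_arclength_edge_points[OF E(1)], rule AE_arclength_edge_points[OF finite_rect_edges])
 have 11: "(\<integral>\<^sup>+x. (\<integral>\<^sup>+y. q x y \<partial>arclength E) \<partial>arclength E) < \<infinity>"
 proof -
  have "(\<integral>\<^sup>+x. (\<integral>\<^sup>+y. q x y \<partial>arclength E) \<partial>arclength E) = (\<integral>\<^sup>+x. (\<integral>\<^sup>+y. ennreal ((cmod (g x - g y))^2 / (dist x y)^2) \<partial>arclength E) \<partial>arclength E)"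
   by (rule nn_integral_cong_AE, use AE1 in eventually_elim, rule nn_integral_cong_AE, use AE1 in eventually_elim) (simp add: q_def hE)
  then show ?thesis using gE by simp
 qed
 have "(\<integral>\<^sup>+x. (\<integral>\<^sup>+y. q x y \<partial>arclength E') \<partial>arclength E) <= (\<integral>\<^sup>+x. (\<integral>\<^sup>+y. ennreal (1 / d^2) * ennreal ((cmod (h x))^2) \<partial>arclength E') \<partial>arclength E)"
  by (rule nn_integral_mono_AE, use AE1 in eventually_elim, rule nn_integral_mono_AE, use AE2 in eventually_elim) (rule q_sep(1))
 also have fin2: "\<dots> < \<infinity>"
 proof -
  have "(\<integral>\<^sup>+x. (\<integral>\<^sup>+y. ennreal (1 / d^2) * ennreal ((cmod (h x))^2) \<partial>arclength E') \<partial>arclength E)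
   = (\<integral>\<^sup>+x. ennreal (1 / d^2) * emeasure (arclength E') UNIV * ennreal ((cmod (h x))^2) \<partial>arclength E)"
   by (simp add: mult_ac)
  also have "\<dots> = ennreal (1 / d^2) * emeasure (arclength E') UNIV * (\<integral>\<^sup>+x. ennreal ((cmod (h x))^2) \<partial>arclength E)"
   by (rule nn_integral_cmult) measurable
  also have "\<dots> < \<infinity>"
  proof -
   have "emeasure (arclength E') UNIV < \<infinity>" using M2.emeasure_finite[of UNIV] unfolding infinity_ennreal_def less_top .
   then show ?thesis using hL by (simp add: Un ennreal_mult_less_top)
  qed
  finally show ?thesis .
 qed
 finally have 12: "(\<integral>\<^sup>+x. (\<integral>\<^sup>+y. q x y \<partial>arclength E') \<partial>arclength E) < \<infinity>" .
 have 21: "(\<integral>\<^sup>+x. (\<integral>\<^sup>+y. q x y \<partial>arclength E) \<partial>arclength E') < \<infinity>"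
 proof -
  have "(\<integral>\<^sup>+x. (\<integral>\<^sup>+y. q x y \<partial>arclength E) \<partial>arclength E') = (\<integral>\<^sup>+y. (\<integral>\<^sup>+x. q x y \<partial>arclength E') \<partial>arclength E)"
  proof -
   interpret pair_sigma_finite "arclength E" "arclength E'" ..
   show ?thesis by (rule Fubini'[of "%y x. q x y"]) (unfold q_def, measurable)
  qed
  also have "\<dots> <= (\<integral>\<^sup>+x. (\<integral>\<^sup>+y. ennreal (1 / d^2) * ennreal ((cmod (h x))^2) \<partial>arclength E') \<partial>arclength E)"
   by (rule nn_integral_mono_AE, use AE1 in eventually_elim, rule nn_integral_mono_AE, use AE2 in eventually_elim) (rule q_sep(2))
  also note fin2
  finally show ?thesis .
 qed
 have 22: "(\<integral>\<^sup>+x. (\<integral>\<^sup>+y. q x y \<partial>arclength E') \<partial>arclength E') = (\<integral>\<^sup>+x. (\<integral>\<^sup>+y. 0 \<partial>arclength E') \<partial>arclength E')"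
  by (rule nn_integral_cong_AE, use AE2 in eventually_elim, rule nn_integral_cong_AE, use AE2 in eventually_elim) (simp add: q_def hE')
 have inner: "(%x. \<integral>\<^sup>+y. q x y \<partial>arclength E) \<in> borel_measurable borel" "(%x. \<integral>\<^sup>+y. q x y \<partial>arclength E') \<in> borel_measurable borel"
  unfolding q_def by measurable
 have hH: "(\<integral>\<^sup>+x. (\<integral>\<^sup>+y. q x y \<partial>?M) \<partial>?M) < \<infinity>"
 proof -
  define p p' where "p x = (\<integral>\<^sup>+y. q x y \<partial>arclength E)" and "p' x = (\<integral>\<^sup>+y. q x y \<partial>arclength E')" for x
  have m: "p \<in> borel_measurable borel" "p' \<in> borel_measurable borel" using inner by (simp_all add: p_def[abs_def] p'_def[abs_def])
  have m': "p \<in> borel_measurable (arclength F)" "p' \<in> borel_measurable (arclength F)" for F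
   using m by (simp_all add: measurable_cong_sets[OF sets_arclength refl])
  have "(\<integral>\<^sup>+y. q x y \<partial>?M) = p x + p' x" for x unfolding p_def p'_def by (rule Un[OF q1(1)])
  then have "(\<integral>\<^sup>+x. (\<integral>\<^sup>+y. q x y \<partial>?M) \<partial>?M) = (\<integral>\<^sup>+x. p x + p' x \<partial>?M)" by simp
  also have "\<dots> = (\<integral>\<^sup>+x. p x + p' x \<partial>arclength E) + (\<integral>\<^sup>+x. p x + p' x \<partial>arclength E')"
   by (rule Un[OF borel_measurable_add[OF m]])
  also have "\<dots> = (\<integral>\<^sup>+x. p x \<partial>arclength E) + (\<integral>\<^sup>+x. p' x \<partial>arclength E) + ((\<integral>\<^sup>+x. p x \<partial>arclength E') + (\<integral>\<^sup>+x. p' x \<partial>arclength E'))"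
   by (simp only: nn_integral_add[OF m'])
  also have "\<dots> < \<infinity>" using 11 12 21 22 by (simp add: p_def p'_def)
  finally show ?thesis .
 qed
 \<comment> \<open>The squared diameter of the rectangle plus 1, so that all parameters e <= 1 are
   admissible in \<open>near\<close>.\<close>
 define R' where "R' = sqrt (4 * b1^2 + 4 * b2^2 + 1)"
 have R': "R' > 0" "R'^2 = 4 * b1^2 + 4 * b2^2 + 1" by (auto simp: R'_def intro: add_nonneg_pos)
 have ne: "E \<union> E' \<noteq> {}" using E_nonempty by simp
 have pq: "p \<noteq> q" if "(p, q) \<in> E \<union> E'" for p q
 proof (cases "(p, q) \<in> E")
  case False
  then have "(p, q) \<in> E'" using that by blast
  then have "p $ 1 \<noteq> q $ 1 \<or> p $ 2 \<noteq> q $ 2"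
   unfolding rect_edges_def insert_iff prod.inject empty_iff using b by (elim disjE conjE) (simp_all add: vector_2)
  then show ?thesis by metis
 qed (rule E(2))
 obtain c where reg: "regular_measure ?M (edge_points (E \<union> E')) c R'"
  using regular_measure_arclength[OF fin ne pq R'(1)] by blast
 interpret reg: regular_measure ?M "edge_points (E \<union> E')" c R' by (rule reg)
 have "h \<in> L2 ?M" using hL by (simp add: L2_def measurable_cong_sets[OF sets_arclength refl])
 then have int: "integrable ?M h" by (rule L2_integrable[OF finite_measure_arclength[OF fin]])
 have box: "\<bar>x $ 1\<bar> <= b1" "\<bar>x $ 2\<bar> <= b2" if "x \<in> \<Omega> \<union> edge_points (E \<union> E')" for x
  using that edge_points_E_box[of x] edge_points_rect_subset[OF b, of x] a by (auto simp: pml_domain_def edge_points_Un)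
 have near: "reg.near e x" if x: "x \<in> \<Omega> \<union> edge_points (E \<union> E')" and e: "e <= 1" for x e
  unfolding reg.near_def
 proof
  fix y assume "y \<in> edge_points (E \<union> E')"
  then have y: "\<bar>y $ 1\<bar> <= b1" "\<bar>y $ 2\<bar> <= b2" using box by auto
  have "\<bar>x $ 1 - y $ 1\<bar> <= 2 * b1" "\<bar>x $ 2 - y $ 2\<bar> <= 2 * b2" using box[OF x] y by linarith+
  then have "\<bar>x $ 1 - y $ 1\<bar>\<^sup>2 <= (2 * b1)^2" "\<bar>x $ 2 - y $ 2\<bar>\<^sup>2 <= (2 * b2)^2" by (intro power_mono; simp)+
  then show "(x - y) \<bullet> (x - y) + e <= R'^2" using e
   unfolding R'(2) inner_vec2 by (simp add: power2_eq_square)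
 qed
 obtain U where U: "U \<in> borel_measurable (lebesgue_on \<Omega>)"
  "\<And>\<eta>. \<eta> > 0 ==> \<exists>\<phi>. smooth \<phi> \<and> sqd (lebesgue_on \<Omega>) (jet \<phi>) U <= ennreal \<eta> \<and> sqd ?M \<phi> h <= ennreal \<eta>"
  using reg.extension_exists[OF int hL hH[unfolded q_def] sets_\<Omega>(1) near] by blast
 have J: "jet_limit \<Omega> (E \<union> E') U h"
  unfolding jet_limit_def using U by (simp add: measurable_cong_sets[OF sets_arclength refl])
 show thesis
 proof (rule that)
  show "jet_limit \<Omega> E U g" by (rule jet_limit_subset[OF fin _ J gm]) (auto simp: hE)
  show "jet_limit \<Omega> E' U (%x. 0)" by (rule jet_limit_subset[OF fin _ J]) (auto simp: hE')
 qed
qed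

lemma pml_form_eq:
 "pml_form \<sigma>1 \<sigma>2 \<Omega> \<kappa> u v = (LINT x|lebesgue_on \<Omega>.
  cip (dg (- (complex_of_real \<kappa> * pml_J \<sigma>1 \<sigma>2 x)) (%i. A i x) (u x, wgrad \<Omega> u x)) (v x, wgrad \<Omega> v x))"
proof -
 have m: "(pml_A \<sigma>1 \<sigma>2 x *v w) $ i = A i x * w $ i" for x w and i :: 2
  using exhaust_2[of i] by (auto simp: pml_A_def A_def matrix_vector_mult_def sum_2 vector_2)
 show ?thesis unfolding pml_form_def m
  by (intro Bochner_Integration.integral_cong refl) (simp add: cip_def dg_def sum_2)
qed

text \<open>The solution is a lift of the boundary datum plus a correction in \<open>H\<close>
  supplied by the alternative. For uniqueness the difference of two solutions is placed in
  \<open>H\<close>, and each element of \<open>H\<close> comes from a function in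
  \<open>H1_0\<close>, so the weak equations can be tested with all of \<open>H\<close>.\<close>

theorem well_posed:
 assumes g: "g \<in> H_half E" and f: "f \<in> L2 (lebesgue_on \<Omega>)"
 shows "\<exists>S::real set. S sparse_in UNIV \<and> (\<forall>k. k \<notin> S \<longrightarrow>
   (\<exists>u. pml_weak_solution \<sigma>1 \<sigma>2 b1 b2 D E k f g u \<and>
    (\<forall>w. pml_weak_solution \<sigma>1 \<sigma>2 b1 b2 D E k f g w \<longrightarrow> (AE x in lebesgue_on \<Omega>. w x = u x))))"
proof -
 obtain K \<alpha> where "coercive_form \<Omega> (E \<union> E') (max b1 b2) A (pml_J \<sigma>1 \<sigma>2) K \<alpha>" using coercive_form_pml by blast
 then interpret cf: coercive_form \<Omega> "E \<union> E'" "max b1 b2" A "pml_J \<sigma>1 \<sigma>2" K \<alpha> .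
 have form: "pml_form \<sigma>1 \<sigma>2 \<Omega> \<kappa> u v = (LINT x|lebesgue_on \<Omega>. cip (cf.T \<kappa> x (u x, wgrad \<Omega> u x)) (v x, wgrad \<Omega> v x))" for \<kappa> u v
  unfolding pml_form_eq cf.T_def ..
 have fin: "finite (E \<union> E')" using E(1) finite_rect_edges by simp
 note sq_f = sqi_value[OF f]
 obtain \<Lambda> :: "real set" where \<Lambda>: "\<forall>r. finite (\<Lambda> \<inter> {-r..r})" and alt: "\<forall>\<mu>. \<mu> \<notin> \<Lambda> \<longrightarrow>
  (\<forall>U V. sqi U \<longrightarrow> sqi V \<longrightarrow> (\<exists>X\<in>H. \<forall>Y\<in>H.
   (LINT x|lebesgue_on \<Omega>. cip (cf.T \<mu> x (U x + fun_of X x)) (fun_of Y x)) = (LINT x|lebesgue_on \<Omega>. cip (V x) (fun_of Y x)))) \<and>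
  (\<forall>X\<in>H. (\<forall>Y\<in>H. (LINT x|lebesgue_on \<Omega>. cip (cf.T \<mu> x (fun_of X x)) (fun_of Y x)) = 0) \<longrightarrow> X = 0)"
  using cf.complex_fredholm by (elim exE conjE) (rule that)
 \<comment> \<open>The alternative concerns mu = k^2. A bounded set of k involves only finitely many
   exceptional mu, and each has at most two real roots.\<close>
 define S where "S = {k. k^2 \<in> \<Lambda>}"
 have "S sparse_in UNIV"
  unfolding sparse_in_def
 proof
  fix x :: real
  have "\<not> y islimpt S" for y
  proof
   assume "y islimpt S"
   then have "infinite (S \<inter> ball y 1)" by (simp add: islimpt_eq_infinite_ball)
   moreover have "S \<inter> ball y 1 \<subseteq> (\<Union>\<mu>\<in>\<Lambda> \<inter> {- ((\<bar>y\<bar> + 1)^2)..(\<bar>y\<bar> + 1)\<^sup>2}. {sqrt \<mu>, - sqrt \<mu>})"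
   proof
    fix k assume k: "k \<in> S \<inter> ball y 1"
    then have "\<bar>k\<bar> <= \<bar>y\<bar> + 1" by (auto simp: dist_real_def)
    then have "\<bar>k\<bar>\<^sup>2 <= (\<bar>y\<bar> + 1)^2" by (rule power_mono) simp
    moreover have "- ((\<bar>y\<bar> + 1)^2) <= 0" "0 <= k^2" by simp_all
    ultimately have "k^2 \<in> \<Lambda> \<inter> {- ((\<bar>y\<bar> + 1)^2)..(\<bar>y\<bar> + 1)\<^sup>2}" using k by (auto simp: S_def)
    moreover have "k \<in> {sqrt (k^2), - sqrt (k^2)}" by auto
    ultimately show "k \<in> (\<Union>\<mu>\<in>\<Lambda> \<inter> {- ((\<bar>y\<bar> + 1)^2)..(\<bar>y\<bar> + 1)\<^sup>2}. {sqrt \<mu>, - sqrt \<mu>})" by blast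
   qed
   moreover have "finite (\<Union>\<mu>\<in>\<Lambda> \<inter> {- ((\<bar>y\<bar> + 1)^2)..(\<bar>y\<bar> + 1)\<^sup>2}. {sqrt \<mu>, - sqrt \<mu>})"
    using \<Lambda> by (intro finite_UN_I) auto
   ultimately show False using finite_subset by blast
  qed
  then show "\<exists>B. x \<in> B \<and> open B \<and> (\<forall>y\<in>B. \<not> y islimpt S)" by (intro exI[of _ UNIV]) simp
 qed
 moreover have "\<exists>u. pml_weak_solution \<sigma>1 \<sigma>2 b1 b2 D E k f g u \<and>
    (\<forall>w. pml_weak_solution \<sigma>1 \<sigma>2 b1 b2 D E k f g w \<longrightarrow> (AE x in lebesgue_on \<Omega>. w x = u x))" if "k \<notin> S" for k
 proof -
  have \<mu>: "k^2 \<notin> \<Lambda>" using that by (simp add: S_def)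
  note ex = conjunct1[OF mp[OF spec[OF alt] \<mu>]] and un = conjunct2[OF mp[OF spec[OF alt] \<mu>]]
  obtain U0 where U0: "jet_limit \<Omega> E U0 g" "jet_limit \<Omega> E' U0 (%x. 0)" using boundary_extension[OF g] by blast
  obtain X where X: "X \<in> H" and eq: "\<And>Y. Y \<in> H ==> (LINT x|lebesgue_on \<Omega>. cip (cf.T (k^2) x (U0 x + fun_of X x)) (fun_of Y x)) = (LINT x|lebesgue_on \<Omega>. cip (f x, 0) (fun_of Y x))"
   using mp[OF mp[OF spec[OF spec[OF ex]] sqi_jet_limit[OF U0(1)]] sq_f] by blast
  define U where "U x = U0 x + fun_of X x" for x
  have JX: "jet_limit \<Omega> (E \<union> E') (fun_of X) (%x. 0)" using X by (simp add: H_def)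
  have JX1: "jet_limit \<Omega> E (fun_of X) (%x. 0)" "jet_limit \<Omega> E' (fun_of X) (%x. 0)"
   by (rule jet_limit_subset[OF fin _ JX]; simp)+
  have JU: "jet_limit \<Omega> E U g" "jet_limit \<Omega> E' U (%x. 0)"
   using jet_limit_linear[OF U0(1) JX1(1), of 1] jet_limit_linear[OF U0(2) JX1(2), of 1] by (simp_all add: cmul_one U_def[abs_def])
  define u where "u x = fst (U x)" for x
  have tr: "has_trace \<Omega> E u g" "has_trace \<Omega> E' u (%x. 0)"
   unfolding u_def using jet_limit_imp_has_trace[OF open_\<Omega> bounded_\<Omega> E(1) JU(1)]
    jet_limit_imp_has_trace[OF open_\<Omega> bounded_\<Omega> finite_rect_edges JU(2)] by auto
  have Uw: "AE x in lebesgue_on \<Omega>. (u x, wgrad \<Omega> u x) = U x"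
   using jet_limit_wgrad[OF open_\<Omega> bounded_\<Omega> JU(1)] unfolding u_def by eventually_elim simp
  have sqU: "sqi U" by (rule sqi_jet_limit[OF JU(1)])
  have sqw: "sqi (%x. (w x, wgrad \<Omega> w x))" if "has_trace \<Omega> E w h" for w h
   by (rule sqi_jet_limit[OF has_trace_imp_jet_limit(1)[OF that]])
  have sol: "pml_weak_solution \<sigma>1 \<sigma>2 b1 b2 D E k f g u"
   unfolding pml_weak_solution_def Let_def
  proof (intro conjI ballI)
   show "u \<in> H1 \<Omega>" using tr(1) by (simp add: has_trace_def)
   fix v assume "v \<in> H1_0 b1 b2 D E"
   then have JV: "jet_limit \<Omega> (E \<union> E') (%x. (v x, wgrad \<Omega> v x)) (%x. 0)"
    by (intro has_trace_imp_jet_limit(1)) (simp add: H1_0_def)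
   define Y where "Y = cls (%x. (v x, wgrad \<Omega> v x))"
   have sqv: "sqi (%x. (v x, wgrad \<Omega> v x))" by (rule sqi_jet_limit[OF JV])
   have YH: "Y \<in> H" unfolding Y_def by (rule cls_in_H[OF JV])
   have Yv: "AE x in lebesgue_on \<Omega>. (v x, wgrad \<Omega> v x) = fun_of Y x"
    using fun_of_cls_on[OF sqv] unfolding Y_def by eventually_elim simp
   have "pml_form \<sigma>1 \<sigma>2 \<Omega> (k^2) u v = (LINT x|lebesgue_on \<Omega>. cip (cf.T (k^2) x (U x)) (fun_of Y x))"
    unfolding form by (rule cf.integral_cip_cong[OF sqw[OF tr(1)] sqU sqv sqi_fun_of Uw Yv])
   also have "\<dots> = (LINT x|lebesgue_on \<Omega>. cip (f x, 0) (fun_of Y x))" unfolding U_def by (rule eq[OF YH])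
   also have "\<dots> = (LINT x|lebesgue_on \<Omega>. f x * cnj (v x))"
   proof (rule integral_cong_AE)
    show "(%x. cip (f x, 0) (fun_of Y x)) \<in> borel_measurable (lebesgue_on \<Omega>)"
     using integral_cip(1)[OF sq_f sqi_fun_of[of Y]] by auto
    show "(%x. f x * cnj (v x)) \<in> borel_measurable (lebesgue_on \<Omega>)"
     using integral_cip(1)[OF sq_f sqv] by (auto simp: cip_fst)
    show "AE x in lebesgue_on \<Omega>. cip (f x, 0) (fun_of Y x) = f x * cnj (v x)"
     using Yv by eventually_elim (metis cip_fst fst_conv)
   qed
   finally show "pml_form \<sigma>1 \<sigma>2 \<Omega> (k^2) u v = (LINT x|lebesgue_on \<Omega>. f x * cnj (v x))" .
  qed (rule tr)+
  have "AE x in lebesgue_on \<Omega>. w x = u x" if w: "pml_weak_solution \<sigma>1 \<sigma>2 b1 b2 D E k f g w" for w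
  proof -
   have trw: "has_trace \<Omega> E w g" "has_trace \<Omega> E' w (%x. 0)"
    and weq: "\<And>v. v \<in> H1_0 b1 b2 D E ==> pml_form \<sigma>1 \<sigma>2 \<Omega> (k^2) w v = (LINT x|lebesgue_on \<Omega>. f x * cnj (v x))"
    using w by (auto simp: pml_weak_solution_def Let_def)
   have ueq: "\<And>v. v \<in> H1_0 b1 b2 D E ==> pml_form \<sigma>1 \<sigma>2 \<Omega> (k^2) u v = (LINT x|lebesgue_on \<Omega>. f x * cnj (v x))"
    using sol by (auto simp: pml_weak_solution_def Let_def)
   define W where "W x = (w x, wgrad \<Omega> w x)" for x
   have JW: "jet_limit \<Omega> E W g" "jet_limit \<Omega> E' W (%x. 0)"
    unfolding W_def using has_trace_imp_jet_limit(1)[OF trw(1)] has_trace_imp_jet_limit(1)[OF trw(2)] by auto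
   have sqW: "sqi W" by (rule sqi_jet_limit[OF JW(1)])
   define V where "V x = W x - U x" for x
   have JV: "jet_limit \<Omega> E V (%x. 0)" "jet_limit \<Omega> E' V (%x. 0)"
    using jet_limit_linear[OF JW(1) JU(1), of "- 1"] jet_limit_linear[OF JW(2) JU(2), of "- 1"]
    by (simp_all add: cmul_minus_one V_def[abs_def])
   obtain \<zeta> where \<zeta>: "smooth \<zeta>" "\<And>x. \<bar>x $ 1\<bar> <= a1 \<and> \<bar>x $ 2\<bar> <= a2 ==> \<zeta> x = 1" "\<And>x. b1 <= \<bar>x $ 1\<bar> \<or> b2 <= \<bar>x $ 2\<bar> ==> \<zeta> x = 0"
    using smooth_cutoff_exists[OF a] by blast
   have JV': "jet_limit \<Omega> (E \<union> E') V (%x. 0)"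
   proof (rule jet_limit_glue[OF open_\<Omega> bounded_\<Omega> E(1) finite_rect_edges disjoint_E JV \<zeta>(1)])
    show "\<zeta> x = 1" if "x \<in> edge_points E" for x by (rule \<zeta>(2)[OF edge_points_E_box[OF that]])
    show "\<zeta> x = 0" if "x \<in> edge_points E'" for x using edge_points_rect_subset(3)[OF b that] by (intro \<zeta>(3)) auto
   qed
   have sqV: "sqi V" by (rule sqi_jet_limit[OF JV'])
   have "cls V = 0"
   proof -
    have zero: "(LINT x|lebesgue_on \<Omega>. cip (cf.T (k^2) x (fun_of (cls V) x)) (fun_of Y x)) = 0" if Y: "Y \<in> H" for Y
    proof -
     have JY: "jet_limit \<Omega> (E \<union> E') (fun_of Y) (%x. 0)" using Y by (simp add: H_def)
     \<comment> \<open>The value component of \<open>Y\<close> is an admissible test function, and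
       its chosen weak gradient is the gradient component of \<open>Y\<close> almost
       everywhere.\<close>
     define v where "v x = fst (fun_of Y x)" for x
     have trv: "has_trace \<Omega> (E \<union> E') v (%x. 0)" unfolding v_def by (rule jet_limit_imp_has_trace[OF open_\<Omega> bounded_\<Omega> fin JY])
     then have v: "v \<in> H1_0 b1 b2 D E" by (simp add: H1_0_def has_trace_def)
     have vY: "AE x in lebesgue_on \<Omega>. (v x, wgrad \<Omega> v x) = fun_of Y x"
      using jet_limit_wgrad[OF open_\<Omega> bounded_\<Omega> JY] unfolding v_def by eventually_elim simp
     have sqv: "sqi (%x. (v x, wgrad \<Omega> v x))" by (rule sqi_jet_limit[OF has_trace_imp_jet_limit(1)[OF trv]])
     have "(LINT x|lebesgue_on \<Omega>. cip (cf.T (k^2) x (U x)) (fun_of Y x)) = pml_form \<sigma>1 \<sigma>2 \<Omega> (k^2) u v"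
      unfolding form by (rule cf.integral_cip_cong[OF sqw[OF tr(1)] sqU sqv sqi_fun_of Uw vY, symmetric])
     also have "\<dots> = pml_form \<sigma>1 \<sigma>2 \<Omega> (k^2) w v" using ueq[OF v] weq[OF v] by simp
     also have "\<dots> = (LINT x|lebesgue_on \<Omega>. cip (cf.T (k^2) x (W x)) (fun_of Y x))"
      unfolding form by (rule cf.integral_cip_cong[OF sqw[OF trw(1)] sqW sqv sqi_fun_of _ vY]) (simp add: W_def)
     finally have e: "(LINT x|lebesgue_on \<Omega>. cip (cf.T (k^2) x (W x)) (fun_of Y x)) = (LINT x|lebesgue_on \<Omega>. cip (cf.T (k^2) x (U x)) (fun_of Y x))" by simp
     have "(LINT x|lebesgue_on \<Omega>. cip (cf.T (k^2) x (fun_of (cls V) x)) (fun_of Y x)) = (LINT x|lebesgue_on \<Omega>. cip (cf.T (k^2) x (V x)) (fun_of Y x))"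
      by (rule cf.integral_cip_cong[OF sqi_fun_of sqV sqi_fun_of sqi_fun_of fun_of_cls_on[OF sqV]]) simp
     also have "\<dots> = (LINT x|lebesgue_on \<Omega>. cip (cf.T (k^2) x (W x)) (fun_of Y x)) - (LINT x|lebesgue_on \<Omega>. cip (cf.T (k^2) x (U x)) (fun_of Y x))"
      unfolding V_def cf.T_diff cip_diff_left
      by (rule Bochner_Integration.integral_diff) (rule integral_cip(1)[OF cf.sqi_T[OF sqW] sqi_fun_of], rule integral_cip(1)[OF cf.sqi_T[OF sqU] sqi_fun_of])
     finally show ?thesis using e by simp
    qed
    show ?thesis by (rule mp[OF bspec[OF un cls_in_H[OF JV']]]) (rule ballI, rule zero)
   qed
   then have "AE x in lebesgue_on \<Omega>. fun_of (cls V) x = 0" by (simp only: AE_on[OF fun_of_zero])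
   with fun_of_cls_on[OF sqV] have "AE x in lebesgue_on \<Omega>. V x = 0" by eventually_elim simp
   then show ?thesis unfolding V_def W_def u_def by eventually_elim (metis eq_iff_diff_eq_0 fst_conv)
  qed
  with sol show ?thesis by blast
 qed
 ultimately show ?thesis by blast
qed

end

theorem theorem2:
  fixes a1 a2 b1 b2 :: real
    and D :: "(real^2) set" and E :: "((real^2) \<times> (real^2)) set"
    and \<sigma>1 \<sigma>2 :: "real \<Rightarrow> real" and f g :: "real^2 \<Rightarrow> complex"
  assumes "0 < a1" "a1 < b1" "0 < a2" "a2 < b2"
    and "polygonal_domain D E"
    and "D \<subseteq> {x. - a1 \<le> x$1 \<and> x$1 \<le> a1 \<and> - a2 \<le> x$2 \<and> x$2 \<le> a2}"
    and "\<And>t. \<sigma>1 (- t) = \<sigma>1 t" "\<And>t. \<sigma>2 (- t) = \<sigma>2 t"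
    and "\<And>t. \<bar>t\<bar> < a1 \<Longrightarrow> \<sigma>1 t = 0" "\<And>t. \<bar>t\<bar> < a2 \<Longrightarrow> \<sigma>2 t = 0"
    and "bounded (range \<sigma>1)" "bounded (range \<sigma>2)"
    and "continuous_on UNIV \<sigma>1" "continuous_on UNIV \<sigma>2"
    and "\<And>t. 0 \<le> \<sigma>1 t" "\<And>t. 0 \<le> \<sigma>2 t"
    and "\<And>s t. \<bar>s\<bar> \<le> \<bar>t\<bar> \<Longrightarrow> \<sigma>1 s \<le> \<sigma>1 t" "\<And>s t. \<bar>s\<bar> \<le> \<bar>t\<bar> \<Longrightarrow> \<sigma>2 s \<le> \<sigma>2 t"
    and "g \<in> H_half E" and "f \<in> L2 (lebesgue_on (pml_domain b1 b2 D))"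
  shows "\<exists>S::real set. S sparse_in UNIV \<and>
    (\<forall>k. k \<notin> S \<longrightarrow>
      (\<exists>u. pml_weak_solution \<sigma>1 \<sigma>2 b1 b2 D E k f g u \<and>
        (\<forall>w. pml_weak_solution \<sigma>1 \<sigma>2 b1 b2 D E k f g w \<longrightarrow>
          (AE x in lebesgue_on (pml_domain b1 b2 D). w x = u x))))"
proof -
 interpret pml a1 a2 b1 b2 D E \<sigma>1 \<sigma>2
  using assms(1-6,11-16) by unfold_locales
 show ?thesis by (rule well_posed[OF assms(19,20)])
qed

end
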